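(* Let $k$ be a field of characteristic zero, $q\in k$ nonzero and not a root of unity, $c,d\in k$ with $c+d\neq0$, and $\mathcal{A}=\mathcal{A}(c,d)$ the coordinate algebra of the Podleś quantum sphere. Let $\lambda\in k$, $\lambda\neq 0$. If $\lambda\notin q^{-2\mathbb{N}}$ and $\sigma=\sigma_\lambda$, then for all $n\ge0$, $HC_{2n}^\sigma(\mathcal{A})=k[1]\oplus k[A]$ and $HC_{2n+1}^\sigma(\mathcal{A})=0$. If $c=d$ and $\sigma=\tau_\lambda$ with $\lambda\neq1$, then $HC_n^\sigma(\mathcal{A})=0$ for $n\ge1$.
   Context: $\mathcal{A}(c,d)$ is the unital $k$-algebra with generators $A,B,B^*$ and relations $BA=q^2AB$, $AB^*=q^2B^*A$, $B^*B=cd+(c-d)A-A^2$, $BB^*=cd+q^2(c-d)A-q^4A^2$. Automorphisms: for $\lambda\in k$, $\lambda\neq0$, $\sigma_\lambda$ is given by $\sigma_\lambda(B)=\lambda B$, $\sigma_\lambda(A)=A$, $\sigma_\lambda(B^* )=\lambda^{-1}B^*$. If $c=d$, there is also $\tau_\lambda$ given by $\tau_\lambda(B)=\lambda B$, $\tau_\lambda(A)=-A$, $\tau_\lambda(B^* )=\lambda^{-1}B^*$. Twisted cyclic homology: for a unital $k$-algebra $\mathcal{A}$ with automorphism $\sigma$, let $\lambda_\sigma(a_0,\dots,a_n)=(-1)^n(\sigma(a_n),a_0,\dots,a_{n-1})$ on $\mathcal{A}^{\otimes(n+1)}$, and $$b_\sigma(a_0,\dots,a_{n+1})=\sum_{j=0}^{n}(-1)^j(a_0,\dots,a_ja_{j+1},\dots,a_{n+1})+(-1)^{n+1}(\sigma(a_{n+1})a_0,a_1,\dots,a_n).$$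 $HC_*^\sigma(\mathcal{A})$ is the homology of the complex $\mathcal{A}^{\otimes(n+1)}/\mathrm{im}(\mathrm{id}-\lambda_\sigma)$, $n\ge0$, with differential induced by $b_\sigma$. Equivalently it is the total homology of Connes' mixed $(b,B)$-bicomplex of the cyclic module $C_n^\sigma=\mathcal{A}^{\otimes(n+1)}/\mathrm{im}(\mathrm{id}-\sigma^{\otimes(n+1)})$. $k[x]$ denotes the $k$-linear span of a class $[x]$. In $HC_{2n}^\sigma(\mathcal{A})$ the symbols $[1],[A]$ denote the classes in the spectral sequence of the bicomplex contributed by $[1],[A]\in HH_0^\sigma(\mathcal{A})=HC_0^\sigma(\mathcal{A})$ in the $n$-th column, i.e. classes mapped to $[1],[A]\in HC_0^\sigma(\mathcal{A})$ by the $n$-th power $S^n$ of the periodicity map. $q^{-2\mathbb{N}}=\{q^{-2n}:n=0,1,2,\dots\}$. *)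

theory Defs
  imports
    Complex_Main
    "HOL-Algebra.QuotRing"
    "HOL-Algebra.Module"
    "HOL-Library.Poly_Mapping"
begin

section \<open>Free vector spaces\<close>

text \<open>The ground field is a type \<open>'k\<close> of class \<open>field\<close>; the free vector space on a type
  \<open>'x\<close> is \<open>'x \<Rightarrow>\<^sub>0 'k\<close>, with basis \<open>basis x\<close>.\<close>

definition fscale :: "'k::field \<Rightarrow> ('x \<Rightarrow>\<^sub>0 'k) \<Rightarrow> ('x \<Rightarrow>\<^sub>0 'k)" where
  "fscale a v = Poly_Mapping.map ((*) a) v"

abbreviation basis :: "'x \<Rightarrow> ('x \<Rightarrow>\<^sub>0 'k::field)" where
  "basis x \<equiv> Poly_Mapping.single x 1"

definition lin :: "('x \<Rightarrow> ('y \<Rightarrow>\<^sub>0 'k::field)) \<Rightarrow> ('x \<Rightarrow>\<^sub>0 'k) \<Rightarrow> ('y \<Rightarrow>\<^sub>0 'k)" where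
  "lin f v = (\<Sum>x\<in>Poly_Mapping.keys v. fscale (Poly_Mapping.lookup v x) (f x))"

lemma lookup_fscale [simp]: "Poly_Mapping.lookup (fscale a v) x = a * Poly_Mapping.lookup v x"
  by (simp add: fscale_def Poly_Mapping.map.rep_eq when_def)

global_interpretation fvs: vector_space "fscale :: 'k::field \<Rightarrow> ('x \<Rightarrow>\<^sub>0 'k) \<Rightarrow> ('x \<Rightarrow>\<^sub>0 'k)"
  by unfold_locales
    (auto intro!: poly_mapping_eqI simp: lookup_add algebra_simps)

text \<open>The quotient \<open>Z/N\<close> of subspaces \<open>N \<subseteq> Z\<close>, its elements being the cosets \<open>x + N\<close>.  The
  \<open>module\<close> record of HOL-Algebra extends the \<open>ring\<close> record, so it has fields \<open>mult\<close> and \<open>one\<close>,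
  which play no role here.\<close>

definition coset :: "('x \<Rightarrow>\<^sub>0 'k::field) \<Rightarrow> ('x \<Rightarrow>\<^sub>0 'k) set \<Rightarrow> ('x \<Rightarrow>\<^sub>0 'k) set" where
  "coset x N = {x + y | y. y \<in> N}"

definition quotient_space ::
    "('x \<Rightarrow>\<^sub>0 'k::field) set \<Rightarrow> ('x \<Rightarrow>\<^sub>0 'k) set \<Rightarrow> ('k, ('x \<Rightarrow>\<^sub>0 'k) set) module" where
  "quotient_space Z N =
     \<lparr>carrier = {coset x N | x. x \<in> Z},
      mult = undefined, one = undefined,
      zero = N,
      add = (\<lambda>X Y. {x + y | x y. x \<in> X \<and> y \<in> Y}),
      smult = (\<lambda>a X. \<Union>x\<in>X. coset (fscale a x) N)\<rparr>"

text \<open>The homology in degree \<open>n\<close> of the complex \<open>V n / R n\<close> with the differential induced by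
  \<open>D n\<close>, written as \<open>{x \<in> V n. D n x \<in> R (n - 1)} / (D (n + 1) (V (n + 1)) + R n)\<close>.
  It is only used with \<open>D 0\<close> vanishing on \<open>V 0\<close>, so that the truncated \<open>0 - 1 = 0\<close> is harmless.\<close>

definition homology ::
    "(nat \<Rightarrow> ('x \<Rightarrow>\<^sub>0 'k::field) set) \<Rightarrow> (nat \<Rightarrow> ('x \<Rightarrow>\<^sub>0 'k) set) \<Rightarrow>
     (nat \<Rightarrow> ('x \<Rightarrow>\<^sub>0 'k) \<Rightarrow> ('x \<Rightarrow>\<^sub>0 'k)) \<Rightarrow> nat \<Rightarrow> ('k, ('x \<Rightarrow>\<^sub>0 'k) set) module" where
  "homology V R D n =
     quotient_space {x \<in> V n. D n x \<in> R (n - 1)}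
                    {D (Suc n) y + r | y r. y \<in> V (Suc n) \<and> r \<in> R n}"

text \<open>The map into a quotient space \<open>H\<close> induced on cosets by a map \<open>f\<close> on representatives.\<close>

definition induced ::
    "('k, ('x \<Rightarrow>\<^sub>0 'k::field) set) module \<Rightarrow> (('x \<Rightarrow>\<^sub>0 'k) \<Rightarrow> ('x \<Rightarrow>\<^sub>0 'k)) \<Rightarrow>
     ('x \<Rightarrow>\<^sub>0 'k) set \<Rightarrow> ('x \<Rightarrow>\<^sub>0 'k) set" where
  "induced H f X = (\<Union>x\<in>X. coset (f x) \<zero>\<^bsub>H\<^esub>)"

section \<open>Twisted cyclic homology\<close>

text \<open>A unital \<open>k\<close>-algebra is given as a \<open>module\<close> record \<open>M\<close> (with its ring structure).
  All chains live in the free vector space on lists of elements of \<open>M\<close>; the list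
  \<open>[a\<^sub>0, \<dots>, a\<^sub>n]\<close> stands for \<open>a\<^sub>0 \<otimes> \<dots> \<otimes> a\<^sub>n\<close>, and the tensor power of order \<open>n + 1\<close> is
  \<open>chains M n\<close> modulo the multilinearity relations \<open>tensor_rel M n\<close>.\<close>

definition tuples :: "('k, 'a) module \<Rightarrow> nat \<Rightarrow> 'a list set" where
  "tuples M n = {as. length as = Suc n \<and> set as \<subseteq> carrier M}"

definition chains :: "('k::field, 'a) module \<Rightarrow> nat \<Rightarrow> ('a list \<Rightarrow>\<^sub>0 'k) set" where
  "chains M n = {x. Poly_Mapping.keys x \<subseteq> tuples M n}"

definition tensor_rel :: "('k::field, 'a) module \<Rightarrow> nat \<Rightarrow> ('a list \<Rightarrow>\<^sub>0 'k) set" where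
  "tensor_rel M n = fvs.span
     ({basis (us @ (a \<oplus>\<^bsub>M\<^esub> b) # vs) - basis (us @ a # vs) - basis (us @ b # vs) | us vs a b.
         us @ a # vs \<in> tuples M n \<and> b \<in> carrier M}
      \<union> {basis (us @ (s \<odot>\<^bsub>M\<^esub> a) # vs) - fscale s (basis (us @ a # vs)) | us vs a s.
         us @ a # vs \<in> tuples M n})"

text \<open>The twisted cyclic operator, with its sign.\<close>

definition cyc :: "('a \<Rightarrow> 'a) \<Rightarrow> ('a list \<Rightarrow>\<^sub>0 'k::field) \<Rightarrow> ('a list \<Rightarrow>\<^sub>0 'k)" where
  "cyc \<sigma> = lin (\<lambda>as. fscale ((-1) ^ (length as - 1)) (basis (\<sigma> (last as) # butlast as)))"

text \<open>The twisted Hochschild boundary; on lists of length \<open>n + 2\<close> the sum runs over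
  \<open>j = 0, \<dots>, n\<close>, and it is \<open>0\<close> in degree \<open>0\<close>.\<close>

definition hoch_b ::
    "('k::field, 'a) module \<Rightarrow> ('a \<Rightarrow> 'a) \<Rightarrow> ('a list \<Rightarrow>\<^sub>0 'k) \<Rightarrow> ('a list \<Rightarrow>\<^sub>0 'k)" where
  "hoch_b M \<sigma> = lin (\<lambda>as.
     if length as \<le> 1 then 0
     else (\<Sum>j<length as - 1. fscale ((-1) ^ j)
             (basis (take j as @ (as ! j \<otimes>\<^bsub>M\<^esub> as ! Suc j) # drop (j + 2) as)))
          + fscale ((-1) ^ (length as - 1))
             (basis ((\<sigma> (last as) \<otimes>\<^bsub>M\<^esub> hd as) # butlast (tl as))))"

definition lambda_rel :: "('k::field, 'a) module \<Rightarrow> ('a \<Rightarrow> 'a) \<Rightarrow> nat \<Rightarrow> ('a list \<Rightarrow>\<^sub>0 'k) set" where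
  "lambda_rel M \<sigma> n =
     fvs.span (tensor_rel M n \<union> {basis as - cyc \<sigma> (basis as) | as. as \<in> tuples M n})"

definition HC ::
    "('k::field, 'a) module \<Rightarrow> ('a \<Rightarrow> 'a) \<Rightarrow> nat \<Rightarrow> ('k, ('a list \<Rightarrow>\<^sub>0 'k) set) module" where
  "HC M \<sigma> = homology (chains M) (lambda_rel M \<sigma>) (\<lambda>n. hoch_b M \<sigma>)"

text \<open>The class in \<open>HC\<^sub>0\<close> of an element of the algebra.\<close>

definition HC0_class ::
    "('k::field, 'a) module \<Rightarrow> ('a \<Rightarrow> 'a) \<Rightarrow> 'a \<Rightarrow> ('a list \<Rightarrow>\<^sub>0 'k) set" where
  "HC0_class M \<sigma> a = coset (basis [a]) \<zero>\<^bsub>HC M \<sigma> 0\<^esub>"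

section \<open>The mixed bicomplex and the periodicity map\<close>

definition sigma_rel :: "('k::field, 'a) module \<Rightarrow> ('a \<Rightarrow> 'a) \<Rightarrow> nat \<Rightarrow> ('a list \<Rightarrow>\<^sub>0 'k) set" where
  "sigma_rel M \<sigma> n =
     fvs.span (tensor_rel M n \<union> {basis as - basis (map \<sigma> as) | as. as \<in> tuples M n})"

text \<open>Connes' operator \<open>B = (1 - t) s N\<close>, where \<open>t = cyc \<sigma>\<close>,
  \<open>s (a\<^sub>0, \<dots>, a\<^sub>n) = (1, a\<^sub>0, \<dots>, a\<^sub>n)\<close> and \<open>N = 1 + t + \<dots> + t\<^sup>n\<close> in degree \<open>n\<close>.\<close>

definition cyc_norm :: "('a \<Rightarrow> 'a) \<Rightarrow> ('a list \<Rightarrow>\<^sub>0 'k::field) \<Rightarrow> ('a list \<Rightarrow>\<^sub>0 'k)" where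
  "cyc_norm \<sigma> = lin (\<lambda>as. \<Sum>i<length as. (cyc \<sigma> ^^ i) (basis as))"

definition connes_B ::
    "('k::field, 'a) module \<Rightarrow> ('a \<Rightarrow> 'a) \<Rightarrow> ('a list \<Rightarrow>\<^sub>0 'k) \<Rightarrow> ('a list \<Rightarrow>\<^sub>0 'k)" where
  "connes_B M \<sigma> x =
     (let y = lin (\<lambda>as. basis (\<one>\<^bsub>M\<^esub> # as)) (cyc_norm \<sigma> x) in y - cyc \<sigma> y)"

text \<open>The total complex has \<open>C\<^sub>n \<oplus> C\<^bsub>n-2\<^esub> \<oplus> C\<^bsub>n-4\<^esub> \<oplus> \<dots>\<close> in degree \<open>n\<close>.  Since the summands are
  spanned by lists of different lengths, this is an internal direct sum in the space of all
  chains; \<open>lower n\<close> is the projection away from the summand \<open>C\<^sub>n\<close>, and \<open>upper n\<close> the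
  projection onto it.\<close>

definition tot_chains :: "('k::field, 'a) module \<Rightarrow> nat \<Rightarrow> ('a list \<Rightarrow>\<^sub>0 'k) set" where
  "tot_chains M n = {x. Poly_Mapping.keys x \<subseteq> (\<Union>m\<in>{m. m \<le> n \<and> even (n - m)}. tuples M m)}"

definition tot_rel :: "('k::field, 'a) module \<Rightarrow> ('a \<Rightarrow> 'a) \<Rightarrow> nat \<Rightarrow> ('a list \<Rightarrow>\<^sub>0 'k) set" where
  "tot_rel M \<sigma> n = fvs.span (\<Union>m\<in>{m. m \<le> n \<and> even (n - m)}. sigma_rel M \<sigma> m)"

definition upper :: "nat \<Rightarrow> ('a list \<Rightarrow>\<^sub>0 'k::field) \<Rightarrow> ('a list \<Rightarrow>\<^sub>0 'k)" where
  "upper n = lin (\<lambda>as. if length as = Suc n then basis as else 0)"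

definition lower :: "nat \<Rightarrow> ('a list \<Rightarrow>\<^sub>0 'k::field) \<Rightarrow> ('a list \<Rightarrow>\<^sub>0 'k)" where
  "lower n x = x - upper n x"

text \<open>No \<open>B\<close> leaves the summand \<open>C\<^sub>n\<close>, which is the \<open>0\<close>-th column of the bicomplex.\<close>

definition tot_d ::
    "('k::field, 'a) module \<Rightarrow> ('a \<Rightarrow> 'a) \<Rightarrow> nat \<Rightarrow> ('a list \<Rightarrow>\<^sub>0 'k) \<Rightarrow> ('a list \<Rightarrow>\<^sub>0 'k)" where
  "tot_d M \<sigma> n x = hoch_b M \<sigma> x + connes_B M \<sigma> (lower n x)"

definition HC_tot ::
    "('k::field, 'a) module \<Rightarrow> ('a \<Rightarrow> 'a) \<Rightarrow> nat \<Rightarrow> ('k, ('a list \<Rightarrow>\<^sub>0 'k) set) module" where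
  "HC_tot M \<sigma> = homology (tot_chains M) (tot_rel M \<sigma>) (tot_d M \<sigma>)"

text \<open>Projection onto the \<open>0\<close>-th column induces the comparison map from the total homology to
  \<open>HC\<close> (an isomorphism in characteristic \<open>0\<close> if \<open>\<sigma>\<close> is an automorphism), and deleting the
  \<open>0\<close>-th column induces the periodicity map on the total homology.\<close>

definition HC_comparison ::
    "('k::field, 'a) module \<Rightarrow> ('a \<Rightarrow> 'a) \<Rightarrow> nat \<Rightarrow> ('a list \<Rightarrow>\<^sub>0 'k) set \<Rightarrow> ('a list \<Rightarrow>\<^sub>0 'k) set" where
  "HC_comparison M \<sigma> n = induced (HC M \<sigma> n) (upper n)"

definition HC_tot_S ::
    "('k::field, 'a) module \<Rightarrow> ('a \<Rightarrow> 'a) \<Rightarrow> nat \<Rightarrow> ('a list \<Rightarrow>\<^sub>0 'k) set \<Rightarrow> ('a list \<Rightarrow>\<^sub>0 'k) set" where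
  "HC_tot_S M \<sigma> n = induced (HC_tot M \<sigma> n) (lower (n + 2))"

text \<open>The periodicity map \<open>S\<close> from \<open>HC\<^bsub>n+2\<^esub>\<close> to \<open>HC\<^sub>n\<close>, and \<open>S\<^sup>n\<close> from \<open>HC\<^bsub>2n\<^esub>\<close> to \<open>HC\<^sub>0\<close>.\<close>

definition HC_S ::
    "('k::field, 'a) module \<Rightarrow> ('a \<Rightarrow> 'a) \<Rightarrow> nat \<Rightarrow> ('a list \<Rightarrow>\<^sub>0 'k) set \<Rightarrow> ('a list \<Rightarrow>\<^sub>0 'k) set" where
  "HC_S M \<sigma> n X = HC_comparison M \<sigma> n
     (HC_tot_S M \<sigma> n
       (inv_into (carrier (HC_tot M \<sigma> (n + 2))) (HC_comparison M \<sigma> (n + 2)) X))"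

primrec HC_S_pow ::
    "('k::field, 'a) module \<Rightarrow> ('a \<Rightarrow> 'a) \<Rightarrow> nat \<Rightarrow> ('a list \<Rightarrow>\<^sub>0 'k) set \<Rightarrow> ('a list \<Rightarrow>\<^sub>0 'k) set" where
  "HC_S_pow M \<sigma> 0 X = X"
| "HC_S_pow M \<sigma> (Suc n) X = HC_S_pow M \<sigma> n (HC_S M \<sigma> (2 * n) X)"

text \<open>The space \<open>H\<close> is \<open>k X \<oplus> k Y\<close> with \<open>X\<close>, \<open>Y\<close> nonzero.\<close>

definition direct_sum_of_lines :: "('k::field, 'v) module \<Rightarrow> 'v \<Rightarrow> 'v \<Rightarrow> bool" where
  "direct_sum_of_lines H X Y \<longleftrightarrow> X \<in> carrier H \<and> Y \<in> carrier H \<and>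
     bij_betw (\<lambda>(a, b). a \<odot>\<^bsub>H\<^esub> X \<oplus>\<^bsub>H\<^esub> b \<odot>\<^bsub>H\<^esub> Y) UNIV (carrier H)"

section \<open>The Podles sphere\<close>

datatype podles_gen = GA | GB | GBs

text \<open>Words are written additively because the convolution product on \<open>\<Rightarrow>\<^sub>0\<close> is the one of the
  monoid algebra of an additive monoid; so \<open>'k free_alg\<close> is the free unital algebra on
  \<open>A\<close>, \<open>B\<close>, \<open>B\<^sup>*\<close>, with \<open>basis u * basis v = basis (u + v)\<close>.\<close>

datatype podles_word = Word (letters: "podles_gen list")

instantiation podles_word :: monoid_add
begin

definition "0 = Word []"

definition "u + v = Word (letters u @ letters v)"

instance
  by standard (auto simp: zero_podles_word_def plus_podles_word_def)

end

type_synonym 'k free_alg = "podles_word \<Rightarrow>\<^sub>0 'k"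

definition free_gen :: "podles_gen \<Rightarrow> 'k::field free_alg" where
  "free_gen g = basis (Word [g])"

definition free_ring :: "('k::field free_alg) ring" where
  "free_ring = \<lparr>carrier = UNIV, mult = (*), one = 1, zero = 0, add = (+)\<rparr>"

text \<open>The unital algebra endomorphism of the free algebra with given values on the generators.\<close>

definition free_hom :: "(podles_gen \<Rightarrow> 'k::field free_alg) \<Rightarrow> 'k free_alg \<Rightarrow> 'k free_alg" where
  "free_hom f = lin (\<lambda>w. prod_list (map f (letters w)))"

definition podles_relators :: "'k::field \<Rightarrow> 'k \<Rightarrow> 'k \<Rightarrow> 'k free_alg set" where
  "podles_relators q c d =
     (let A = free_gen GA; B = free_gen GB; Bs = free_gen GBs in
      {B * A - fscale (q^2) (A * B),
       A * Bs - fscale (q^2) (Bs * A),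
       Bs * B - (fscale (c * d) 1 + fscale (c - d) A - A^2),
       B * Bs - (fscale (c * d) 1 + fscale (q^2 * (c - d)) A - fscale (q^4) (A^2))})"

definition podles_ideal :: "'k::field \<Rightarrow> 'k \<Rightarrow> 'k \<Rightarrow> 'k free_alg set" where
  "podles_ideal q c d = Idl\<^bsub>free_ring\<^esub> (podles_relators q c d)"

definition podles_class :: "'k::field \<Rightarrow> 'k \<Rightarrow> 'k \<Rightarrow> 'k free_alg \<Rightarrow> 'k free_alg set" where
  "podles_class q c d x = podles_ideal q c d +>\<^bsub>free_ring\<^esub> x"

definition podles :: "'k::field \<Rightarrow> 'k \<Rightarrow> 'k \<Rightarrow> ('k, 'k free_alg set) module" where
  "podles q c d =
     (let Q = free_ring Quot podles_ideal q c d in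
      \<lparr>carrier = carrier Q, mult = mult Q, one = one Q, zero = zero Q, add = add Q,
       smult = (\<lambda>a X. podles_class q c d (fscale a 1) \<otimes>\<^bsub>Q\<^esub> X)\<rparr>)"

text \<open>The map induced on the quotient by \<open>free_hom f\<close>; it is meant for \<open>f\<close> compatible with the
  relations.\<close>

definition podles_hom ::
    "'k::field \<Rightarrow> 'k \<Rightarrow> 'k \<Rightarrow> (podles_gen \<Rightarrow> 'k free_alg) \<Rightarrow> 'k free_alg set \<Rightarrow> 'k free_alg set" where
  "podles_hom q c d f X = (\<Union>x\<in>X. podles_class q c d (free_hom f x))"

primrec sigma_gens :: "'k::field \<Rightarrow> podles_gen \<Rightarrow> 'k free_alg" where
  "sigma_gens l GA = free_gen GA"
| "sigma_gens l GB = fscale l (free_gen GB)"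
| "sigma_gens l GBs = fscale (inverse l) (free_gen GBs)"

primrec tau_gens :: "'k::field \<Rightarrow> podles_gen \<Rightarrow> 'k free_alg" where
  "tau_gens l GA = - free_gen GA"
| "tau_gens l GB = fscale l (free_gen GB)"
| "tau_gens l GBs = fscale (inverse l) (free_gen GBs)"

definition podles_sigma ::
    "'k::field \<Rightarrow> 'k \<Rightarrow> 'k \<Rightarrow> 'k \<Rightarrow> 'k free_alg set \<Rightarrow> 'k free_alg set" where
  "podles_sigma q c d l = podles_hom q c d (sigma_gens l)"

text \<open>An automorphism only if \<open>c = d\<close>.\<close>

definition podles_tau ::
    "'k::field \<Rightarrow> 'k \<Rightarrow> 'k \<Rightarrow> 'k \<Rightarrow> 'k free_alg set \<Rightarrow> 'k free_alg set" where
  "podles_tau q c d l = podles_hom q c d (tau_gens l)"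

text \<open>Checks that the constructions above are what they are meant to be: \<open>podles q c d\<close> is a ring
  in which the four relations hold, and the automorphisms have the stated values.\<close>

lemma free_ring_ring: "ring (free_ring :: ('k::field free_alg) ring)"
proof (rule ringI)
  show "abelian_group (free_ring :: ('k free_alg) ring)"
  proof (rule abelian_groupI)
    fix x :: "'k free_alg"
    show "\<exists>y\<in>carrier free_ring. y \<oplus>\<^bsub>free_ring\<^esub> x = \<zero>\<^bsub>free_ring\<^esub>"
      by (rule bexI[of _ "- x"]) (simp_all add: free_ring_def)
  qed (simp_all add: free_ring_def add_ac)
  show "Group.monoid (free_ring :: ('k free_alg) ring)"
    by (rule monoidI) (simp_all add: free_ring_def mult.assoc)
qed (simp_all add: free_ring_def algebra_simps)

lemma podles_ideal_ideal: "ideal (podles_ideal q c d) free_ring"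
  unfolding podles_ideal_def by (rule ring.genideal_ideal[OF free_ring_ring]) (simp add: free_ring_def)

lemma podles_relators_in_ideal: "podles_relators q c d \<subseteq> podles_ideal q c d"
  unfolding podles_ideal_def by (rule ring.genideal_self[OF free_ring_ring]) (simp add: free_ring_def)

lemma podles_ring: "ring (podles q c d)"
proof -
  let ?Q = "free_ring Quot podles_ideal q c d"
  interpret Q: ring ?Q
    by (rule ideal.quotient_is_ring[OF podles_ideal_ideal])
  have eqs: "carrier (podles q c d) = carrier ?Q" "mult (podles q c d) = mult ?Q"
      "one (podles q c d) = one ?Q" "zero (podles q c d) = zero ?Q" "add (podles q c d) = add ?Q"
    by (simp_all add: podles_def Let_def)
  show ?thesis
  proof (rule ringI)
    show "abelian_group (podles q c d)"
      by (rule abelian_groupI; unfold eqs)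
        (auto simp: Q.a_ac intro: Q.l_neg intro!: bexI[OF _ Q.a_inv_closed])
    show "Group.monoid (podles q c d)"
      by (rule monoidI; unfold eqs) (auto simp: Q.m_assoc)
  qed (unfold eqs; simp add: Q.l_distr Q.r_distr)+
qed

lemma podles_class_eqI:
  assumes "x - y \<in> podles_ideal q c d"
  shows "podles_class q c d x = podles_class q c d y"
proof -
  interpret ideal "podles_ideal q c d" free_ring by (rule podles_ideal_ideal)
  have "x \<ominus>\<^bsub>free_ring\<^esub> y \<in> podles_ideal q c d"
  proof -
    have "\<ominus>\<^bsub>free_ring\<^esub> y = - y"
      using minus_equality[of "- y" y] by (simp add: free_ring_def)
    then show ?thesis using assms by (simp add: a_minus_def) (simp add: free_ring_def)
  qed
  then show ?thesis
    unfolding podles_class_def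
    by (subst (asm) quotient_eq_iff_same_a_r_cos[OF podles_ideal_ideal]) (simp_all add: free_ring_def)
qed

lemma podles_relations:
  fixes q c d :: "'k::field"
  defines "cl \<equiv> podles_class q c d"
  defines "A \<equiv> free_gen GA" and "B \<equiv> free_gen GB" and "Bs \<equiv> free_gen GBs"
  shows "cl (B * A) = cl (fscale (q^2) (A * B))"
    and "cl (A * Bs) = cl (fscale (q^2) (Bs * A))"
    and "cl (Bs * B) = cl (fscale (c * d) 1 + fscale (c - d) A - A^2)"
    and "cl (B * Bs) = cl (fscale (c * d) 1 + fscale (q^2 * (c - d)) A - fscale (q^4) (A^2))"
  unfolding cl_def
  by (rule podles_class_eqI, rule subsetD[OF podles_relators_in_ideal],
      simp add: podles_relators_def Let_def A_def B_def Bs_def)+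

lemma lin_superset:
  assumes "finite S" "Poly_Mapping.keys v \<subseteq> S"
  shows "lin f v = (\<Sum>x\<in>S. fscale (Poly_Mapping.lookup v x) (f x))"
  unfolding lin_def
  by (rule sum.mono_neutral_left) (use assms in \<open>auto simp: in_keys_iff\<close>)

lemma lin_add: "lin f (u + v) = lin f u + lin f v"
proof -
  let ?S = "Poly_Mapping.keys u \<union> Poly_Mapping.keys v"
  have "Poly_Mapping.keys (u + v) \<subseteq> ?S" by (rule Poly_Mapping.keys_add)
  then show ?thesis
    by (subst (1 2 3) lin_superset[of ?S])
      (auto simp: lookup_add fvs.scale_left_distrib sum.distrib)
qed

lemma lin_fscale: "lin f (fscale a v) = fscale a (lin f v)"
proof -
  have "Poly_Mapping.keys (fscale a v) \<subseteq> Poly_Mapping.keys v"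
    by (auto simp: in_keys_iff)
  then show ?thesis
    by (subst lin_superset[of "Poly_Mapping.keys v"]) (auto simp: lin_def fvs.scale_sum_right)
qed

lemma lin_diff: "lin f (u - v) = lin f u - lin f v"
  using lin_add[of f u "fscale (-1) v"] lin_fscale[of f "-1" v] by simp

lemma lin_basis [simp]: "lin f (basis x) = f x"
  by (simp add: lin_def)

lemma fscale_single: "fscale a (Poly_Mapping.single x b) = Poly_Mapping.single x (a * b)"
  by (rule poly_mapping_eqI) (simp add: lookup_single when_def)

lemma basis_expansion: "(\<Sum>x\<in>Poly_Mapping.keys v. fscale (Poly_Mapping.lookup v x) (basis x)) = v"
  by (rule poly_mapping_eqI)
    (auto simp: lookup_sum lookup_single when_def in_keys_iff if_distrib cong: if_cong)

lemma free_vector_induct [case_names zero add scale basis]: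
  assumes "P 0" "\<And>u v. P u \<Longrightarrow> P v \<Longrightarrow> P (u + v)" "\<And>a v. P v \<Longrightarrow> P (fscale a v)"
    and "\<And>x. P (basis x)"
  shows "P v"
proof -
  have "P (\<Sum>x\<in>S. fscale (Poly_Mapping.lookup v x) (basis x))" if "finite S" for S
    using that by induction (use assms in auto)
  from this[of "Poly_Mapping.keys v"] show ?thesis by (simp add: basis_expansion)
qed

lemma fscale_conv_mult: "fscale a x = Poly_Mapping.single 0 a * (x :: 'k::field free_alg)"
  unfolding fscale_def by (rule mult_map_scale_conv_mult)

lemma fscale_mult_left: "fscale a x * y = fscale a (x * (y :: 'k::field free_alg))"
  by (simp add: fscale_conv_mult mult.assoc)

lemma fscale_mult_right: "x * fscale a y = fscale a (x * (y :: 'k::field free_alg))"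
proof -
  have "x * Poly_Mapping.single 0 a = Poly_Mapping.single 0 a * x"
  proof (induction x rule: free_vector_induct)
    case (scale b v)
    have "fscale b v * Poly_Mapping.single 0 a = Poly_Mapping.single 0 (b * a) * v"
      by (simp add: fscale_mult_left scale) (simp add: fscale_conv_mult mult_single flip: mult.assoc)
    also have "\<dots> = Poly_Mapping.single 0 a * fscale b v"
      by (simp add: fscale_conv_mult mult_single mult.commute flip: mult.assoc)
    finally show ?case .
  qed (simp_all add: distrib_left distrib_right mult_single)
  then show ?thesis by (metis fscale_conv_mult mult.assoc)
qed

lemma free_hom_add: "free_hom f (x + y) = free_hom f x + free_hom f y"
  and free_hom_diff: "free_hom f (x - y) = free_hom f x - free_hom f y"
  and free_hom_fscale: "free_hom f (fscale a x) = fscale a (free_hom f x)"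
  by (simp_all add: free_hom_def lin_add lin_diff lin_fscale)

lemma free_hom_one: "free_hom f 1 = 1"
  by (simp add: free_hom_def zero_podles_word_def flip: single_one)

lemma free_hom_gen: "free_hom f (free_gen g) = f g"
  by (simp add: free_hom_def free_gen_def)

lemma free_hom_mult: "free_hom f (x * y) = free_hom f x * free_hom f y"
proof (induction x rule: free_vector_induct)
  case (basis u)
  show ?case
  proof (induction y rule: free_vector_induct)
    case (basis v)
    show ?case by (simp add: free_hom_def mult_single plus_podles_word_def)
  qed (simp_all add: free_hom_def lin_add lin_fscale distrib_left fscale_mult_right lin_def[of _ 0])
qed (simp_all add: free_hom_def lin_add lin_fscale distrib_right fscale_mult_left lin_def[of _ 0])

lemmas free_hom_simps =
  free_hom_add free_hom_diff free_hom_fscale free_hom_one free_hom_gen free_hom_mult power2_eq_square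

lemma free_ring_uminus: "\<ominus>\<^bsub>free_ring\<^esub> x = - (x :: 'k::field free_alg)"
proof -
  interpret ring "free_ring :: 'k free_alg ring" by (rule free_ring_ring)
  show ?thesis using minus_equality[of "- x" x] by (simp add: free_ring_def)
qed

context
  fixes q c d :: "'k::field" and f :: "podles_gen \<Rightarrow> 'k free_alg"
  assumes compatible: "free_hom f ` podles_relators q c d \<subseteq> podles_ideal q c d"
begin

lemma free_hom_ideal:
  assumes "x \<in> podles_ideal q c d"
  shows "free_hom f x \<in> podles_ideal q c d"
proof -
  interpret ideal "podles_ideal q c d" free_ring by (rule podles_ideal_ideal)
  let ?J = "{x. free_hom f x \<in> podles_ideal q c d}"
  have "ideal ?J free_ring"
  proof (rule idealI[OF free_ring_ring])
    show "subgroup ?J (add_monoid free_ring)"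
    proof (rule subgroup.intro)
      fix x y assume "x \<in> ?J" "y \<in> ?J"
      then show "x \<otimes>\<^bsub>add_monoid free_ring\<^esub> y \<in> ?J"
        using additive_subgroup.a_closed[OF is_additive_subgroup, of "free_hom f x" "free_hom f y"] by (simp add: free_ring_def free_hom_add)
    next
      show "\<one>\<^bsub>add_monoid free_ring\<^esub> \<in> ?J"
        using additive_subgroup.zero_closed[OF is_additive_subgroup]
        by (simp add: free_ring_def free_hom_def lin_def)
    next
      fix x assume x: "x \<in> ?J"
      have "inv\<^bsub>add_monoid free_ring\<^esub> x = - x"
        using free_ring_uminus[of x] by (simp add: a_inv_def)
      moreover have "free_hom f (- x) = - free_hom f x"
        using free_hom_diff[of f 0 x] by (simp add: free_hom_def lin_def[of _ 0])
      ultimately show "inv\<^bsub>add_monoid free_ring\<^esub> x \<in> ?J"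
        using x additive_subgroup.a_inv_closed[OF is_additive_subgroup, of "free_hom f x"] by (simp add: free_ring_uminus)
    qed (simp add: free_ring_def)
  next
    fix a x assume "a \<in> ?J"
    then show "x \<otimes>\<^bsub>free_ring\<^esub> a \<in> ?J" "a \<otimes>\<^bsub>free_ring\<^esub> x \<in> ?J"
      using I_l_closed[of "free_hom f a" "free_hom f x"] I_r_closed[of "free_hom f a" "free_hom f x"]
      by (simp_all add: free_ring_def free_hom_mult)
  qed
  moreover have "podles_relators q c d \<subseteq> ?J" using compatible by auto
  ultimately have "podles_ideal q c d \<subseteq> ?J"
    unfolding podles_ideal_def by (intro ring.genideal_minimal[OF free_ring_ring])
  then show ?thesis using assms by auto
qed

lemma podles_hom_class: "podles_hom q c d f (podles_class q c d x) = podles_class q c d (free_hom f x)"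
proof -
  interpret ideal "podles_ideal q c d" free_ring by (rule podles_ideal_ideal)
  have "podles_class q c d (free_hom f y) = podles_class q c d (free_hom f x)"
    if "y \<in> podles_class q c d x" for y
  proof -
    have "y - x \<in> podles_ideal q c d"
      using that by (auto simp: podles_class_def a_r_coset_def' free_ring_def)
    then show ?thesis
      using free_hom_ideal by (intro podles_class_eqI) (simp flip: free_hom_diff)
  qed
  moreover have "x \<in> podles_class q c d x"
    using additive_subgroup.zero_closed[OF is_additive_subgroup] by (force simp: podles_class_def a_r_coset_def' free_ring_def)
  ultimately show ?thesis unfolding podles_hom_def by blast
qed

end

lemma podles_operations:
  shows "\<one>\<^bsub>podles q c d\<^esub> = podles_class q c d 1"
    and "podles_class q c d x \<otimes>\<^bsub>podles q c d\<^esub> podles_class q c d y = podles_class q c d (x * y)"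
    and "podles_class q c d x \<oplus>\<^bsub>podles q c d\<^esub> podles_class q c d y = podles_class q c d (x + y)"
    and "s \<odot>\<^bsub>podles q c d\<^esub> podles_class q c d x = podles_class q c d (fscale s x)"
proof -
  interpret ideal "podles_ideal q c d" free_ring by (rule podles_ideal_ideal)
  have mult: "podles_class q c d x \<otimes>\<^bsub>free_ring Quot podles_ideal q c d\<^esub> podles_class q c d y
      = podles_class q c d (x * y)" for x y
    using rcoset_mult_add[of x y] by (simp add: FactRing_def podles_class_def) (simp add: free_ring_def)
  show "podles_class q c d x \<otimes>\<^bsub>podles q c d\<^esub> podles_class q c d y = podles_class q c d (x * y)"
    by (simp add: podles_def Let_def mult)
  show "s \<odot>\<^bsub>podles q c d\<^esub> podles_class q c d x = podles_class q c d (fscale s x)"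
    by (simp add: podles_def Let_def mult fscale_mult_left)
  show "\<one>\<^bsub>podles q c d\<^esub> = podles_class q c d 1"
    by (simp add: podles_def Let_def FactRing_def podles_class_def) (simp add: free_ring_def)
  show "podles_class q c d x \<oplus>\<^bsub>podles q c d\<^esub> podles_class q c d y = podles_class q c d (x + y)"
    using a_rcos_sum[of x y]
    by (simp add: podles_def Let_def FactRing_def podles_class_def) (simp add: free_ring_def)
qed

lemma podles_ideal_fscale: "x \<in> podles_ideal q c d \<Longrightarrow> fscale s x \<in> podles_ideal q c d"
  using ideal.I_l_closed[OF podles_ideal_ideal, of x q c d "fscale s 1"]
  by (simp add: free_ring_def fscale_mult_left)

lemmas fscale_simps = fscale_mult_left fscale_mult_right fvs.scale_right_diff_distrib mult_ac

lemma podles_sigma_class: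
  assumes "l \<noteq> 0"
  shows "podles_sigma q c d l (podles_class q c d x) = podles_class q c d (free_hom (sigma_gens l) x)"
  unfolding podles_sigma_def
proof (rule podles_hom_class, rule image_subsetI)
  fix r assume r: "r \<in> podles_relators q c d"
  have "free_hom (sigma_gens l) r \<in> {r, fscale (l) r, fscale (inverse l) r}"
    using r assms by (auto simp: podles_relators_def Let_def free_hom_simps fscale_simps)
  then show "free_hom (sigma_gens l) r \<in> podles_ideal q c d"
    using subsetD[OF podles_relators_in_ideal r] podles_ideal_fscale
    by (metis empty_iff insert_iff)
qed

lemma podles_tau_class:
  assumes "l \<noteq> 0"
  shows "podles_tau q c c l (podles_class q c c x) = podles_class q c c (free_hom (tau_gens l) x)"
  unfolding podles_tau_def
proof (rule podles_hom_class, rule image_subsetI)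
  fix r assume r: "r \<in> podles_relators q c c"
  have "free_hom (tau_gens l) r \<in> {r, fscale (- l) r, fscale (- inverse l) r}"
    using r assms by (auto simp: podles_relators_def Let_def free_hom_simps fscale_simps)
  then show "free_hom (tau_gens l) r \<in> podles_ideal q c c"
    using subsetD[OF podles_relators_in_ideal r] podles_ideal_fscale
    by (metis empty_iff insert_iff)
qed

lemma podles_sigma_gens:
  assumes "l \<noteq> 0"
  shows "podles_sigma q c d l (podles_class q c d (free_gen GA)) = podles_class q c d (free_gen GA)"
    and "podles_sigma q c d l (podles_class q c d (free_gen GB)) =
      l \<odot>\<^bsub>podles q c d\<^esub> podles_class q c d (free_gen GB)"
    and "podles_sigma q c d l (podles_class q c d (free_gen GBs)) =
      inverse l \<odot>\<^bsub>podles q c d\<^esub> podles_class q c d (free_gen GBs)"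
  by (simp_all add: podles_sigma_class[OF assms] free_hom_gen podles_operations)

lemma podles_tau_gens:
  assumes "l \<noteq> 0"
  shows "podles_tau q c c l (podles_class q c c (free_gen GA)) =
      (-1) \<odot>\<^bsub>podles q c c\<^esub> podles_class q c c (free_gen GA)"
    and "podles_tau q c c l (podles_class q c c (free_gen GB)) =
      l \<odot>\<^bsub>podles q c c\<^esub> podles_class q c c (free_gen GB)"
    and "podles_tau q c c l (podles_class q c c (free_gen GBs)) =
      inverse l \<odot>\<^bsub>podles q c c\<^esub> podles_class q c c (free_gen GBs)"
  by (simp_all add: podles_tau_class[OF assms] free_hom_gen podles_operations)

end

theory Submission
  imports Defs "HOL-Computational_Algebra.Polynomial"
begin

text \<open>By a Poincare-Birkhoff-Witt argument the sphere has the basis \<open>A\<^sup>i B\<^sup>j\<close>, \<open>A\<^sup>i (B\<^sup>*)\<^sup>j\<close>, on which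
  the automorphism acts diagonally, so that chains may be restricted to those of total weight \<open>1\<close>;
  there the cyclic operator has finite order, and in characteristic zero the bicomplex computes
  \<open>HC\<close>.  A free bimodule resolution, on alternating words in
  \<open>B\<close>, \<open>B\<^sup>*\<close> with or without a factor \<open>A\<close>, reduces the twisted Hochschild homology to a small
  complex of polynomials in \<open>A\<close>, graded by the degree in \<open>B\<close>.  Under the hypotheses on \<open>\<lambda>\<close> it is exact in
  positive degrees, where the part of degree \<open>0\<close> in \<open>B\<close> for \<open>\<sigma>\<^sub>\<lambda>\<close> also needs the coprimality of \<open>c - A\<close>
  and \<open>d + A\<close>, that is \<open>c + d \<noteq> 0\<close>; its homology in degree \<open>0\<close> is spanned by \<open>1\<close> and \<open>A\<close> for
  \<open>\<sigma>\<^sub>\<lambda>\<close>, and zero for \<open>\<tau>\<^sub>\<lambda>\<close>.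
  With the Hochschild homology concentrated in degree \<open>0\<close>, a cycle of the total
  complex is determined up to boundaries by its last component, every class in degree \<open>0\<close> lifts,
  and \<open>S\<close> is an isomorphism from \<open>HC\<^bsub>n+2\<^esub>\<close> to \<open>HC\<^sub>n\<close>.\<close>

section \<open>Linear maps between free vector spaces\<close>

text \<open>Deleting two letters of an alternating word leaves \<open>B B\<^sup>*\<close> or
  \<open>B\<^sup>* B\<close>, a polynomial in \<open>A\<close> and not zero, so the alternating
  words alone do not form a complex. The generators carrying a factor \<open>A\<close> repair this:
  their differential expresses commutation with \<open>A\<close>, and the difference quotient of the
  polynomial supplies the missing map. The ranks are 1, 3, 4, 4, ..., as for a hypersurface, and the
  resolution never stops. It is compared with the Hochschild complex by a chase in a double complex
  that lives in spaces of words: the second letter is the right factor of a free bimodule, longer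
  words are Hochschild chains with coefficients in it, and one-letter words are its twisted
  coinvariants. In total degree \<open>w\<close> in \<open>B\<close> the generators with
  \<open>A\<close> enter the small complex through multiplication by
  \<open>(eps - q powi (2 * w)) A\<close>, where \<open>eps\<close> is the eigenvalue of
  \<open>A\<close>. If the scalar is nonzero, only constant terms of polynomials matter. It vanishes
  only for \<open>eps = 1\<close> and \<open>w = 0\<close>; there the condition on
  \<open>\<lambda>\<close> ensures that \<open>f(A) - \<lambda> f(q\<^sup>2 A)\<close> determines
  \<open>f\<close>.\<close>

definition klin :: "(('x \<Rightarrow>\<^sub>0 'k::field) \<Rightarrow> ('y \<Rightarrow>\<^sub>0 'k)) \<Rightarrow> bool" where
  "klin f \<longleftrightarrow> (\<forall>u v. f (u + v) = f u + f v) \<and> (\<forall>a v. f (fscale a v) = fscale a (f v))"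

named_theorems klin_intros

lemma klin_add: "klin f \<Longrightarrow> f (u + v) = f u + f v"
  and klin_scale: "klin f \<Longrightarrow> f (fscale a v) = fscale a (f v)"
  by (auto simp: klin_def)

lemma klin_zero: "klin f \<Longrightarrow> f 0 = 0"
  using klin_scale[of f 0 0] by simp

lemma klin_minus: "klin f \<Longrightarrow> f (- v) = - f v"
  using klin_scale[of f "-1" v] by simp

lemma klin_diff: "klin f \<Longrightarrow> f (u - v) = f u - f v"
  using klin_add[of f u "- v"] klin_minus[of f v] by simp

lemma klin_sum: "klin f \<Longrightarrow> f (\<Sum>i\<in>I. g i) = (\<Sum>i\<in>I. f (g i))"
  by (induction I rule: infinite_finite_induct) (auto simp: klin_zero klin_add)

lemma klin_id [klin_intros]: "klin (\<lambda>x. x)"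
  by (simp add: klin_def)

lemma klin_const_zero [klin_intros]: "klin (\<lambda>x. 0)"
  by (simp add: klin_def)

lemma klin_lin [klin_intros]: "klin g \<Longrightarrow> klin (\<lambda>x. lin f (g x))"
  by (simp add: klin_def lin_add lin_fscale)

lemma klin_plus [klin_intros]: "klin f \<Longrightarrow> klin g \<Longrightarrow> klin (\<lambda>x. f x + g x)"
  by (simp add: klin_def algebra_simps fvs.scale_right_distrib)

lemma klin_minus_fun [klin_intros]: "klin f \<Longrightarrow> klin (\<lambda>x. - f x)"
  by (simp add: klin_def)

lemma klin_diff_fun [klin_intros]: "klin f \<Longrightarrow> klin g \<Longrightarrow> klin (\<lambda>x. f x - g x)"
  by (simp add: klin_def algebra_simps fvs.scale_right_diff_distrib)

lemma klin_fscale [klin_intros]: "klin f \<Longrightarrow> klin (\<lambda>x. fscale a (f x))"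
  by (simp add: klin_def fvs.scale_right_distrib mult.commute)

lemma klin_sum_fun [klin_intros]: "(\<And>i. i \<in> I \<Longrightarrow> klin (f i)) \<Longrightarrow> klin (\<lambda>x. \<Sum>i\<in>I. f i x)"
  by (induction I rule: infinite_finite_induct) (auto intro: klin_intros)

lemma klin_comp: "klin f \<Longrightarrow> klin g \<Longrightarrow> klin (\<lambda>x. f (g x))"
  by (simp add: klin_def)

lemma klin_funpow:
  fixes f :: "('x \<Rightarrow>\<^sub>0 'k::field) \<Rightarrow> ('x \<Rightarrow>\<^sub>0 'k)"
  shows "klin f \<Longrightarrow> klin (f ^^ n)"
  by (induction n) (auto simp: klin_def)

lemma klin_funpow_fun [klin_intros]:
  fixes f :: "('x \<Rightarrow>\<^sub>0 'k::field) \<Rightarrow> ('x \<Rightarrow>\<^sub>0 'k)"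
  shows "klin f \<Longrightarrow> klin g \<Longrightarrow> klin (\<lambda>x. (f ^^ n) (g x))"
  using klin_comp[OF klin_funpow] .

lemma klin_if [klin_intros]: "klin f \<Longrightarrow> klin g \<Longrightarrow> klin (\<lambda>x. if P then f x else g x)"
  by (cases P) simp_all

lemma lin_zero_right [simp]: "lin f 0 = 0"
  by (simp add: lin_def)

lemma lin_minus: "lin f (- v) = - lin f v"
  using lin_diff[of f 0 v] by simp

definition supported :: "'x set \<Rightarrow> ('x \<Rightarrow>\<^sub>0 'k::field) set" where
  "supported S = {v. Poly_Mapping.keys v \<subseteq> S}"

lemma supported_UNIV [simp]: "v \<in> supported UNIV"
  by (simp add: supported_def)

lemma supported_mono: "v \<in> supported S \<Longrightarrow> S \<subseteq> T \<Longrightarrow> v \<in> supported T"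
  by (auto simp: supported_def)

lemma supported_zero [simp]: "0 \<in> supported S"
  by (simp add: supported_def)

lemma supported_basis [simp]: "basis x \<in> supported S \<longleftrightarrow> x \<in> S"
  by (simp add: supported_def)

lemma supported_add: "u \<in> supported S \<Longrightarrow> v \<in> supported S \<Longrightarrow> u + v \<in> supported S"
  using Poly_Mapping.keys_add[of u v] by (auto simp: supported_def)

lemma supported_scale: "v \<in> supported S \<Longrightarrow> fscale a v \<in> supported S"
  by (auto simp: supported_def in_keys_iff)

lemma supported_minus: "v \<in> supported S \<Longrightarrow> - v \<in> supported S"
  using supported_scale[of v S "-1"] by simp

lemma supported_diff: "u \<in> supported S \<Longrightarrow> v \<in> supported S \<Longrightarrow> u - v \<in> supported S"
  using supported_add[of u S "- v"] supported_minus[of v S] by simp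

lemma supported_sum: "(\<And>i. i \<in> I \<Longrightarrow> f i \<in> supported S) \<Longrightarrow> (\<Sum>i\<in>I. f i) \<in> supported S"
  by (induction I rule: infinite_finite_induct) (auto intro: supported_add)

lemmas supported_intros =
  supported_zero supported_add supported_scale supported_minus supported_diff supported_sum

lemma supported_induct [consumes 1, case_names zero add scale basis]:
  assumes v: "v \<in> supported S"
    and "P 0" "\<And>u v. P u \<Longrightarrow> P v \<Longrightarrow> P (u + v)" "\<And>a v. P v \<Longrightarrow> P (fscale a v)"
    and "\<And>x. x \<in> S \<Longrightarrow> P (basis x)"
  shows "P v"
proof -
  have "P (\<Sum>x\<in>T. fscale (Poly_Mapping.lookup v x) (basis x))" if "finite T" "T \<subseteq> S" for T
    using that by induction (use assms in auto)
  from this[of "Poly_Mapping.keys v"] v show ?thesis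
    by (simp add: basis_expansion supported_def)
qed

lemma klin_ext_on:
  assumes "v \<in> supported S" "klin f" "klin g" "\<And>x. x \<in> S \<Longrightarrow> f (basis x) = g (basis x)"
  shows "f v = g v"
  using assms(1)
  by (induction rule: supported_induct) (use assms(2-) in \<open>auto simp: klin_zero klin_add klin_scale\<close>)

lemma klin_ext:
  assumes "klin f" "klin g" "\<And>x. f (basis x) = g (basis x)"
  shows "f v = g v"
  by (rule klin_ext_on[of v UNIV]) (use assms in auto)

lemma klin_supported:
  assumes "v \<in> supported S" "klin f" "\<And>x. x \<in> S \<Longrightarrow> f (basis x) \<in> supported T"
  shows "f v \<in> supported T"
  using assms(1)
  by (induction rule: supported_induct)
    (use assms(2-) in \<open>auto simp: klin_zero klin_add klin_scale intro: supported_intros\<close>)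

section \<open>The Hochschild complex of a twisted algebra\<close>

text \<open>The tensor power of order \<open>n\<close> of the algebra is spanned by the words of length \<open>n\<close> in the
  index set of its basis.\<close>

definition tcons :: "('i \<Rightarrow>\<^sub>0 'k::field) \<Rightarrow> ('i list \<Rightarrow>\<^sub>0 'k) \<Rightarrow> ('i list \<Rightarrow>\<^sub>0 'k)" where
  "tcons u x = lin (\<lambda>i. lin (\<lambda>w. basis (i # w)) x) u"

lemma tcons_basis [simp]: "tcons (basis i) (basis w) = basis (i # w)"
  by (simp add: tcons_def)

lemma klin_tcons_left [klin_intros]: "klin f \<Longrightarrow> klin (\<lambda>u. tcons (f u) x)"
  unfolding tcons_def by (intro klin_intros)

lemma klin_tcons_right [klin_intros]: "klin f \<Longrightarrow> klin (\<lambda>x. tcons u (f x))"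
  by (auto simp: klin_def tcons_def lin_add lin_fscale)
    (auto simp: lin_def fvs.scale_right_distrib sum.distrib fvs.scale_sum_right ac_simps)

lemmas tcons_simps =
  klin_zero[OF klin_tcons_left[OF klin_id]] klin_zero[OF klin_tcons_right[OF klin_id]]
  klin_add[OF klin_tcons_left[OF klin_id]] klin_add[OF klin_tcons_right[OF klin_id]]
  klin_diff[OF klin_tcons_left[OF klin_id]] klin_diff[OF klin_tcons_right[OF klin_id]]
  klin_minus[OF klin_tcons_left[OF klin_id]] klin_minus[OF klin_tcons_right[OF klin_id]]
  klin_scale[OF klin_tcons_left[OF klin_id]] klin_scale[OF klin_tcons_right[OF klin_id]]

definition words :: "nat \<Rightarrow> ('i list \<Rightarrow>\<^sub>0 'k::field) set" where
  "words n = supported {w. length w = n}"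

lemma tcons_words: "x \<in> words n \<Longrightarrow> tcons u x \<in> words (Suc n)"
  unfolding words_def
  by (rule klin_supported[of x], assumption, intro klin_intros,
      rule klin_supported[of u UNIV], simp, intro klin_intros, simp)

lemma words_zero [simp]: "0 \<in> words n"
  and words_add: "u \<in> words n \<Longrightarrow> v \<in> words n \<Longrightarrow> u + v \<in> words n"
  and words_scale: "u \<in> words n \<Longrightarrow> fscale a u \<in> words n"
  and words_minus: "u \<in> words n \<Longrightarrow> - u \<in> words n"
  and words_diff: "u \<in> words n \<Longrightarrow> v \<in> words n \<Longrightarrow> u - v \<in> words n"
  and words_sum: "(\<And>j. j \<in> J \<Longrightarrow> f j \<in> words n) \<Longrightarrow> (\<Sum>j\<in>J. f j) \<in> words n"
  unfolding words_def by (auto intro: supported_intros)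

lemmas words_intros = words_zero words_add words_scale words_minus words_diff words_sum

lemma words_basis [simp]: "basis w \<in> words n \<longleftrightarrow> length w = n"
  by (simp add: words_def)

lemma klin_words:
  assumes "v \<in> words n" "klin f" "\<And>w. length w = n \<Longrightarrow> f (basis w) \<in> words m"
  shows "f v \<in> words m"
  using assms unfolding words_def by (rule klin_supported) simp

lemma words_ext:
  assumes "v \<in> words n" "klin f" "klin g" "\<And>w. length w = n \<Longrightarrow> f (basis w) = g (basis w)"
  shows "f v = g v"
  using assms unfolding words_def by (rule klin_ext_on) simp

text \<open>The automorphism of the algebra in a basis of eigenvectors, \<open>chi\<close> being the
  eigenvalues; homogeneous components then become sets of words.\<close>

definition diag :: "('i \<Rightarrow> 'k::field) \<Rightarrow> ('i \<Rightarrow>\<^sub>0 'k) \<Rightarrow> ('i \<Rightarrow>\<^sub>0 'k)" where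
  "diag chi = lin (\<lambda>i. fscale (chi i) (basis i))"

lemma diag_basis [simp]: "diag chi (basis i) = fscale (chi i) (basis i)"
  by (simp add: diag_def)

lemma klin_diag [klin_intros]: "klin f \<Longrightarrow> klin (\<lambda>x. diag chi (f x))"
  unfolding diag_def by (intro klin_intros)

lemma lookup_diag: "Poly_Mapping.lookup (diag chi v) i = chi i * Poly_Mapping.lookup v i"
proof (induction v rule: free_vector_induct)
  case (basis x)
  then show ?case by (simp add: lookup_single when_def)
qed (auto simp: diag_def lin_add lin_fscale lookup_add algebra_simps)

locale twisted_algebra =
  fixes mul :: "('i \<Rightarrow>\<^sub>0 'k::field) \<Rightarrow> ('i \<Rightarrow>\<^sub>0 'k) \<Rightarrow> ('i \<Rightarrow>\<^sub>0 'k)" and one :: 'i and chi :: "'i \<Rightarrow> 'k"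
  assumes mul_left: "klin (\<lambda>u. mul u v)" and mul_right: "klin (mul u)"
    and mul_assoc: "mul (mul u v) w = mul u (mul v w)"
    and mul_one_left [simp]: "mul (basis one) v = v" and mul_one_right [simp]: "mul v (basis one) = v"
    and chi_one [simp]: "chi one = 1" and diag_mul: "diag chi (mul u v) = mul (diag chi u) (diag chi v)"
begin

lemma klin_mul_left [klin_intros]: "klin f \<Longrightarrow> klin (\<lambda>x. mul (f x) v)"
  by (rule klin_comp[OF mul_left])

lemma klin_mul_right [klin_intros]: "klin f \<Longrightarrow> klin (\<lambda>x. mul u (f x))"
  by (rule klin_comp[OF mul_right])

lemmas mul_simps =
  klin_zero[OF mul_left] klin_zero[OF mul_right] klin_add[OF mul_left] klin_add[OF mul_right]
  klin_diff[OF mul_left] klin_diff[OF mul_right] klin_minus[OF mul_left] klin_minus[OF mul_right]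
  klin_scale[OF mul_left] klin_scale[OF mul_right]

section \<open>Faces, bar differential and twisted Hochschild boundary\<close>

definition face0 :: "('i list \<Rightarrow>\<^sub>0 'k) \<Rightarrow> ('i list \<Rightarrow>\<^sub>0 'k)" where
  "face0 = lin (\<lambda>w. case w of i # j # v \<Rightarrow> tcons (mul (basis i) (basis j)) (basis v) | _ \<Rightarrow> 0)"

lemma klin_face0 [klin_intros]: "klin f \<Longrightarrow> klin (\<lambda>x. face0 (f x))"
  unfolding face0_def by (intro klin_intros)

lemmas face0_lin =
  klin_face0[OF klin_id, THEN klin_zero] klin_face0[OF klin_id, THEN klin_add]
  klin_face0[OF klin_id, THEN klin_diff] klin_face0[OF klin_id, THEN klin_minus]
  klin_face0[OF klin_id, THEN klin_scale]

lemma face0_short [simp]: "face0 (basis []) = 0" "face0 (basis [i]) = 0"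
  by (simp_all add: face0_def)

lemma face0_words0: "x \<in> words (Suc 0) \<Longrightarrow> face0 x = 0"
  unfolding words_def
  by (rule klin_ext_on, assumption) (auto intro!: klin_intros simp: length_Suc_conv)

lemma face0_tcons2 [simp]: "face0 (tcons u (tcons v x)) = tcons (mul u v) x"
proof (rule klin_ext[where v = u])
  show "face0 (tcons (basis i) (tcons v x)) = tcons (mul (basis i) v) x" for i
  proof (rule klin_ext[where v = v])
    show "face0 (tcons (basis i) (tcons (basis j) x)) = tcons (mul (basis i) (basis j)) x" for j
      by (rule klin_ext[where v = x]) (auto intro!: klin_intros simp: face0_def)
  qed (intro klin_intros)+
qed (intro klin_intros)+

lemma face0_basis_Cons [simp]: "face0 (tcons u (basis (j # w))) = tcons (mul u (basis j)) (basis w)"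
  using face0_tcons2[of u "basis j" "basis w"] by simp

lemma face0_basis_Cons2 [simp]: "face0 (basis (i # j # w)) = tcons (mul (basis i) (basis j)) (basis w)"
  using face0_basis_Cons[of "basis i" j w] by simp

lemma face0_tcons_Nil [simp]: "face0 (tcons u (basis [])) = 0"
  by (rule klin_ext[where v = u]) (auto intro!: klin_intros)

lemma face0_words: "x \<in> words (Suc (Suc n)) \<Longrightarrow> face0 x \<in> words (Suc n)"
  by (rule klin_words, assumption) (auto intro!: klin_intros tcons_words simp: length_Suc_conv)

text \<open>This is the differential \<open>b'\<close> of the bar complex, all faces but the wrapped
  one. The recursion on the first letter suits \<open>tcons\<close>; the single faces are recovered
  later, where powers of \<open>cycl\<close> enter.\<close>

fun bar_word :: "'i list \<Rightarrow> ('i list \<Rightarrow>\<^sub>0 'k)" where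
  "bar_word [] = 0"
| "bar_word (i # w) = face0 (basis (i # w)) - tcons (basis i) (bar_word w)"

definition bar :: "('i list \<Rightarrow>\<^sub>0 'k) \<Rightarrow> ('i list \<Rightarrow>\<^sub>0 'k)" where
  "bar = lin bar_word"

lemma klin_bar [klin_intros]: "klin f \<Longrightarrow> klin (\<lambda>x. bar (f x))"
  unfolding bar_def by (intro klin_intros)

lemmas bar_lin =
  klin_bar[OF klin_id, THEN klin_zero] klin_bar[OF klin_id, THEN klin_add]
  klin_bar[OF klin_id, THEN klin_diff] klin_bar[OF klin_id, THEN klin_minus]
  klin_bar[OF klin_id, THEN klin_scale]

lemma bar_Nil [simp]: "bar (basis []) = 0"
  by (simp add: bar_def)

lemma bar_tcons: "bar (tcons u x) = face0 (tcons u x) - tcons u (bar x)"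
proof (rule klin_ext[where v = u])
  show "bar (tcons (basis i) x) = face0 (tcons (basis i) x) - tcons (basis i) (bar x)" for i
    by (rule klin_ext[where v = x]) (auto intro!: klin_intros simp: bar_def)
qed (intro klin_intros)+

lemma bar_Cons: "bar (basis (i # w)) = face0 (basis (i # w)) - tcons (basis i) (bar (basis w))"
  using bar_tcons[of "basis i" "basis w"] by simp

lemma bar_single [simp]: "bar (basis [i]) = 0"
  by (simp add: bar_Cons tcons_simps)

lemma bar_words0: "x \<in> words (Suc 0) \<Longrightarrow> bar x = 0"
  unfolding words_def
  by (rule klin_ext_on, assumption) (auto intro!: klin_intros simp: length_Suc_conv)

lemma bar_words: "x \<in> words (Suc (Suc n)) \<Longrightarrow> bar x \<in> words (Suc n)"
proof (induction n arbitrary: x)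
  case 0
  show ?case by (rule klin_words[OF 0])
    (auto intro!: klin_intros tcons_words simp: length_Suc_conv bar_Cons tcons_simps)
next
  case (Suc n)
  show ?case
  proof (rule klin_words[OF Suc.prems])
    fix w :: "'i list" assume w: "length w = Suc (Suc (Suc n))"
    then obtain i v where v: "w = i # v" "length v = Suc (Suc n)" by (auto simp: length_Suc_conv)
    show "bar (basis w) \<in> words (Suc (Suc n))"
      using w v by (auto simp: bar_Cons intro!: words_diff face0_words tcons_words Suc.IH)
  qed (intro klin_intros)
qed

definition cycl :: "('i list \<Rightarrow>\<^sub>0 'k) \<Rightarrow> ('i list \<Rightarrow>\<^sub>0 'k)" where
  "cycl = lin (\<lambda>w. fscale ((-1) ^ (length w - 1) * chi (last w)) (basis (last w # butlast w)))"

lemma klin_cycl [klin_intros]: "klin f \<Longrightarrow> klin (\<lambda>x. cycl (f x))"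
  unfolding cycl_def by (intro klin_intros)

lemmas cycl_lin =
  klin_cycl[OF klin_id, THEN klin_zero] klin_cycl[OF klin_id, THEN klin_add]
  klin_cycl[OF klin_id, THEN klin_diff] klin_cycl[OF klin_id, THEN klin_minus]
  klin_cycl[OF klin_id, THEN klin_scale]

lemma cycl_snoc [simp]: "cycl (basis (w @ [i])) = fscale ((-1) ^ length w * chi i) (basis (i # w))"
  by (simp add: cycl_def)

lemma cycl_Cons_snoc [simp]:
  "cycl (basis (j # w @ [i])) = fscale ((-1) ^ Suc (length w) * chi i) (basis (i # j # w))"
  using cycl_snoc[of "j # w" i] by (simp del: cycl_snoc)

lemma cycl_words: "x \<in> words (Suc n) \<Longrightarrow> cycl x \<in> words (Suc n)"
  by (rule klin_words, assumption)
    (auto intro!: klin_intros supported_intros simp: words_def cycl_def)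

lemma cycl_tcons_snoc:
  "cycl (tcons u (basis (w @ [i]))) = fscale ((-1) ^ Suc (length w) * chi i) (tcons (basis i) (tcons u (basis w)))"
  by (rule klin_ext[where v = u]) (auto intro!: klin_intros)

text \<open>The last face is \<open>face0\<close> after \<open>cycl\<close>, because the sign of
  \<open>cycl\<close> is the sign of that face.\<close>

definition hoch :: "('i list \<Rightarrow>\<^sub>0 'k) \<Rightarrow> ('i list \<Rightarrow>\<^sub>0 'k)" where
  "hoch x = bar x + face0 (cycl x)"

lemma klin_hoch [klin_intros]: "klin f \<Longrightarrow> klin (\<lambda>x. hoch (f x))"
  unfolding hoch_def by (intro klin_intros)

lemmas hoch_lin =
  klin_hoch[OF klin_id, THEN klin_zero] klin_hoch[OF klin_id, THEN klin_add]
  klin_hoch[OF klin_id, THEN klin_diff] klin_hoch[OF klin_id, THEN klin_minus]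
  klin_hoch[OF klin_id, THEN klin_scale]

lemma hoch_words: "x \<in> words (Suc (Suc n)) \<Longrightarrow> hoch x \<in> words (Suc n)"
  unfolding hoch_def by (intro words_intros bar_words face0_words cycl_words)

lemma hoch_words0: "x \<in> words (Suc 0) \<Longrightarrow> hoch x = 0"
  by (simp add: hoch_def bar_words0 face0_words0 cycl_words)

text \<open>Up to sign, the faces other than the first one.  With the bimodule structure acting on the
  first two letters this is the Hochschild boundary with coefficients in a free bimodule, and
  \<open>face0\<close> is the augmentation onto the coefficients in the twisted algebra.\<close>

definition fhoch :: "('i list \<Rightarrow>\<^sub>0 'k) \<Rightarrow> ('i list \<Rightarrow>\<^sub>0 'k)" where
  "fhoch x = face0 x - hoch x"

lemma klin_fhoch [klin_intros]: "klin f \<Longrightarrow> klin (\<lambda>x. fhoch (f x))"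
  unfolding fhoch_def by (intro klin_intros)

lemmas fhoch_lin =
  klin_fhoch[OF klin_id, THEN klin_zero] klin_fhoch[OF klin_id, THEN klin_add]
  klin_fhoch[OF klin_id, THEN klin_diff] klin_fhoch[OF klin_id, THEN klin_minus]
  klin_fhoch[OF klin_id, THEN klin_scale]

lemma fhoch_words: "x \<in> words (Suc (Suc n)) \<Longrightarrow> fhoch x \<in> words (Suc n)"
  unfolding fhoch_def by (intro words_intros hoch_words face0_words)

lemma fhoch_words0: "x \<in> words (Suc 0) \<Longrightarrow> fhoch x = 0"
  by (simp add: fhoch_def face0_words0 hoch_words0)

lemma fhoch_tcons: "fhoch (tcons u x) = tcons u (bar x) - face0 (cycl (tcons u x))"
  by (simp add: fhoch_def hoch_def bar_tcons)

lemma fhoch_tcons_snoc: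
  "fhoch (tcons u (basis (w @ [i]))) = tcons u (bar (basis (w @ [i])))
     + fscale ((-1) ^ length w * chi i) (tcons (mul (basis i) u) (basis w))"
  by (simp add: fhoch_tcons cycl_tcons_snoc face0_lin)

lemma fhoch_tcons_Nil [simp]: "fhoch (tcons u (basis [])) = 0"
  by (rule fhoch_words0, rule tcons_words) simp

definition insert_one :: "('i list \<Rightarrow>\<^sub>0 'k) \<Rightarrow> ('i list \<Rightarrow>\<^sub>0 'k)" where
  "insert_one = lin (\<lambda>w. case w of [] \<Rightarrow> 0 | i # v \<Rightarrow> basis (i # one # v))"

lemma klin_insert_one [klin_intros]: "klin f \<Longrightarrow> klin (\<lambda>x. insert_one (f x))"
  unfolding insert_one_def by (intro klin_intros)

lemmas insert_one_lin =
  klin_insert_one[OF klin_id, THEN klin_zero] klin_insert_one[OF klin_id, THEN klin_add]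
  klin_insert_one[OF klin_id, THEN klin_diff] klin_insert_one[OF klin_id, THEN klin_minus]
  klin_insert_one[OF klin_id, THEN klin_scale]

lemma insert_one_tcons [simp]: "insert_one (tcons u x) = tcons u (tcons (basis one) x)"
proof (rule klin_ext[where v = u])
  show "insert_one (tcons (basis i) x) = tcons (basis i) (tcons (basis one) x)" for i
    by (rule klin_ext[where v = x]) (auto intro!: klin_intros simp: insert_one_def)
qed (intro klin_intros)+

lemma insert_one_basis [simp]: "insert_one (basis (i # w)) = basis (i # one # w)"
  by (simp add: insert_one_def)

lemma insert_one_words: "x \<in> words (Suc n) \<Longrightarrow> insert_one x \<in> words (Suc (Suc n))"
  by (rule klin_words, assumption) (auto intro!: klin_intros simp: insert_one_def length_Suc_conv)

lemma face0_insert_one: "x \<in> words (Suc n) \<Longrightarrow> face0 (insert_one x) = x"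
  by (rule words_ext, assumption) (auto intro!: klin_intros simp: length_Suc_conv)

lemma bar_unit_word: "bar (basis (one # i # w)) = basis (i # w) - tcons (basis one) (bar (basis (i # w)))"
  by (simp add: bar_Cons[of one])

text \<open>After a unit is inserted as second letter, the first inner product restores the word and
  every later face commutes with the insertion up to sign. One-letter words are included, so this
  contracts the complex augmented by them: the columns of the later double complex are
  exact.\<close>

lemma fhoch_insert_one:
  assumes "z \<in> words (Suc n)"
  shows "fhoch (insert_one z) + insert_one (fhoch z) = z"
  using assms unfolding words_def
proof (rule klin_ext_on)
  fix w :: "'i list" assume "w \<in> {w. length w = Suc n}"
  then obtain x v where w: "w = x # v" by (auto simp: length_Suc_conv)
  show "fhoch (insert_one (basis w)) + insert_one (fhoch (basis w)) = basis w"
  proof (cases v rule: rev_cases)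
    case Nil
    have "insert_one (basis w) = basis [x, one]" by (simp add: w Nil insert_one_def)
    then show ?thesis
      using fhoch_tcons_snoc[of "basis x" "[]" one] fhoch_tcons_Nil[of "basis x"]
      by (simp add: w Nil tcons_simps insert_one_lin)
  next
    case (snoc v' l)
    have *: "bar (basis (one # v)) = basis v - tcons (basis one) (bar (basis v))"
    proof -
      obtain a u where "v = a # u" using snoc by (metis Nil_is_append_conv list.exhaust not_Cons_self2)
      then show ?thesis by (simp add: bar_unit_word)
    qed
    have 1: "fhoch (insert_one (basis w)) = tcons (basis x) (bar (basis (one # v)))
        + fscale ((-1) ^ Suc (length v') * chi l) (tcons (mul (basis l) (basis x)) (basis (one # v')))"
      using fhoch_tcons_snoc[of "basis x" "one # v'" l]
      by (simp add: w snoc insert_one_def)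
    have 2: "fhoch (basis w) = tcons (basis x) (bar (basis v))
        + fscale ((-1) ^ length v' * chi l) (tcons (mul (basis l) (basis x)) (basis v'))"
      using fhoch_tcons_snoc[of "basis x" v' l] by (simp add: w snoc)
    have 3: "insert_one (fhoch (basis w)) = tcons (basis x) (tcons (basis one) (bar (basis v)))
        + fscale ((-1) ^ length v' * chi l) (tcons (mul (basis l) (basis x)) (basis (one # v')))"
      unfolding 2 by (simp add: insert_one_lin)
    show ?thesis unfolding 1 3 * by (simp add: tcons_simps w)
  qed
qed (intro klin_intros)+


text \<open>For a word read as \<open>x g y\<close> followed by inert letters, \<open>rmul\<close>
  and \<open>lmul\<close> multiply on the inner sides, next to \<open>g\<close>. They are the matrix
  entries of bimodule maps, and they commute with \<open>fhoch\<close>, which acts from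
  outside.\<close>

definition rmul :: "('i \<Rightarrow>\<^sub>0 'k) \<Rightarrow> ('i list \<Rightarrow>\<^sub>0 'k) \<Rightarrow> ('i list \<Rightarrow>\<^sub>0 'k)" where
  "rmul v = lin (\<lambda>w. case w of [] \<Rightarrow> 0 | i # w' \<Rightarrow> tcons (mul (basis i) v) (basis w'))"

lemma klin_rmul [klin_intros]: "klin f \<Longrightarrow> klin (\<lambda>x. rmul v (f x))"
  unfolding rmul_def by (intro klin_intros)

lemmas rmul_lin =
  klin_rmul[OF klin_id, THEN klin_zero] klin_rmul[OF klin_id, THEN klin_add]
  klin_rmul[OF klin_id, THEN klin_diff] klin_rmul[OF klin_id, THEN klin_minus]
  klin_rmul[OF klin_id, THEN klin_scale]

lemma rmul_tcons [simp]: "rmul v (tcons u x) = tcons (mul u v) x"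
proof (rule klin_ext[where v = u])
  show "rmul v (tcons (basis i) x) = tcons (mul (basis i) v) x" for i
    by (rule klin_ext[where v = x]) (auto intro!: klin_intros simp: rmul_def)
qed (intro klin_intros)+

lemma rmul_basis [simp]: "rmul v (basis (i # w)) = tcons (mul (basis i) v) (basis w)"
  using rmul_tcons[of v "basis i" "basis w"] by simp

lemma rmul_words: "x \<in> words (Suc n) \<Longrightarrow> rmul v x \<in> words (Suc n)"
  by (rule klin_words, assumption) (auto intro!: klin_intros tcons_words simp: length_Suc_conv)

definition first_lmul :: "('i \<Rightarrow>\<^sub>0 'k) \<Rightarrow> ('i list \<Rightarrow>\<^sub>0 'k) \<Rightarrow> ('i list \<Rightarrow>\<^sub>0 'k)" where
  "first_lmul v = lin (\<lambda>w. case w of [] \<Rightarrow> 0 | i # w' \<Rightarrow> tcons (mul v (basis i)) (basis w'))"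

lemma klin_first_lmul [klin_intros]: "klin f \<Longrightarrow> klin (\<lambda>x. first_lmul v (f x))"
  unfolding first_lmul_def by (intro klin_intros)

lemmas first_lmul_lin =
  klin_first_lmul[OF klin_id, THEN klin_zero] klin_first_lmul[OF klin_id, THEN klin_add]
  klin_first_lmul[OF klin_id, THEN klin_diff] klin_first_lmul[OF klin_id, THEN klin_minus]
  klin_first_lmul[OF klin_id, THEN klin_scale]

lemma first_lmul_tcons [simp]: "first_lmul v (tcons u x) = tcons (mul v u) x"
proof (rule klin_ext[where v = u])
  show "first_lmul v (tcons (basis i) x) = tcons (mul v (basis i)) x" for i
    by (rule klin_ext[where v = x]) (auto intro!: klin_intros simp: first_lmul_def)
qed (intro klin_intros)+

lemma first_lmul_basis [simp]: "first_lmul v (basis (i # w)) = tcons (mul v (basis i)) (basis w)"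
  using first_lmul_tcons[of v "basis i" "basis w"] by simp

lemma first_lmul_face0:
  "x \<in> words (Suc n) \<Longrightarrow> face0 (first_lmul v x) = first_lmul v (face0 x)"
proof (rule words_ext, assumption)
  fix w :: "'i list" assume "length w = Suc n"
  then show "face0 (first_lmul v (basis w)) = first_lmul v (face0 (basis w))"
    by (cases w rule: bar_word.cases; cases "tl w")
      (auto simp: mul_assoc first_lmul_lin)
qed (intro klin_intros)+

lemma first_lmul_bar: "x \<in> words (Suc n) \<Longrightarrow> bar (first_lmul v x) = first_lmul v (bar x)"
proof (rule words_ext, assumption)
  fix w :: "'i list" assume w: "length w = Suc n"
  then obtain i u where "w = i # u" by (auto simp: length_Suc_conv)
  then show "bar (first_lmul v (basis w)) = first_lmul v (bar (basis w))"
    using first_lmul_face0[of "basis w" n v] w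
    by (simp add: bar_tcons bar_Cons first_lmul_lin)
qed (intro klin_intros)+

text \<open>A word with first letter \<open>i\<close> comes from one with the unit in front by left
  multiplication of the first letter, which commutes with \<open>bar\<close>. For a leading unit the
  claim reduces to a shorter word.\<close>

lemma bar_bar: "x \<in> words n \<Longrightarrow> bar (bar x) = 0"
proof (induction n arbitrary: x)
  case 0
  show ?case by (rule words_ext[OF 0]) (auto intro!: klin_intros simp: bar_lin)
next
  case (Suc n)
  show ?case
  proof (rule words_ext[OF Suc.prems])
    fix w :: "'i list" assume "length w = Suc n"
    then obtain i u where u: "w = i # u" "length u = n" by (auto simp: length_Suc_conv)
    show "bar (bar (basis w)) = 0"
    proof (cases n)
      case 0
      then show ?thesis using u by (simp add: bar_lin)
    next
      case (Suc m)
      then obtain j u' where u': "u = j # u'" using u by (cases u) auto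
      have 1: "bar (basis (one # u)) = basis u - tcons (basis one) (bar (basis u))"
        unfolding u' by (rule bar_unit_word)
      have 2: "bar (tcons (basis one) (bar (basis u))) = bar (basis u)"
      proof (cases m)
        case 0
        then have "bar (basis u) = 0" using u Suc by (auto simp: length_Suc_conv)
        then show ?thesis by (simp add: tcons_simps bar_lin)
      next
        case (Suc m')
        then have "bar (basis u) \<in> words (Suc m')"
          using u \<open>n = Suc m\<close> by (intro bar_words) simp
        then have "face0 (tcons (basis one) (bar (basis u))) = bar (basis u)"
          by (rule words_ext) (auto intro!: klin_intros simp: length_Suc_conv)
        moreover have "bar (bar (basis u)) = 0" using Suc.IH[of "basis u"] u by simp
        ultimately show ?thesis by (simp add: bar_tcons tcons_simps)
      qed
      have "bar (bar (basis (one # u))) = 0"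
        unfolding 1 by (simp add: bar_lin 2)
      moreover have "basis w = first_lmul (basis i) (basis (one # u))" by (simp add: u)
      moreover have "bar (basis (one # u)) \<in> words (Suc m)"
        using u Suc by (intro bar_words) simp
      ultimately show ?thesis
        using u Suc by (simp add: first_lmul_bar[of "basis (one # u)" n] first_lmul_bar[of _ m]
            first_lmul_lin del: first_lmul_basis)
    qed
  qed (intro klin_intros)+
qed

text \<open>On words of length one the two outer factors are wrapped around to a single one.\<close>

definition lmul :: "('i \<Rightarrow>\<^sub>0 'k) \<Rightarrow> ('i list \<Rightarrow>\<^sub>0 'k) \<Rightarrow> ('i list \<Rightarrow>\<^sub>0 'k)" where
  "lmul v = lin (\<lambda>w. case w of [] \<Rightarrow> 0 | [i] \<Rightarrow> tcons (mul (diag chi v) (basis i)) (basis [])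
     | i # j # w' \<Rightarrow> tcons (basis i) (tcons (mul v (basis j)) (basis w')))"

lemma klin_lmul [klin_intros]: "klin f \<Longrightarrow> klin (\<lambda>x. lmul v (f x))"
  unfolding lmul_def by (intro klin_intros)

lemmas lmul_lin =
  klin_lmul[OF klin_id, THEN klin_zero] klin_lmul[OF klin_id, THEN klin_add]
  klin_lmul[OF klin_id, THEN klin_diff] klin_lmul[OF klin_id, THEN klin_minus]
  klin_lmul[OF klin_id, THEN klin_scale]

lemma lmul_single [simp]: "lmul v (tcons u (basis [])) = tcons (mul (diag chi v) u) (basis [])"
  by (rule klin_ext[where v = u]) (auto intro!: klin_intros simp: lmul_def)

lemma lmul_tcons: "x \<in> words (Suc n) \<Longrightarrow> lmul v (tcons u x) = tcons u (first_lmul v x)"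
proof (rule klin_ext[where v = u])
  fix i assume x: "x \<in> words (Suc n)"
  show "lmul v (tcons (basis i) x) = tcons (basis i) (first_lmul v x)"
    by (rule words_ext[OF x]) (auto intro!: klin_intros simp: lmul_def length_Suc_conv)
qed (intro klin_intros)+

lemma lmul_tcons2 [simp]: "lmul v (tcons u (tcons z x)) = tcons u (tcons (mul v z) x)"
proof (rule klin_ext[where v = x])
  show "lmul v (tcons u (tcons z (basis w))) = tcons u (tcons (mul v z) (basis w))" for w
    using lmul_tcons[OF tcons_words[of "basis w" "length w" z], of v u] by simp
qed (intro klin_intros)+

lemma lmul_basis2 [simp]: "lmul v (basis (i # j # w)) = tcons (basis i) (tcons (mul v (basis j)) (basis w))"
  using lmul_tcons2[of v "basis i" "basis j" "basis w"] by simp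

lemma lmul_tcons_basis [simp]: "lmul v (tcons u (basis (j # w))) = tcons u (tcons (mul v (basis j)) (basis w))"
  using lmul_tcons2[of v u "basis j" "basis w"] by simp

lemma lmul_basis1 [simp]: "lmul v (basis [i]) = tcons (mul (diag chi v) (basis i)) (basis [])"
  using lmul_single[of v "basis i"] by simp

lemma lmul_words: "x \<in> words (Suc n) \<Longrightarrow> lmul v x \<in> words (Suc n)"
  by (cases n; rule klin_words, assumption) (auto intro!: klin_intros tcons_words simp: length_Suc_conv)

lemma klin_rmul_arg [klin_intros]: "klin f \<Longrightarrow> klin (\<lambda>v. rmul (f v) x)"
proof (rule klin_comp[where f = "\<lambda>v. rmul v x"])
  show "klin (\<lambda>v. rmul v x)"
  proof -
    have "rmul (u + v) x = rmul u x + rmul v x" "rmul (fscale a v) x = fscale a (rmul v x)" for a u v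
      by (rule klin_ext[where v = x];
          auto intro!: klin_intros simp: rmul_def mul_simps tcons_simps split: list.split)+
    then show ?thesis by (simp add: klin_def)
  qed
qed

lemma klin_lmul_arg [klin_intros]: "klin f \<Longrightarrow> klin (\<lambda>v. lmul (f v) x)"
proof (rule klin_comp[where f = "\<lambda>v. lmul v x"])
  show "klin (\<lambda>v. lmul v x)"
  proof -
    have "lmul (u + v) x = lmul u x + lmul v x" "lmul (fscale a v) x = fscale a (lmul v x)" for a u v
      by (rule klin_ext[where v = x];
          auto intro!: klin_intros simp: lmul_def mul_simps tcons_simps split: list.split
            simp: klin_add[OF klin_diag[OF klin_id]] klin_scale[OF klin_diag[OF klin_id]])+
    then show ?thesis by (simp add: klin_def)
  qed
qed

lemma rmul_rmul: "rmul u (rmul v x) = rmul (mul v u) x"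
proof (rule klin_ext[where v = x])
  show "rmul u (rmul v (basis w)) = rmul (mul v u) (basis w)" for w
    by (cases w) (auto simp: mul_assoc, simp add: rmul_def)
qed (intro klin_intros)+

lemma lmul_lmul: "lmul u (lmul v x) = lmul (mul u v) x"
proof (rule klin_ext[where v = x])
  show "lmul u (lmul v (basis w)) = lmul (mul u v) (basis w)" for w
  proof (cases w)
    case (Cons i w')
    then show ?thesis by (cases w') (auto simp: mul_assoc diag_mul)
  qed (auto simp: lmul_def)
qed (intro klin_intros)+

lemma lmul_rmul: "lmul u (rmul v x) = rmul v (lmul u x)"
proof (rule klin_ext[where v = x])
  show "lmul u (rmul v (basis w)) = rmul v (lmul u (basis w))" for w
  proof (cases w)
    case (Cons i w')
    then show ?thesis
      using lmul_tcons2[of u _ "basis (hd w')" "basis (tl w')"]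
      by (cases w') (auto simp: mul_assoc)
  qed (auto simp: lmul_def rmul_def)
qed (intro klin_intros)+

lemma lmul_one: "x \<in> words (Suc n) \<Longrightarrow> lmul (basis one) x = x"
  by (cases n; rule words_ext, assumption) (auto intro!: klin_intros simp: length_Suc_conv)

lemma rmul_one: "x \<in> words (Suc n) \<Longrightarrow> rmul (basis one) x = x"
  by (rule words_ext, assumption) (auto intro!: klin_intros simp: length_Suc_conv)

lemma face0_lmul: "x \<in> words (Suc (Suc n)) \<Longrightarrow> face0 (lmul v x) = face0 (rmul v x)"
  by (rule words_ext, assumption) (auto intro!: klin_intros simp: length_Suc_conv mul_assoc)

lemma fhoch_rmul:
  assumes "x \<in> words (Suc n)"
  shows "fhoch (rmul v x) = rmul v (fhoch x)"
  using assms
proof (rule words_ext)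
  fix w :: "'i list" assume "length w = Suc n"
  then obtain i u where w: "w = i # u" by (cases w) auto
  show "fhoch (rmul v (basis w)) = rmul v (fhoch (basis w))"
  proof (cases u rule: rev_cases)
    case Nil
    then show ?thesis by (simp add: w fhoch_words0[of "basis [i]"] rmul_lin)
  next
    case (snoc u' l)
    have "fhoch (tcons z (basis u)) = tcons z (bar (basis u))
        + fscale ((-1) ^ length u' * chi l) (tcons (mul (basis l) z) (basis u'))" for z
      unfolding snoc by (rule fhoch_tcons_snoc)
    from this[of "basis i"] this show ?thesis by (simp add: w rmul_lin mul_assoc)
  qed
qed (intro klin_intros)+

lemma fhoch_lmul:
  assumes "x \<in> words (Suc (Suc n))"
  shows "fhoch (lmul v x) = lmul v (fhoch x)"
  using assms
proof (rule words_ext)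
  fix w :: "'i list" assume "length w = Suc (Suc n)"
  then obtain i j u where w: "w = i # j # u" by (cases w rule: bar_word.cases; cases "tl w") auto
  show "fhoch (lmul v (basis w)) = lmul v (fhoch (basis w))"
  proof (cases u rule: rev_cases)
    case Nil
    \<comment> \<open>The last letter of a two-letter word wraps around with its twist; the value of
      \<open>lmul\<close> on one-letter words is chosen to match this.\<close>
    have 1: "fhoch (tcons (basis i) (tcons z (basis []))) = tcons (mul (diag chi z) (basis i)) (basis [])" for z
    proof (rule klin_ext[where v = z])
      show "fhoch (tcons (basis i) (tcons (basis j) (basis []))) =
          tcons (mul (diag chi (basis j)) (basis i)) (basis [])" for j
        using fhoch_tcons_snoc[of "basis i" "[]" j] by (simp add: tcons_simps mul_simps)
    qed (intro klin_intros)+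
    from this[of "basis j"] this show ?thesis
      by (simp add: w Nil diag_mul mul_assoc del: diag_basis)
  next
    case (snoc u' l)
    have 1: "fhoch (tcons (basis i) (tcons z (basis u))) = tcons (basis i) (bar (tcons z (basis u)))
        + fscale ((-1) ^ Suc (length u') * chi l) (tcons (mul (basis l) (basis i)) (tcons z (basis u')))" for z
    proof (rule klin_ext[where v = z])
      show "fhoch (tcons (basis i) (tcons (basis j) (basis u))) = tcons (basis i) (bar (tcons (basis j) (basis u)))
        + fscale ((-1) ^ Suc (length u') * chi l) (tcons (mul (basis l) (basis i)) (tcons (basis j) (basis u')))" for j
        using fhoch_tcons_snoc[of "basis i" "j # u'" l] by (simp add: snoc)
    qed (intro klin_intros)+
    have 2: "bar (basis (j # u)) \<in> words (Suc (length u'))"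
      by (rule bar_words) (simp add: snoc)
    have 3: "bar (tcons (mul v (basis j)) (basis u)) = first_lmul v (bar (basis (j # u)))"
      using first_lmul_bar[of "basis (j # u)" "length u" v] by simp
    from 1[of "basis j"] 1 show ?thesis
      by (simp add: w lmul_lin lmul_tcons[OF 2] 3)
  qed
qed (intro klin_intros)+

text \<open>Write \<open>h\<close> for \<open>insert_one\<close>. From
  \<open>fhoch h = 1 - h fhoch\<close> one gets \<open>fhoch fhoch h = h fhoch fhoch\<close>, zero
  by induction, and \<open>lmul\<close> extends this from words whose second letter is the unit to
  all words.\<close>

lemma fhoch_fhoch: "x \<in> words (Suc n) \<Longrightarrow> fhoch (fhoch x) = 0"
proof (induction n arbitrary: x)
  case 0
  then show ?case by (simp add: fhoch_words0 fhoch_lin)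
next
  case (Suc m)
  show ?case
  proof (rule words_ext[OF Suc.prems])
    fix w :: "'i list" assume w: "length w = Suc (Suc m)"
    then obtain i j u where u: "w = i # j # u" "length u = m" by (auto simp: length_Suc_conv)
    define z where "z = (basis (i # u) :: 'i list \<Rightarrow>\<^sub>0 'k)"
    have z: "z \<in> words (Suc m)" by (simp add: z_def u)
    have wz: "basis w = lmul (basis j) (insert_one z)" by (simp add: z_def u)
    have iz: "insert_one z \<in> words (Suc (Suc m))" using z by (rule insert_one_words)
    have 1: "fhoch (insert_one z) = z - insert_one (fhoch z)"
      using fhoch_insert_one[OF z] by (simp add: algebra_simps)
    show "fhoch (fhoch (basis w)) = 0"
    proof (cases m)
      case 0
      then show ?thesis
        using fhoch_words0[of "fhoch (basis w)"] fhoch_words[of "basis w" 0] u by simp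
    next
      case (Suc m')
      then have "fhoch z \<in> words (Suc m')" using z fhoch_words by blast
      from fhoch_insert_one[OF this] Suc.IH[OF z]
      have 2: "fhoch (fhoch (insert_one z)) = 0" by (simp add: 1 fhoch_lin insert_one_lin)
      from Suc have "fhoch (insert_one z) \<in> words (Suc (Suc m'))" using iz fhoch_words by blast
      then show ?thesis
        unfolding wz fhoch_lmul[OF iz] by (simp add: fhoch_lmul 2 lmul_lin)
    qed
  qed (intro klin_intros)+
qed

text \<open>Multiplying the two outer factors of \<open>x g y\<close> is a bimodule map, so it
  induces a chain map; the sign convention of \<open>fhoch\<close> is such that none is left
  here.\<close>

lemma hoch_face0:
  assumes "x \<in> words (Suc n)"
  shows "hoch (face0 x) = face0 (fhoch x)"
  using assms
proof (rule words_ext)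
  fix w :: "'i list" assume lw: "length w = Suc n"
  show "hoch (face0 (basis w)) = face0 (fhoch (basis w))"
  proof (cases n)
    case 0
    with lw obtain i where "w = [i]" by (auto simp: length_Suc_conv)
    then show ?thesis by (simp add: fhoch_words0 hoch_def face0_lin bar_lin cycl_lin)
  next
    case (Suc m)
    with lw obtain i j u where w: "w = i # j # u" by (auto simp: length_Suc_conv)
    show ?thesis
    proof (cases u rule: rev_cases)
      case Nil
      have "fhoch (basis w) \<in> words (Suc 0)" by (rule fhoch_words) (simp add: w Nil)
      moreover have "face0 (basis w) \<in> words (Suc 0)" by (rule face0_words) (simp add: w Nil)
      ultimately show ?thesis by (simp add: face0_words0 hoch_words0)
    next
      case (snoc u' l)
      have 1: "face0 (tcons x (bar (basis (j # u)))) = bar (tcons (mul x (basis j)) (basis u))" for x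
      proof -
        obtain k u2 where "u = k # u2" using snoc by (metis Nil_is_append_conv list.exhaust not_Cons_self2)
        then show ?thesis by (simp add: bar_Cons[of j] bar_tcons tcons_simps face0_lin mul_assoc)
      qed
      have 2: "fhoch (basis w) = tcons (basis i) (bar (basis (j # u)))
         + fscale ((-1) ^ Suc (length u') * chi l) (tcons (mul (basis l) (basis i)) (basis (j # u')))"
        using fhoch_tcons_snoc[of "basis i" "j # u'" l] by (simp add: w snoc)
      show ?thesis
        unfolding 2 by (simp add: w hoch_def 1[unfolded snoc] face0_lin snoc cycl_tcons_snoc mul_assoc)
    qed
  qed
qed (intro klin_intros)+

text \<open>Every chain is \<open>face0\<close> of the same chain with a unit inserted, so the
  vanishing of the square of \<open>fhoch\<close> carries over.\<close>

lemma hoch_hoch: "x \<in> words (Suc n) \<Longrightarrow> hoch (hoch x) = 0"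
proof -
  assume x: "x \<in> words (Suc n)"
  have "hoch (hoch (face0 (insert_one x))) = face0 (fhoch (fhoch (insert_one x)))"
  proof (cases n)
    case 0
    then show ?thesis
      using x face0_insert_one[of x n] fhoch_fhoch[OF insert_one_words[OF x]]
      by (simp add: hoch_words0 hoch_lin face0_lin)
  next
    case (Suc m)
    have "insert_one x \<in> words (Suc (Suc n))" using x by (rule insert_one_words)
    then show ?thesis by (simp add: hoch_face0 hoch_face0[OF fhoch_words])
  qed
  then show ?thesis using x by (simp add: face0_insert_one fhoch_fhoch[OF insert_one_words] face0_lin)
qed

end

section \<open>The mixed complex and the periodicity sequence\<close>

text \<open>The bicomplex of a cyclic module in which the cyclic operator \<open>t\<close> has order \<open>n + 1\<close> in
  degree \<open>n\<close>, including its sign: every face is \<open>t\<^sup>j d\<^sub>0 t\<^sup>-\<^sup>j\<close>, and \<open>s\<close> is the extra degeneracy.  All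
  degrees live in the same space, and \<open>proj n\<close> extracts the component of degree \<open>n\<close>.\<close>

locale cyclic_complex =
  fixes V :: "nat \<Rightarrow> ('x \<Rightarrow>\<^sub>0 'k::field_char_0) set"
    and t d0 s b b' N :: "('x \<Rightarrow>\<^sub>0 'k) \<Rightarrow> ('x \<Rightarrow>\<^sub>0 'k)" and proj :: "nat \<Rightarrow> ('x \<Rightarrow>\<^sub>0 'k) \<Rightarrow> ('x \<Rightarrow>\<^sub>0 'k)"
  assumes V_zero [simp]: "0 \<in> V n" and V_add: "x \<in> V n \<Longrightarrow> y \<in> V n \<Longrightarrow> x + y \<in> V n"
    and V_scale: "x \<in> V n \<Longrightarrow> fscale a x \<in> V n"
    and klin_t: "klin t" and klin_d0: "klin d0" and klin_s: "klin s" and klin_b: "klin b"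
    and klin_b': "klin b'" and klin_N: "klin N" and klin_proj: "klin (proj m)"
    and t_V: "x \<in> V n \<Longrightarrow> t x \<in> V n" and t_pow: "x \<in> V n \<Longrightarrow> (t ^^ Suc n) x = x"
    and d0_V: "x \<in> V (Suc n) \<Longrightarrow> d0 x \<in> V n" and s_V: "x \<in> V n \<Longrightarrow> s x \<in> V (Suc n)"
    and b0: "x \<in> V 0 \<Longrightarrow> b x = 0" and b'0: "x \<in> V 0 \<Longrightarrow> b' x = 0"
    and b_Suc: "x \<in> V (Suc n) \<Longrightarrow> b x = (\<Sum>j\<le>Suc n. (t ^^ j) (d0 ((t ^^ (Suc (Suc n) - j)) x)))"
    and b'_Suc: "x \<in> V (Suc n) \<Longrightarrow> b' x = (\<Sum>j\<le>n. (t ^^ j) (d0 ((t ^^ (Suc (Suc n) - j)) x)))"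
    and N_eq: "x \<in> V n \<Longrightarrow> N x = (\<Sum>i\<le>n. (t ^^ i) x)"
    and contraction: "x \<in> V n \<Longrightarrow> b' (s x) + s (b' x) = x"
    and bb: "x \<in> V n \<Longrightarrow> b (b x) = 0" and b'b': "x \<in> V n \<Longrightarrow> b' (b' x) = 0"
    and proj_same: "x \<in> V n \<Longrightarrow> proj n x = x" and proj_other: "x \<in> V n \<Longrightarrow> m \<noteq> n \<Longrightarrow> proj m x = 0"
begin

lemmas lin_simps =
  klin_zero[OF klin_t] klin_add[OF klin_t] klin_diff[OF klin_t] klin_scale[OF klin_t] klin_sum[OF klin_t] klin_minus[OF klin_t]
  klin_zero[OF klin_d0] klin_add[OF klin_d0] klin_diff[OF klin_d0] klin_scale[OF klin_d0] klin_sum[OF klin_d0]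
  klin_zero[OF klin_s] klin_add[OF klin_s] klin_diff[OF klin_s] klin_scale[OF klin_s] klin_minus[OF klin_s]
  klin_zero[OF klin_b] klin_add[OF klin_b] klin_diff[OF klin_b] klin_scale[OF klin_b] klin_minus[OF klin_b]
  klin_zero[OF klin_b'] klin_add[OF klin_b'] klin_diff[OF klin_b'] klin_scale[OF klin_b']
  klin_zero[OF klin_N] klin_add[OF klin_N] klin_diff[OF klin_N] klin_scale[OF klin_N] klin_minus[OF klin_N]
  klin_zero[OF klin_proj] klin_add[OF klin_proj] klin_diff[OF klin_proj] klin_scale[OF klin_proj] klin_minus[OF klin_proj]

lemma V_minus: "x \<in> V n \<Longrightarrow> - x \<in> V n"
  using V_scale[of x n "-1"] by simp

lemma V_diff: "x \<in> V n \<Longrightarrow> y \<in> V n \<Longrightarrow> x - y \<in> V n"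
  using V_add[of x n "- y"] V_minus by simp

lemma V_sum: "(\<And>i. i \<in> I \<Longrightarrow> f i \<in> V n) \<Longrightarrow> sum f I \<in> V n"
  by (induction I rule: infinite_finite_induct) (auto intro: V_add)

lemma t_pow_V: "x \<in> V n \<Longrightarrow> (t ^^ i) x \<in> V n"
  by (induction i) (auto intro: t_V)

lemma N_V: "x \<in> V n \<Longrightarrow> N x \<in> V n"
  by (simp add: N_eq V_sum t_pow_V)

lemma b_V: "x \<in> V (Suc n) \<Longrightarrow> b x \<in> V n"
  by (auto simp: b_Suc simp del: sum.atMost_Suc funpow.simps intro!: V_sum t_pow_V d0_V)

lemma b'_V: "x \<in> V (Suc n) \<Longrightarrow> b' x \<in> V n"
  by (auto simp: b'_Suc simp del: sum.atMost_Suc funpow.simps intro!: V_sum t_pow_V d0_V)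

lemma t_V0: "x \<in> V 0 \<Longrightarrow> t x = x"
  using t_pow[of x 0] by simp

lemma tN: "x \<in> V n \<Longrightarrow> t (N x) = N x"
proof -
  assume x: "x \<in> V n"
  have "t (N x) = (\<Sum>i\<le>n. (t ^^ Suc i) x)" by (simp add: N_eq[OF x] lin_simps)
  also have "\<dots> = (\<Sum>i\<in>{..<Suc n}. (t ^^ Suc i) x)" by (simp only: lessThan_Suc_atMost)
  also have "\<dots> = (\<Sum>i\<in>{..<Suc n}. (t ^^ i) x)"
    using sum.lessThan_Suc_shift[of "\<lambda>i. (t ^^ i) x" "Suc n"]
      sum.lessThan_Suc[of "\<lambda>i. (t ^^ i) x" "Suc n"] t_pow[OF x]
    by (simp del: sum.lessThan_Suc funpow.simps)
  finally show ?thesis by (simp only: N_eq[OF x] lessThan_Suc_atMost)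
qed

lemma Nt: "x \<in> V n \<Longrightarrow> N (t x) = N x"
proof -
  assume x: "x \<in> V n"
  have "N (t x) = t (N x)" by (simp add: N_eq[OF x] N_eq[OF t_V[OF x]] lin_simps funpow_swap1)
  then show ?thesis using tN x by simp
qed

lemma N_pow: "x \<in> V n \<Longrightarrow> N ((t ^^ j) x) = N x"
  by (induction j) (auto simp: Nt[OF t_pow_V])

lemma pow_N: "x \<in> V n \<Longrightarrow> (t ^^ j) (N x) = N x"
  by (induction j) (auto simp: tN)

lemma sum_const_scale: "(\<Sum>i\<le>n. x) = fscale (of_nat (Suc n)) x"
proof (induction n)
  case (Suc n)
  then show ?case
    by (simp only: sum.atMost_Suc of_nat_Suc[of "Suc n"] fvs.scale_left_distrib fvs.scale_one add.commute)
qed simp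

section \<open>Exactness of the rows with the maps \<open>1 - t\<close> and \<open>N\<close>\<close>

lemma invariant_image_N:
  assumes "x \<in> V n" "t x = x"
  obtains w where "w \<in> V n" "x = N w"
proof
  show "fscale (inverse (of_nat (Suc n))) x \<in> V n" using assms by (intro V_scale)
  have "(t ^^ i) x = x" for i by (induction i) (auto simp: assms)
  then have "N x = fscale (of_nat (Suc n)) x"
    using assms by (simp add: N_eq[OF assms(1)] sum_const_scale del: of_nat_Suc)
  then show "x = N (fscale (inverse (of_nat (Suc n))) x)"
    by (simp add: lin_simps del: of_nat_Suc)
qed

text \<open>The partial sums \<open>u i\<close> satisfy
  \<open>u i - t (u i) = x - (t ^^ i) x\<close>; once \<open>N x = 0\<close>, their average over
  \<open>i \<le> n\<close> is a preimage of \<open>x\<close>.\<close>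

lemma kernel_N:
  assumes "x \<in> V n" "N x = 0"
  obtains v where "v \<in> V n" "x = v - t v"
proof
  define u where "u i = (\<Sum>j<i. (t ^^ j) x)" for i
  let ?v = "fscale (inverse (of_nat (Suc n))) (\<Sum>i\<le>n. u i)"
  show "?v \<in> V n" unfolding u_def using assms by (intro V_scale V_sum t_pow_V)
  have u: "u i - t (u i) = x - (t ^^ i) x" for i
    by (induction i) (simp_all add: u_def lin_simps, simp add: algebra_simps)
  have "(\<Sum>i\<le>n. u i) - t (\<Sum>i\<le>n. u i) = (\<Sum>i\<le>n. u i - t (u i))"
    by (simp add: lin_simps sum_subtractf)
  also have "\<dots> = fscale (of_nat (Suc n)) x - N x"
    by (simp add: u sum_subtractf sum_const_scale N_eq[OF assms(1)] del: of_nat_Suc)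
  finally have "(\<Sum>i\<le>n. u i) - t (\<Sum>i\<le>n. u i) = fscale (of_nat (Suc n)) x"
    using assms by simp
  then have "fscale (inverse (of_nat (Suc n))) ((\<Sum>i\<le>n. u i) - t (\<Sum>i\<le>n. u i)) = x"
    by (simp del: of_nat_Suc)
  then show "x = ?v - t ?v" by (simp add: lin_simps fvs.scale_right_diff_distrib)
qed

text \<open>Precomposition with \<open>t\<close> turns each face
  \<open>t\<^sup>j d\<^sub>0 t\<^sup>-\<^sup>j\<close> into \<open>t\<close> times the preceding
  one, hence \<open>b t = d\<^sub>0 t + t b'\<close>; and \<open>d\<^sub>0 t\<close> is exactly the
  last face of \<open>b\<close>.\<close>

lemma b_one_minus_t:
  assumes x: "x \<in> V n"
  shows "b (x - t x) = b' x - t (b' x)"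
proof (cases n)
  case 0
  then show ?thesis using x by (simp add: t_V0 lin_simps b'0)
next
  case (Suc m)
  define f where "f j = (t ^^ j) (d0 ((t ^^ (Suc (Suc m) - j)) x))" for j
  have b: "b x = sum f {..Suc m}" and b': "b' x = sum f {..m}"
    using x Suc unfolding f_def by (simp_all add: b_Suc b'_Suc del: sum.atMost_Suc)
  have tf: "(t ^^ j) (d0 ((t ^^ (Suc (Suc m) - j)) (t x))) = (if j = 0 then d0 (t x) else t (f (j - 1)))"
    if "j \<le> Suc m" for j
  proof (cases j)
    case 0
    have "(t ^^ Suc (Suc m)) (t x) = t x" using t_pow[of "t x" n] x Suc t_V by simp
    then show ?thesis using 0 by (simp del: funpow.simps)
  next
    case (Suc i)
    have "(t ^^ (Suc (Suc m) - j)) (t x) = (t ^^ (Suc (Suc m) - i)) x"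
    proof -
      have "Suc (Suc m) - j = Suc m - i" "Suc (Suc m) - i = Suc (Suc m - i)" using that Suc by auto
      then show ?thesis by (simp add: funpow_swap1)
    qed
    then show ?thesis using Suc by (simp add: f_def)
  qed
  have "b (t x) = (\<Sum>j\<le>Suc m. if j = 0 then d0 (t x) else t (f (j - 1)))"
    using b_Suc[of "t x" m] x Suc t_V tf by (simp del: sum.atMost_Suc)
  also have "\<dots> = d0 (t x) + t (b' x)"
    unfolding sum.atMost_Suc_shift by (simp add: b' lin_simps)
  finally have "b (t x) = d0 (t x) + t (b' x)" .
  moreover have "f (Suc m) = d0 (t x)"
    using t_pow[of "d0 (t x)" m] d0_V[of "t x" m] t_V[of x] x Suc by (simp add: f_def)
  ultimately show ?thesis by (simp add: lin_simps b b')
qed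

text \<open>\<open>N\<close> absorbs powers of \<open>t\<close> on both sides, so both expressions
  reduce to \<open>N d\<^sub>0 N\<close>.\<close>

lemma N_b:
  assumes x: "x \<in> V (Suc n)"
  shows "N (b x) = b' (N x)"
proof -
  have "N (b x) = (\<Sum>j\<le>Suc n. N (d0 ((t ^^ (Suc (Suc n) - j)) x)))"
    unfolding b_Suc[OF x] klin_sum[OF klin_N]
    by (intro sum.cong refl N_pow[of _ n] d0_V t_pow_V x)
  also have "\<dots> = (\<Sum>j\<le>Suc n. N (d0 ((t ^^ Suc j) x)))"
    by (rule sum.reindex_bij_witness[of _ "\<lambda>j. Suc n - j" "\<lambda>j. Suc n - j"]) (auto simp: Suc_diff_le)
  also have "\<dots> = N (d0 (\<Sum>j\<le>Suc n. (t ^^ Suc j) x))"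
    by (simp add: lin_simps klin_sum[OF klin_N] del: sum.atMost_Suc funpow.simps)
  also have "(\<Sum>j\<le>Suc n. (t ^^ Suc j) x) = t (N x)"
    by (simp add: N_eq[OF x] lin_simps del: sum.atMost_Suc)
  also have "\<dots> = N x" by (rule tN[OF x])
  finally have 1: "N (b x) = N (d0 (N x))" .
  have "b' (N x) = (\<Sum>j\<le>n. (t ^^ j) (d0 (N x)))"
    by (simp add: b'_Suc[OF N_V[OF x]] pow_N[OF x])
  also have "\<dots> = N (d0 (N x))" using d0_V[OF N_V[OF x]] by (simp add: N_eq)
  finally show ?thesis using 1 by simp
qed

section \<open>The mixed complex and its total complex\<close>

definition B :: "('x \<Rightarrow>\<^sub>0 'k) \<Rightarrow> ('x \<Rightarrow>\<^sub>0 'k)" where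
  "B x = s (N x) - t (s (N x))"

lemma klin_B: "klin B"
  unfolding B_def klin_def by (simp add: lin_simps algebra_simps fvs.scale_right_diff_distrib)

lemmas B_lin = klin_zero[OF klin_B] klin_add[OF klin_B] klin_diff[OF klin_B] klin_minus[OF klin_B]

lemma B_V: "x \<in> V n \<Longrightarrow> B x \<in> V (Suc n)"
  unfolding B_def by (intro V_diff t_V s_V N_V)

lemma B_one_minus_t: "v \<in> V n \<Longrightarrow> B (v - t v) = 0"
  by (simp add: B_def lin_simps Nt)

lemma N_one_minus_t: "v \<in> V n \<Longrightarrow> N (v - t v) = 0"
  by (simp add: lin_simps Nt)

text \<open>Since \<open>b (1 - t) = (1 - t) b'\<close>, the left side is
  \<open>(1 - t) b' s N\<close>, and the contraction replaces \<open>b' s N\<close> by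
  \<open>N - s N b\<close>; the term \<open>N\<close> is killed by \<open>1 - t\<close>.\<close>

lemma bB:
  assumes x: "x \<in> V n"
  shows "b (B x) = - B (b x)"
proof -
  let ?y = "b' (s (N x))"
  have 1: "b (B x) = ?y - t ?y"
    unfolding B_def by (rule b_one_minus_t[OF s_V[OF N_V[OF x]]])
  have 2: "?y = N x - s (N (b x))"
  proof (cases n)
    case 0
    then show ?thesis using contraction[OF N_V[OF x]] b0 b'0 N_V[OF x] x by (simp add: lin_simps)
  next
    case (Suc m)
    then show ?thesis using contraction[OF N_V[OF x]] N_b[of x m] x by (simp add: algebra_simps)
  qed
  show ?thesis unfolding 1 unfolding 2 by (simp add: lin_simps tN[OF x] B_def)
qed

lemma BB: "x \<in> V n \<Longrightarrow> B (B x) = 0"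
  using B_one_minus_t[OF s_V[OF N_V]] by (simp add: B_def)

fun Tot :: "nat \<Rightarrow> ('x \<Rightarrow>\<^sub>0 'k) set" where
  "Tot 0 = V 0"
| "Tot (Suc 0) = V 1"
| "Tot (Suc (Suc n)) = {x + y | x y. x \<in> V (Suc (Suc n)) \<and> y \<in> Tot n}"

declare Tot.simps(3) [simp del]

lemma TotI: "x \<in> V (Suc (Suc n)) \<Longrightarrow> y \<in> Tot n \<Longrightarrow> x + y \<in> Tot (Suc (Suc n))"
  by (auto simp: Tot.simps(3))

lemma TotE:
  assumes "z \<in> Tot (Suc (Suc n))"
  obtains x y where "z = x + y" "x \<in> V (Suc (Suc n))" "y \<in> Tot n"
  using assms by (auto simp: Tot.simps(3))

definition low :: "nat \<Rightarrow> ('x \<Rightarrow>\<^sub>0 'k) \<Rightarrow> ('x \<Rightarrow>\<^sub>0 'k)" where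
  "low n x = x - proj n x"

definition dtot :: "nat \<Rightarrow> ('x \<Rightarrow>\<^sub>0 'k) \<Rightarrow> ('x \<Rightarrow>\<^sub>0 'k)" where
  "dtot n x = b x + B (low n x)"

lemma klin_dtot: "klin (dtot n)"
  unfolding dtot_def low_def klin_def
  by (simp add: lin_simps B_lin klin_scale[OF klin_B] algebra_simps fvs.scale_right_diff_distrib fvs.scale_right_distrib)

lemmas dtot_lin = klin_zero[OF klin_dtot] klin_add[OF klin_dtot] klin_diff[OF klin_dtot] klin_minus[OF klin_dtot]

lemma Tot_zero [simp]: "0 \<in> Tot n"
proof (induction n rule: Tot.induct)
  case (3 n)
  from TotI[OF V_zero this] show ?case by simp
qed auto

lemma Tot_add: "x \<in> Tot n \<Longrightarrow> y \<in> Tot n \<Longrightarrow> x + y \<in> Tot n"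
proof (induction n arbitrary: x y rule: Tot.induct)
  case (3 n)
  from 3(2) obtain x1 x2 where x: "x = x1 + x2" "x1 \<in> V (Suc (Suc n))" "x2 \<in> Tot n" by (rule TotE)
  from 3(3) obtain y1 y2 where y: "y = y1 + y2" "y1 \<in> V (Suc (Suc n))" "y2 \<in> Tot n" by (rule TotE)
  have "(x1 + y1) + (x2 + y2) \<in> Tot (Suc (Suc n))" using x y 3(1) by (intro TotI V_add)
  then show ?case using x y by (simp add: algebra_simps)
qed (auto intro: V_add)

lemma Tot_minus: "x \<in> Tot n \<Longrightarrow> - x \<in> Tot n"
proof (induction n arbitrary: x rule: Tot.induct)
  case (3 n)
  from 3(2) obtain x1 x2 where x: "x = x1 + x2" "x1 \<in> V (Suc (Suc n))" "x2 \<in> Tot n" by (rule TotE)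
  have "- x1 + - x2 \<in> Tot (Suc (Suc n))" using x 3(1) by (intro TotI V_minus)
  then show ?case using x by simp
qed (auto intro: V_minus)

lemma Tot_diff: "x \<in> Tot n \<Longrightarrow> y \<in> Tot n \<Longrightarrow> x - y \<in> Tot n"
  using Tot_add[of x n "- y"] Tot_minus by simp

lemma V_Tot: "x \<in> V n \<Longrightarrow> x \<in> Tot n"
proof (cases n rule: Tot.cases)
  case (3 m)
  assume "x \<in> V n"
  then show ?thesis using 3 TotI[of x m 0] by simp
qed auto

lemma Tot_Suc_Suc: "x \<in> Tot n \<Longrightarrow> x \<in> Tot (Suc (Suc n))"
  using TotI[OF V_zero] by simp

lemma Tot_induct [consumes 1, case_names add V]:
  assumes "x \<in> Tot n" "\<And>x y. P x \<Longrightarrow> P y \<Longrightarrow> P (x + y)" "\<And>m x. m \<le> n \<Longrightarrow> x \<in> V m \<Longrightarrow> P x"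
  shows "P x"
  using assms(1,3)
proof (induction n arbitrary: x rule: Tot.induct)
  case (3 n)
  from 3(2) obtain x1 x2 where x: "x = x1 + x2" "x1 \<in> V (Suc (Suc n))" "x2 \<in> Tot n" by (rule TotE)
  have "P x2" using 3(1)[OF x(3)] 3(3) by (metis le_SucI)
  then show ?case using x 3(3) by (auto intro!: assms(2))
qed auto

lemma proj_Tot_gt: "x \<in> Tot n \<Longrightarrow> n < m \<Longrightarrow> proj m x = 0"
  by (induction rule: Tot_induct) (auto simp: lin_simps proj_other)

lemma proj_split:
  assumes "x \<in> V n" "y \<in> Tot m" "m < n"
  shows "proj n (x + y) = x" "low n (x + y) = y"
  using proj_Tot_gt[OF assms(2,3)] assms(1) by (simp_all add: lin_simps proj_same low_def)

lemma proj_V: "x \<in> Tot n \<Longrightarrow> proj n x \<in> V n"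
  by (cases n rule: Tot.cases) (auto simp: proj_same proj_split elim!: TotE)

lemma low_Tot: "x \<in> Tot (Suc (Suc n)) \<Longrightarrow> low (Suc (Suc n)) x \<in> Tot n"
  by (auto simp: proj_split elim!: TotE)

lemma low_V: "x \<in> V n \<Longrightarrow> low n x = 0"
  by (simp add: low_def proj_same)

lemma low_smaller: "x \<in> Tot n \<Longrightarrow> low (Suc (Suc n)) x = x"
  by (simp add: low_def proj_Tot_gt)

lemma split_Tot: "x = proj n x + low n x"
  by (simp add: low_def)

lemma b_Tot: "x \<in> Tot (Suc n) \<Longrightarrow> b x \<in> Tot n"
proof (induction "Suc n" arbitrary: n x rule: Tot.induct)
  case 2
  then show ?case by (auto intro: V_Tot b_V)
next
  case (3 n)
  then obtain x1 x2 where x: "x = x1 + x2" "x1 \<in> V (Suc (Suc n))" "x2 \<in> Tot n" by (auto elim: TotE)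
  have "b x2 \<in> Tot (Suc n)"
  proof (cases n)
    case 0
    then show ?thesis using x by (simp add: b0)
  next
    case (Suc m)
    then show ?thesis using 3(1)[OF Suc] x Tot_Suc_Suc by blast
  qed
  then show ?case using x by (auto simp: lin_simps intro!: Tot_add V_Tot[OF b_V])
qed

lemma B_Tot: "x \<in> Tot n \<Longrightarrow> B x \<in> Tot (Suc n)"
proof (induction n arbitrary: x rule: Tot.induct)
  case (3 n)
  then obtain x1 x2 where "x = x1 + x2" "x1 \<in> V (Suc (Suc n))" "x2 \<in> Tot n" by (auto elim: TotE)
  with 3(1)[of x2] B_V[of x1] show ?case
    by (simp add: B_lin TotI)
qed (auto simp: B_V[of _ 0, simplified] intro!: V_Tot B_V)

lemma dtot_Suc_Suc:
  assumes "x \<in> Tot n"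
  shows "dtot (Suc (Suc n)) x = dtot n x + B (proj n x)"
  using assms by (simp add: dtot_def low_smaller) (simp add: low_def B_lin)

lemma dtot_V: "x \<in> V n \<Longrightarrow> dtot n x = b x"
  by (simp add: dtot_def low_V B_lin)

lemma dtot_split:
  assumes "x \<in> V (Suc (Suc n))" "y \<in> Tot n"
  shows "dtot (Suc (Suc n)) (x + y) = (b x + B (proj n y)) + dtot n y"
  using assms by (simp add: dtot_lin dtot_V dtot_Suc_Suc algebra_simps)

lemma dtot_Tot: "x \<in> Tot (Suc n) \<Longrightarrow> dtot (Suc n) x \<in> Tot n"
proof (cases n)
  case 0
  assume "x \<in> Tot (Suc n)"
  then show ?thesis using 0 dtot_V[of x 1] b_V[of x 0] by auto
next
  case (Suc m)
  assume x: "x \<in> Tot (Suc n)"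
  then show ?thesis unfolding dtot_def Suc
    by (intro Tot_add b_Tot B_Tot low_Tot)
qed

lemma dtot_parts:
  assumes "x \<in> V (Suc (Suc n))" "y \<in> Tot n" "dtot (Suc (Suc n)) (x + y) = 0"
  shows "b x + B (proj n y) = 0" "dtot n y = 0"
proof -
  have V: "b x + B (proj n y) \<in> V (Suc n)"
    using assms by (intro V_add b_V B_V proj_V)
  have eq: "(b x + B (proj n y)) + dtot n y = 0" using assms by (simp add: dtot_split)
  show "dtot n y = 0"
  proof (cases n)
    case 0
    then show ?thesis using assms dtot_V[of y 0] b0 by simp
  next
    case (Suc m)
    then have "dtot n y \<in> Tot m" using assms dtot_Tot by blast
    from proj_split(2)[OF V this] Suc eq show ?thesis by (simp add: low_def klin_zero[OF klin_proj])
  qed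
  with eq show "b x + B (proj n y) = 0" by simp
qed

lemma dtot_dtot: "x \<in> Tot (Suc n) \<Longrightarrow> dtot n (dtot (Suc n) x) = 0"
proof (induction n arbitrary: x rule: Tot.induct)
  case 1
  then show ?case using dtot_V[of x 1] b_V[of x 0] by (auto simp: dtot_V b0)
next
  case 2
  then obtain x1 x2 where x: "x = x1 + x2" "x1 \<in> V (Suc (Suc 0))" "x2 \<in> Tot 0" by (auto elim: TotE)
  then have "dtot (Suc (Suc 0)) x = b x1 + B x2"
    using dtot_split[of x1 0 x2] by (simp add: proj_same dtot_V b0)
  moreover have "b x1 + B x2 \<in> V 1" using x b_V B_V by (auto intro!: V_add)
  ultimately show ?case using x dtot_V[of "b x1 + B x2" 1] bb bB[of x2 0] by (simp add: lin_simps b0 B_lin)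
next
  case (3 n)
  then obtain x1 x2 where x: "x = x1 + x2" "x1 \<in> V (Suc (Suc (Suc n)))" "x2 \<in> Tot (Suc n)" by (auto elim: TotE)
  define y where "y = b x1 + B (proj (Suc n) x2)"
  have y: "y \<in> V (Suc (Suc n))" unfolding y_def using x by (intro V_add b_V B_V proj_V)
  have z: "dtot (Suc n) x2 \<in> Tot n" using x dtot_Tot by blast
  have 1: "dtot (Suc (Suc (Suc n))) x = y + dtot (Suc n) x2"
    unfolding x(1) y_def by (rule dtot_split) (use x in auto)
  have 2: "b y = - B (b (proj (Suc n) x2))"
    unfolding y_def using x bb bB[OF proj_V[OF x(3)]] by (simp add: lin_simps)
  \<comment> \<open>\<open>B\<close> annihilates the second summand because \<open>B B = 0\<close>;
    what remains cancels the term \<open>b B\<close> from above.\<close>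
  have "proj n (dtot (Suc n) x2) = b (proj (Suc n) x2) + B (if n = 0 then 0 else proj (n - 1) (low (Suc n) x2))"
  proof (cases n)
    case 0
    then show ?thesis using x dtot_V[of x2 1] b_V[of x2 0] by (simp add: proj_same B_lin)
  next
    case (Suc m)
    have lx: "low (Suc n) x2 \<in> Tot m" using x Suc low_Tot by blast
    have px: "proj (Suc n) x2 \<in> V (Suc (Suc m))" using x Suc proj_V by blast
    define y where "y = b (proj (Suc n) x2) + B (proj m (low (Suc n) x2))"
    have y: "y \<in> V n" unfolding y_def using Suc x(3) lx px by (auto intro!: V_add B_V b_V proj_V)
    have "proj n (dtot m (low (Suc n) x2)) = 0"
    proof (cases m)
      case 0
      then show ?thesis using lx dtot_V[of "low (Suc n) x2" 0] by (simp add: b0 lin_simps)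
    next
      case (Suc m')
      then show ?thesis using dtot_Tot[of "low (Suc n) x2" m'] lx \<open>n = Suc m\<close> by (auto intro!: proj_Tot_gt)
    qed
    moreover have "dtot (Suc n) x2 = y + dtot m (low (Suc n) x2)"
      unfolding y_def using dtot_split[of "proj (Suc n) x2" m "low (Suc n) x2"] x lx Suc px
      by (simp flip: split_Tot)
    ultimately have "proj n (dtot (Suc n) x2) = y" using y by (simp add: klin_add[OF klin_proj] proj_same)
    then show ?thesis using Suc by (simp add: y_def)
  qed
  moreover have "B (B (if n = 0 then 0 else proj (n - 1) (low (Suc n) x2))) = 0"
  proof (cases n)
    case (Suc m)
    then have "proj m (low (Suc n) x2) \<in> V m" using x low_Tot proj_V by blast
    then show ?thesis using BB Suc by simp
  qed (simp add: B_lin)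
  ultimately have 3: "B (proj n (dtot (Suc n) x2)) = B (b (proj (Suc n) x2))" by (simp add: B_lin)
  show ?case
    unfolding 1 using dtot_split[OF y z] 2 3 "3.IH"[OF x(3)] by simp
qed


text \<open>Surjectivity of the comparison with the cyclic complex. Changing \<open>x\<close> by an
  element of the image of \<open>1 - t\<close> makes \<open>b x\<close> equal to \<open>B w\<close>,
  where \<open>w\<close> is again a cyclic cycle, two degrees lower; the induction lifts
  \<open>w\<close>.\<close>

lemma S_lift:
  assumes "x \<in> V n" "n > 0 \<Longrightarrow> \<exists>u\<in>V (n - 1). b x = u - t u"
  shows "\<exists>y\<in>Tot n. dtot n y = 0 \<and> (\<exists>v\<in>V n. proj n y = x - (v - t v))"
  using assms
proof (induction n arbitrary: x rule: Tot.induct)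
  case 1
  then show ?case by (intro bexI[of _ x] conjI bexI[of _ 0]) (auto simp: dtot_V b0 lin_simps proj_same)
next
  case 2
  then obtain u where "u \<in> V 0" "b x = u - t u" by auto
  then have "b x = 0" by (simp add: t_V0)
  with 2 show ?case
    by (intro bexI[of _ x] conjI bexI[of _ 0]) (auto simp: dtot_V[of _ 1, simplified] lin_simps proj_same)
next
  case (3 n)
  then obtain u where u: "u \<in> V (Suc n)" "b x = u - t u" by auto
  have u': "b' u \<in> V n" using u by (rule_tac b'_V)
  have "b' u - t (b' u) = b (b x)" using u by (simp add: b_one_minus_t)
  also have "\<dots> = 0" using 3 bb by blast
  finally obtain w where w: "w \<in> V n" "b' u = N w"
    using invariant_image_N[OF u'] by (metis eq_iff_diff_eq_0)
  \<comment> \<open>Chosen so that \<open>b' v = u - s (N w)\<close>; then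
    \<open>(1 - t) (u - b' v)\<close> is \<open>B w\<close>.\<close>
  define v where "v = s (u - s (N w))"
  have v: "v \<in> V (Suc (Suc n))" unfolding v_def using u w by (intro s_V V_diff N_V)
  have bw: "b' (u - s (N w)) = 0"
  proof -
    have "b' (N w) = 0" using b'b' u w by (metis)
    then have "b' (s (N w)) = N w" using contraction[of "N w" n] w N_V by (simp add: lin_simps)
    then show ?thesis using w by (simp add: lin_simps)
  qed
  have uv: "b' v = u - s (N w)"
    unfolding v_def using contraction[of "u - s (N w)" "Suc n"] u w bw by (simp add: V_diff s_V N_V lin_simps)
  have "b (x - (v - t v)) = (u - t u) - (b' v - t (b' v))"
    using b_one_minus_t[OF v] by (simp add: lin_simps u)
  also have "\<dots> = B w" by (simp add: uv B_def lin_simps)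
  finally have bx: "b (x - (v - t v)) = B w" .
  have "\<exists>u\<in>V (n - 1). b w = u - t u" if "n > 0"
  proof -
    from that obtain m where m: "n = Suc m" by (cases n) auto
    have "N (b w) = 0" using N_b[of w m] w u b'b' m by metis
    then show ?thesis using kernel_N[of "b w" m] b_V[of w m] w m by auto
  qed
  with 3(1)[OF w(1)] obtain y z where y: "y \<in> Tot n" "dtot n y = 0" "z \<in> V n" "proj n y = w - (z - t z)"
    by auto
  have By: "B (proj n y) = B w" using y w B_one_minus_t[of z n] by (simp add: B_lin)
  define y' where "y' = (x - (v - t v)) + - y"
  have V: "x - (v - t v) \<in> V (Suc (Suc n))" using 3 v by (intro V_diff t_V)
  have "dtot (Suc (Suc n)) y' = 0"
    unfolding y'_def using y By bx dtot_split[OF V Tot_minus[OF y(1)]]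
    by (simp add: lin_simps B_lin dtot_lin)
  moreover have "y' \<in> Tot (Suc (Suc n))" unfolding y'_def using V y by (intro TotI Tot_minus)
  moreover have "proj (Suc (Suc n)) y' = x - (v - t v)"
    unfolding y'_def using proj_split(1)[OF V Tot_minus[OF y(1)]] by simp
  ultimately show ?case using v by blast
qed

text \<open>Injectivity of the comparison. The primitive is also required to have its top component
  in the image of \<open>1 - t\<close>, because in the induction step \<open>B\<close> must vanish
  on it.\<close>

lemma Tot_boundary:
  assumes "x \<in> Tot n" "dtot n x = 0" "v \<in> V n" "proj n x = v - t v"
  shows "\<exists>y\<in>Tot (Suc n). x = dtot (Suc n) y \<and> (\<exists>v\<in>V (Suc n). proj (Suc n) y = v - t v)"
  using assms
proof (induction n arbitrary: x v rule: Tot.induct)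
  case 1
  then have "x = 0" by (simp add: proj_same t_V0)
  then show ?case by (auto intro!: bexI[of _ 0] simp: dtot_lin lin_simps)
next
  case 2
  then have x: "x = v - t v" "v \<in> V 1" by (simp_all add: proj_same)
  have b'v: "b' v \<in> V 0" using b'_V[of v 0] x by simp
  then obtain w where w: "w \<in> V 0" "b' v = N w"
    using invariant_image_N[of "b' v" 0] t_V0 by metis
  define v' where "v' = v - s (N w)"
  have v': "v' \<in> V 1" unfolding v'_def using x w s_V[OF N_V] by (auto intro!: V_diff)
  have "b' v' = 0"
    using contraction[OF N_V[OF w(1)]] b'0[OF N_V[OF w(1)]] w by (simp add: v'_def lin_simps)
  then have "b' (s v') = v'" using contraction[OF v'] by (simp add: lin_simps)
  then have *: "b (s v' - t (s v')) = v' - t v'" using b_one_minus_t[OF s_V[OF v']] by simp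
  define y where "y = (s v' - t (s v')) + w"
  have V: "s v' - t (s v') \<in> V (Suc (Suc 0))" using v' s_V[of v' 1] by (auto intro!: V_diff t_V)
  have "dtot (Suc (Suc 0)) y = x"
    unfolding y_def using dtot_split[OF V, of w] w * x
    by (simp add: proj_same dtot_V b0) (simp add: v'_def B_def lin_simps)
  moreover have "y \<in> Tot (Suc (Suc 0))" unfolding y_def using V w by (intro TotI) auto
  moreover have "proj (Suc (Suc 0)) y = s v' - t (s v')" unfolding y_def using proj_split(1)[OF V, of w 0] w by simp
  moreover have "s v' \<in> V (Suc (Suc 0))" using s_V[of v' 1] v' by simp
  ultimately show ?case by (metis One_nat_def)
next
  case (3 n)
  define y where "y = low (Suc (Suc n)) x"
  define y' where "y' = proj n y"
  have y: "y \<in> Tot n" unfolding y_def using 3 low_Tot by blast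
  have y': "y' \<in> V n" unfolding y'_def using y by (rule proj_V)
  have v: "v \<in> V (Suc (Suc n))" using 3 by blast
  have vt: "v - t v \<in> V (Suc (Suc n))" using v by (intro V_diff t_V)
  have x: "x = (v - t v) + y" using 3 by (simp add: y_def low_def)
  have d: "b (v - t v) + B y' = 0" "dtot n y = 0"
    using dtot_parts[OF vt y] 3 x y'_def by auto
  \<comment> \<open>\<open>(1 - t) u\<close> is the top component of the cycle equation, so
    \<open>u\<close> is invariant; its preimage \<open>w\<close> under \<open>N\<close> becomes part
    of the next component of the primitive.\<close>
  define u where "u = b' v + s (N y')"
  have u: "u \<in> V (Suc n)" unfolding u_def using v y' by (intro V_add b'_V s_V N_V)
  have "u - t u = (b' v - t (b' v)) + (s (N y') - t (s (N y')))" by (simp add: u_def lin_simps)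
  then have "u - t u = 0" using d(1) by (simp add: b_one_minus_t[OF v] B_def)
  then obtain w where w: "w \<in> V (Suc n)" "u = N w"
    using invariant_image_N[OF u] by (metis eq_iff_diff_eq_0)
  have NBy: "N (b y') = 0"
  proof (cases n rule: Tot.cases)
    case (3 m)
    have "y = y' + low n y" by (simp add: y'_def low_def)
    then have "b y' + B (proj m (low n y)) = 0"
      using dtot_parts(1)[of y' m "low n y"] 3 y' y low_Tot d(2) by simp
    moreover have "N (B z) = 0" if "z \<in> V m" for z
      unfolding B_def by (rule N_one_minus_t[OF s_V[OF N_V[OF that]]])
    ultimately show ?thesis
      using proj_V[OF low_Tot, of y m] y 3 by (metis add.inverse_inverse add_eq_0_iff klin_minus[OF klin_N] neg_equal_0_iff_equal)
  next
    case 2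
    then show ?thesis using d(2) dtot_V[of y' 1] y by (simp add: y'_def proj_same lin_simps)
  qed (use y' in \<open>simp add: b0 lin_simps\<close>)
  have sb: "s (b' (N y')) = 0"
  proof (cases n)
    case (Suc m)
    then show ?thesis using N_b[of y' m] y' NBy by (simp add: lin_simps)
  qed (use y' N_V[of y' n] in \<open>simp add: b'0 lin_simps\<close>)
  have Ny: "N y' = N (b w)"
  proof -
    have "b' u = N y'"
      using contraction[OF N_V[OF y']] sb b'b'[OF v] by (simp add: u_def lin_simps)
    then show ?thesis using N_b[OF w(1)] w by simp
  qed
  then obtain v2 where v2: "v2 \<in> V n" "y' - b w = v2 - t v2"
    using kernel_N[of "y' - b w" n] y' b_V[OF w(1)] by (metis V_diff klin_diff[OF klin_N] right_minus_eq)
  \<comment> \<open>Subtracting \<open>s (N w)\<close> makes \<open>v'\<close> a cycle for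
    \<open>b'\<close>, hence \<open>b' (s v') = v'\<close>; the correction is balanced by
    \<open>B w\<close>.\<close>
  define v' where "v' = v - s (N w)"
  have v': "v' \<in> V (Suc (Suc n))" unfolding v'_def using v w by (intro V_diff s_V N_V)
  have "b' v' = 0"
  proof -
    have "b' (s (N w)) = N w - s (N (b w))"
      using contraction[OF N_V[OF w(1)]] N_b[OF w(1)] by (simp add: algebra_simps)
    then have "b' (s (N w)) + s (N (b w)) = N w" by simp
    moreover have "b' v + s (N y') = N w" using w by (simp add: u_def)
    ultimately have "b' v = b' (s (N w))" unfolding Ny by (metis add_right_cancel)
    then show ?thesis by (simp add: v'_def lin_simps)
  qed
  then have "b' (s v') = v'" using contraction[OF v'] by (simp add: lin_simps)
  then have bsv: "b (s v' - t (s v')) = v' - t v'" using b_one_minus_t[OF s_V[OF v']] by simp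
  define x3 where "x3 = y - b w"
  have x3: "x3 \<in> Tot n" unfolding x3_def by (rule Tot_diff[OF y V_Tot[OF b_V[OF w(1)]]])
  have px3: "proj n x3 = v2 - t v2"
    using v2 proj_same[OF b_V[OF w(1)]] by (simp add: x3_def klin_diff[OF klin_proj] y'_def)
  have "dtot n x3 = 0"
  proof -
    have "dtot n (b w) = b (b w)" by (rule dtot_V[OF b_V[OF w(1)]])
    then show ?thesis using d(2) bb[OF w(1)] by (simp add: x3_def dtot_lin)
  qed
  from 3(1)[OF x3 this v2(1) px3] obtain z z2 where
    z: "z \<in> Tot (Suc n)" "x3 = dtot (Suc n) z" "z2 \<in> V (Suc n)" "proj (Suc n) z = z2 - t z2" by auto
  define yy where "yy = (s v' - t (s v')) + (w + z)"
  have V: "s v' - t (s v') \<in> V (Suc (Suc (Suc n)))" using v' by (intro V_diff t_V s_V)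
  have wz: "w + z \<in> Tot (Suc n)" by (rule Tot_add[OF V_Tot[OF w(1)] z(1)])
  have "B (proj (Suc n) (w + z)) = B w"
    using z w B_one_minus_t[OF z(3)] by (simp add: lin_simps B_lin proj_same)
  then have "dtot (Suc (Suc (Suc n))) yy = (v' - t v') + B w + (b w + x3)"
    unfolding yy_def using dtot_split[OF V wz] z w bsv by (simp add: dtot_lin dtot_V)
  also have "\<dots> = x" by (simp add: x x3_def v'_def B_def lin_simps)
  finally have "x = dtot (Suc (Suc (Suc n))) yy" by simp
  moreover have "yy \<in> Tot (Suc (Suc (Suc n)))" unfolding yy_def using V wz by (rule TotI)
  moreover have "proj (Suc (Suc (Suc n))) yy = s v' - t (s v')"
    unfolding yy_def using V wz proj_split(1) by simp
  ultimately show ?case using s_V[OF v'] by blast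
qed

text \<open>On top components the total differential is \<open>b\<close> modulo the image of
  \<open>1 - t\<close>, as \<open>B\<close> has values there; this makes the comparison compatible
  with boundaries.\<close>

lemma proj_dtot:
  assumes "z \<in> Tot (Suc n)"
  shows "\<exists>y\<in>V (Suc n). \<exists>v\<in>V n. proj n (dtot (Suc n) z) = b y + (v - t v)"
proof (cases n)
  case 0
  then show ?thesis using assms dtot_V[of z 1] b_V[of z 0]
    by (intro bexI[of _ z] bexI[of _ 0]) (auto simp: proj_same lin_simps)
next
  case (Suc m)
  from assms[unfolded Suc] obtain z1 z2 where z: "z = z1 + z2" "z1 \<in> V (Suc (Suc m))" "z2 \<in> Tot m" by (rule TotE)
  have V: "b z1 + B (proj m z2) \<in> V (Suc m)" using z by (intro V_add b_V B_V proj_V)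
  have "proj (Suc m) (dtot m z2) = 0"
  proof (cases m)
    case 0
    then show ?thesis using z dtot_V[of z2 0] by (simp add: b0 lin_simps)
  next
    case (Suc p)
    then show ?thesis using dtot_Tot[of z2 p] z by (auto intro!: proj_Tot_gt)
  qed
  then have "proj (Suc m) (dtot (Suc (Suc m)) z) = b z1 + B (proj m z2)"
    using dtot_split[OF z(2,3)] proj_same[OF V] by (simp add: z(1) klin_add[OF klin_proj])
  moreover have "s (N (proj m z2)) \<in> V (Suc m)" using z by (intro s_V N_V proj_V)
  ultimately show ?thesis using z Suc unfolding B_def by blast
qed

lemma low_dtot:
  assumes "z \<in> Tot (Suc (Suc (Suc n)))"
  shows "low (Suc (Suc n)) (dtot (Suc (Suc (Suc n))) z) = dtot (Suc n) (low (Suc (Suc (Suc n))) z)"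
proof -
  from assms obtain z1 z2 where z: "z = z1 + z2" "z1 \<in> V (Suc (Suc (Suc n)))" "z2 \<in> Tot (Suc n)" by (rule TotE)
  have V: "b z1 + B (proj (Suc n) z2) \<in> V (Suc (Suc n))" using z by (intro V_add b_V B_V proj_V)
  have "dtot (Suc n) z2 \<in> Tot n" using z by (intro dtot_Tot)
  from proj_split(2)[OF V this] show ?thesis
    using dtot_split[OF z(2,3)] proj_split(2)[OF z(2,3)] by (simp add: z(1))
qed

lemma proj_0_dtot: "z \<in> Tot (Suc (2 * n)) \<Longrightarrow> proj 1 z \<in> V 1 \<and> proj 0 (dtot (Suc (2 * n)) z) = b (proj 1 z)"
proof (induction n arbitrary: z)
  case 0
  then show ?case using dtot_V[of z 1] b_V[of z 0] by (auto simp: proj_same)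
next
  case (Suc n)
  then have "z \<in> Tot (Suc (Suc (Suc (2 * n))))" by simp
  then obtain z1 z2 where z: "z = z1 + z2" "z1 \<in> V (Suc (Suc (Suc (2 * n))))" "z2 \<in> Tot (Suc (2 * n))" by (rule TotE)
  have V: "b z1 + B (proj (Suc (2 * n)) z2) \<in> V (Suc (Suc (2 * n)))" using z by (intro V_add b_V B_V proj_V)
  have "dtot (Suc (2 * Suc n)) z = (b z1 + B (proj (Suc (2 * n)) z2)) + dtot (Suc (2 * n)) z2"
    using dtot_split[OF z(2,3)] by (simp add: z(1))
  moreover have "proj 0 (b z1 + B (proj (Suc (2 * n)) z2)) = 0" by (rule proj_other[OF V]) simp
  moreover have "proj 1 z = proj 1 z2" using proj_other[OF z(2), of 1] by (simp add: z(1) klin_add[OF klin_proj])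
  ultimately show ?case using Suc.IH[OF z(3)] by (simp add: klin_add[OF klin_proj])
qed

lemma Tot_cycle_comparison:
  assumes x: "x \<in> Tot n" "dtot n x = 0" and y: "y \<in> V (Suc n)" "v \<in> V n" "proj n x = b y + (v - t v)"
  shows "\<exists>z\<in>Tot (Suc n). x = dtot (Suc n) z"
proof -
  have dy: "dtot (Suc n) y = b y" by (rule dtot_V[OF y(1)])
  have "dtot n (x - b y) = 0" using dtot_dtot[OF V_Tot[OF y(1)]] x by (simp add: dy dtot_lin)
  moreover have "x - b y \<in> Tot n" by (rule Tot_diff[OF x(1) V_Tot[OF b_V[OF y(1)]]])
  moreover have "proj n (x - b y) = v - t v"
    using y(3) proj_same[OF b_V[OF y(1)]] by (simp add: klin_diff[OF klin_proj])
  ultimately obtain z where z: "z \<in> Tot (Suc n)" "x - b y = dtot (Suc n) z" using Tot_boundary y(2) by blast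
  then have "x = dtot (Suc n) (y + z)" by (simp add: dtot_lin dy algebra_simps)
  then show ?thesis using Tot_add[OF V_Tot[OF y(1)] z(1)] by blast
qed

lemma V_Tot_le: "v \<in> V m \<Longrightarrow> m \<le> n \<Longrightarrow> even (n - m) \<Longrightarrow> v \<in> Tot n"
proof (induction n rule: Tot.induct)
  case (3 n)
  show ?case
  proof (cases "m = Suc (Suc n)")
    case True
    then show ?thesis using 3 V_Tot by blast
  next
    case False
    then have "m \<le> n" using 3 by (cases "m = Suc n") auto
    moreover have "even (n - m)" using 3 \<open>m \<le> n\<close> by (simp add: Suc_diff_le)
    ultimately show ?thesis using 3 Tot_Suc_Suc by blast
  qed
next
  case 2
  then have "m = 1" by (cases m) auto
  then show ?case using 2 by simp
qed auto

lemma Tot_scale: "x \<in> Tot n \<Longrightarrow> fscale a x \<in> Tot n"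
proof (induction n arbitrary: x rule: Tot.induct)
  case (3 n)
  from 3(2) obtain x1 x2 where x: "x = x1 + x2" "x1 \<in> V (Suc (Suc n))" "x2 \<in> Tot n" by (rule TotE)
  have "fscale a x1 + fscale a x2 \<in> Tot (Suc (Suc n))" using x 3(1) by (intro TotI V_scale)
  then show ?case using x by (simp add: fvs.scale_right_distrib)
qed (auto intro: V_scale)

lemma Tot_proj_V: "x \<in> Tot n \<Longrightarrow> proj m x \<in> V m"
proof (induction rule: Tot_induct)
  case (add x y)
  then show ?case by (simp add: lin_simps V_add)
next
  case (V k x)
  then show ?case by (cases "k = m") (simp_all add: proj_same proj_other)
qed

lemma b_proj_cycle:
  assumes "x \<in> Tot n" "dtot n x = 0" "n > 0"
  shows "\<exists>u\<in>V (n - 1). b (proj n x) = u - t u"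
proof (cases n rule: Tot.cases)
  case 2
  then show ?thesis using assms by (intro bexI[of _ 0]) (auto simp: dtot_V[of _ 1, simplified] proj_same lin_simps)
next
  case (3 m)
  from assms(1)[unfolded 3] obtain x1 x2 where x: "x = x1 + x2" "x1 \<in> V (Suc (Suc m))" "x2 \<in> Tot m" by (rule TotE)
  let ?w = "s (N (proj m x2))"
  have w: "?w \<in> V (Suc m)" using x by (intro s_V N_V proj_V)
  have "b x1 + B (proj m x2) = 0" using dtot_parts(1)[OF x(2,3)] assms 3 x by simp
  then have "b x1 = - ?w - t (- ?w)" by (simp add: B_def lin_simps) (metis add_diff_cancel_right' add_eq_0_iff2 diff_0 minus_diff_eq)
  moreover have "proj n x = x1" using proj_split(1)[OF x(2,3)] x 3 by simp
  ultimately show ?thesis using V_minus[OF w] 3 by auto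
qed (use assms in simp)

lemma low_cycle:
  assumes "x \<in> Tot (Suc (Suc n))" "dtot (Suc (Suc n)) x = 0"
  shows "dtot n (low (Suc (Suc n)) x) = 0"
proof -
  from assms(1) obtain x1 x2 where x: "x = x1 + x2" "x1 \<in> V (Suc (Suc n))" "x2 \<in> Tot n" by (rule TotE)
  have "low (Suc (Suc n)) x = x2" using proj_split(2)[OF x(2,3)] x by simp
  then show ?thesis using dtot_parts(2)[OF x(2,3)] x assms by simp
qed

end

section \<open>Cyclic modules with Hochschild homology only in degree zero\<close>

locale acyclic_cyclic_complex = cyclic_complex +
  assumes acyclic: "x \<in> V (Suc n) \<Longrightarrow> b x = 0 \<Longrightarrow> \<exists>y\<in>V (Suc (Suc n)). x = b y"
begin

text \<open>The lowest component is the only obstruction, and for odd \<open>n\<close> it has degree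
  one, where there is no homology. Given a primitive of the lower part, the top component minus
  \<open>B\<close> of the top of that primitive is a \<open>b\<close>-cycle of positive degree,
  hence a boundary.\<close>

lemma Tot_cycle_boundary:
  assumes "x \<in> Tot n" "dtot n x = 0" "even n \<Longrightarrow> \<exists>y\<in>V 1. proj 0 x = b y"
  shows "\<exists>y\<in>Tot (Suc n). x = dtot (Suc n) y"
  using assms
proof (induction n arbitrary: x rule: Tot.induct)
  case 1
  then show ?case by (auto simp: proj_same dtot_V[of _ 1, simplified])
next
  case 2
  then obtain y where "y \<in> V (Suc (Suc 0))" "x = b y" using acyclic[of x 0] dtot_V[of x 1] by auto
  then show ?case using V_Tot dtot_V by metis
next
  case (3 n)
  from 3(2) obtain x1 x2 where x: "x = x1 + x2" "x1 \<in> V (Suc (Suc n))" "x2 \<in> Tot n" by (rule TotE)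
  have d: "b x1 + B (proj n x2) = 0" "dtot n x2 = 0" using dtot_parts[of x1 n x2] 3 x by auto
  have "\<exists>y\<in>V 1. proj 0 x2 = b y" if "even n"
    using 3(4) that x by (simp add: lin_simps proj_other[of x1 "Suc (Suc n)"])
  with 3(1)[OF x(3) d(2)] obtain y where y: "y \<in> Tot (Suc n)" "x2 = dtot (Suc n) y" by auto
  define x0 where "x0 = x1 - B (proj (Suc n) y)"
  have x0: "x0 \<in> V (Suc (Suc n))" unfolding x0_def using x y by (intro V_diff B_V proj_V)
  have y2: "dtot (Suc (Suc (Suc n))) y = x2 + B (proj (Suc n) y)"
    using dtot_Suc_Suc[OF y(1)] y by simp
  have "dtot (Suc (Suc n)) (x - dtot (Suc (Suc (Suc n))) y) = 0"
    using dtot_dtot[OF Tot_Suc_Suc[OF y(1)]] 3 by (simp add: dtot_lin)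
  then have "b x0 = 0" using dtot_V[OF x0] by (simp add: y2 x x0_def)
  then obtain z where z: "z \<in> V (Suc (Suc (Suc n)))" "x0 = b z" using acyclic[OF x0] by blast
  have "x = dtot (Suc (Suc (Suc n))) (z + y)"
    using z y2 by (simp add: dtot_lin dtot_V x) (simp add: x0_def algebra_simps)
  moreover have "z + y \<in> Tot (Suc (Suc (Suc n)))" using z y by (intro TotI)
  ultimately show ?case by blast
qed

text \<open>\<open>B\<close> of the current top component is a \<open>b\<close>-cycle of positive
  degree; the negative of a \<open>b\<close>-primitive of it is the next component up.\<close>

lemma Tot_cycle_exists:
  assumes "v \<in> V 0"
  shows "\<exists>x\<in>Tot (2 * n). dtot (2 * n) x = 0 \<and> proj 0 x = v"
proof (induction n)
  case 0
  show ?case using assms by (auto intro!: bexI[of _ v] simp: dtot_V b0 proj_same)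
next
  case (Suc n)
  then obtain x where x: "x \<in> Tot (2 * n)" "dtot (2 * n) x = 0" "proj 0 x = v" by blast
  let ?B = "B (proj (2 * n) x)"
  have B: "?B \<in> V (Suc (2 * n))" using x by (intro B_V proj_V)
  have "b ?B = 0"
  proof -
    have "dtot (2 * n) (dtot (Suc (Suc (2 * n))) x - ?B) = 0"
      using x dtot_Suc_Suc[OF x(1)] by (simp add: dtot_lin)
    moreover have "b ?B = dtot (Suc (2 * n)) ?B" using dtot_V[OF B] by simp
    moreover have "dtot (Suc (2 * n)) ?B = dtot (Suc (2*n)) (dtot (Suc (Suc (2 * n))) x)"
      using x dtot_Suc_Suc[OF x(1)] by simp
    ultimately show ?thesis using dtot_dtot[OF Tot_Suc_Suc[OF x(1)]] by simp
  qed
  then obtain z where z: "z \<in> V (Suc (Suc (2 * n)))" "?B = b z" using acyclic[OF B] by blast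
  have "dtot (Suc (Suc (2 * n))) (- z + x) = 0"
    using dtot_split[OF V_minus[OF z(1)] x(1)] x z by (simp add: lin_simps)
  moreover have "- z + x \<in> Tot (Suc (Suc (2 * n)))" using z x by (intro TotI V_minus)
  moreover have "proj 0 (- z + x) = v" using x proj_other[OF z(1), of 0] by (simp add: lin_simps)
  ultimately show ?case by (auto simp del: diff_add_cancel)
qed

end

section \<open>Words of weight one as a cyclic module\<close>

context twisted_algebra
begin

definition weight_words :: "nat \<Rightarrow> 'k \<Rightarrow> ('i list \<Rightarrow>\<^sub>0 'k) set" where
  "weight_words n a = supported {w. length w = n \<and> prod_list (map chi w) = a}"

lemma weight_words_basis [simp]:
  "basis w \<in> weight_words n a \<longleftrightarrow> length w = n \<and> prod_list (map chi w) = a"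
  by (simp add: weight_words_def)

lemma weight_words_zero [simp]: "0 \<in> weight_words n a"
  and weight_words_add: "u \<in> weight_words n a \<Longrightarrow> v \<in> weight_words n a \<Longrightarrow> u + v \<in> weight_words n a"
  and weight_words_scale: "u \<in> weight_words n a \<Longrightarrow> fscale c u \<in> weight_words n a"
  and weight_words_minus: "u \<in> weight_words n a \<Longrightarrow> - u \<in> weight_words n a"
  and weight_words_diff: "u \<in> weight_words n a \<Longrightarrow> v \<in> weight_words n a \<Longrightarrow> u - v \<in> weight_words n a"
  unfolding weight_words_def by (auto intro: supported_intros)

lemmas weight_words_intros =
  weight_words_zero weight_words_add weight_words_scale weight_words_minus weight_words_diff

lemma weight_words_words: "x \<in> weight_words n a \<Longrightarrow> x \<in> words n"
  unfolding weight_words_def words_def by (erule supported_mono) auto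

lemma klin_weight_words:
  assumes "v \<in> weight_words n a" "klin f"
    "\<And>w. length w = n \<Longrightarrow> prod_list (map chi w) = a \<Longrightarrow> f (basis w) \<in> weight_words m b"
  shows "f v \<in> weight_words m b"
  unfolding weight_words_def
  by (rule klin_supported[OF assms(1)[unfolded weight_words_def] assms(2)])
    (use assms(3) in \<open>auto simp: weight_words_def\<close>)

lemma chi_mul: "mul (basis i) (basis j) \<in> supported {k. chi k = chi i * chi j}"
proof -
  have "diag chi (mul (basis i) (basis j)) = fscale (chi i * chi j) (mul (basis i) (basis j))"
    by (simp add: diag_mul mul_simps mult.commute)
  then have "chi k * Poly_Mapping.lookup (mul (basis i) (basis j)) k
      = (chi i * chi j) * Poly_Mapping.lookup (mul (basis i) (basis j)) k" for k
    by (metis lookup_diag lookup_fscale)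
  then show ?thesis by (auto simp: supported_def in_keys_iff)
qed

lemma tcons_weight_words:
  assumes "u \<in> supported {k. chi k = a}" "x \<in> weight_words n b"
  shows "tcons u x \<in> weight_words (Suc n) (a * b)"
  unfolding weight_words_def
proof (rule klin_supported[OF assms(1)])
  fix i assume i: "i \<in> {k. chi k = a}"
  show "tcons (basis i) x \<in> supported {w. length w = Suc n \<and> prod_list (map chi w) = a * b}"
    using assms(2) unfolding weight_words_def
    by (rule klin_supported) (use i in \<open>auto intro!: klin_intros\<close>)
qed (intro klin_intros)

lemma face0_weight_words: "x \<in> weight_words (Suc (Suc n)) a \<Longrightarrow> face0 x \<in> weight_words (Suc n) a"
proof (rule klin_weight_words, assumption)
  fix w assume "length w = Suc (Suc n)" "prod_list (map chi w) = a"
  then obtain i j u where "w = i # j # u" "length u = n" "a = (chi i * chi j) * prod_list (map chi u)"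
    by (auto simp: length_Suc_conv)
  then show "face0 (basis w) \<in> weight_words (Suc n) a"
    using tcons_weight_words[OF chi_mul, of "basis u" n "prod_list (map chi u)"] by simp
qed (intro klin_intros)

lemma bar_weight_words: "x \<in> weight_words (Suc (Suc n)) a \<Longrightarrow> bar x \<in> weight_words (Suc n) a"
proof (induction n arbitrary: x a)
  case 0
  show ?case
    by (rule klin_weight_words[OF 0])
      (auto intro!: klin_intros face0_weight_words weight_words_diff simp: length_Suc_conv bar_Cons tcons_simps
        simp del: face0_basis_Cons2)
next
  case (Suc n)
  show ?case
  proof (rule klin_weight_words[OF Suc.prems])
    fix w :: "'i list" assume w: "length w = Suc (Suc (Suc n))" "prod_list (map chi w) = a"
    then obtain i v where v: "w = i # v" "length v = Suc (Suc n)" by (auto simp: length_Suc_conv)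
    have "tcons (basis i) (bar (basis v)) \<in> weight_words (Suc (Suc n)) (chi i * prod_list (map chi v))"
      using v by (intro tcons_weight_words Suc.IH) auto
    then show "bar (basis w) \<in> weight_words (Suc (Suc n)) a"
      using w v by (auto simp: bar_Cons intro!: weight_words_diff face0_weight_words)
  qed (intro klin_intros)
qed

lemma cycl_weight_words: "x \<in> weight_words (Suc n) a \<Longrightarrow> cycl x \<in> weight_words (Suc n) a"
proof (rule klin_weight_words, assumption)
  fix w assume w: "length w = Suc n" "prod_list (map chi w) = a"
  then obtain u i where u: "w = u @ [i]" by (metis append_butlast_last_id length_0_conv nat.distinct(1))
  then show "cycl (basis w) \<in> weight_words (Suc n) a"
    using w by (auto simp: mult.commute intro!: weight_words_scale)
qed (intro klin_intros)

lemma hoch_weight_words: "x \<in> weight_words (Suc (Suc n)) a \<Longrightarrow> hoch x \<in> weight_words (Suc n) a"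
  unfolding hoch_def by (intro weight_words_add bar_weight_words face0_weight_words cycl_weight_words)

text \<open>Carries the block \<open>v\<close> from the end to the front. A full turn of
  \<open>n + 1\<close> letters has sign exponent \<open>n * (n + 1)\<close>, which is even, and
  picks up the weight of the word.\<close>

lemma cycl_pow_append:
  "(cycl ^^ length v) (basis (u @ v)) =
     fscale ((-1) ^ ((length u + length v - 1) * length v) * prod_list (map chi v)) (basis (v @ u))"
proof (induction v arbitrary: u rule: rev_induct)
  case (snoc i v)
  have "(cycl ^^ length (v @ [i])) (basis (u @ v @ [i])) = (cycl ^^ length v) (cycl (basis ((u @ v) @ [i])))"
    by (simp add: funpow_swap1)
  also have "\<dots> = (cycl ^^ length v) (fscale ((-1) ^ length (u @ v) * chi i) (basis ((i # u) @ v)))"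
    by (subst cycl_snoc) simp
  also have "\<dots> = fscale ((-1) ^ length (u @ v) * chi i) ((cycl ^^ length v) (basis ((i # u) @ v)))"
    by (rule klin_scale) (intro klin_funpow klin_intros)
  also have "\<dots> = fscale ((-1) ^ ((length u + length (v @ [i]) - 1) * length (v @ [i])) * prod_list (map chi (v @ [i])))
      (basis ((v @ [i]) @ u))"
    unfolding snoc.IH by (simp add: power_add mult_ac)
  finally show ?case .
qed simp

lemma cycl_pow: "x \<in> weight_words (Suc n) 1 \<Longrightarrow> (cycl ^^ Suc n) x = x"
  unfolding weight_words_def
proof (rule klin_ext_on, assumption)
  fix w :: "'i list" assume w: "w \<in> {w. length w = Suc n \<and> prod_list (map chi w) = 1}"
  have "even (n * Suc n)" by simp
  then have "(-1::'k) ^ (n * Suc n) = 1" by (rule neg_one_even_power)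
  then show "(cycl ^^ Suc n) (basis w) = basis w"
    using cycl_pow_append[of w "[]"] w by simp
qed (intro klin_funpow klin_intros | rule klin_funpow_fun)+

text \<open>The individual faces hidden in the recursion for \<open>bar\<close>, needed to show that
  each of them is a conjugate of \<open>face0\<close> by a power of \<open>cycl\<close>.\<close>

fun face_word :: "nat \<Rightarrow> 'i list \<Rightarrow> ('i list \<Rightarrow>\<^sub>0 'k)" where
  "face_word 0 w = face0 (basis w)"
| "face_word (Suc k) [] = 0"
| "face_word (Suc k) (i # w) = tcons (basis i) (face_word k w)"

definition face :: "nat \<Rightarrow> ('i list \<Rightarrow>\<^sub>0 'k) \<Rightarrow> ('i list \<Rightarrow>\<^sub>0 'k)" where
  "face k = lin (face_word k)"

lemma klin_face [klin_intros]: "klin f \<Longrightarrow> klin (\<lambda>x. face k (f x))"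
  unfolding face_def by (intro klin_intros)

lemmas face_lin =
  klin_face[OF klin_id, THEN klin_zero] klin_face[OF klin_id, THEN klin_add]
  klin_face[OF klin_id, THEN klin_diff] klin_face[OF klin_id, THEN klin_minus]
  klin_face[OF klin_id, THEN klin_scale]

lemma face_0: "face 0 x = face0 x"
  by (rule klin_ext) (auto intro!: klin_intros simp: face_def)

lemma bar_faces: "x \<in> words (Suc n) \<Longrightarrow> bar x = (\<Sum>k<n. fscale ((-1) ^ k) (face k x))"
proof (rule words_ext, assumption)
  fix w :: "'i list"
  show "length w = Suc n \<Longrightarrow> bar (basis w) = (\<Sum>k<n. fscale ((-1) ^ k) (face k (basis w)))"
  proof (induction n arbitrary: w)
    case 0
    then show ?case by (auto simp: length_Suc_conv)
  next
    case (Suc n)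
    then obtain i v where v: "w = i # v" "length v = Suc n" by (auto simp: length_Suc_conv)
    show ?case
      unfolding sum.lessThan_Suc_shift
      by (simp add: v bar_Cons Suc.IH[OF v(2)] klin_sum[OF klin_tcons_right[OF klin_id]] tcons_simps)
        (simp add: face_def sum_negf)
  qed
qed (intro klin_intros)+

definition tsnoc :: "'i \<Rightarrow> ('i list \<Rightarrow>\<^sub>0 'k) \<Rightarrow> ('i list \<Rightarrow>\<^sub>0 'k)" where
  "tsnoc i = lin (\<lambda>w. basis (w @ [i]))"

lemma klin_tsnoc [klin_intros]: "klin f \<Longrightarrow> klin (\<lambda>x. tsnoc i (f x))"
  unfolding tsnoc_def by (intro klin_intros)

lemma tsnoc_tcons: "tsnoc i (tcons u x) = tcons u (tsnoc i x)"
proof (rule klin_ext[where v = u])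
  show "tsnoc i (tcons (basis j) x) = tcons (basis j) (tsnoc i x)" for j
    by (rule klin_ext[where v = x]) (auto intro!: klin_intros simp: tsnoc_def)
qed (intro klin_intros)+

lemma tsnoc_basis [simp]: "tsnoc i (basis w) = basis (w @ [i])"
  by (simp add: tsnoc_def)

lemma face_word_snoc: "k + 2 \<le> length w \<Longrightarrow> face_word k (w @ [i]) = tsnoc i (face_word k w)"
proof (induction k w rule: face_word.induct)
  case (1 w)
  then obtain a b u where "w = a # b # u" by (cases w; cases "tl w") auto
  then show ?case by (simp add: tsnoc_tcons)
qed (auto simp: tsnoc_tcons)

lemma cycl_tsnoc: "x \<in> words n \<Longrightarrow> cycl (tsnoc i x) = fscale ((-1) ^ n * chi i) (tcons (basis i) x)"
  by (rule words_ext, assumption) (auto intro!: klin_intros)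

lemma face_word_words: "k + 2 \<le> length w \<Longrightarrow> face_word k w \<in> words (length w - 1)"
proof (induction k w rule: face_word.induct)
  case (1 w)
  then obtain a b u where "w = a # b # u" by (cases w; cases "tl w") auto
  then show ?case by (auto intro!: tcons_words)
next
  case (3 k i w)
  then have "tcons (basis i) (face_word k w) \<in> words (Suc (length w - 1))" by (intro tcons_words) simp
  moreover have "Suc (length w - 1) = length w" using 3 by simp
  ultimately show ?case by simp
qed auto

text \<open>For \<open>k + 2 \<le> n\<close> the face does not involve the last letter. Rotating
  that letter to the front moves the face one place on, and the sign of \<open>cycl\<close> changes
  because the word has become shorter.\<close>

lemma face_cycl:
  assumes "x \<in> words (Suc n)" "k + 2 \<le> n"
  shows "face (Suc k) (cycl x) = - cycl (face k x)"
  using assms(1)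
proof (rule words_ext)
  fix w :: "'i list" assume w: "length w = Suc n"
  then obtain u i where u: "w = u @ [i]" by (metis append_butlast_last_id length_0_conv nat.distinct(1))
  have len: "length u = n" using w u by simp
  have "cycl (tsnoc i (face_word k u)) = fscale ((-1) ^ (n - 1) * chi i) (tcons (basis i) (face_word k u))"
    using face_word_words[of k u] assms(2) len by (intro cycl_tsnoc) simp
  moreover have "(-1 :: 'k) ^ n = - ((-1) ^ (n - 1))" using assms(2) by (cases n) auto
  ultimately show "face (Suc k) (cycl (basis w)) = - cycl (face k (basis w))"
    using face_word_snoc[of k u i] assms(2) len
    by (simp add: u face_lin) (simp add: face_def)
qed (intro klin_intros)+

lemma face_pow:
  assumes "x \<in> words (Suc n)" "k + 1 \<le> n"
  shows "face k ((cycl ^^ k) x) = fscale ((-1) ^ k) ((cycl ^^ k) (face0 x))"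
  using assms
proof (induction k arbitrary: x)
  case (Suc k)
  have "(cycl ^^ k) x \<in> words (Suc n)"
    by (induction k) (auto intro: cycl_words Suc.prems)
  then have "face (Suc k) (cycl ((cycl ^^ k) x)) = - cycl (face k ((cycl ^^ k) x))"
    by (rule face_cycl) (use Suc in simp)
  then show ?case using Suc by (simp add: cycl_lin)
qed (simp add: face_0)

lemma bar_cycl:
  assumes x: "x \<in> weight_words (Suc (Suc n)) 1"
  shows "bar x = (\<Sum>j\<le>n. (cycl ^^ j) (face0 ((cycl ^^ (Suc (Suc n) - j)) x)))"
proof -
  have "bar x = (\<Sum>k<Suc n. fscale ((-1) ^ k) (face k x))"
    using x by (intro bar_faces weight_words_words)
  also have "\<dots> = (\<Sum>k<Suc n. (cycl ^^ k) (face0 ((cycl ^^ (Suc (Suc n) - k)) x)))"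
  proof (rule sum.cong[OF refl])
    fix k assume k: "k \<in> {..<Suc n}"
    let ?y = "(cycl ^^ (Suc (Suc n) - k)) x"
    have y: "(cycl ^^ m) x \<in> words (Suc (Suc n))" for m
      by (induction m) (auto intro: cycl_words weight_words_words x)
    have "x = (cycl ^^ Suc (Suc n)) x" using cycl_pow[OF x] by simp
    also have "\<dots> = (cycl ^^ (k + (Suc (Suc n) - k))) x" using k by simp
    also have "\<dots> = (cycl ^^ k) ?y" by (simp only: funpow_add comp_def)
    finally have eq: "x = (cycl ^^ k) ?y" .
    have "face k x = face k ((cycl ^^ k) ?y)" by (subst eq) (rule refl)
    also have "\<dots> = fscale ((-1) ^ k) ((cycl ^^ k) (face0 ?y))"
      using y k by (intro face_pow[of _ "Suc n"]) auto
    finally show "fscale ((-1) ^ k) (face k x) = (cycl ^^ k) (face0 ?y)"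
      by (simp flip: power_add)
  qed
  finally show ?thesis by (simp only: lessThan_Suc_atMost)
qed

lemma hoch_cycl:
  assumes x: "x \<in> weight_words (Suc (Suc n)) 1"
  shows "hoch x = (\<Sum>j\<le>Suc n. (cycl ^^ j) (face0 ((cycl ^^ (Suc (Suc n) - j)) x)))"
proof -
  have "(cycl ^^ Suc n) (face0 (cycl x)) = face0 (cycl x)"
    using x by (intro cycl_pow face0_weight_words cycl_weight_words)
  moreover have "(cycl ^^ (Suc (Suc n) - Suc n)) x = cycl x" by simp
  ultimately show ?thesis
    unfolding hoch_def bar_cycl[OF x] sum.atMost_Suc[of _ n] by (simp only:)
qed

definition wproj :: "nat \<Rightarrow> ('i list \<Rightarrow>\<^sub>0 'k) \<Rightarrow> ('i list \<Rightarrow>\<^sub>0 'k)" where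
  "wproj n = lin (\<lambda>w. if length w = Suc n then basis w else 0)"

definition norm_op :: "('i list \<Rightarrow>\<^sub>0 'k) \<Rightarrow> ('i list \<Rightarrow>\<^sub>0 'k)" where
  "norm_op = lin (\<lambda>w. \<Sum>i<length w. (cycl ^^ i) (basis w))"

lemma norm_op_words: "x \<in> words n \<Longrightarrow> norm_op x = (\<Sum>i<n. (cycl ^^ i) x)"
  by (rule words_ext, assumption)
    (auto intro!: klin_intros klin_cycl[OF klin_id] simp: norm_op_def)

end

locale twisted_algebra_char0 = twisted_algebra mul one chi
  for mul :: "('i \<Rightarrow>\<^sub>0 'k::field_char_0) \<Rightarrow> ('i \<Rightarrow>\<^sub>0 'k) \<Rightarrow> ('i \<Rightarrow>\<^sub>0 'k)" and one chi
begin

sublocale cyc: cyclic_complex "\<lambda>n. weight_words (Suc n) 1" cycl face0 "tcons (basis one)" hoch bar norm_op wproj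
proof
  fix n and x :: "'i list \<Rightarrow>\<^sub>0 'k"
  assume x: "x \<in> weight_words (Suc n) 1"
  show "(cycl ^^ Suc n) x = x" by (rule cycl_pow[OF x])
  show "tcons (basis one) x \<in> weight_words (Suc (Suc n)) 1"
    using tcons_weight_words[of "basis one" 1 x "Suc n" 1] x by simp
  show "norm_op x = (\<Sum>i\<le>n. (cycl ^^ i) x)"
    using norm_op_words[OF weight_words_words[OF x]] by (simp only: lessThan_Suc_atMost)
  show "bar (tcons (basis one) x) + tcons (basis one) (bar x) = x"
  proof -
    have "face0 (tcons (basis one) x) = x"
      by (rule words_ext[OF weight_words_words[OF x]]) (auto intro!: klin_intros simp: length_Suc_conv)
    then show ?thesis by (simp add: bar_tcons)
  qed
  show "hoch (hoch x) = 0" "bar (bar x) = 0"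
    using hoch_hoch bar_bar weight_words_words[OF x] by blast+
  show "wproj n x = x"
    by (rule words_ext[OF weight_words_words[OF x]]) (auto intro!: klin_intros simp: wproj_def)
  show "m \<noteq> n \<Longrightarrow> wproj m x = 0" for m
    by (rule words_ext[OF weight_words_words[OF x]]) (auto intro!: klin_intros simp: wproj_def)
next
  fix n and x :: "'i list \<Rightarrow>\<^sub>0 'k"
  assume x: "x \<in> weight_words (Suc 0) 1"
  show "hoch x = 0" "bar x = 0"
    using hoch_words0 bar_words0 weight_words_words[OF x] by auto
next
  fix n and x :: "'i list \<Rightarrow>\<^sub>0 'k"
  assume x: "x \<in> weight_words (Suc (Suc n)) 1"
  show "hoch x = (\<Sum>j\<le>Suc n. (cycl ^^ j) (face0 ((cycl ^^ (Suc (Suc n) - j)) x)))" by (rule hoch_cycl[OF x])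
  show "bar x = (\<Sum>j\<le>n. (cycl ^^ j) (face0 ((cycl ^^ (Suc (Suc n) - j)) x)))" by (rule bar_cycl[OF x])
qed (auto intro!: weight_words_add weight_words_scale klin_intros cycl_weight_words face0_weight_words
    klin_cycl[OF klin_id] klin_face0[OF klin_id] klin_hoch[OF klin_id] klin_bar[OF klin_id]
    klin_tcons_right[OF klin_id] klin_lin[OF klin_id] simp: norm_op_def wproj_def)

end

section \<open>The basis of the Podles sphere\<close>

text \<open>The index \<open>(i, j)\<close> stands for \<open>A\<^sup>i B\<^sup>j\<close>, or for \<open>A\<^sup>i (B\<^sup>*)\<^sup>-\<^sup>j\<close> if \<open>j\<close> is negative.  Linear
  independence is proved by letting the free algebra act on the space with this basis.\<close>

type_synonym 'k pvec = "(nat \<times> int) \<Rightarrow>\<^sub>0 'k"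

text \<open>\<open>eps\<close> and \<open>l\<close> are the eigenvalues of \<open>A\<close> and
  \<open>B\<close>: \<open>eps = 1\<close> gives the automorphisms \<open>\<sigma>\<close>, and
  \<open>eps = -1\<close>, which requires \<open>c = d\<close>, gives \<open>\<tau>\<close>.\<close>

locale podles_algebra =
  fixes q c d eps l :: "'k::field_char_0"
  assumes q_nz [simp]: "q \<noteq> 0" and l_nz [simp]: "l \<noteq> 0"
    and eps: "eps = 1 \<or> eps = -1 \<and> c = d"
begin

definition opA :: "'k pvec \<Rightarrow> 'k pvec" where
  "opA = lin (\<lambda>(i, j). basis (i + 1, j))"

text \<open>Left multiplication by \<open>B\<close> on normal forms: the power of \<open>q\<close>
  comes from passing \<open>A\<^sup>i\<close>; for \<open>j < 0\<close> the letter meets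
  \<open>B\<^sup>*\<close>, and \<open>B B\<^sup>*\<close> is replaced by its polynomial.\<close>

definition opB :: "'k pvec \<Rightarrow> 'k pvec" where
  "opB = lin (\<lambda>(i, j). fscale (q ^ (2 * i))
     (if j \<ge> 0 then basis (i, j + 1)
      else fscale (c * d) (basis (i, j + 1)) + fscale (q^2 * (c - d)) (basis (i + 1, j + 1))
        - fscale (q^4) (basis (i + 2, j + 1))))"

definition opBs :: "'k pvec \<Rightarrow> 'k pvec" where
  "opBs = lin (\<lambda>(i, j). fscale (inverse (q ^ (2 * i)))
     (if j \<le> 0 then basis (i, j - 1)
      else fscale (c * d) (basis (i, j - 1)) + fscale (c - d) (basis (i + 1, j - 1))
        - basis (i + 2, j - 1)))"

lemma klin_opA [klin_intros]: "klin f \<Longrightarrow> klin (\<lambda>x. opA (f x))"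
  and klin_opB [klin_intros]: "klin f \<Longrightarrow> klin (\<lambda>x. opB (f x))"
  and klin_opBs [klin_intros]: "klin f \<Longrightarrow> klin (\<lambda>x. opBs (f x))"
  unfolding opA_def opB_def opBs_def by (intro klin_intros; assumption)+

lemmas op_lin =
  klin_opA[OF klin_id, THEN klin_zero] klin_opA[OF klin_id, THEN klin_add]
  klin_opA[OF klin_id, THEN klin_diff] klin_opA[OF klin_id, THEN klin_minus]
  klin_opA[OF klin_id, THEN klin_scale]
  klin_opB[OF klin_id, THEN klin_zero] klin_opB[OF klin_id, THEN klin_add]
  klin_opB[OF klin_id, THEN klin_diff] klin_opB[OF klin_id, THEN klin_minus]
  klin_opB[OF klin_id, THEN klin_scale]
  klin_opBs[OF klin_id, THEN klin_zero] klin_opBs[OF klin_id, THEN klin_add]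
  klin_opBs[OF klin_id, THEN klin_diff] klin_opBs[OF klin_id, THEN klin_minus]
  klin_opBs[OF klin_id, THEN klin_scale]

lemma opA_basis [simp]: "opA (basis (i, j)) = basis (i + 1, j)"
  by (simp add: opA_def)

lemma opB_basis: "opB (basis (i, j)) = fscale (q ^ (2 * i))
     (if j \<ge> 0 then basis (i, j + 1)
      else fscale (c * d) (basis (i, j + 1)) + fscale (q^2 * (c - d)) (basis (i + 1, j + 1))
        - fscale (q^4) (basis (i + 2, j + 1)))"
  by (simp add: opB_def)

lemma opBs_basis: "opBs (basis (i, j)) = fscale (inverse (q ^ (2 * i)))
     (if j \<le> 0 then basis (i, j - 1)
      else fscale (c * d) (basis (i, j - 1)) + fscale (c - d) (basis (i + 1, j - 1))
        - basis (i + 2, j - 1))"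
  by (simp add: opBs_def)

lemma opB_opA: "opB (opA v) = fscale (q^2) (opA (opB v))"
proof (rule klin_ext[where v = v])
  fix x :: "nat \<times> int"
  obtain i j where x: "x = (i, j)" by (cases x)
  have h: "q ^ (2 * Suc i) = q^2 * q ^ (2 * i)" by (simp add: power2_eq_square)
  show "opB (opA (basis x)) = fscale (q^2) (opA (opB (basis x)))"
    by (simp add: x opB_basis op_lin h del: mult_Suc_right)
qed (intro klin_intros)+

lemma opA_opBs: "opA (opBs v) = fscale (q^2) (opBs (opA v))"
proof (rule klin_ext[where v = v])
  fix x :: "nat \<times> int"
  obtain i j where x: "x = (i, j)" by (cases x)
  have h: "q^2 * inverse (q ^ (2 * Suc i)) = inverse (q ^ (2 * i))"
    by (simp add: power2_eq_square field_simps)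
  show "opA (opBs (basis x)) = fscale (q^2) (opBs (opA (basis x)))"
    by (simp add: x opBs_basis op_lin h del: mult_Suc_right)
qed (intro klin_intros)+

lemma fscale_cong: "a = b \<Longrightarrow> fscale a x = fscale b x" and fscale_one_cong: "a = 1 \<Longrightarrow> fscale a x = x"
  by simp_all

text \<open>For \<open>j < 0\<close> this is the compatibility of the two quadratic relations:
  moving the polynomial of \<open>B B\<^sup>*\<close> past \<open>B\<^sup>*\<close> replaces
  \<open>A\<close> by \<open>q\<^sup>-\<^sup>2 A\<close>, which turns it into that of
  \<open>B\<^sup>* B\<close>.\<close>

lemma opBs_opB: "opBs (opB v) = fscale (c * d) v + fscale (c - d) (opA v) - opA (opA v)"
proof (rule klin_ext[where v = v])
  fix x :: "nat \<times> int"
  obtain i j where x: "x = (i, j)" by (cases x)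
  show "opBs (opB (basis x)) = fscale (c * d) (basis x) + fscale (c - d) (opA (basis x)) - opA (opA (basis x))"
  proof (cases "j \<ge> 0")
    case True
    then show ?thesis by (simp add: x opB_basis opBs_basis op_lin)
  next
    case False
    have "opBs (opB (basis x)) =
        fscale (q ^ (2 * i) * (c * d) * inverse (q ^ (2 * i))) (basis (i, j))
        + fscale (q ^ (2 * i) * (q^2 * (c - d)) * inverse (q ^ (2 * (i + 1)))) (basis (i + 1, j))
        - fscale (q ^ (2 * i) * q^4 * inverse (q ^ (2 * (i + 2)))) (basis (i + 2, j))"
      using False by (simp add: x opB_basis opBs_basis op_lin fvs.scale_right_distrib
          fvs.scale_right_diff_distrib mult.assoc del: mult_Suc_right)
    also have "\<dots> = fscale (c * d) (basis (i, j)) + fscale (c - d) (basis (i + 1, j)) - basis (i + 2, j)"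
      by (intro arg_cong2[where f = "(-)"] arg_cong2[where f = "(+)"] fscale_cong fscale_one_cong)
        (simp_all add: power_add power2_eq_square power4_eq_xxxx field_simps)
    finally show ?thesis by (simp add: x)
  qed
qed (intro klin_intros)+

lemma opB_opBs:
  "opB (opBs v) = fscale (c * d) v + fscale (q^2 * (c - d)) (opA v) - fscale (q^4) (opA (opA v))"
proof (rule klin_ext[where v = v])
  fix x :: "nat \<times> int"
  obtain i j where x: "x = (i, j)" by (cases x)
  show "opB (opBs (basis x)) =
      fscale (c * d) (basis x) + fscale (q^2 * (c - d)) (opA (basis x)) - fscale (q^4) (opA (opA (basis x)))"
  proof (cases "j \<le> 0")
    case True
    then show ?thesis by (simp add: x opB_basis opBs_basis op_lin)
  next
    case False
    have "opB (opBs (basis x)) =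
        fscale (inverse (q ^ (2 * i)) * (c * d) * q ^ (2 * i)) (basis (i, j))
        + fscale (inverse (q ^ (2 * i)) * (c - d) * q ^ (2 * (i + 1))) (basis (i + 1, j))
        - fscale (inverse (q ^ (2 * i)) * q ^ (2 * (i + 2))) (basis (i + 2, j))"
      using False by (simp add: x opB_basis opBs_basis op_lin fvs.scale_right_distrib
          fvs.scale_right_diff_distrib mult.assoc del: mult_Suc_right)
    also have "\<dots> = fscale (c * d) (basis (i, j)) + fscale (q^2 * (c - d)) (basis (i + 1, j))
        - fscale (q^4) (basis (i + 2, j))"
      by (intro arg_cong2[where f = "(-)"] arg_cong2[where f = "(+)"] fscale_cong)
        (simp_all add: power_add power2_eq_square power4_eq_xxxx field_simps)
    finally show ?thesis by (simp add: x)
  qed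
qed (intro klin_intros)+

primrec gen_op :: "podles_gen \<Rightarrow> 'k pvec \<Rightarrow> 'k pvec" where
  "gen_op GA = opA"
| "gen_op GB = opB"
| "gen_op GBs = opBs"

lemma klin_gen_op [klin_intros]: "klin f \<Longrightarrow> klin (\<lambda>x. gen_op g (f x))"
  by (cases g) (auto intro: klin_intros)

lemma klin_foldr_gen_op [klin_intros]: "klin f \<Longrightarrow> klin (\<lambda>x. foldr gen_op w (f x))"
  by (induction w) (auto intro: klin_intros)

definition rep :: "'k free_alg \<Rightarrow> 'k pvec \<Rightarrow> 'k pvec" where
  "rep x v = lin (\<lambda>w. foldr gen_op (letters w) v) x"

lemma rep_add: "rep (x + y) v = rep x v + rep y v"
  and rep_diff: "rep (x - y) v = rep x v - rep y v"
  and rep_fscale: "rep (fscale a x) v = fscale a (rep x v)"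
  and rep_basis: "rep (basis w) v = foldr gen_op (letters w) v"
  and rep_zero: "rep 0 v = 0" and rep_minus: "rep (- x) v = - rep x v"
  by (simp_all add: rep_def lin_add lin_diff lin_fscale lin_minus)

lemma rep_one: "rep 1 v = v"
  by (simp add: rep_basis zero_podles_word_def flip: single_one)

lemma rep_gen: "rep (free_gen g) v = gen_op g v"
  by (simp add: free_gen_def rep_basis)

lemma klin_rep: "klin (rep x)"
proof (induction x rule: free_vector_induct)
  case (basis w)
  show ?case unfolding rep_basis by (intro klin_intros)
qed (auto simp: rep_def[abs_def] klin_def lin_add lin_fscale fvs.scale_right_distrib algebra_simps)

lemma klin_rep_right [klin_intros]: "klin f \<Longrightarrow> klin (\<lambda>v. rep x (f v))"
  by (rule klin_comp[OF klin_rep])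

lemma klin_rep_left [klin_intros]: "klin f \<Longrightarrow> klin (\<lambda>x. rep (f x) v)"
  unfolding rep_def by (intro klin_intros)

lemma rep_mult: "rep (x * y) v = rep x (rep y v)"
proof (induction x rule: free_vector_induct)
  case (basis u)
  show ?case
  proof (induction y rule: free_vector_induct)
    case (basis v)
    show ?case by (simp add: mult_single rep_basis plus_podles_word_def)
  qed (simp_all add: distrib_left fscale_mult_right rep_add rep_fscale rep_zero klin_zero[OF klin_rep]
      klin_add[OF klin_rep] klin_scale[OF klin_rep])
qed (simp_all add: distrib_right fscale_mult_left rep_add rep_fscale rep_zero)

lemmas rep_simps = rep_add rep_diff rep_fscale rep_zero rep_minus rep_one rep_gen rep_mult

abbreviation I :: "'k free_alg set" where
  "I \<equiv> podles_ideal q c d"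

lemma I_zero: "0 \<in> I" and I_add: "x \<in> I \<Longrightarrow> y \<in> I \<Longrightarrow> x + y \<in> I"
  and I_minus: "x \<in> I \<Longrightarrow> - x \<in> I"
  and I_left: "x \<in> I \<Longrightarrow> y * x \<in> I" and I_right: "x \<in> I \<Longrightarrow> x * y \<in> I"
  using additive_subgroup.zero_closed[OF ideal.axioms(1)[OF podles_ideal_ideal], of q c d]
    additive_subgroup.a_closed[OF ideal.axioms(1)[OF podles_ideal_ideal], of x q c d y]
    podles_ideal_fscale[of x q c d "-1"]
    ideal.I_l_closed[OF podles_ideal_ideal, of x q c d y] ideal.I_r_closed[OF podles_ideal_ideal, of x q c d y]
  by (simp_all add: free_ring_def)

lemma rep_ideal:
  assumes "x \<in> I"
  shows "rep x v = 0"
proof -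
  let ?J = "{x. \<forall>v. rep x v = 0}"
  have "ideal ?J free_ring"
  proof (rule idealI[OF free_ring_ring])
    show "subgroup ?J (add_monoid free_ring)"
    proof (rule subgroup.intro)
      fix x assume x: "x \<in> ?J"
      have "inv\<^bsub>add_monoid free_ring\<^esub> x = - x"
        using free_ring_uminus[of x] by (simp add: a_inv_def)
      then show "inv\<^bsub>add_monoid free_ring\<^esub> x \<in> ?J" using x by (simp add: rep_simps)
    qed (simp_all add: free_ring_def rep_simps)
  qed (simp_all add: free_ring_def rep_simps klin_zero[OF klin_rep])
  moreover have "podles_relators q c d \<subseteq> ?J"
    by (auto simp: podles_relators_def Let_def rep_simps opB_opA opA_opBs opBs_opB opB_opBs power2_eq_square)
  ultimately have "I \<subseteq> ?J"
    unfolding podles_ideal_def by (intro ring.genideal_minimal[OF free_ring_ring])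
  then show ?thesis using assms by auto
qed

section \<open>Reduction to normal form modulo the relations\<close>

definition eqv :: "'k free_alg \<Rightarrow> 'k free_alg \<Rightarrow> bool" (infix "\<approx>" 50) where
  "x \<approx> y \<longleftrightarrow> x - y \<in> I"

lemma eqv_refl [simp, intro]: "x \<approx> x"
  and eqv_sym: "x \<approx> y \<Longrightarrow> y \<approx> x"
  and eqv_trans [trans]: "x \<approx> y \<Longrightarrow> y \<approx> z \<Longrightarrow> x \<approx> z"
  and eqv_left: "x \<approx> y \<Longrightarrow> u * x \<approx> u * y"
  and eqv_right: "x \<approx> y \<Longrightarrow> x * u \<approx> y * u"
  and eqv_scale: "x \<approx> y \<Longrightarrow> fscale a x \<approx> fscale a y"
  and eqv_add: "x \<approx> y \<Longrightarrow> x' \<approx> y' \<Longrightarrow> x + x' \<approx> y + y'"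
  and eqv_diff: "x \<approx> y \<Longrightarrow> x' \<approx> y' \<Longrightarrow> x - x' \<approx> y - y'"
  using I_zero I_minus[of "x - y"] I_add[of "x - y" "y - z"] I_left[of "x - y" u] I_right[of "x - y" u]
    podles_ideal_fscale[of "x - y" q c d a] I_add[of "x - y" "x' - y'"] I_add[of "x - y" "- (x' - y')"]
    I_minus[of "x' - y'"]
  by (simp_all add: eqv_def algebra_simps fvs.scale_right_diff_distrib)

lemma eqv_trans_eq [trans]: "x \<approx> y \<Longrightarrow> y = z \<Longrightarrow> x \<approx> z" "x = y \<Longrightarrow> y \<approx> z \<Longrightarrow> x \<approx> z"
  by auto

lemma eqv_rep: "x \<approx> y \<Longrightarrow> rep x v = rep y v"
  using rep_ideal[of "x - y" v] by (simp add: eqv_def rep_diff)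

abbreviation gA :: "'k free_alg" where "gA \<equiv> free_gen GA"
abbreviation gB :: "'k free_alg" where "gB \<equiv> free_gen GB"
abbreviation gBs :: "'k free_alg" where "gBs \<equiv> free_gen GBs"

lemma relations:
  "gB * gA \<approx> fscale (q^2) (gA * gB)"
  "gA * gBs \<approx> fscale (q^2) (gBs * gA)"
  "gBs * gB \<approx> fscale (c * d) 1 + fscale (c - d) gA - gA^2"
  "gB * gBs \<approx> fscale (c * d) 1 + fscale (q^2 * (c - d)) gA - fscale (q^4) (gA^2)"
  unfolding eqv_def
  by (rule subsetD[OF podles_relators_in_ideal], simp add: podles_relators_def Let_def)+

lemma B_Apow: "gB * gA ^ i \<approx> fscale (q ^ (2 * i)) (gA ^ i * gB)"
proof (induction i)
  case (Suc i)
  have "gB * gA ^ Suc i = (gB * gA ^ i) * gA" by (simp add: mult.assoc power_Suc2 del: power_Suc)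
  also have "\<dots> \<approx> fscale (q ^ (2 * i)) (gA ^ i * gB) * gA" by (rule eqv_right[OF Suc])
  also have "\<dots> = fscale (q ^ (2 * i)) (gA ^ i * (gB * gA))" by (simp add: fscale_mult_left mult.assoc)
  also have "\<dots> \<approx> fscale (q ^ (2 * i)) (gA ^ i * fscale (q^2) (gA * gB))"
    by (intro eqv_scale eqv_left relations)
  also have "\<dots> = fscale (q ^ (2 * Suc i)) (gA ^ Suc i * gB)"
    by (simp add: fscale_mult_right mult.assoc power_Suc2 power_add power2_eq_square del: power_Suc)
  finally show ?case .
qed simp

lemma Bs_Apow: "gBs * gA ^ i \<approx> fscale (inverse (q ^ (2 * i))) (gA ^ i * gBs)"
proof (induction i)
  case (Suc i)
  have 1: "gBs * gA \<approx> fscale (inverse (q^2)) (gA * gBs)"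
    using eqv_sym[OF eqv_scale[OF relations(2), of "inverse (q^2)"]] by simp
  have "gBs * gA ^ Suc i = (gBs * gA ^ i) * gA" by (simp add: mult.assoc power_Suc2 del: power_Suc)
  also have "\<dots> \<approx> fscale (inverse (q ^ (2 * i))) (gA ^ i * gBs) * gA" by (rule eqv_right[OF Suc])
  also have "\<dots> = fscale (inverse (q ^ (2 * i))) (gA ^ i * (gBs * gA))" by (simp add: fscale_mult_left mult.assoc)
  also have "\<dots> \<approx> fscale (inverse (q ^ (2 * i))) (gA ^ i * fscale (inverse (q^2)) (gA * gBs))"
    by (intro eqv_scale eqv_left 1)
  also have "\<dots> = fscale (inverse (q ^ (2 * Suc i))) (gA ^ Suc i * gBs)"
    by (simp add: fscale_mult_right mult.assoc power_Suc2 power_add power2_eq_square del: power_Suc)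
  finally show ?case .
qed simp

definition Bpow :: "int \<Rightarrow> 'k free_alg" where
  "Bpow j = (if j \<ge> 0 then gB ^ nat j else gBs ^ nat (- j))"

definition lift :: "'k pvec \<Rightarrow> 'k free_alg" where
  "lift = lin (\<lambda>(i, j). gA ^ i * Bpow j)"

lemma lift_basis: "lift (basis (i, j)) = gA ^ i * Bpow j"
  by (simp add: lift_def)

lemma klin_lift [klin_intros]: "klin f \<Longrightarrow> klin (\<lambda>x. lift (f x))"
  unfolding lift_def by (intro klin_intros)

lemmas lift_lin =
  klin_lift[OF klin_id, THEN klin_zero] klin_lift[OF klin_id, THEN klin_add]
  klin_lift[OF klin_id, THEN klin_diff] klin_lift[OF klin_id, THEN klin_scale]

lemma B_Bpow:
  assumes "j < 0"
  shows "gB * Bpow j \<approx> fscale (c * d) (Bpow (j + 1)) + fscale (q^2 * (c - d)) (gA * Bpow (j + 1))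
           - fscale (q^4) (gA^2 * Bpow (j + 1))"
proof -
  have n: "nat (- j) = Suc (nat (- (j + 1)))" using assms by simp
  have 1: "Bpow (j + 1) = gBs ^ nat (- (j + 1))"
    using assms by (cases "j = -1") (auto simp: Bpow_def)
  have "gB * Bpow j = (gB * gBs) * Bpow (j + 1)"
    unfolding 1 using assms by (simp add: Bpow_def n mult.assoc)
  also have "\<dots> \<approx> (fscale (c * d) 1 + fscale (q^2 * (c - d)) gA - fscale (q^4) (gA^2)) * Bpow (j + 1)"
    by (intro eqv_right relations)
  finally show ?thesis by (simp add: algebra_simps fscale_mult_left)
qed

lemma Bs_Bpow:
  assumes "j > 0"
  shows "gBs * Bpow j \<approx> fscale (c * d) (Bpow (j - 1)) + fscale (c - d) (gA * Bpow (j - 1)) - gA^2 * Bpow (j - 1)"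
proof -
  have n: "nat j = Suc (nat (j - 1))" using assms by simp
  have "gBs * Bpow j = (gBs * gB) * Bpow (j - 1)"
    using assms by (simp add: Bpow_def n mult.assoc)
  also have "\<dots> \<approx> (fscale (c * d) 1 + fscale (c - d) gA - gA^2) * Bpow (j - 1)"
    by (intro eqv_right relations)
  finally show ?thesis by (simp add: algebra_simps fscale_mult_left)
qed

lemma Apow_mult: "gA ^ i * (gA * x) = gA ^ (i + 1) * x" "gA ^ i * (gA ^ 2 * x) = gA ^ (i + 2) * x"
  by (simp_all only: power_add mult.assoc power_one_right)

lemma gen_lift_basis: "free_gen g * lift (basis (i, j)) \<approx> lift (gen_op g (basis (i, j)))"
proof (cases g)
  case GA
  then show ?thesis by (simp add: lift_basis mult.assoc)
next
  case GB
  have "gB * lift (basis (i, j)) = gB * gA ^ i * Bpow j" by (simp add: lift_basis mult.assoc)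
  also have "\<dots> \<approx> fscale (q ^ (2 * i)) (gA ^ i * gB) * Bpow j" by (intro eqv_right B_Apow)
  also have "\<dots> = fscale (q ^ (2 * i)) (gA ^ i * (gB * Bpow j))" by (simp add: fscale_mult_left mult.assoc)
  also have "\<dots> \<approx> lift (opB (basis (i, j)))"
  proof (cases "j \<ge> 0")
    case True
    then have "gB * Bpow j = Bpow (j + 1)" by (simp add: Bpow_def nat_add_distrib)
    then show ?thesis using True by (simp add: opB_basis lift_lin lift_basis)
  next
    case False
    then have "fscale (q ^ (2 * i)) (gA ^ i * (gB * Bpow j)) \<approx> fscale (q ^ (2 * i)) (gA ^ i *
        (fscale (c * d) (Bpow (j + 1)) + fscale (q^2 * (c - d)) (gA * Bpow (j + 1))
           - fscale (q^4) (gA^2 * Bpow (j + 1))))"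
      by (intro eqv_scale eqv_left B_Bpow) simp
    also have "\<dots> = lift (opB (basis (i, j)))"
      using False by (simp only: opB_basis if_False lift_lin lift_basis fscale_mult_right distrib_left
          right_diff_distrib Apow_mult)
    finally show ?thesis .
  qed
  finally show ?thesis using GB by simp
next
  case GBs
  have "gBs * lift (basis (i, j)) = gBs * gA ^ i * Bpow j" by (simp add: lift_basis mult.assoc)
  also have "\<dots> \<approx> fscale (inverse (q ^ (2 * i))) (gA ^ i * gBs) * Bpow j" by (intro eqv_right Bs_Apow)
  also have "\<dots> = fscale (inverse (q ^ (2 * i))) (gA ^ i * (gBs * Bpow j))" by (simp add: fscale_mult_left mult.assoc)
  also have "\<dots> \<approx> lift (opBs (basis (i, j)))"
  proof (cases "j \<le> 0")
    case True
    then have "nat (- (j - 1)) = Suc (nat (- j))" by simp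
    then have "gBs * Bpow j = Bpow (j - 1)" using True by (cases "j = 0") (auto simp: Bpow_def)
    then show ?thesis using True by (simp add: opBs_basis lift_lin lift_basis)
  next
    case False
    then have "fscale (inverse (q ^ (2 * i))) (gA ^ i * (gBs * Bpow j)) \<approx> fscale (inverse (q ^ (2 * i))) (gA ^ i *
        (fscale (c * d) (Bpow (j - 1)) + fscale (c - d) (gA * Bpow (j - 1)) - gA^2 * Bpow (j - 1)))"
      by (intro eqv_scale eqv_left Bs_Bpow) simp
    also have "\<dots> = lift (opBs (basis (i, j)))"
      using False by (simp only: opBs_basis if_False lift_lin lift_basis fscale_mult_right distrib_left
          right_diff_distrib Apow_mult)
    finally show ?thesis .
  qed
  finally show ?thesis using GBs by simp
qed

lemma gen_lift: "free_gen g * lift v \<approx> lift (gen_op g v)"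
proof (induction v rule: free_vector_induct)
  case (basis x)
  then show ?case using gen_lift_basis by (cases x) simp
next
  case (add u v)
  then show ?case using eqv_add by (simp add: lift_lin distrib_left klin_add[OF klin_gen_op[OF klin_id]])
next
  case (scale a v)
  then show ?case using eqv_scale by (simp add: lift_lin fscale_mult_right klin_scale[OF klin_gen_op[OF klin_id]])
qed (simp add: lift_lin klin_zero[OF klin_gen_op[OF klin_id]])

abbreviation unit :: "'k pvec" where "unit \<equiv> basis (0, 0)"

lemma lift_unit: "lift unit = 1"
  by (simp add: lift_basis Bpow_def)

text \<open>The spanning half of the basis theorem: acting on the unit computes the coordinates. The
  independence half is \<open>rep_lift_unit\<close>.\<close>

lemma eqv_lift_rep: "x \<approx> lift (rep x unit)"
proof (induction x rule: free_vector_induct)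
  case (basis w)
  have "basis (Word ws) \<approx> lift (rep (basis (Word ws)) unit)" for ws
  proof (induction ws)
    case Nil
    then show ?case by (simp add: rep_one lift_unit flip: zero_podles_word_def)
  next
    case (Cons g ws)
    have "basis (Word (g # ws)) = free_gen g * basis (Word ws)"
      by (simp add: free_gen_def mult_single plus_podles_word_def)
    also have "\<dots> \<approx> free_gen g * lift (rep (basis (Word ws)) unit)" by (rule eqv_left[OF Cons])
    also have "\<dots> \<approx> lift (gen_op g (rep (basis (Word ws)) unit))" by (rule gen_lift)
    finally show ?case by (simp add: rep_basis)
  qed
  then show ?case by (cases w) simp
qed (auto simp: rep_simps lift_lin intro: eqv_add eqv_scale)

lemma foldr_rep_power: "rep (x ^ n) v = (rep x ^^ n) v"
  by (induction n) (simp_all add: rep_simps)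

definition bop :: "int \<Rightarrow> 'k pvec \<Rightarrow> 'k pvec" where
  "bop j = (if j \<ge> 0 then opB ^^ nat j else opBs ^^ nat (- j))"

lemma rep_lift_basis: "rep (lift (basis (i, j))) v = (opA ^^ i) (bop j v)"
  by (simp add: lift_basis rep_mult foldr_rep_power Bpow_def bop_def rep_gen[abs_def])

lemma opA_pow: "(opA ^^ n) (basis (i, j)) = basis (n + i, j)"
  by (induction n) auto

lemma opB_pow_basis: "(opB ^^ n) (basis (i, 0)) = fscale (q ^ (2 * i * n)) (basis (i, int n))"
proof (induction n)
  case (Suc n)
  have "(opB ^^ Suc n) (basis (i, 0)) = fscale (q ^ (2 * i * n) * q ^ (2 * i)) (basis (i, int (Suc n)))"
    by (simp add: Suc.IH op_lin opB_basis add.commute)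
  then show ?case by (simp add: power_add mult.commute)
qed simp

lemma opBs_pow_basis: "(opBs ^^ n) (basis (i, 0)) = fscale (inverse (q ^ (2 * i * n))) (basis (i, - int n))"
proof (induction n)
  case (Suc n)
  have e: "- int n - 1 = - int (Suc n)" by simp
  have "opBs (basis (i, - int n)) = fscale (inverse (q ^ (2 * i))) (basis (i, - int (Suc n)))"
    unfolding e[symmetric] by (simp add: opBs_basis)
  then have "(opBs ^^ Suc n) (basis (i, 0)) =
      fscale (inverse (q ^ (2 * i * n)) * inverse (q ^ (2 * i))) (basis (i, - int (Suc n)))"
    by (simp only: funpow.simps comp_def Suc.IH op_lin fvs.scale_scale)
  then show ?case by (simp add: power_add mult.commute)
qed simp

lemma bop_basis: "bop j (basis (i, 0)) = fscale (q powi (2 * int i * j)) (basis (i, j))"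
proof (cases "j \<ge> 0")
  case True
  have "q powi (2 * int i * j) = q powi int (2 * i * nat j)" using True by simp
  also have "\<dots> = q ^ (2 * i * nat j)" by (rule power_int_of_nat)
  finally show ?thesis using True by (simp add: bop_def opB_pow_basis)
next
  case False
  have "q powi (2 * int i * j) = q powi - int (2 * i * nat (- j))" using False by simp
  also have "\<dots> = inverse (q ^ (2 * i * nat (- j)))" by (simp only: power_int_minus power_int_of_nat)
  finally show ?thesis using False by (simp add: bop_def opBs_pow_basis)
qed

lemma rep_lift_unit: "rep (lift v) unit = v"
  by (rule klin_ext[where v = v])
    (auto intro!: klin_intros simp: rep_lift_basis bop_basis opA_pow)

lemma eqv_iff: "x \<approx> y \<longleftrightarrow> rep x unit = rep y unit"
  using eqv_rep eqv_lift_rep[of x] eqv_lift_rep[of y] eqv_sym eqv_trans by metis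

definition mul :: "'k pvec \<Rightarrow> 'k pvec \<Rightarrow> 'k pvec" where
  "mul u v = rep (lift u) v"

definition chi :: "nat \<times> int \<Rightarrow> 'k" where
  "chi = (\<lambda>(i, j). eps ^ i * l powi j)"

lemma mul_rep: "mul (rep x unit) v = rep x v"
  unfolding mul_def using eqv_rep[OF eqv_lift_rep] by simp

lemma chi_shift: "chi (i, j + 1) = chi (i, j) * l" "chi (i, j - 1) = chi (i, j) * inverse l"
  by (simp_all add: chi_def power_int_add_1 power_int_diff divide_inverse mult_ac)

lemma chi_A: "chi (i + 1, j) = eps * chi (i, j)" "chi (Suc i, j) = eps * chi (i, j)"
  by (simp_all add: chi_def)

lemma eps_sq [simp]: "eps * eps = 1" "eps * (eps * x) = x"
  using eps by auto

lemma diag_gen: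
  "diag chi (opA v) = fscale eps (opA (diag chi v))"
  "diag chi (opB v) = fscale l (opB (diag chi v))"
  "diag chi (opBs v) = fscale (inverse l) (opBs (diag chi v))"
proof -
  note D = klin_diag[OF klin_id, THEN klin_add] klin_diag[OF klin_id, THEN klin_scale] klin_diag[OF klin_id, THEN klin_diff]
  show "diag chi (opA v) = fscale eps (opA (diag chi v))"
    by (rule klin_ext[where v = v]) (auto intro!: klin_intros simp: op_lin chi_A)
  have chi2: "chi (i + 2, j) = chi (i, j)" for i j
    by (simp add: chi_def power_add power2_eq_square)
  \<comment> \<open>Passing to \<open>i + 1\<close> changes the eigenvalue by \<open>eps\<close>;
    for \<open>eps = -1\<close> the linear term is absent since \<open>c = d\<close>.\<close>
  have chi1: "(c - d) * chi (i + 1, j) = (c - d) * chi (i, j)" for i j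
    using eps by (auto simp: chi_def)
  show "diag chi (opB v) = fscale l (opB (diag chi v))"
  proof (rule klin_ext[where v = v])
    fix x :: "nat \<times> int"
    obtain i j where x: "x = (i, j)" by (cases x)
    have "q^2 * (c - d) * chi (i + 1, j + 1) = q^2 * ((c - d) * chi (i + 1, j + 1))" by (rule mult.assoc)
    also have "\<dots> = q^2 * (c - d) * (chi (i, j) * l)" unfolding chi1 by (simp add: chi_shift)
    finally show "diag chi (opB (basis x)) = fscale l (opB (diag chi (basis x)))"
      unfolding x opB_basis
      by (simp only: op_lin opB_basis D diag_basis chi2 chi_shift fvs.scale_right_distrib
          fvs.scale_right_diff_distrib fvs.scale_scale if_distrib[of "diag chi"] if_distrib[of "fscale _"]
          if_distrib[of opB] cong: if_cong)
        (simp add: mult_ac)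
  qed (intro klin_intros)+
  show "diag chi (opBs v) = fscale (inverse l) (opBs (diag chi v))"
  proof (rule klin_ext[where v = v])
    fix x :: "nat \<times> int"
    obtain i j where x: "x = (i, j)" by (cases x)
    have "(c - d) * chi (i + 1, j - 1) = (c - d) * (chi (i, j) * inverse l)"
      unfolding chi1 by (simp add: chi_shift)
    then show "diag chi (opBs (basis x)) = fscale (inverse l) (opBs (diag chi (basis x)))"
      unfolding x opBs_basis
      by (simp only: op_lin opBs_basis D diag_basis chi2 chi_shift fvs.scale_right_distrib
          fvs.scale_right_diff_distrib fvs.scale_scale if_distrib[of "diag chi"] if_distrib[of "fscale _"]
          if_distrib[of opBs] cong: if_cong)
        (simp add: mult_ac)
  qed (intro klin_intros)+
qed

lemma diag_pow:
  "diag chi ((opA ^^ n) v) = fscale (eps ^ n) ((opA ^^ n) (diag chi v))"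
  "diag chi ((opB ^^ n) v) = fscale (l ^ n) ((opB ^^ n) (diag chi v))"
  "diag chi ((opBs ^^ n) v) = fscale (inverse l ^ n) ((opBs ^^ n) (diag chi v))"
  by (induction n) (simp_all add: diag_gen op_lin)

lemma diag_mul_basis: "diag chi (mul (basis x) v) = mul (diag chi (basis x)) (diag chi v)"
proof (cases x)
  case (Pair i j)
  have *: "bop j (diag chi v) = (if j \<ge> 0 then (opB ^^ nat j) (diag chi v) else (opBs ^^ nat (- j)) (diag chi v))"
    by (simp add: bop_def)
  have "diag chi (bop j v) = fscale (l powi j) (bop j (diag chi v))"
    by (auto simp: bop_def diag_pow power_int_def)
  moreover have "chi (i, j) = eps ^ i * l powi j" by (simp add: chi_def)
  ultimately show ?thesis
    unfolding Pair mul_def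
    by (simp add: lift_lin rep_fscale rep_lift_basis diag_pow
        klin_scale[OF klin_funpow[OF klin_opA[OF klin_id]]] mult.commute)
qed

lemma mul_assoc_aux: "mul (mul u v) w = mul u (mul v w)"
proof -
  have "mul u v = rep (lift u * lift v) unit" by (simp add: mul_def rep_mult rep_lift_unit)
  then show ?thesis by (simp add: mul_rep) (simp add: rep_mult mul_def)
qed

lemma klin_mul_aux: "klin (\<lambda>u. mul u v)" "klin (mul u)"
  unfolding mul_def[abs_def] by (intro klin_intros klin_rep)+

lemma diag_mul_aux: "diag chi (mul u v) = mul (diag chi u) (diag chi v)"
proof (rule klin_ext[where v = u])
  show "klin (\<lambda>u. diag chi (mul u v))" by (intro klin_intros klin_mul_aux)
  show "klin (\<lambda>u. mul (diag chi u) (diag chi v))" unfolding mul_def by (intro klin_intros)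
qed (rule diag_mul_basis)

lemma mul_unit_aux: "mul unit v = v" "mul v unit = v" "chi (0, 0) = 1"
  by (simp_all add: mul_def lift_unit rep_one rep_lift_unit chi_def)

lemma twisted_algebra_mul: "twisted_algebra mul (0, 0) chi"
proof (rule twisted_algebra.intro)
  show "klin (\<lambda>u. mul u v)" "klin (mul u)" for u v by (rule klin_mul_aux)+
  show "mul (mul u v) w = mul u (mul v w)" for u v w by (rule mul_assoc_aux)
  show "mul unit v = v" "mul v unit = v" for v by (rule mul_unit_aux)+
  show "chi (0, 0) = 1" by (rule mul_unit_aux)
  show "diag chi (mul u v) = mul (diag chi u) (diag chi v)" for u v by (rule diag_mul_aux)
qed

sublocale twisted_algebra_char0 mul "(0, 0)" chi
  by (rule twisted_algebra_char0.intro[OF twisted_algebra_mul])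

end

section \<open>A free bimodule resolution\<close>

context podles_algebra
begin

lemma mul_A: "mul (basis (Suc 0, 0)) v = opA v"
  and mul_B: "mul (basis (0, 1)) v = opB v" and mul_Bs: "mul (basis (0, -1)) v = opBs v"
  using rep_lift_basis[of 1 0 v] rep_lift_basis[of 0 1 v] rep_lift_basis[of 0 "-1" v]
  by (simp_all add: mul_def bop_def)

definition genA :: "'k pvec" where "genA = basis (Suc 0, 0)"

definition sg :: "bool \<Rightarrow> int" where "sg s = (if s then 1 else -1)"

definition genB :: "bool \<Rightarrow> 'k pvec" where "genB s = basis (0, sg s)"

definition qs :: "bool \<Rightarrow> 'k" where "qs s = (if s then q^2 else inverse (q^2))"

text \<open>\<open>c1\<close> and \<open>c2\<close> are the linear and quadratic coefficients of
  \<open>B B\<^sup>*\<close> (for \<open>True\<close>) and \<open>B\<^sup>* B\<close> (for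
  \<open>False\<close>) as polynomials in \<open>A\<close>.\<close>

definition c1 :: "bool \<Rightarrow> 'k" where "c1 s = (if s then q^2 * (c - d) else c - d)"

definition c2 :: "bool \<Rightarrow> 'k" where "c2 s = (if s then - (q^4) else -1)"

lemma mul_genA: "mul genA v = opA v"
  by (simp add: genA_def mul_A)

lemma mul_genB: "mul (genB s) v = (if s then opB v else opBs v)"
  by (simp add: genB_def sg_def mul_B mul_Bs)

lemma genB_genA: "mul (genB s) genA = fscale (qs s) (mul genA (genB s))"
  by (cases s; simp only: mul_genB mul_genA if_True if_False;
      simp add: genA_def genB_def sg_def qs_def opB_basis opBs_basis)

lemma genB_genB: "mul (genB s) (genB (\<not> s)) =
    fscale (c * d) unit + fscale (c1 s) genA + fscale (c2 s) (mul genA genA)"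
  by (cases s; simp only: mul_genB mul_genA if_True if_False;
      simp add: genA_def genB_def sg_def opB_basis opBs_basis c1_def c2_def numeral_2_eq_2 power2_eq_square)

lemma rmul_genA_genB: "rmul genA (rmul (genB s) x) = fscale (qs s) (rmul (genB s) (rmul genA x))"
  by (simp add: rmul_rmul genB_genA klin_scale[OF klin_rmul_arg[OF klin_id]])

lemma lmul_genB_genA: "lmul (genB s) (lmul genA x) = fscale (qs s) (lmul genA (lmul (genB s) x))"
  by (simp add: lmul_lmul genB_genA klin_scale[OF klin_lmul_arg[OF klin_id]])

lemma rmul_genB_genB:
  assumes "x \<in> words (Suc k)"
  shows "rmul (genB (\<not> s)) (rmul (genB s) x) =
    fscale (c * d) x + fscale (c1 s) (rmul genA x) + fscale (c2 s) (rmul genA (rmul genA x))"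
  using assms
  by (simp add: rmul_rmul genB_genB klin_scale[OF klin_rmul_arg[OF klin_id]] klin_add[OF klin_rmul_arg[OF klin_id]] rmul_one)

lemma lmul_genB_genB:
  assumes "x \<in> words (Suc k)"
  shows "lmul (genB s) (lmul (genB (\<not> s)) x) =
    fscale (c * d) x + fscale (c1 s) (lmul genA x) + fscale (c2 s) (lmul genA (lmul genA x))"
  using assms
  by (simp add: lmul_lmul genB_genB klin_scale[OF klin_lmul_arg[OF klin_id]] klin_add[OF klin_lmul_arg[OF klin_id]] lmul_one)

text \<open>The generators \<open>g\<close> of the resolution in degree \<open>n\<close> are the two alternating words of length \<open>n\<close>
  in \<open>B\<close> and \<open>B\<^sup>*\<close>, indexed by whether they start with \<open>B\<close>, and, in degree \<open>n + 1\<close>, these words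
  followed by \<open>A\<close>.  An element of the free bimodule is given by its coefficients: in the word
  \<open>x # y # w\<close> the outer factors \<open>x\<close> and \<open>y\<close> stand for \<open>x g y\<close>, and the rest of the word is inert.\<close>

definition lastB :: "nat \<Rightarrow> bool \<Rightarrow> bool" where "lastB n s = (if odd n then s else \<not> s)"

definition wq :: "nat \<Rightarrow> bool \<Rightarrow> 'k" where "wq n s = (if odd n then qs s else 1)"

type_synonym 'c tagged = "bool \<Rightarrow> ((nat \<times> int) list \<Rightarrow>\<^sub>0 'c)"

text \<open>Deletes the first letter of an alternating word, which passes into the left factor and
  flips the tag, or the last letter, which passes into the right factor.\<close>

definition dd :: "nat \<Rightarrow> 'k tagged \<Rightarrow> 'k tagged" where
  "dd n a s = rmul (genB (\<not> s)) (a (\<not> s)) + fscale ((-1) ^ n) (lmul (genB (lastB n s)) (a s))"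

text \<open>Sends the generator \<open>g\<close> followed by \<open>A\<close> to
  \<open>g A - Q A g\<close>, where \<open>Q = wq n s\<close> is the scalar with
  \<open>g A = Q A g\<close> in the algebra.\<close>

definition del :: "nat \<Rightarrow> 'k tagged \<Rightarrow> 'k tagged" where
  "del n a s = lmul genA (a s) - fscale (wq n s) (rmul genA (a s))"

text \<open>The deletions of \<open>dd\<close> on words followed by \<open>A\<close>. A last letter
  passing into the right factor first crosses that \<open>A\<close>, hence the extra
  \<open>qs\<close>.\<close>

definition dbar :: "nat \<Rightarrow> 'k tagged \<Rightarrow> 'k tagged" where
  "dbar n a s = rmul (genB (\<not> s)) (a (\<not> s)) + fscale ((-1) ^ n * qs (lastB n s)) (lmul (genB (lastB n s)) (a s))"

text \<open>The correction term, a difference quotient of the polynomials \<open>B B\<^sup>*\<close> and \<open>B\<^sup>* B\<close> in \<open>A\<close>.\<close>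

definition kap :: "nat \<Rightarrow> 'k tagged \<Rightarrow> 'k tagged" where
  "kap n a s = fscale (c1 (s = even n)) (a s)
     + fscale (c2 (s = even n)) (fscale (wq n s) (rmul genA (a s)) + lmul genA (a s))"

lemmas bimod_lin = rmul_lin lmul_lin fvs.scale_right_distrib fvs.scale_right_diff_distrib lmul_rmul
  rmul_genA_genB lmul_genB_genA

lemma genB_genB_simps:
  assumes "x \<in> words (Suc k)"
  shows "rmul (genB False) (rmul (genB True) x) =
    fscale (c * d) x + fscale (c1 True) (rmul genA x) + fscale (c2 True) (rmul genA (rmul genA x))"
   "rmul (genB True) (rmul (genB False) x) =
    fscale (c * d) x + fscale (c1 False) (rmul genA x) + fscale (c2 False) (rmul genA (rmul genA x))"
   "lmul (genB True) (lmul (genB False) x) =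
    fscale (c * d) x + fscale (c1 True) (lmul genA x) + fscale (c2 True) (lmul genA (lmul genA x))"
   "lmul (genB False) (lmul (genB True) x) =
    fscale (c * d) x + fscale (c1 False) (lmul genA x) + fscale (c2 False) (lmul genA (lmul genA x))"
  using rmul_genB_genB[OF assms, of True] rmul_genB_genB[OF assms, of False]
    lmul_genB_genB[OF assms, of True] lmul_genB_genB[OF assms, of False] by simp_all

text \<open>The mixed deletions cancel. Two deletions at the same end give the polynomial of
  \<open>B B\<^sup>*\<close> or \<open>B\<^sup>* B\<close>, in the left copy of \<open>A\<close> and
  with the opposite sign in the right copy; this difference factors through \<open>del\<close>, the
  quotient being \<open>kap\<close> up to sign. This and the next three identities are the four
  entries of \<open>D\<close> squared.\<close>

lemma dd_dd:
  assumes "\<And>s. a s \<in> words (Suc k)"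
  shows "dd (Suc n) (dd (Suc (Suc n)) a) s + del n (kap (Suc (Suc n)) a) s = 0"
  by (cases "even n"; cases s;
      simp add: dd_def del_def kap_def lastB_def wq_def bimod_lin genB_genB_simps[OF assms];
      simp add: c1_def c2_def qs_def;
      rule poly_mapping_eqI; simp add: lookup_add lookup_minus field_simps)

lemma dd_del: "dd (Suc n) (del (Suc n) a) s = del n (dbar (Suc n) a) s"
  by (cases "even n"; cases s;
      simp add: dd_def del_def dbar_def lastB_def wq_def bimod_lin;
      simp add: qs_def;
      rule poly_mapping_eqI; simp add: lookup_add lookup_minus field_simps)

lemma kap_del:
  assumes "\<And>s. a s \<in> words (Suc k)"
  shows "kap (Suc (Suc n)) (del (Suc (Suc n)) a) s + dbar (Suc n) (dbar (Suc (Suc n)) a) s = 0"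
  by (cases "even n"; cases s;
      simp add: dbar_def del_def kap_def lastB_def wq_def bimod_lin genB_genB_simps[OF assms];
      simp add: c1_def c2_def qs_def;
      rule poly_mapping_eqI; simp add: lookup_add lookup_minus field_simps)

lemma kap_dd: "kap (Suc (Suc n)) (dd (Suc (Suc (Suc n))) a) s = dbar (Suc n) (kap (Suc (Suc (Suc n))) a) s"
  by (cases "even n"; cases s;
      rule poly_mapping_eqI;
      simp add: dd_def dbar_def kap_def lastB_def wq_def bimod_lin lookup_add lookup_minus;
      simp add: c1_def c2_def qs_def field_simps)

text \<open>In degree \<open>0\<close> both words are empty, so the two tags have to be identified.\<close>

definition col :: "nat \<Rightarrow> 'k tagged \<Rightarrow> 'k tagged" where
  "col n f = (if n = 0 then (\<lambda>s. if s then f True + f False else 0) else f)"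

section \<open>The resolution by free bimodules\<close>

definition D :: "nat \<Rightarrow> 'k tagged \<times> 'k tagged \<Rightarrow> 'k tagged \<times> 'k tagged" where
  "D m x = (col m (\<lambda>s. dd (Suc m) (fst x) s + del m (snd x) s),
     case m of 0 \<Rightarrow> (\<lambda>s. 0) | Suc p \<Rightarrow> col p (\<lambda>s. kap (Suc m) (fst x) s - dbar m (snd x) s))"

text \<open>\<open>m\<close> is the degree in the resolution and \<open>k\<close> the length of the
  words; \<open>k = 1\<close> will be the small complex. The zero conditions discard the second copy
  of the empty word and, in degree zero, all words followed by \<open>A\<close>.\<close>

definition F :: "nat \<Rightarrow> nat \<Rightarrow> ('k tagged \<times> 'k tagged) set" where
  "F m k = {x. (\<forall>s. fst x s \<in> words k \<and> snd x s \<in> words k)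
     \<and> (m = 0 \<longrightarrow> fst x False = 0 \<and> snd x = (\<lambda>s. 0)) \<and> (m = 1 \<longrightarrow> snd x False = 0)}"

definition fzero :: "'k tagged \<times> 'k tagged" where "fzero = (\<lambda>s. 0, \<lambda>s. 0)"

definition fadd :: "'k tagged \<times> 'k tagged \<Rightarrow> 'k tagged \<times> 'k tagged \<Rightarrow> 'k tagged \<times> 'k tagged" where
  "fadd x y = (\<lambda>s. fst x s + fst y s, \<lambda>s. snd x s + snd y s)"

definition fdiff :: "'k tagged \<times> 'k tagged \<Rightarrow> 'k tagged \<times> 'k tagged \<Rightarrow> 'k tagged \<times> 'k tagged" where
  "fdiff x y = (\<lambda>s. fst x s - fst y s, \<lambda>s. snd x s - snd y s)"

definition fmap :: "(((nat \<times> int) list \<Rightarrow>\<^sub>0 'k) \<Rightarrow> ((nat \<times> int) list \<Rightarrow>\<^sub>0 'k)) \<Rightarrow>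
    'k tagged \<times> 'k tagged \<Rightarrow> 'k tagged \<times> 'k tagged" where
  "fmap f x = (\<lambda>s. f (fst x s), \<lambda>s. f (snd x s))"

lemma D_fadd: "D m (fadd x y) = fadd (D m x) (D m y)"
  unfolding D_def fadd_def
  by (auto simp: fun_eq_iff col_def dd_def del_def kap_def dbar_def rmul_lin lmul_lin
      fvs.scale_right_distrib split: nat.split)

lemma D_fdiff: "D m (fdiff x y) = fdiff (D m x) (D m y)"
  unfolding D_def fdiff_def
  by (auto simp: fun_eq_iff col_def dd_def del_def kap_def dbar_def rmul_lin lmul_lin
      fvs.scale_right_diff_distrib fvs.scale_right_distrib algebra_simps split: nat.split)

lemma D_fzero: "D m fzero = fzero"
  by (auto simp: D_def fzero_def fun_eq_iff col_def dd_def del_def kap_def dbar_def rmul_lin lmul_lin split: nat.split)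

lemma fadd_F: "x \<in> F m k \<Longrightarrow> y \<in> F m k \<Longrightarrow> fadd x y \<in> F m k"
  by (auto simp: F_def fadd_def intro: words_add)

lemma fdiff_F: "x \<in> F m k \<Longrightarrow> y \<in> F m k \<Longrightarrow> fdiff x y \<in> F m k"
  by (auto simp: F_def fdiff_def intro: words_diff)

lemma dd_words: "(\<And>s. a s \<in> words (Suc k)) \<Longrightarrow> dd n a s \<in> words (Suc k)"
  and del_words: "(\<And>s. a s \<in> words (Suc k)) \<Longrightarrow> del n a s \<in> words (Suc k)"
  and kap_words: "(\<And>s. a s \<in> words (Suc k)) \<Longrightarrow> kap n a s \<in> words (Suc k)"
  and dbar_words: "(\<And>s. a s \<in> words (Suc k)) \<Longrightarrow> dbar n a s \<in> words (Suc k)"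
  unfolding dd_def del_def kap_def dbar_def by (intro words_intros rmul_words lmul_words; assumption)+

lemma col_words: "(\<And>s. a s \<in> words k) \<Longrightarrow> col n a s \<in> words k"
  by (auto simp: col_def intro: words_add)

lemma D_F: "x \<in> F (Suc m) (Suc k) \<Longrightarrow> D m x \<in> F m (Suc k)"
  unfolding F_def D_def
  by (auto intro!: col_words words_add words_diff dd_words del_words kap_words dbar_words split: nat.split)
    (auto simp: col_def)

lemma del_col: "del 0 (col 0 f) s = col 0 (del 0 f) s"
  by (simp add: del_def col_def wq_def rmul_lin lmul_lin algebra_simps)

lemma D_D:
  assumes "x \<in> F (Suc (Suc m)) (Suc k)"
  shows "D m (D (Suc m) x) = fzero"
proof -
  obtain a b where x: "x = (a, b)" by (cases x)
  have w: "a s \<in> words (Suc k)" "b s \<in> words (Suc k)" for s using assms by (auto simp: F_def x)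
  define a' where "a' = (\<lambda>s. dd (Suc (Suc m)) a s + del (Suc m) b s)"
  define g where "g = (\<lambda>s. kap (Suc (Suc m)) a s - dbar (Suc m) b s)"
  have D1: "D (Suc m) x = (a', col m g)"
    by (simp add: D_def x a'_def g_def col_def)
  have first: "dd (Suc m) a' s + del m g s = 0" for s
  proof -
    have "dd (Suc m) a' s = dd (Suc m) (dd (Suc (Suc m)) a) s + dd (Suc m) (del (Suc m) b) s"
      by (simp add: a'_def dd_def rmul_lin lmul_lin fvs.scale_right_distrib)
    moreover have "del m g s = del m (kap (Suc (Suc m)) a) s - del m (dbar (Suc m) b) s"
      by (simp add: g_def del_def rmul_lin lmul_lin fvs.scale_right_diff_distrib)
    ultimately show ?thesis using dd_dd[of a k m s] dd_del[of m b s] w by simp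
  qed
  have second: "kap (Suc m) a' s - dbar m g s = 0" if "m = Suc p" for p s
  proof -
    have "kap (Suc m) a' s = kap (Suc m) (dd (Suc (Suc m)) a) s + kap (Suc m) (del (Suc m) b) s"
      by (simp add: a'_def kap_def rmul_lin lmul_lin fvs.scale_right_distrib)
    moreover have "dbar m g s = dbar m (kap (Suc (Suc m)) a) s - dbar m (dbar (Suc m) b) s"
      by (simp add: g_def dbar_def rmul_lin lmul_lin fvs.scale_right_diff_distrib)
    ultimately have "kap (Suc m) a' s - dbar m g s =
        (kap (Suc m) (dd (Suc (Suc m)) a) s - dbar m (kap (Suc (Suc m)) a) s)
        + (kap (Suc m) (del (Suc m) b) s + dbar m (dbar (Suc m) b) s)" by simp
    then show ?thesis using kap_dd[of p a s] kap_del[of b k p s] w that by simp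
  qed
  have "col m (\<lambda>s. dd (Suc m) a' s + del m (col m g) s) = (\<lambda>s. 0)"
  proof (cases m)
    case 0
    have "col 0 (\<lambda>s. dd (Suc 0) a' s + col 0 (del 0 g) s) = col 0 (\<lambda>s. dd (Suc 0) a' s + del 0 g s)"
      by (auto simp: col_def fun_eq_iff algebra_simps)
    then show ?thesis using 0 first by (simp add: del_col) (simp add: col_def fun_eq_iff)
  qed (use first in \<open>simp add: col_def\<close>)
  moreover have "(case m of 0 \<Rightarrow> \<lambda>s. 0 | Suc p \<Rightarrow> col p (\<lambda>s. kap (Suc m) a' s - dbar m (col m g) s)) = (\<lambda>s. 0)"
    using second by (auto split: nat.split simp: col_def fun_eq_iff)
  ultimately show ?thesis
    unfolding D1 D_def[of m] fzero_def fst_conv snd_conv by simp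
qed

lemma D_fhoch:
  assumes "x \<in> F (Suc m) (Suc (Suc k))"
  shows "D m (fmap fhoch x) = fmap fhoch (D m x)"
proof -
  have w: "fst x s \<in> words (Suc (Suc k))" "snd x s \<in> words (Suc (Suc k))" for s using assms by (auto simp: F_def)
  show ?thesis
    by (auto simp: D_def fmap_def fun_eq_iff col_def dd_def del_def kap_def dbar_def fhoch_rmul[OF w(1)] fhoch_rmul[OF w(2)]
        fhoch_lmul[OF w(1)] fhoch_lmul[OF w(2)] fhoch_lin split: nat.split)
qed

lemma fhoch_F: "x \<in> F m (Suc (Suc k)) \<Longrightarrow> fmap fhoch x \<in> F m (Suc k)"
  by (auto simp: F_def fmap_def fhoch_lin intro: fhoch_words)

lemma insert_one_F: "x \<in> F m (Suc k) \<Longrightarrow> fmap insert_one x \<in> F m (Suc (Suc k))"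
  by (auto simp: F_def fmap_def insert_one_lin intro: insert_one_words)

lemma fhoch_insert_one_F: "x \<in> F m (Suc k) \<Longrightarrow> fadd (fmap fhoch (fmap insert_one x)) (fmap insert_one (fmap fhoch x)) = x"
  by (auto simp: F_def fmap_def fadd_def prod_eq_iff fun_eq_iff fhoch_insert_one[of _ k])

lemma fhoch_fhoch_F: "x \<in> F m (Suc k) \<Longrightarrow> fmap fhoch (fmap fhoch x) = fzero"
  by (auto simp: F_def fmap_def fzero_def prod_eq_iff fun_eq_iff fhoch_fhoch[of _ k])

lemma fmap_fhoch_lin: "fmap fhoch (fdiff x y) = fdiff (fmap fhoch x) (fmap fhoch y)"
  "fmap fhoch (fadd x y) = fadd (fmap fhoch x) (fmap fhoch y)" "fmap fhoch fzero = fzero"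
  "fmap insert_one fzero = fzero"
  by (simp_all add: fmap_def fdiff_def fadd_def fzero_def fhoch_lin insert_one_lin)

lemma face0_D:
  assumes "x \<in> F (Suc 0) (Suc (Suc k))"
  shows "face0 (fst (D 0 x) True) = 0"
proof -
  have w: "fst x s \<in> words (Suc (Suc k))" "snd x s \<in> words (Suc (Suc k))" for s using assms by (auto simp: F_def)
  show ?thesis
    by (simp add: D_def col_def dd_def del_def lastB_def wq_def face0_lin face0_lmul[OF w(1)] face0_lmul[OF w(2)])
qed

end

section \<open>Exactness of the resolution\<close>

context podles_algebra
begin

lemma words2_ext:
  assumes "x \<in> words (Suc (Suc k))" "klin f" "klin g"
    "\<And>i j n r. f (tcons (basis i) (basis ((n, j) # r))) = g (tcons (basis i) (basis ((n, j) # r)))"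
  shows "f x = g x"
  using assms(1-3) by (rule words_ext) (use assms(4) in \<open>force simp: length_Suc_conv\<close>)

lemma lmul_genA_tcons: "lmul genA (tcons u (basis ((i, j) # r))) = tcons u (basis ((Suc i, j) # r))"
  by (simp add: mul_genA)

text \<open>Modulo the image of \<open>g A - Q A g\<close> the coefficients can be written with no \<open>A\<close> in the right
  factor; \<open>pure Q\<close> is the projection and \<open>sec Q\<close> the corresponding section.\<close>

definition pure :: "'k \<Rightarrow> ((nat \<times> int) list \<Rightarrow>\<^sub>0 'k) \<Rightarrow> ((nat \<times> int) list \<Rightarrow>\<^sub>0 'k)" where
  "pure Q = lin (\<lambda>w. case w of x # y # r \<Rightarrow>
     fscale (Q ^ fst y) (tcons (mul (basis x) (basis (fst y, 0))) (basis ((0, snd y) # r))) | _ \<Rightarrow> 0)"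

lemma klin_pure [klin_intros]: "klin f \<Longrightarrow> klin (\<lambda>x. pure Q (f x))"
  unfolding pure_def by (intro klin_intros)

lemmas pure_lin =
  klin_pure[OF klin_id, THEN klin_zero] klin_pure[OF klin_id, THEN klin_add]
  klin_pure[OF klin_id, THEN klin_diff] klin_pure[OF klin_id, THEN klin_minus]
  klin_pure[OF klin_id, THEN klin_scale]

lemma pure_tcons [simp]: "pure Q (tcons u (basis ((i, j) # r))) =
    fscale (Q ^ i) (tcons (mul u (basis (i, 0))) (basis ((0, j) # r)))"
  by (rule klin_ext[where v = u]) (auto intro!: klin_intros simp: pure_def)

text \<open>Division of \<open>g A\<^sup>i - Q\<^sup>i A\<^sup>i g\<close> by
  \<open>g A - Q A g\<close>: one factor \<open>A\<close> at a time is carried to the left of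
  \<open>g\<close>.\<close>

primrec sec_rec :: "'k \<Rightarrow> nat \<Rightarrow> int \<Rightarrow> (nat \<times> int) list \<Rightarrow> 'k pvec \<Rightarrow> ((nat \<times> int) list \<Rightarrow>\<^sub>0 'k)" where
  "sec_rec Q 0 j r u = 0"
| "sec_rec Q (Suc i) j r u = tcons u (basis ((i, j) # r)) + fscale Q (sec_rec Q i j r (mul u genA))"

lemma klin_sec_rec [klin_intros]: "klin f \<Longrightarrow> klin (\<lambda>u. sec_rec Q i j r (f u))"
  by (induction i arbitrary: f) (auto intro!: klin_intros)

definition sec :: "'k \<Rightarrow> ((nat \<times> int) list \<Rightarrow>\<^sub>0 'k) \<Rightarrow> ((nat \<times> int) list \<Rightarrow>\<^sub>0 'k)" where
  "sec Q = lin (\<lambda>w. case w of x # y # r \<Rightarrow> sec_rec Q (fst y) (snd y) r (basis x) | _ \<Rightarrow> 0)"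

lemma klin_sec [klin_intros]: "klin f \<Longrightarrow> klin (\<lambda>x. sec Q (f x))"
  unfolding sec_def by (intro klin_intros)

lemmas sec_lin =
  klin_sec[OF klin_id, THEN klin_zero] klin_sec[OF klin_id, THEN klin_add]
  klin_sec[OF klin_id, THEN klin_diff] klin_sec[OF klin_id, THEN klin_minus]
  klin_sec[OF klin_id, THEN klin_scale]

lemma sec_tcons [simp]: "sec Q (tcons u (basis ((i, j) # r))) = sec_rec Q i j r u"
  by (rule klin_ext[where v = u]) (auto intro!: klin_intros simp: sec_def)

definition delQ :: "'k \<Rightarrow> ((nat \<times> int) list \<Rightarrow>\<^sub>0 'k) \<Rightarrow> ((nat \<times> int) list \<Rightarrow>\<^sub>0 'k)" where
  "delQ Q x = lmul genA x - fscale Q (rmul genA x)"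

lemma klin_delQ [klin_intros]: "klin f \<Longrightarrow> klin (\<lambda>x. delQ Q (f x))"
  unfolding delQ_def by (intro klin_intros)

lemmas delQ_lin =
  klin_delQ[OF klin_id, THEN klin_zero] klin_delQ[OF klin_id, THEN klin_add]
  klin_delQ[OF klin_id, THEN klin_diff] klin_delQ[OF klin_id, THEN klin_minus]
  klin_delQ[OF klin_id, THEN klin_scale]

lemma del_delQ: "del n a s = delQ (wq n s) (a s)"
  by (simp add: del_def delQ_def)

lemma delQ_sec_rec: "delQ Q (sec_rec Q i j r u) = tcons u (basis ((i, j) # r)) - pure Q (tcons u (basis ((i, j) # r)))"
proof (induction i arbitrary: u)
  case (Suc i)
  have "mul (mul u genA) (basis (i, 0)) = mul u (basis (Suc i, 0))"
    by (simp add: mul_assoc mul_genA)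
  then show ?case
    using Suc[of "mul u genA"]
    by (simp add: delQ_lin fvs.scale_right_diff_distrib) (simp add: delQ_def mul_genA)
qed (simp add: delQ_lin)

lemma delQ_sec: "x \<in> words (Suc (Suc k)) \<Longrightarrow> delQ Q (sec Q x) = x - pure Q x"
  by (rule words2_ext, assumption) (auto intro!: klin_intros simp: delQ_sec_rec simp del: tcons_basis)

lemma sec_delQ: "x \<in> words (Suc (Suc k)) \<Longrightarrow> sec Q (delQ Q x) = x"
  by (rule words2_ext, assumption)
    (auto intro!: klin_intros simp: delQ_def sec_lin lmul_genA_tcons simp del: tcons_basis lmul_tcons_basis)

lemma pure_delQ: "x \<in> words (Suc (Suc k)) \<Longrightarrow> pure Q (delQ Q x) = 0"
  by (rule words2_ext, assumption)
    (auto intro!: klin_intros simp: delQ_def pure_lin lmul_genA_tcons mul_assoc mul_genA simp del: tcons_basis lmul_tcons_basis)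

lemma face0_delQ: "x \<in> words (Suc (Suc k)) \<Longrightarrow> face0 (delQ 1 x) = 0"
  by (simp add: delQ_def face0_lin face0_lmul)

lemma sec_rec_words: "sec_rec Q i j r u \<in> words (Suc (Suc (length r)))"
  by (induction i arbitrary: u) (auto intro!: words_intros tcons_words)

lemma sec_words: "x \<in> words (Suc (Suc k)) \<Longrightarrow> sec Q x \<in> words (Suc (Suc k))"
proof (rule klin_words, assumption)
  fix w :: "(nat \<times> int) list" assume "length w = Suc (Suc k)"
  then obtain x i j r where "w = x # (i, j) # r" "length r = k" by (auto simp: length_Suc_conv)
  then show "sec Q (basis w) \<in> words (Suc (Suc k))"
    using sec_tcons[of Q "basis x" i j r] sec_rec_words[of Q i j r "basis x"] by simp
qed (intro klin_intros)

definition pwords :: "nat \<Rightarrow> ((nat \<times> int) list \<Rightarrow>\<^sub>0 'k) set" where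
  "pwords k = supported {w. length w = Suc (Suc k) \<and> fst (w ! 1) = 0}"

lemma pwords_words: "x \<in> pwords k \<Longrightarrow> x \<in> words (Suc (Suc k))"
  unfolding pwords_def words_def by (erule supported_mono) auto

lemma pwords_ext:
  assumes "x \<in> pwords k" "klin f" "klin g"
    "\<And>i j r. length r = k \<Longrightarrow> f (tcons (basis i) (basis ((0, j) # r))) = g (tcons (basis i) (basis ((0, j) # r)))"
  shows "f x = g x"
  using assms(1) unfolding pwords_def
  by (rule klin_ext_on) (use assms(2-) in \<open>force simp: length_Suc_conv\<close>)+

lemma klin_pwords:
  assumes "x \<in> pwords k" "klin f"
    "\<And>i j r. length r = k \<Longrightarrow> f (tcons (basis i) (basis ((0, j) # r))) \<in> pwords k"
  shows "f x \<in> pwords k"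
  unfolding pwords_def
  by (rule klin_supported[OF assms(1)[unfolded pwords_def] assms(2)])
    (use assms(3) in \<open>force simp: length_Suc_conv pwords_def\<close>)

lemma pwords_tcons: "length r = k \<Longrightarrow> tcons u (basis ((0, j) # r)) \<in> pwords k"
  unfolding pwords_def by (rule klin_supported[of u UNIV]) (auto intro!: klin_intros)

lemma pwords_intros:
  "0 \<in> pwords k" "x \<in> pwords k \<Longrightarrow> y \<in> pwords k \<Longrightarrow> x + y \<in> pwords k"
  "x \<in> pwords k \<Longrightarrow> y \<in> pwords k \<Longrightarrow> x - y \<in> pwords k" "x \<in> pwords k \<Longrightarrow> fscale a x \<in> pwords k"
  unfolding pwords_def by (auto intro: supported_intros)

lemma pure_pwords: "x \<in> words (Suc (Suc k)) \<Longrightarrow> pure Q x \<in> pwords k"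
proof -
  assume x: "x \<in> words (Suc (Suc k))"
  show ?thesis
    unfolding pwords_def
  proof (rule klin_supported[OF x[unfolded words_def]])
    fix w :: "(nat \<times> int) list" assume "w \<in> {w. length w = Suc (Suc k)}"
    then obtain x i j r where "w = x # (i, j) # r" "length r = k" by (auto simp: length_Suc_conv)
    then show "pure Q (basis w) \<in> supported {w. length w = Suc (Suc k) \<and> fst (w ! 1) = 0}"
      using pure_tcons[of Q "basis x" i j r]
        pwords_intros(4)[OF pwords_tcons[of r k "mul (basis x) (basis (i, 0))" j], of "Q ^ i"]
      by (simp add: pwords_def)
  qed (intro klin_intros)
qed

lemma pure_id: "x \<in> pwords k \<Longrightarrow> pure Q x = x"
  by (rule pwords_ext, assumption) (auto intro!: klin_intros simp del: tcons_basis)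

lemma rmul_pwords: "x \<in> pwords k \<Longrightarrow> rmul v x \<in> pwords k"
  by (rule klin_pwords, assumption) (auto intro!: klin_intros pwords_tcons simp del: tcons_basis)

text \<open>A partial inverse to left multiplication: strips the letter \<open>t\<close> from a
  right factor that starts with it and gives zero otherwise, in particular for exponent
  zero.\<close>

definition shift :: "bool \<Rightarrow> ((nat \<times> int) list \<Rightarrow>\<^sub>0 'k) \<Rightarrow> ((nat \<times> int) list \<Rightarrow>\<^sub>0 'k)" where
  "shift t = lin (\<lambda>w. case w of x # y # r \<Rightarrow>
     if sg t * snd y > 0 then basis (x # (fst y, snd y - sg t) # r) else 0 | _ \<Rightarrow> 0)"

lemma klin_shift [klin_intros]: "klin f \<Longrightarrow> klin (\<lambda>x. shift t (f x))"
  unfolding shift_def by (intro klin_intros)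

lemmas shift_lin =
  klin_shift[OF klin_id, THEN klin_zero] klin_shift[OF klin_id, THEN klin_add]
  klin_shift[OF klin_id, THEN klin_diff] klin_shift[OF klin_id, THEN klin_minus]
  klin_shift[OF klin_id, THEN klin_scale]

lemma shift_tcons [simp]: "shift t (tcons u (basis ((i, j) # r))) =
    (if sg t * j > 0 then tcons u (basis ((i, j - sg t) # r)) else 0)"
  by (rule klin_ext[where v = u]) (auto intro!: klin_intros simp: shift_def)

lemma shift_pwords: "x \<in> pwords k \<Longrightarrow> shift t x \<in> pwords k"
  by (rule klin_pwords, assumption) (auto intro!: klin_intros pwords_tcons pwords_intros simp del: tcons_basis)

lemma shift_rmul: "x \<in> words (Suc (Suc k)) \<Longrightarrow> shift t (rmul v x) = rmul v (shift t x)"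
  by (rule words2_ext, assumption) (auto intro!: klin_intros simp: rmul_lin simp del: tcons_basis)

lemma sg_simps [simp]: "sg True = 1" "sg False = -1"
  by (simp_all add: sg_def)

lemma lmul_genB_same:
  "sg s * j \<ge> 0 \<Longrightarrow> lmul (genB s) (tcons u (basis ((0, j) # r))) = tcons u (basis ((0, j + sg s) # r))"
  by (cases s) (simp_all add: mul_genB opB_basis opBs_basis)

lemma pure_lmul_genB_opposite:
  assumes "sg s * j < 0"
  shows "pure Q (lmul (genB s) (tcons u (basis ((0, j) # r)))) =
    tcons (mul u (fscale (c * d) unit + fscale (c1 s * Q) genA + fscale (c2 s * Q ^ 2) (mul genA genA))) (basis ((0, j + sg s) # r))"
  using assms
  by (cases s) (simp_all add: mul_genB opB_basis opBs_basis tcons_simps pure_lin mul_simps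
      c1_def c2_def mul_genA genA_def mul_A numeral_2_eq_2)

text \<open>If the right factor starts with \<open>t\<close>, stripping and reattaching it is the
  identity and the second term vanishes; in all other cases attaching the opposite letter is undone
  by stripping it, and the first term vanishes.\<close>

lemma shift_homotopy:
  assumes "z \<in> pwords k"
  shows "pure Q (lmul (genB t) (shift t z)) + shift (\<not> t) (pure Q' (lmul (genB (\<not> t)) z)) = z"
  using assms
proof (rule pwords_ext)
  fix i :: "nat \<times> int" and j and r :: "(nat \<times> int) list"
  let ?z = "tcons (basis i) (basis ((0, j) # r))"
  show "pure Q (lmul (genB t) (shift t ?z)) + shift (\<not> t) (pure Q' (lmul (genB (\<not> t)) ?z)) = ?z"
  proof (cases "sg t * j > 0")
    case True
    then have "sg (\<not> t) * j < 0" by (cases t) auto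
    from pure_lmul_genB_opposite[OF this, of Q' "basis i" r] True
    have "shift (\<not> t) (pure Q' (lmul (genB (\<not> t)) ?z)) = 0" by (cases t) auto
    moreover have "lmul (genB t) (shift t ?z) = ?z"
      using True lmul_genB_same[of t "j - sg t" "basis i" r] by (cases t) (auto simp del: tcons_basis lmul_tcons_basis)
    ultimately show ?thesis by (simp del: tcons_basis)
  next
    case False
    then have "sg (\<not> t) * j \<ge> 0" by (cases t) auto
    from lmul_genB_same[OF this, of "basis i" r]
    have "lmul (genB (\<not> t)) ?z = tcons (basis i) (basis ((0, j + sg (\<not> t)) # r))" .
    then show ?thesis using False by (cases t) (auto simp: lmul_lin pure_lin simp del: tcons_basis lmul_tcons_basis)
  qed
qed (intro klin_intros)+

definition hh :: "nat \<Rightarrow> 'k tagged \<Rightarrow> 'k tagged" where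
  "hh n a s = fscale ((-1) ^ Suc n) (shift (lastB (Suc n) s) (a s))"

lemma lastB_Suc [simp]: "lastB n s = (\<not> lastB (Suc n) s)" "lastB n (\<not> s) = (\<not> lastB n s)"
  by (auto simp: lastB_def)

declare lastB_Suc(1) [simp del]

text \<open>Deletion on the left commutes with \<open>shift\<close>, which acts on the other factor;
  the cycle condition therefore turns the left term of the candidate into the missing term of
  \<open>shift_homotopy\<close>. The scalars of the two projections belong to different degrees, so
  they may differ.\<close>

lemma pure_exact:
  assumes a: "\<And>s. a s \<in> pwords k" and cyc: "\<And>s. pure (Q' s) (dd n a s) = 0"
  shows "a s = pure Q (dd (Suc n) (hh n a) s)"
proof -
  define t where "t = lastB (Suc n) s"
  have t: "lastB n s = (\<not> t)" by (simp add: t_def lastB_Suc(1)[of n])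
  have w: "a s \<in> words (Suc (Suc k))" for s using a pwords_words by blast
  have p: "pure R (rmul v (shift u (a s))) = rmul v (shift u (a s))" for R v u s
    by (rule pure_id[OF rmul_pwords[OF shift_pwords[OF a]]])
  have p': "pure R (rmul v (a s)) = rmul v (a s)" for R v s by (rule pure_id[OF rmul_pwords[OF a]])
  have "shift (\<not> t) (pure (Q' s) (dd n a s)) = 0" by (simp add: cyc shift_lin)
  then have e: "rmul (genB (\<not> s)) (shift (\<not> t) (a (\<not> s)))
      = - fscale ((-1) ^ n) (shift (\<not> t) (pure (Q' s) (lmul (genB (\<not> t)) (a s))))"
    by (simp add: dd_def t pure_lin p' shift_lin shift_rmul[OF w] eq_neg_iff_add_eq_0)
  have "pure Q (dd (Suc n) (hh n a) s) = fscale ((-1) ^ Suc n) (rmul (genB (\<not> s)) (shift (\<not> t) (a (\<not> s))))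
      + pure Q (lmul (genB t) (shift t (a s)))"
    by (simp add: dd_def hh_def pure_lin rmul_lin lmul_lin p flip: t_def)
  also have "\<dots> = shift (\<not> t) (pure (Q' s) (lmul (genB (\<not> t)) (a s))) + pure Q (lmul (genB t) (shift t (a s)))"
    unfolding e by simp
  also have "\<dots> = a s" using shift_homotopy[OF a] by (simp add: add.commute)
  finally show ?thesis by simp
qed

text \<open>Records the passage from \<open>x g b\<^sup>n\<close> to \<open>x b\<^sup>n g\<close>,
  one letter across the generator at a time; this contracts the resolution in the lowest
  degree.\<close>

primrec h0_rec :: "bool \<Rightarrow> nat \<Rightarrow> (nat \<times> int) list \<Rightarrow> bool \<Rightarrow> 'k pvec \<Rightarrow> ((nat \<times> int) list \<Rightarrow>\<^sub>0 'k)" where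
  "h0_rec t 0 r s u = 0"
| "h0_rec t (Suc n) r s u = h0_rec t n r s (mul u (genB t))
     - (if s = t then tcons u (basis ((0, sg t * int n) # r)) else 0)"

lemma klin_h0_rec [klin_intros]: "klin f \<Longrightarrow> klin (\<lambda>u. h0_rec t n r s (f u))"
  by (induction n arbitrary: f) (auto intro!: klin_intros)

definition h0 :: "bool \<Rightarrow> ((nat \<times> int) list \<Rightarrow>\<^sub>0 'k) \<Rightarrow> ((nat \<times> int) list \<Rightarrow>\<^sub>0 'k)" where
  "h0 s = lin (\<lambda>w. case w of x # y # r \<Rightarrow> h0_rec (snd y \<ge> 0) (nat \<bar>snd y\<bar>) r s (basis x) | _ \<Rightarrow> 0)"

lemma klin_h0 [klin_intros]: "klin f \<Longrightarrow> klin (\<lambda>x. h0 s (f x))"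
  unfolding h0_def by (intro klin_intros)

lemmas h0_lin =
  klin_h0[OF klin_id, THEN klin_zero] klin_h0[OF klin_id, THEN klin_add]
  klin_h0[OF klin_id, THEN klin_diff] klin_h0[OF klin_id, THEN klin_minus]
  klin_h0[OF klin_id, THEN klin_scale]

lemma h0_tcons: "h0 s (tcons u (basis ((i, j) # r))) = h0_rec (j \<ge> 0) (nat \<bar>j\<bar>) r s u"
  by (rule klin_ext[where v = u]) (auto intro!: klin_intros simp: h0_def)

lemma h0_tcons_sg: "h0 s (tcons u (basis ((i, sg t * int n) # r))) = h0_rec t n r s u"
  by (cases "n = 0"; cases t) (auto simp: h0_tcons)

lemma h0_rec_pwords: "h0_rec t n r s u \<in> pwords (length r)"
  by (induction n arbitrary: u) (auto intro!: pwords_intros pwords_tcons)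

lemma h0_pwords: "x \<in> pwords k \<Longrightarrow> h0 s x \<in> pwords k"
  by (rule klin_pwords, assumption)
    (auto intro!: klin_intros simp: h0_tcons simp del: tcons_basis intro: h0_rec_pwords)

lemma pure_lmul_genB_opposite1:
  assumes "sg s * j < 0"
  shows "pure 1 (lmul (genB s) (tcons u (basis ((0, j) # r)))) =
    tcons (mul (mul u (genB s)) (genB (\<not> s))) (basis ((0, j + sg s) # r))"
  using pure_lmul_genB_opposite[OF assms, of 1 u r] by (simp add: mul_assoc genB_genB)

text \<open>In degree one the cycle condition controls only the sum over both tags. Applying
  \<open>h0 s'\<close> separates the tags: up to explicit boundary terms it returns the component
  with tag \<open>s'\<close>.\<close>

lemma h0_homotopy:
  assumes "z \<in> pwords k"
  shows "h0 s' (rmul (genB s) z) - h0 s' (pure 1 (lmul (genB s) z)) =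
    (if s' = s then z - pure Q (lmul (genB (\<not> s)) (shift (\<not> s) z)) else - rmul (genB s) (shift (\<not> s) z))"
  using assms
proof (rule pwords_ext)
  fix i :: "nat \<times> int" and j and r :: "(nat \<times> int) list"
  let ?z = "tcons (basis i) (basis ((0, j) # r))"
  show "h0 s' (rmul (genB s) ?z) - h0 s' (pure 1 (lmul (genB s) ?z)) =
    (if s' = s then ?z - pure Q (lmul (genB (\<not> s)) (shift (\<not> s) ?z)) else - rmul (genB s) (shift (\<not> s) ?z))"
  proof (cases "sg s * j \<ge> 0")
    case True
    then obtain n where n: "j = sg s * int n"
      by (cases s) (auto intro!: that[of "nat \<bar>j\<bar>"])
    have sh: "shift (\<not> s) ?z = 0" using True by (cases s) (auto simp del: tcons_basis)
    have "lmul (genB s) ?z = tcons (basis i) (basis ((0, j + sg s) # r))" by (rule lmul_genB_same[OF True])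
    moreover have "j + sg s = sg s * int (Suc n)" by (simp add: n algebra_simps)
    ultimately have 1: "pure 1 (lmul (genB s) ?z) = tcons (basis i) (basis ((0, sg s * int (Suc n)) # r))"
      by (simp only: pure_id[OF pwords_tcons[OF refl]])
    have "rmul (genB s) ?z = tcons (mul (basis i) (genB s)) (basis ((0, sg s * int n) # r))"
      by (simp add: n del: tcons_basis rmul_basis)
    then show ?thesis
      unfolding 1 sh by (simp add: h0_tcons_sg lmul_lin rmul_lin pure_lin n del: of_nat_Suc tcons_basis)
  next
    case False
    then obtain n where n: "j = sg (\<not> s) * int (Suc n)"
      by (cases s) (auto intro!: that[of "nat \<bar>j\<bar> - 1"])
    have j: "j + sg s = sg (\<not> s) * int n" using n by (cases s) auto
    have pos: "sg (\<not> s) * j > 0" using n by (cases s) auto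
    have "j - sg (\<not> s) = sg (\<not> s) * int n" using n by (cases s) auto
    with pos have sh: "shift (\<not> s) ?z = tcons (basis i) (basis ((0, sg (\<not> s) * int n) # r))"
      by (simp del: tcons_basis)
    have "lmul (genB (\<not> s)) (shift (\<not> s) ?z) = ?z"
    proof -
      have "sg (\<not> s) * (sg (\<not> s) * int n) \<ge> 0" by (cases s) auto
      moreover have "sg (\<not> s) * int n + sg (\<not> s) = j" using n by (cases s) auto
      ultimately show ?thesis unfolding sh using lmul_genB_same by metis
    qed
    then have 2: "pure Q (lmul (genB (\<not> s)) (shift (\<not> s) ?z)) = ?z"
      by (simp only: pure_id[OF pwords_tcons[OF refl]])
    have 1: "pure 1 (lmul (genB s) ?z) = tcons (mul (mul (basis i) (genB s)) (genB (\<not> s))) (basis ((0, sg (\<not> s) * int n) # r))"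
      using pure_lmul_genB_opposite1[of s j "basis i" r] False j by simp
    have 3: "rmul (genB s) ?z = tcons (mul (basis i) (genB s)) (basis ((0, sg (\<not> s) * int (Suc n)) # r))"
      by (simp only: n rmul_tcons)
    show ?thesis
      unfolding 1 2 3 unfolding sh h0_tcons_sg
      by (cases "s' = s") (auto simp del: tcons_basis)
  qed
qed (intro klin_intros)+

lemma pure_exact_1:
  assumes a: "\<And>s. a s \<in> pwords k" and cyc: "pure 1 (dd 1 a True + dd 1 a False) = 0"
  shows "a s = pure Q (dd 2 (hh 1 a) s)"
proof -
  have w: "a s \<in> words (Suc (Suc k))" for s using a pwords_words by blast
  have p: "pure R (rmul v (shift u (a s))) = rmul v (shift u (a s))" for R v u s
    by (rule pure_id[OF rmul_pwords[OF shift_pwords[OF a]]])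
  have p': "pure R (rmul v (a s)) = rmul v (a s)" for R v s by (rule pure_id[OF rmul_pwords[OF a]])
  have e: "pure 1 (dd 1 a True + dd 1 a False) =
      (rmul (genB s) (a s) - pure 1 (lmul (genB s) (a s)))
      + (rmul (genB (\<not> s)) (a (\<not> s)) - pure 1 (lmul (genB (\<not> s)) (a (\<not> s))))"
    by (cases s) (simp_all add: dd_def lastB_def pure_lin p')
  have "(h0 s (rmul (genB s) (a s)) - h0 s (pure 1 (lmul (genB s) (a s))))
      + (h0 s (rmul (genB (\<not> s)) (a (\<not> s))) - h0 s (pure 1 (lmul (genB (\<not> s)) (a (\<not> s))))) = 0"
    using arg_cong[OF e, of "h0 s"] unfolding cyc by (simp add: h0_lin)
  then have "a s = pure Q (lmul (genB (\<not> s)) (shift (\<not> s) (a s))) + rmul (genB (\<not> s)) (shift s (a (\<not> s)))"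
    unfolding h0_homotopy[OF a[of s], of s s Q] h0_homotopy[OF a[of "\<not> s"], of s "\<not> s" Q] by (simp add: algebra_simps)
  moreover have "pure Q (dd 2 (hh 1 a) s) =
      rmul (genB (\<not> s)) (shift s (a (\<not> s))) + pure Q (lmul (genB (\<not> s)) (shift (\<not> s) (a s)))"
    by (simp add: dd_def hh_def lastB_def pure_lin p flip: numeral_2_eq_2)
  ultimately show ?thesis by (metis add.commute)
qed

lemma pure_exact_0:
  assumes z: "z \<in> pwords k"
  shows "(\<Sum>s\<in>UNIV. rmul (genB s) (h0 s z) - pure 1 (lmul (genB s) (h0 s z))) = z - insert_one (face0 z)"
proof -
  let ?T = "\<lambda>f. \<Sum>s\<in>UNIV. rmul (genB s) (f s) - pure 1 (lmul (genB s) (f s))"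
  have T: "?T (\<lambda>s. h0_rec t n r s u) = tcons u (basis ((0, sg t * int n) # r))
      - tcons (mul u (basis (0, sg t * int n))) (basis ((0, 0) # r))" for t n r u
  proof (induction n arbitrary: u)
    case 0
    then show ?case by (simp add: rmul_lin lmul_lin pure_lin UNIV_bool)
  next
    case (Suc n)
    let ?y = "tcons u (basis ((0, sg t * int n) # r))"
    have "sg t * (sg t * int n) \<ge> 0" by (cases t) auto
    from lmul_genB_same[OF this, of u r]
    have l: "pure 1 (lmul (genB t) ?y) = tcons u (basis ((0, sg t * int (Suc n)) # r))"
      by (simp only: pure_id[OF pwords_tcons[OF refl]]) (simp add: algebra_simps)
    have m: "mul (mul u (genB t)) (basis (0, sg t * int n)) = mul u (basis (0, sg t * int (Suc n)))"
    proof -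
      have "mul (genB t) (basis (0, sg t * int n)) = basis (0, sg t * int n + sg t)"
        by (cases t) (simp_all add: mul_genB opB_basis opBs_basis)
      moreover have "sg t * int n + sg t = sg t * int (Suc n)" by (simp add: algebra_simps)
      ultimately show ?thesis by (simp only: mul_assoc)
    qed
    have "?T (\<lambda>s. h0_rec t (Suc n) r s u) = ?T (\<lambda>s. h0_rec t n r s (mul u (genB t)))
       - (rmul (genB t) ?y - pure 1 (lmul (genB t) ?y))"
      by (cases t) (simp_all add: UNIV_bool rmul_lin lmul_lin pure_lin)
    also have "\<dots> = tcons u (basis ((0, sg t * int (Suc n)) # r))
      - tcons (mul u (basis (0, sg t * int (Suc n)))) (basis ((0, 0) # r))"
      unfolding Suc l m by (simp del: of_nat_Suc)
    finally show ?case .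
  qed
  show ?thesis
    using z
  proof (rule pwords_ext)
    fix i :: "nat \<times> int" and j and r :: "(nat \<times> int) list"
    let ?z = "tcons (basis i) (basis ((0, j) # r))"
    have j: "j = sg (j \<ge> 0) * int (nat \<bar>j\<bar>)" by (simp add: sg_def)
    have "face0 ?z = tcons (mul (basis i) (basis (0, j))) (basis r)" by (rule face0_basis_Cons)
    then have "insert_one (face0 ?z) = tcons (mul (basis i) (basis (0, j))) (basis ((0, 0) # r))"
      by (simp del: tcons_basis add: tcons_basis[of "(0,0)" r])
    then show "?T (\<lambda>s. h0 s ?z) = ?z - insert_one (face0 ?z)"
      using T[of "j \<ge> 0" "nat \<bar>j\<bar>" r "basis i"] j by (simp add: h0_tcons del: tcons_basis)
  qed (intro klin_intros)+
qed

text \<open>A boundary removes \<open>A\<close> from the right factors of the word part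
  \<open>fst x\<close>. The remainder is exact modulo the image of \<open>del\<close> by
  \<open>pure_exact\<close>, and a second boundary clears it together with the error. A cycle with
  zero word part vanishes since \<open>delQ\<close> has the left inverse \<open>sec\<close>.\<close>

lemma F_exact:
  assumes x: "x \<in> F (Suc m) (Suc (Suc k))" and Dx: "D m x = fzero"
  shows "\<exists>y\<in>F (Suc (Suc m)) (Suc (Suc k)). x = D (Suc m) y"
proof -
  define n where "n = Suc m"
  define a1 :: "'k tagged" where "a1 = (\<lambda>s. sec (wq n s) (fst x s))"
  define x1 where "x1 = fdiff x (D n (\<lambda>s. 0, a1))"
  define a0 :: "'k tagged" where "a0 = (\<lambda>s. pure (wq n s) (fst x s))"
  have w: "fst x s \<in> words (Suc (Suc k))" for s using x by (auto simp: F_def)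
  have y1: "(\<lambda>s. 0, a1) \<in> F (Suc n) (Suc (Suc k))" by (auto simp: F_def a1_def n_def intro: sec_words w)
  have x1F: "x1 \<in> F n (Suc (Suc k))" unfolding x1_def using x y1 by (auto simp: n_def intro: fdiff_F D_F)
  have fst_D: "fst (D n (f, g)) s = dd (Suc n) f s + del n g s" for f g s
    by (simp add: D_def n_def col_def)
  have dd0: "dd p (\<lambda>s. 0) s = 0" for p s by (simp add: dd_def rmul_lin lmul_lin)
  have del0: "del p (\<lambda>s. 0) s = 0" for p s by (simp add: del_def rmul_lin lmul_lin)
  have fst_x1: "fst x1 = a0"
    by (rule ext) (simp add: x1_def fdiff_def fst_D dd0 del_delQ a1_def a0_def delQ_sec[OF w])
  have Dx1: "D m x1 = fzero"
    using D_D[OF y1[unfolded n_def]] Dx by (simp add: x1_def D_fdiff n_def) (simp add: fdiff_def fzero_def)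
  have a0: "a0 s \<in> pwords k" for s unfolding a0_def by (rule pure_pwords[OF w])
  have w1: "snd x1 s \<in> words (Suc (Suc k))" for s using x1F by (auto simp: F_def)
  have ex: "a0 s = pure (wq n s) (dd (Suc n) (hh n a0) s)" for s
  proof (cases m)
    case 0
    have "snd x1 False = 0" using x1F 0 by (simp add: F_def n_def)
    then have "dd 1 a0 True + dd 1 a0 False + delQ 1 (snd x1 True) = 0"
      using arg_cong[OF Dx1, of "\<lambda>x. fst x True"] fst_x1 0
      by (simp add: D_def col_def fzero_def del_delQ wq_def delQ_lin algebra_simps)
    then have "pure 1 (dd 1 a0 True + dd 1 a0 False + delQ 1 (snd x1 True)) = 0" by (simp only: pure_lin)
    then have "pure 1 (dd 1 a0 True + dd 1 a0 False) = 0"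
      using pure_delQ[OF w1] by (simp add: pure_lin)
    from pure_exact_1[OF a0 this] 0 show ?thesis by (simp add: n_def numeral_2_eq_2)
  next
    case (Suc p)
    have "dd n a0 s + delQ (wq m s) (snd x1 s) = 0" for s
      using arg_cong[OF Dx1, of "\<lambda>x. fst x s"] fst_x1 Suc
      by (simp add: D_def col_def fzero_def del_delQ n_def)
    then have "pure (wq m s) (dd n a0 s + delQ (wq m s) (snd x1 s)) = 0" for s by (simp only: pure_lin)
    then have "pure (wq m s) (dd n a0 s) = 0" for s
      using pure_delQ[OF w1] by (simp add: pure_lin)
    from pure_exact[OF a0 this] show ?thesis .
  qed
  define a' :: "'k tagged" where "a' = dd (Suc n) (hh n a0)"
  have hw: "hh n a0 s \<in> words (Suc (Suc k))" for s
    unfolding hh_def using a0 by (intro words_scale pwords_words shift_pwords)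
  then have a'w: "a' s \<in> words (Suc (Suc k))" for s unfolding a'_def by (rule dd_words)
  \<comment> \<open>Compensates the difference between \<open>a'\<close> and its projection, which
    lies in the image of \<open>delQ\<close>.\<close>
  define a2 :: "'k tagged" where "a2 = (\<lambda>s. - sec (wq n s) (a' s))"
  have y2: "(hh n a0, a2) \<in> F (Suc n) (Suc (Suc k))"
    by (auto simp: F_def a2_def n_def hw[unfolded n_def] intro!: words_minus sec_words a'w)
  define x2 where "x2 = fdiff x1 (D n (hh n a0, a2))"
  have x2F: "x2 \<in> F n (Suc (Suc k))" unfolding x2_def using x1F y2 by (auto simp: n_def intro: fdiff_F D_F)
  have "dd (Suc n) (hh n a0) s + del n a2 s = a0 s" for s
    using ex[of s] delQ_sec[OF a'w, of "wq n s" s]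
    by (simp add: del_delQ a2_def delQ_lin) (simp add: a'_def)
  then have fst_x2: "fst x2 = (\<lambda>s. 0)"
    by (auto simp: x2_def fdiff_def fst_D fst_x1)
  have Dx2: "D m x2 = fzero"
    using D_D[OF y2[unfolded n_def]] Dx1 by (simp add: x2_def D_fdiff n_def) (simp add: fdiff_def fzero_def)
  have w2: "snd x2 s \<in> words (Suc (Suc k))" for s using x2F by (auto simp: F_def)
  have "snd x2 s = 0" for s
  proof (cases m)
    case 0
    have "snd x2 False = 0" using x2F 0 by (simp add: F_def n_def)
    moreover from this have "delQ 1 (snd x2 True) = 0"
      using arg_cong[OF Dx2, of "\<lambda>x. fst x True"] fst_x2 0
      by (simp add: D_def col_def fzero_def del_delQ wq_def dd0 delQ_lin)
    then have "snd x2 True = 0" using sec_delQ[OF w2, of 1 True] by (simp add: sec_lin)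
    ultimately show ?thesis by (cases s) auto
  next
    case (Suc p)
    then have "delQ (wq m s) (snd x2 s) = 0"
      using arg_cong[OF Dx2, of "\<lambda>x. fst x s"] fst_x2
      by (simp add: D_def col_def fzero_def del_delQ dd0)
    then show ?thesis using sec_delQ[OF w2, of "wq m s" s] by (simp add: sec_lin)
  qed
  then have "x2 = fzero" using fst_x2 by (simp add: prod_eq_iff fzero_def fun_eq_iff)
  then have "x = D n (fadd (\<lambda>s. 0, a1) (hh n a0, a2))"
    unfolding D_fadd using x2_def x1_def
    by (auto simp: fdiff_def fadd_def fzero_def prod_eq_iff fun_eq_iff algebra_simps)
  moreover have "fadd (\<lambda>s. 0, a1) (hh n a0, a2) \<in> F (Suc n) (Suc (Suc k))" using y1 y2 by (rule fadd_F)
  ultimately show ?thesis unfolding n_def by blast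
qed

text \<open>An element of the kernel of the product splits into a part in the image of
  \<open>delQ 1\<close>, on which \<open>face0\<close> vanishes, and a remainder whose letters are
  carried across the generator by \<open>h0\<close>.\<close>

lemma F_exact_0:
  assumes x: "x \<in> F 0 (Suc (Suc k))" and face: "face0 (fst x True) = 0"
  shows "\<exists>y\<in>F (Suc 0) (Suc (Suc k)). x = D 0 y"
proof -
  define z where "z = fst x True"
  have z: "z \<in> words (Suc (Suc k))" using x by (auto simp: F_def z_def)
  define z0 where "z0 = pure 1 z"
  have z0: "z0 \<in> pwords k" unfolding z0_def by (rule pure_pwords[OF z])
  have zs: "z = z0 + delQ 1 (sec 1 z)" using delQ_sec[OF z, of 1] by (simp add: z0_def)
  have "face0 z0 = 0"
    using face face0_delQ[OF sec_words[OF z, of 1]] arg_cong[OF zs, of face0] by (simp add: z_def face0_lin)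
  then have e: "(\<Sum>s\<in>UNIV. rmul (genB s) (h0 s z0) - pure 1 (lmul (genB s) (h0 s z0))) = z0"
    using pure_exact_0[OF z0] by (simp add: insert_one_lin)
  define a :: "'k tagged" where "a = (\<lambda>s. h0 s z0)"
  have ap: "a s \<in> pwords k" for s unfolding a_def by (rule h0_pwords[OF z0])
  have aw: "a s \<in> words (Suc (Suc k))" for s using ap pwords_words by blast
  define g where "g = dd 1 a True + dd 1 a False"
  have g: "g \<in> words (Suc (Suc k))" unfolding g_def by (intro words_add dd_words aw)
  have "pure 1 g = (\<Sum>s\<in>UNIV. rmul (genB s) (a s) - pure 1 (lmul (genB s) (a s)))"
    using pure_id[OF rmul_pwords[OF ap]]
    by (simp add: g_def dd_def lastB_def pure_lin UNIV_bool algebra_simps)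
  then have "pure 1 g = z0" by (simp only: a_def e)
  then have gs: "delQ 1 (sec 1 g) = g - z0" using delQ_sec[OF g, of 1] by simp
  define b :: "'k tagged" where "b = (\<lambda>s. if s then sec 1 z - sec 1 g else 0)"
  have y: "(a, b) \<in> F (Suc 0) (Suc (Suc k))"
    by (auto simp: F_def aw b_def intro!: words_diff sec_words z g)
  have "fst (D 0 (a, b)) True = g + delQ 1 (sec 1 z - sec 1 g)"
    by (simp add: D_def col_def del_delQ wq_def b_def delQ_lin g_def)
  also have "\<dots> = z" by (simp add: delQ_lin gs) (metis add.commute zs)
  finally have "fst (D 0 (a, b)) True = fst x True" by (simp add: z_def)
  moreover have "fst (D 0 (a, b)) False = fst x False" using x by (simp add: D_def col_def F_def)
  moreover have "snd (D 0 (a, b)) = snd x" using x by (simp add: D_def F_def)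
  ultimately have "x = D 0 (a, b)" by (auto simp: prod_eq_iff fun_eq_iff all_bool_eq)
  then show ?thesis using y by blast
qed

end

section \<open>The small complex\<close>

definition psc :: "'k::field_char_0 \<Rightarrow> 'k poly \<Rightarrow> 'k poly" where
  "psc a f = pcompose f [:0, a:]"

lemma psc_pCons: "psc a (pCons b f) = pCons b (smult a (psc a f))"
  by (simp add: psc_def pcompose_pCons)

lemma coeff_psc: "coeff (psc a f) i = a ^ i * coeff f i"
proof (induction f arbitrary: i)
  case (pCons b f)
  then show ?case by (cases i) (auto simp: psc_pCons)
qed (simp add: psc_def)

lemma psc_add: "psc a (f + g) = psc a f + psc a g" and psc_diff: "psc a (f - g) = psc a f - psc a g"
  and psc_mult: "psc a (f * g) = psc a f * psc a g" and psc_smult: "psc a (smult b f) = smult b (psc a f)"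
  and psc_zero [simp]: "psc a 0 = 0" and psc_minus: "psc a (- f) = - psc a f"
  by (simp_all add: psc_def pcompose_add pcompose_diff pcompose_mult pcompose_smult pcompose_uminus)

lemma psc_psc: "psc a (psc b f) = psc (a * b) f"
  by (rule poly_eqI) (simp add: coeff_psc power_mult_distrib)

lemma psc_one [simp]: "psc 1 f = f"
  by (rule poly_eqI) (simp add: coeff_psc)

lemmas psc_simps = psc_add psc_diff psc_mult psc_smult psc_minus psc_psc

text \<open>Dilation is diagonal on monomials, so \<open>f - L f(Q X)\<close> has eigenvalues
  \<open>1 - L Q\<^sup>i\<close>; if none vanishes, the operator is bijective and can be inverted
  without raising the degree.\<close>

lemma one_minus_psc_injective:
  assumes "\<And>i. L * Q ^ i \<noteq> 1" "u = smult L (psc Q u)"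
  shows "u = (0 :: 'k::field_char_0 poly)"
proof (rule poly_eqI)
  fix i
  have "coeff u i = L * Q ^ i * coeff u i"
    using arg_cong[OF assms(2), of "\<lambda>p. coeff p i"] by (simp add: coeff_psc mult.assoc)
  then show "coeff u i = coeff 0 i" using assms(1)[of i] by simp
qed

lemma one_minus_psc_surjective:
  assumes "\<And>i. L * Q ^ i \<noteq> 1"
  shows "\<exists>u. u - smult L (psc Q u) = (f :: 'k::field_char_0 poly) \<and> degree u \<le> degree f"
proof -
  define u where "u = (\<Sum>i\<le>degree f. monom (coeff f i / (1 - L * Q ^ i)) i)"
  have c: "coeff u i = coeff f i / (1 - L * Q ^ i)" for i
    by (auto simp: u_def coeff_sum coeff_eq_0 if_distrib cong: if_cong)
  have "coeff (u - smult L (psc Q u)) i = coeff f i" for i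
  proof -
    have "coeff (u - smult L (psc Q u)) i = (1 - L * Q ^ i) * coeff u i"
      by (simp add: coeff_psc algebra_simps)
    then show ?thesis using assms[of i] by (simp add: c)
  qed
  then have "u - smult L (psc Q u) = f" by (intro poly_eqI)
  moreover have "degree u \<le> degree f" unfolding u_def by (intro degree_sum_le) (auto intro: order_trans[OF degree_monom_le])
  ultimately show ?thesis by blast
qed

context podles_algebra
begin

text \<open>Equals \<open>(c - Q A) (d + Q A)\<close>, which is \<open>B\<^sup>* B\<close> for
  \<open>Q = 1\<close> and \<open>B B\<^sup>*\<close> for \<open>Q = q\<^sup>2\<close>.\<close>

definition pQ :: "'k \<Rightarrow> 'k poly" where "pQ Q = [:c * d, (c - d) * Q, - (Q^2):]"

lemma psc_pQ: "psc a (pQ Q) = pQ (a * Q)"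
  by (simp add: pQ_def psc_pCons power2_eq_square mult_ac)

text \<open>Coordinates on one-letter words, that is on the algebra: the polynomial \<open>f\<close>
  in the summand \<open>f(A) B\<^sup>j\<close>, where negative \<open>j\<close> stands for powers of
  \<open>B\<^sup>*\<close>.\<close>

definition wcw :: "((nat \<times> int) list \<Rightarrow>\<^sub>0 'k) \<Rightarrow> int \<Rightarrow> 'k poly" where
  "wcw x j = (\<Sum>w\<in>Poly_Mapping.keys x. if length w = 1 \<and> snd (hd w) = j then monom (Poly_Mapping.lookup x w) (fst (hd w)) else 0)"

lemma coeff_wcw: "coeff (wcw x j) i = Poly_Mapping.lookup x [(i, j)]"
proof -
  have "coeff (wcw x j) i = (\<Sum>w\<in>Poly_Mapping.keys x. if w = [(i, j)] then Poly_Mapping.lookup x w else 0)"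
    unfolding wcw_def coeff_sum
  proof (intro sum.cong refl)
    fix w
    show "coeff (if length w = 1 \<and> snd (hd w) = j then monom (Poly_Mapping.lookup x w) (fst (hd w)) else 0) i =
        (if w = [(i, j)] then Poly_Mapping.lookup x w else 0)"
      by (cases w; cases "tl w") auto
  qed
  then show ?thesis by (simp add: in_keys_iff)
qed

lemma wcw_add: "wcw (x + y) j = wcw x j + wcw y j" and wcw_diff: "wcw (x - y) j = wcw x j - wcw y j"
  and wcw_fscale: "wcw (fscale a x) j = smult a (wcw x j)" and wcw_zero [simp]: "wcw 0 j = 0"
  and wcw_minus: "wcw (- x) j = - wcw x j"
  by (auto intro!: poly_eqI simp: coeff_wcw lookup_add lookup_minus)

lemma wcw_basis: "wcw (basis [(i, j')]) j = (if j = j' then monom 1 i else 0)"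
  by (auto intro!: poly_eqI simp: coeff_wcw lookup_single when_def)

lemma words1_eqI:
  assumes "x \<in> words (Suc 0)" "y \<in> words (Suc 0)" "\<And>j. wcw x j = wcw y j"
  shows "x = y"
proof (rule poly_mapping_eqI)
  fix w
  show "Poly_Mapping.lookup x w = Poly_Mapping.lookup y w"
  proof (cases "length w = 1")
    case True
    then obtain i j where "w = [(i, j)]" by (auto simp: length_Suc_conv)
    then show ?thesis using coeff_wcw[of x j i] coeff_wcw[of y j i] assms(3)[of j] by simp
  next
    case False
    then have "w \<notin> Poly_Mapping.keys x" "w \<notin> Poly_Mapping.keys y"
      using assms(1,2) by (auto simp: words_def supported_def)
    then show ?thesis by (simp add: in_keys_iff)
  qed
qed

lemma words1_induct [consumes 1, case_names lin zero basis]: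
  assumes "x \<in> words (Suc 0)" "\<And>a u v. P u \<Longrightarrow> P v \<Longrightarrow> P (fscale a u + v)" "P 0" "\<And>i j. P (basis [(i, j)])"
  shows "P x"
  using assms(1) unfolding words_def
proof (induction rule: supported_induct)
  case (add u v)
  then show ?case using assms(2)[of u v 1] by simp
next
  case (scale a v)
  then show ?case using assms(2)[of v 0 a] assms(3) by simp
next
  case (basis w)
  then show ?case using assms(4) by (auto simp: length_Suc_conv)
qed (fact assms(3))

lemma mul_basis: "mul (basis (i, j)) v = (opA ^^ i) (bop j v)"
  by (simp add: mul_def rep_lift_basis)

lemma opA_pow_fscale: "(opA ^^ i) (fscale a v) = fscale a ((opA ^^ i) v)"
  and opA_pow_add: "(opA ^^ i) (u + v) = (opA ^^ i) u + (opA ^^ i) v"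
  and opA_pow_diff: "(opA ^^ i) (u - v) = (opA ^^ i) u - (opA ^^ i) v"
  by (induction i) (simp_all add: op_lin)

lemma klin_bop: "klin (bop j)"
  unfolding bop_def by (auto intro: klin_funpow klin_opB[OF klin_id] klin_opBs[OF klin_id])

lemma wcw_rmul_genA:
  "x \<in> words (Suc 0) \<Longrightarrow> wcw (rmul genA x) j = smult (q powi (2 * j)) (pCons 0 (wcw x j))"
proof (induction rule: words1_induct)
  case (lin a u v)
  then show ?case by (simp add: rmul_lin wcw_add wcw_fscale smult_add_right mult.commute)
next
  case (basis i j')
  have "mul (basis (i, j')) genA = fscale (q powi (2 * j')) (basis (Suc i, j'))"
    by (simp add: mul_basis genA_def bop_basis[of j' 1, simplified] opA_pow_fscale opA_pow)
  then have "rmul genA (basis [(i, j')]) = fscale (q powi (2 * j')) (basis [(Suc i, j')])"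
    by (simp add: tcons_simps)
  then show ?case by (simp add: wcw_fscale wcw_basis monom_Suc)
qed (simp add: rmul_lin)

lemma wcw_lmul_genA:
  "x \<in> words (Suc 0) \<Longrightarrow> wcw (lmul genA x) j = smult eps (pCons 0 (wcw x j))"
proof (induction rule: words1_induct)
  case (lin a u v)
  then show ?case by (simp add: lmul_lin wcw_add wcw_fscale smult_add_right mult.commute)
next
  case (basis i j')
  have "diag chi genA = fscale eps genA" by (simp add: genA_def chi_def)
  then have "lmul genA (basis [(i, j')]) = fscale eps (basis [(Suc i, j')])"
    by (simp add: tcons_simps mul_simps mul_genA)
  then show ?case by (simp add: wcw_fscale wcw_basis monom_Suc)
qed (simp add: lmul_lin)

text \<open>The factor produced when \<open>B\<^sup>j\<close> absorbs one more letter on the right.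
  If that letter cancels, the resulting polynomial is moved to the left past the remaining power,
  which dilates its variable; \<open>mu\<close> is the same on the left, where the polynomial
  crosses nothing.\<close>

definition rho :: "bool \<Rightarrow> int \<Rightarrow> 'k poly" where
  "rho t j = (if sg t * j \<ge> 0 then 1 else pQ (q powi (if t then 2 * (j + 1) else 2 * j)))"

definition mu :: "bool \<Rightarrow> int \<Rightarrow> 'k poly" where
  "mu t j = (if sg t * j \<ge> 0 then 1 else pQ (if t then q^2 else 1))"

definition lp :: "bool \<Rightarrow> 'k" where "lp t = (if t then l else inverse l)"

lemma bop_neg_Suc: "j < 0 \<Longrightarrow> bop j v = bop (j + 1) (opBs v)"
proof -
  assume j: "j < 0"
  then have "nat (- j) = Suc (nat (- (j + 1)))" by simp
  then show ?thesis using j by (cases "j = -1") (simp_all add: bop_def funpow_swap1)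
qed

lemma bop_pos_Suc: "j > 0 \<Longrightarrow> bop j v = bop (j - 1) (opB v)"
proof -
  assume j: "j > 0"
  then have "nat j = Suc (nat (j - 1))" by simp
  then show ?thesis using j by (simp add: bop_def funpow_swap1)
qed

lemma bop_same: "sg t * j \<ge> 0 \<Longrightarrow> bop j (genB t) = basis (0, j + sg t)"
proof (cases "j = 0")
  case False
  assume "sg t * j \<ge> 0"
  then have "bop (j + sg t) unit = bop j (genB t)"
    using False bop_pos_Suc[of "j + 1" unit] bop_neg_Suc[of "j - 1" unit]
    by (cases t) (simp_all add: genB_def opB_basis opBs_basis)
  then show ?thesis using bop_basis[of "j + sg t" 0] by simp
qed (simp add: bop_def genB_def)

lemma wcw_rmul_genB:
  "x \<in> words (Suc 0) \<Longrightarrow> wcw (rmul (genB t) x) j = wcw x (j - sg t) * rho t (j - sg t)"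
proof (induction rule: words1_induct)
  case (lin a u v)
  then show ?case by (simp add: rmul_lin wcw_add wcw_fscale algebra_simps)
next
  case (basis i j')
  note B = klin_add[OF klin_bop] klin_diff[OF klin_bop] klin_scale[OF klin_bop]
  show ?case
  proof (cases "sg t * j' \<ge> 0")
    case True
    then have "mul (basis (i, j')) (genB t) = basis (i, j' + sg t)"
      by (simp add: mul_basis bop_same opA_pow)
    then have "rmul (genB t) (basis [(i, j')]) = basis [(i, j' + sg t)]" by simp
    then show ?thesis using True by (auto simp: wcw_basis rho_def)
  next
    case False
    define Q where "Q = q powi (if t then 2 * (j' + 1) else 2 * j')"
    have "bop j' (genB t) = fscale (c * d) (basis (0, j' + sg t)) + fscale ((c - d) * Q) (basis (1, j' + sg t))
        - fscale (Q^2) (basis (2, j' + sg t))"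
    proof (cases t)
      case True
      have "bop j' (genB t) = bop (j' + 1) (fscale (c * d) (basis (0, 0)) + fscale (c - d) (basis (1, 0)) - basis (2, 0))"
        using False True by (subst bop_neg_Suc) (simp_all add: genB_def opBs_basis numeral_2_eq_2)
      moreover have "q powi (2 * 2 * (j' + 1)) = Q^2"
        using True power_int_mult[of q "2 * (j' + 1)" 2] by (simp add: Q_def mult.commute mult.left_commute)
      ultimately show ?thesis using True bop_basis[of "j' + 1" 0] bop_basis[of "j' + 1" 1] bop_basis[of "j' + 1" 2]
        by (simp add: B Q_def)
    next
      case f: False
      have "bop j' (genB t) = bop (j' - 1) (fscale (c * d) (basis (0, 0)) + fscale (q^2 * (c - d)) (basis (1, 0)) - fscale (q^4) (basis (2, 0)))"
        using False f by (subst bop_pos_Suc) (simp_all add: genB_def opB_basis numeral_2_eq_2)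
      moreover have "q^2 * q powi (2 * (j' - 1)) = Q"
        using f power_int_add[of q 2 "2 * (j' - 1)"] by (simp add: Q_def)
      moreover have "q^4 * q powi (2 * 2 * (j' - 1)) = Q^2"
        using f power_int_add[of q 4 "2 * 2 * (j' - 1)"] power_int_mult[of q "2 * j'" 2]
        by (simp add: Q_def algebra_simps)
      ultimately show ?thesis using f bop_basis[of "j' - 1" 0] bop_basis[of "j' - 1" 1] bop_basis[of "j' - 1" 2]
        by (simp add: B mult.assoc)
    qed
    then have "rmul (genB t) (basis [(i, j')]) = fscale (c * d) (basis [(i, j' + sg t)])
        + fscale ((c - d) * Q) (basis [(i + 1, j' + sg t)]) - fscale (Q^2) (basis [(i + 2, j' + sg t)])"
      by (simp add: mul_basis opA_pow_add opA_pow_diff opA_pow_fscale opA_pow tcons_simps)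
    then have "wcw (rmul (genB t) (basis [(i, j')])) j =
        (if j = j' + sg t then smult (c * d) (monom 1 i) + smult ((c - d) * Q) (monom 1 (i + 1)) - smult (Q^2) (monom 1 (i + 2)) else 0)"
      by (simp add: wcw_add wcw_diff wcw_fscale wcw_basis)
    moreover have "monom 1 i * pQ Q = smult (c * d) (monom 1 i) + smult ((c - d) * Q) (monom 1 (i + 1)) - smult (Q^2) (monom 1 (i + 2))"
      by (induction i) (simp_all add: pQ_def monom_Suc monom_0)
    ultimately show ?thesis using False by (auto simp: wcw_basis rho_def Q_def)
  qed
qed (simp add: rmul_lin)

lemma wcw_lmul_genB:
  "x \<in> words (Suc 0) \<Longrightarrow>
    wcw (lmul (genB t) x) j = smult (lp t) (psc (qs t) (wcw x (j - sg t)) * mu t (j - sg t))"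
proof (induction rule: words1_induct)
  case (lin a u v)
  then show ?case by (simp add: lmul_lin wcw_add wcw_fscale psc_simps smult_add_right algebra_simps)
next
  case (basis i j')
  have D: "diag chi (genB t) = fscale (lp t) (genB t)" for t
    by (cases t) (simp_all add: genB_def chi_def lp_def)
  have psc_monom: "psc (qs t) (monom 1 i) = smult (qs t ^ i) (monom 1 i)"
    by (rule poly_eqI) (simp add: coeff_psc)
  have qi: "qs t ^ i = (if t then q ^ (2 * i) else inverse (q ^ (2 * i)))" for t
    by (simp add: qs_def power_mult power_inverse)
  show ?case
  proof (cases "sg t * j' \<ge> 0")
    case True
    then have "lmul (genB t) (basis [(i, j')]) = fscale (lp t * qs t ^ i) (basis [(i, j' + sg t)])"
      by (cases t) (simp_all add: D mul_simps mul_genB opB_basis opBs_basis tcons_simps qi)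
    then show ?thesis using True by (auto simp: wcw_fscale wcw_basis mu_def psc_monom)
  next
    case False
    have "lmul (genB t) (basis [(i, j')]) = fscale (lp t * qs t ^ i) (fscale (c * d) (basis [(i, j' + sg t)])
       + fscale ((c - d) * (if t then q^2 else 1)) (basis [(i + 1, j' + sg t)]) - fscale ((if t then q^2 else 1)^2) (basis [(i + 2, j' + sg t)]))"
      using False by (cases t) (simp_all add: D mul_simps mul_genB opB_basis opBs_basis tcons_simps qi mult_ac
          fvs.scale_right_distrib fvs.scale_right_diff_distrib flip: power_mult)
    then have "wcw (lmul (genB t) (basis [(i, j')])) j = (if j = j' + sg t then
        smult (lp t * qs t ^ i) (smult (c * d) (monom 1 i) + smult ((c - d) * (if t then q^2 else 1)) (monom 1 (i + 1)) - smult ((if t then q^2 else 1)^2) (monom 1 (i + 2))) else 0)"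
      by (simp add: wcw_add wcw_diff wcw_fscale wcw_basis)
    moreover have "monom 1 i * pQ Q = smult (c * d) (monom 1 i) + smult ((c - d) * Q) (monom 1 (i + 1)) - smult (Q^2) (monom 1 (i + 2))" for Q
      by (induction i) (simp_all add: pQ_def monom_Suc monom_0)
    ultimately show ?thesis using False by (auto simp: wcw_basis mu_def psc_monom)
  qed
qed (simp add: lmul_lin)

text \<open>Degree in \<open>B\<close> of an alternating word. Counted together with the degree of
  its coefficient it is preserved by \<open>D\<close>, so the small complex splits.\<close>

definition wt :: "nat \<Rightarrow> bool \<Rightarrow> int" where "wt n s = (if odd n then sg s else 0)"

type_synonym 'c ppair = "(bool \<Rightarrow> 'c poly) \<times> (bool \<Rightarrow> 'c poly)"

definition pdd :: "nat \<Rightarrow> int \<Rightarrow> (bool \<Rightarrow> 'k poly) \<Rightarrow> (bool \<Rightarrow> 'k poly)" where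
  "pdd n w f s = f (\<not> s) * rho (\<not> s) (w - wt n (\<not> s))
     + smult ((-1) ^ n * lp (lastB n s)) (psc (qs (lastB n s)) (f s) * mu (lastB n s) (w - wt n s))"

text \<open>On one-letter words an \<open>A\<close> to the right of the generator wraps around to
  \<open>eps A\<close>, and one to the left crosses total degree \<open>w\<close>; the scalar is
  thus the same for all generators.\<close>

definition pdel :: "int \<Rightarrow> (bool \<Rightarrow> 'k poly) \<Rightarrow> (bool \<Rightarrow> 'k poly)" where
  "pdel w f s = smult (eps - q powi (2 * w)) (pCons 0 (f s))"

definition pdbar :: "nat \<Rightarrow> int \<Rightarrow> (bool \<Rightarrow> 'k poly) \<Rightarrow> (bool \<Rightarrow> 'k poly)" where
  "pdbar n w f s = f (\<not> s) * rho (\<not> s) (w - wt n (\<not> s))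
     + smult ((-1) ^ n * qs (lastB n s) * lp (lastB n s)) (psc (qs (lastB n s)) (f s) * mu (lastB n s) (w - wt n s))"

definition pkap :: "nat \<Rightarrow> int \<Rightarrow> (bool \<Rightarrow> 'k poly) \<Rightarrow> (bool \<Rightarrow> 'k poly)" where
  "pkap n w f s = smult (c1 (s = even n)) (f s) + smult (c2 (s = even n) * (q powi (2 * w) + eps)) (pCons 0 (f s))"

definition pcol :: "nat \<Rightarrow> (bool \<Rightarrow> 'k poly) \<Rightarrow> (bool \<Rightarrow> 'k poly)" where
  "pcol n f = (if n = 0 then (\<lambda>s. if s then f True + f False else 0) else f)"

definition PD :: "nat \<Rightarrow> int \<Rightarrow> 'k ppair \<Rightarrow> 'k ppair" where
  "PD m w x = (pcol m (\<lambda>s. pdd (Suc m) w (fst x) s + pdel w (snd x) s),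
     case m of 0 \<Rightarrow> (\<lambda>s. 0) | Suc p \<Rightarrow> pcol p (\<lambda>s. pkap (Suc m) w (fst x) s - pdbar m w (snd x) s))"

definition comp :: "nat \<Rightarrow> int \<Rightarrow> 'k tagged \<times> 'k tagged \<Rightarrow> 'k ppair" where
  "comp m w x = (\<lambda>s. wcw (fst x s) (w - wt m s), \<lambda>s. wcw (snd x s) (w - wt (m - 1) s))"

lemma wt_lastB: "w - wt n s - sg (lastB (Suc n) s) = w - wt (Suc n) s" "w - wt n s - sg (\<not> s) = w - wt (Suc n) (\<not> s)"
  by (cases s; simp add: wt_def lastB_def)+

lemma comp_dd:
  assumes "\<And>s. a s \<in> words (Suc 0)"
  shows "wcw (dd (Suc n) a s) (w - wt n s) = pdd (Suc n) w (\<lambda>s. wcw (a s) (w - wt (Suc n) s)) s"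
  by (simp only: dd_def pdd_def wcw_add wcw_fscale wcw_rmul_genB[OF assms] wcw_lmul_genB[OF assms] wt_lastB smult_smult)

lemma comp_dbar:
  assumes "\<And>s. a s \<in> words (Suc 0)"
  shows "wcw (dbar (Suc n) a s) (w - wt n s) = pdbar (Suc n) w (\<lambda>s. wcw (a s) (w - wt (Suc n) s)) s"
  by (simp only: dbar_def pdbar_def wcw_add wcw_fscale wcw_rmul_genB[OF assms] wcw_lmul_genB[OF assms] wt_lastB smult_smult)

lemma wq_shift: "wq n s * q powi (2 * (w - wt n s)) = q powi (2 * w)"
proof -
  have "wq n s = q powi (2 * wt n s)"
    by (auto simp: wq_def wt_def qs_def power_int_minus)
  then show ?thesis by (simp add: right_diff_distrib flip: power_int_add)
qed

lemma comp_del: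
  assumes "\<And>s. a s \<in> words (Suc 0)"
  shows "wcw (del n a s) (w - wt n s) = pdel w (\<lambda>s. wcw (a s) (w - wt n s)) s"
  by (simp add: del_def pdel_def wcw_diff wcw_fscale wcw_rmul_genA[OF assms] wcw_lmul_genA[OF assms] wq_shift[unfolded right_diff_distrib] smult_diff_left)

lemma comp_kap:
  assumes "\<And>s. a s \<in> words (Suc 0)"
  shows "wcw (kap n a s) (w - wt n s) = pkap n w (\<lambda>s. wcw (a s) (w - wt n s)) s"
  by (simp add: kap_def pkap_def wcw_add wcw_fscale wcw_rmul_genA[OF assms] wcw_lmul_genA[OF assms] wq_shift[unfolded right_diff_distrib] smult_add_left
      smult_add_right distrib_left)

lemma comp_col: "wcw (col n f s) (w - wt n s) = pcol n (\<lambda>s. wcw (f s) (w - wt n s)) s"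
  by (simp add: col_def pcol_def wt_def wcw_add)

lemma wt_Suc_Suc: "wt (Suc (Suc n)) s = wt n s"
  by (simp add: wt_def)

lemma comp_D:
  assumes "x \<in> F (Suc m) (Suc 0)"
  shows "comp m w (D m x) = PD m w (comp (Suc m) w x)"
proof -
  have a: "fst x s \<in> words (Suc 0)" and b: "snd x s \<in> words (Suc 0)" for s using assms by (auto simp: F_def)
  have "fst (comp m w (D m x)) s = fst (PD m w (comp (Suc m) w x)) s" for s
    by (simp only: comp_def D_def PD_def fst_conv snd_conv comp_col wcw_add comp_dd[OF a] comp_del[OF b] diff_Suc_1)
  moreover have "snd (comp m w (D m x)) s = snd (PD m w (comp (Suc m) w x)) s" for s
  proof (cases m)
    case (Suc p)
    have "wcw (kap (Suc m) (fst x) s) (w - wt p s) = pkap (Suc m) w (\<lambda>s. wcw (fst x s) (w - wt (Suc m) s)) s" for s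
      using comp_kap[of "fst x" "Suc m" s w] a by (simp add: Suc wt_Suc_Suc)
    then show ?thesis
      unfolding comp_def D_def PD_def Suc nat.case fst_conv snd_conv diff_Suc_1 comp_col
      by (simp only: wcw_diff comp_dbar[OF b])
  qed (simp add: comp_def D_def PD_def)
  ultimately show ?thesis by (auto simp: prod_eq_iff)
qed

end

text \<open>Serves both assertions: for \<open>eps = 1\<close> the condition \<open>l_one\<close> is
  the case \<open>m = 0\<close> of \<open>l_generic\<close>, and for \<open>eps = -1\<close> it is
  the hypothesis on \<open>\<tau>\<close>.\<close>

locale podles_generic = podles_algebra q c d eps l for q c d eps l :: "'k::field_char_0" +
  assumes q_root: "\<And>m::nat. m > 0 \<Longrightarrow> q ^ m \<noteq> 1" and cd: "c + d \<noteq> 0"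
    and l_generic: "eps = 1 \<Longrightarrow> l \<noteq> inverse (q ^ (2 * m))" and l_one: "l \<noteq> 1"
begin

text \<open>The constant term of \<open>rho\<close> and \<open>mu\<close>: at \<open>A = 0\<close>
  both \<open>B B\<^sup>*\<close> and \<open>B\<^sup>* B\<close> become \<open>c d\<close>. The
  resulting complex of scalars is given by \<open>kdd\<close>.\<close>

definition gam :: "bool \<Rightarrow> int \<Rightarrow> 'k" where
  "gam t j = (if sg t * j \<ge> 0 then 1 else c * d)"

definition kdd :: "nat \<Rightarrow> int \<Rightarrow> (bool \<Rightarrow> 'k) \<Rightarrow> bool \<Rightarrow> 'k" where
  "kdd n w f s = f (\<not> s) * gam (\<not> s) (w - wt n (\<not> s))
     + (-1) ^ n * lp (lastB n s) * f s * gam (lastB n s) (w - wt n s)"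

lemma coeff_pdd_const:
  "coeff (pdd n w (\<lambda>s. [:f s:]) s) 0 = kdd n w f s"
  by (simp add: pdd_def kdd_def rho_def mu_def gam_def coeff_mult_0 coeff_psc pQ_def)

text \<open>In total degree \<open>w \<noteq> 0\<close> one of the two letters multiplies by 1 and
  can be divided out; for \<open>w = 0\<close> the factor \<open>c d\<close> has to be inverted. In
  degree one only the sum over the tags is known to vanish, but it is \<open>1 - inverse l\<close>
  times the separate equation.\<close>

lemma kdd_exact:
  assumes cyc: "if n = 1 then kdd n w f True + kdd n w f False = 0 else (\<forall>s. kdd n w f s = 0)"
    and n: "n \<ge> 1" and w: "w = 0 \<longrightarrow> c * d \<noteq> 0"
  shows "\<exists>g. \<forall>s. kdd (Suc n) w g s = f s"
proof (cases "even n")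
  case True
  with n have n1: "n \<noteq> 1" by auto
  have e: "gam False w * f False + inverse l * gam False w * f True = 0"
    "gam True w * f True + l * gam True w * f False = 0"
    using cyc True n1 by (auto simp: kdd_def lastB_def lp_def wt_def all_bool_eq algebra_simps)
  have fT: "f True = - l * f False"
  proof (cases "w \<ge> 0")
    case True
    then show ?thesis using e(2) by (simp add: gam_def eq_neg_iff_add_eq_0)
  next
    case False
    then have "f False + inverse l * f True = 0" using e(1) by (simp add: gam_def)
    then show ?thesis by (simp add: field_simps eq_neg_iff_add_eq_0)
  qed
  have "\<exists>a b. gam False (w + 1) * b - l * gam True (w - 1) * a = f True
      \<and> gam True (w - 1) * a - inverse l * gam False (w + 1) * b = f False"
  proof -
    consider "w \<ge> 1" | "w \<le> -1" | "w = 0" by linarith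
    then show ?thesis
    proof cases
      case 1
      then show ?thesis by (intro exI[of _ "f False"] exI[of _ 0]) (simp add: gam_def fT)
    next
      case 2
      then show ?thesis by (intro exI[of _ 0] exI[of _ "- l * f False"]) (simp add: gam_def fT)
    next
      case 3
      then show ?thesis using w
        by (intro exI[of _ "f False / (c * d)"] exI[of _ 0]) (simp add: gam_def fT)
    qed
  qed
  then obtain a b where "gam False (w + 1) * b - l * gam True (w - 1) * a = f True"
      "gam True (w - 1) * a - inverse l * gam False (w + 1) * b = f False" by blast
  then show ?thesis using True
    by (intro exI[of _ "\<lambda>s. if s then a else b"])
      (auto simp: kdd_def lastB_def lp_def wt_def all_bool_eq algebra_simps)
next
  case False
  have cyc': "f False * gam False (w + 1) = l * f True * gam True (w - 1)"
  proof (cases "n = 1")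
    case True
    define u v where "u = f False * gam False (w + 1)" and "v = f True * gam True (w - 1)"
    have "(u - l * v) + (v - inverse l * u) = 0"
      using cyc True by (simp add: kdd_def lastB_def lp_def wt_def u_def v_def algebra_simps)
    moreover have "(u - l * v) + (v - inverse l * u) = (1 - inverse l) * (u - l * v)"
      by (simp add: algebra_simps)
    ultimately have "(1 - inverse l) * (u - l * v) = 0" by simp
    moreover have "1 - inverse l \<noteq> 0" using l_one by (metis inverse_1 inverse_inverse_eq right_minus_eq)
    ultimately show ?thesis by (simp add: u_def v_def mult.assoc)
  next
    case n1: False
    then have "kdd n w f True = 0" using cyc by simp
    then show ?thesis using False by (simp add: kdd_def lastB_def lp_def wt_def)
  qed
  have "\<exists>b. gam False w * b = f True \<and> l * gam True w * b = f False"
  proof -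
    consider "w \<ge> 1" | "w \<le> -1" | "w = 0" by linarith
    then show ?thesis
    proof cases
      case 1
      then show ?thesis using cyc'
        by (intro exI[of _ "f False / l"]) (simp add: gam_def field_simps)
    next
      case 2
      then show ?thesis using cyc' by (intro exI[of _ "f True"]) (simp add: gam_def mult_ac)
    next
      case 3
      then show ?thesis using cyc' w by (intro exI[of _ "f True"]) (simp add: gam_def)
    qed
  qed
  then obtain b where "gam False w * b = f True" "l * gam True w * b = f False" by blast
  then show ?thesis using False
    by (intro exI[of _ "\<lambda>s. if s then 0 else b"])
      (auto simp: kdd_def lastB_def lp_def wt_def all_bool_eq algebra_simps)
qed

definition padd :: "'k ppair \<Rightarrow> 'k ppair \<Rightarrow> 'k ppair" where
  "padd x y = (\<lambda>s. fst x s + fst y s, \<lambda>s. snd x s + snd y s)"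

definition pzero :: "'k ppair" where "pzero = (\<lambda>s. 0, \<lambda>s. 0)"

lemma PD_padd: "PD m w (padd x y) = padd (PD m w x) (PD m w y)"
  by (auto simp: PD_def padd_def fun_eq_iff pcol_def pdd_def pdel_def pkap_def pdbar_def psc_simps
      smult_add_right algebra_simps split: nat.split)

lemma pdd_zero [simp]: "pdd n w (\<lambda>s. 0) s = 0" and pdel_zero [simp]: "pdel w (\<lambda>s. 0) s = 0"
  and pkap_zero [simp]: "pkap n w (\<lambda>s. 0) s = 0" and pdbar_zero [simp]: "pdbar n w (\<lambda>s. 0) s = 0"
  by (simp_all add: pdd_def pdel_def pkap_def pdbar_def)

text \<open>In degrees \<open>0\<close> and \<open>1\<close> some of the generators are absent.\<close>

definition pvalid :: "nat \<Rightarrow> 'k ppair \<Rightarrow> bool" where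
  "pvalid m x \<longleftrightarrow> (m = 0 \<longrightarrow> fst x False = 0 \<and> snd x = (\<lambda>s. 0)) \<and> (m = 1 \<longrightarrow> snd x False = 0)"

lemma PD_pvalid: "pvalid m (PD m w x)"
  by (auto simp: pvalid_def PD_def pcol_def)

text \<open>Every pair of polynomials is the degree-\<open>w\<close> component of a chain of
  one-letter words, so the identity is inherited from \<open>D_D\<close>.\<close>

lemma PD_PD:
  "PD m w (PD (Suc m) w x) = pzero"
proof -
  have ex: "\<exists>y\<in>words (Suc 0). \<forall>j. wcw y j = (if j = i then p else 0)" for i p
  proof -
    define y where "y = (\<Sum>n\<le>degree p. fscale (coeff p n) (basis [(n, i)]))"
    have "Poly_Mapping.lookup y [(n, j)] = coeff (if j = i then p else 0) n" for n j
      by (auto simp: y_def lookup_sum lookup_single when_def if_distrib coeff_eq_0 cong: if_cong)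
    then have "wcw y j = (if j = i then p else 0)" for j
      by (intro poly_eqI) (simp add: coeff_wcw)
    moreover have "y \<in> words (Suc 0)" unfolding y_def by (intro words_sum words_scale) simp
    ultimately show ?thesis by blast
  qed
  then obtain Y where Y: "\<And>i p. Y i p \<in> words (Suc 0)" "\<And>i p j. wcw (Y i p) j = (if j = i then p else 0)"
    by metis
  define X where "X = (\<lambda>s. Y (w - wt (Suc (Suc m)) s) (fst x s), \<lambda>s. Y (w - wt (Suc m) s) (snd x s))"
  have F: "X \<in> F (Suc (Suc m)) (Suc 0)" by (simp add: F_def X_def Y)
  have cX: "comp (Suc (Suc m)) w X = x" by (simp add: comp_def X_def Y)
  have "comp m w (D m (D (Suc m) X)) = PD m w (PD (Suc m) w x)"
    by (simp only: comp_D[OF D_F[OF F]] comp_D[OF F] cX)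
  then show ?thesis unfolding D_D[OF F] by (simp add: comp_def fzero_def pzero_def)
qed

definition psub :: "'k ppair \<Rightarrow> 'k ppair \<Rightarrow> 'k ppair" where
  "psub x y = (\<lambda>s. fst x s - fst y s, \<lambda>s. snd x s - snd y s)"

lemma PD_psub: "PD m w (psub x y) = psub (PD m w x) (PD m w y)"
  by (auto simp: PD_def psub_def fun_eq_iff pcol_def pdd_def pdel_def pkap_def pdbar_def psc_simps
      smult_diff_right algebra_simps split: nat.split)

lemma psub_boundary:
  assumes "PD m w x = pzero" "pvalid (Suc m) x"
  shows "PD m w (psub x (PD (Suc m) w y)) = pzero" "pvalid (Suc m) (psub x (PD (Suc m) w y))"
  using assms PD_pvalid[of "Suc m" w y] by (auto simp: PD_psub PD_PD) (auto simp: psub_def pzero_def pvalid_def)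

lemma psub_exact:
  assumes "psub x (PD m w y) = PD m w z"
  shows "x = PD m w (padd y z)"
  using assms unfolding PD_padd by (auto simp: psub_def padd_def prod_eq_iff fun_eq_iff algebra_simps)

lemma poly_split: "f = [:coeff f 0:] + pCons 0 (poly_shift 1 f)" for f :: "'k poly"
  by (rule poly_eqI) (auto simp: coeff_poly_shift coeff_pCons split: nat.split)

lemma pCons_poly_shift: "pCons 0 (poly_shift 1 f) = f - [:coeff f 0:]" for f :: "'k poly"
  using poly_split[of f] by (metis add_diff_cancel_left')

text \<open>\<open>pdel\<close> is an invertible scalar times multiplication by \<open>A\<close>.
  Boundaries of the generators with \<open>A\<close> hence reduce the word part to its constant
  terms, where \<open>kdd_exact\<close> applies; a cycle with zero word part is zero because
  \<open>pdel\<close> is injective.\<close>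

lemma PD_exact_unit:
  assumes E: "eps - q powi (2 * w) \<noteq> 0" and cyc: "PD m w x = pzero" and v: "pvalid (Suc m) x"
  shows "\<exists>y. x = PD (Suc m) w y"
proof -
  define E where "E = eps - q powi (2 * w)"
  have E0: "E \<noteq> 0" using assms by (simp add: E_def)
  \<comment> \<open>For \<open>w = 0\<close> the scalar is \<open>eps - 1\<close>, so
    \<open>eps = -1\<close>; then \<open>c = d\<close>, and \<open>c + d \<noteq> 0\<close> gives
    \<open>c d \<noteq> 0\<close>.\<close>
  have w0: "w = 0 \<longrightarrow> c * d \<noteq> 0"
  proof
    assume "w = 0"
    with E have "c = d" using eps by auto
    then show "c * d \<noteq> 0" using cd by auto
  qed
  have fst_PD: "fst (PD (Suc m) w (f, g)) s = pdd (Suc (Suc m)) w f s + pdel w g s" for f g s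
    by (simp add: PD_def pcol_def)
  define shp :: "(bool \<Rightarrow> 'k poly) \<Rightarrow> bool \<Rightarrow> 'k poly"
    where "shp = (\<lambda>g s. smult (inverse E) (poly_shift 1 (g s)))"
  have shp: "pdel w (shp g) s = g s - [:coeff (g s) 0:]" for g :: "bool \<Rightarrow> 'k poly" and s
    using E0 by (simp add: pdel_def shp_def pCons_poly_shift del: One_nat_def flip: E_def)
  define f0 where "f0 = (\<lambda>s. coeff (fst x s) 0)"
  define x1 where "x1 = psub x (PD (Suc m) w (\<lambda>s. 0, shp (fst x)))"
  have x1: "PD m w x1 = pzero" "pvalid (Suc m) x1"
    unfolding x1_def using psub_boundary[OF cyc v] by auto
  have fx1: "fst x1 = (\<lambda>s. [:f0 s:])"
    by (simp add: x1_def psub_def fst_PD shp f0_def)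
  have c0: "coeff (pdel w g s) 0 = 0" for g s by (simp add: pdel_def)
  have "if Suc m = 1 then kdd (Suc m) w f0 True + kdd (Suc m) w f0 False = 0 else (\<forall>s. kdd (Suc m) w f0 s = 0)"
  proof -
    have *: "coeff (fst (PD m w x1) s) 0 = 0" for s using x1 by (simp add: pzero_def)
    show ?thesis
    proof (cases m)
      case 0
      then show ?thesis using *[of True] by (simp add: PD_def pcol_def fx1 coeff_pdd_const c0)
    next
      case (Suc p)
      then show ?thesis using * by (simp add: PD_def pcol_def fx1 coeff_pdd_const c0)
    qed
  qed
  from kdd_exact[OF this _ w0] obtain g where g: "\<And>s. kdd (Suc (Suc m)) w g s = f0 s" by auto
  define h where "h = pdd (Suc (Suc m)) w (\<lambda>s. [:g s:])"
  define y2 where "y2 = (\<lambda>s. [:g s:], \<lambda>s. - shp h s)"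
  define x2 where "x2 = psub x1 (PD (Suc m) w y2)"
  have x2: "PD m w x2 = pzero" "pvalid (Suc m) x2"
    unfolding x2_def using psub_boundary[OF x1] by auto
  have "pdel w (\<lambda>s. - shp h s) s = - pdel w (shp h) s" for s by (simp add: pdel_def)
  moreover have "coeff (h s) 0 = f0 s" for s using g by (simp add: h_def coeff_pdd_const)
  ultimately have fx2: "fst x2 = (\<lambda>s. 0)"
    by (auto simp: x2_def psub_def y2_def fst_PD fx1 shp simp flip: h_def)
  have p0: "pdel w g s = 0 \<Longrightarrow> g s = 0" for g s using E0 by (simp add: pdel_def flip: E_def)
  have "snd x2 s = 0" for s
  proof (cases m)
    case 0
    then have F: "snd x2 False = 0" using x2(2) by (simp add: pvalid_def)
    then have "pdel w (snd x2) True = 0"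
      using arg_cong[OF x2(1), of "\<lambda>x. fst x True"] 0 by (simp add: PD_def pcol_def fx2 pzero_def pdel_def)
    then show ?thesis using p0 F by (cases s) auto
  next
    case (Suc p)
    then show ?thesis
      using arg_cong[OF x2(1), of "\<lambda>x. fst x s"] p0 by (simp add: PD_def pcol_def fx2 pzero_def)
  qed
  then have "x2 = PD (Suc m) w (\<lambda>s. 0, \<lambda>s. 0)"
    using fx2 by (auto simp: prod_eq_iff fun_eq_iff PD_def pcol_def)
  then have "x1 = PD (Suc m) w (padd y2 (\<lambda>s. 0, \<lambda>s. 0))" unfolding x2_def by (rule psub_exact)
  then show ?thesis unfolding x1_def using psub_exact by blast
qed

text \<open>Multiples of \<open>A\<close> are boundaries through \<open>pdel\<close>, and the
  constant term is reached because both \<open>1 - l\<close> and \<open>1 - inverse l\<close> are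
  nonzero.\<close>

lemma PD_exact_unit_0:
  assumes E: "eps - q powi (2 * w) \<noteq> 0"
  shows "\<exists>y. snd y False = 0 \<and> fst (PD 0 w y) True = f"
proof -
  define E where "E = eps - q powi (2 * w)"
  have E0: "E \<noteq> 0" using assms by (simp add: E_def)
  have w0: "w = 0 \<longrightarrow> c * d \<noteq> 0"
  proof
    assume "w = 0"
    with E have "c = d" using eps by auto
    then show "c * d \<noteq> 0" using cd by auto
  qed
  have kd: "kdd 1 w g True + kdd 1 w g False =
      (1 - inverse l) * (g False * gam False (w + 1)) + (1 - l) * (g True * gam True (w - 1))" for g
    by (simp add: kdd_def lastB_def lp_def wt_def algebra_simps)
  have l1: "1 - l \<noteq> 0" using l_one by simp
  have l1': "1 - inverse l \<noteq> 0" using l_one by (metis inverse_1 inverse_inverse_eq right_minus_eq)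
  have "\<exists>g. kdd 1 w g True + kdd 1 w g False = coeff f 0"
  proof (cases "w \<le> -1")
    case True
    then show ?thesis unfolding kd using l1'
      by (intro exI[of _ "\<lambda>s. if s then 0 else coeff f 0 / (1 - inverse l)"]) (simp add: gam_def)
  next
    case False
    then have "gam True (w - 1) \<noteq> 0" using w0 by (auto simp: gam_def)
    then show ?thesis unfolding kd using l1
      by (intro exI[of _ "\<lambda>s. if s then coeff f 0 / ((1 - l) * gam True (w - 1)) else 0"]) simp
  qed
  then obtain g where g: "kdd 1 w g True + kdd 1 w g False = coeff f 0" by blast
  define h where "h = f - (pdd 1 w (\<lambda>s. [:g s:]) True + pdd 1 w (\<lambda>s. [:g s:]) False)"
  have "coeff h 0 = 0" using g by (simp add: h_def coeff_pdd_const)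
  then have h: "pCons 0 (poly_shift 1 h) = h" using pCons_poly_shift[of h] by simp
  define b where "b = (\<lambda>s. if s then smult (inverse E) (poly_shift 1 h) else 0)"
  have "pdel w b True = h" "pdel w b False = 0"
    using E0 h by (simp_all add: pdel_def b_def del: One_nat_def flip: E_def)
  then have "fst (PD 0 w (\<lambda>s. [:g s:], b)) True = f"
    by (simp add: PD_def pcol_def) (simp add: h_def algebra_simps)
  then show ?thesis by (intro exI[of _ "(\<lambda>s. [:g s:], b)"]) (simp add: b_def)
qed

text \<open>The remaining case, weight zero for \<open>\<sigma>\<^sub>\<lambda>\<close>, is where \<open>c + d \<noteq> 0\<close> enters: the polynomial
  \<open>B\<^sup>* B = (c - A) (d + A)\<close> has simple roots.\<close>

abbreviation p1 :: "'k poly" where "p1 \<equiv> pQ 1"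
abbreviation p2 :: "'k poly" where "p2 \<equiv> pQ (q^2)"

text \<open>The discriminant identity \<open>p1'\<^sup>2 + 4 p1 = (c + d)\<^sup>2\<close>, with
  \<open>p1'\<close> the derivative, divided by its right side.\<close>

lemma bezout: "\<exists>k v. pderiv p1 * k - p1 * v = f"
proof -
  define D where "D = (c + d)^2"
  have D: "D \<noteq> 0" using cd by (simp add: D_def)
  have "pderiv p1 * pderiv p1 + smult 4 p1 = [:D:]"
    by (simp add: pQ_def pderiv_pCons D_def power2_eq_square algebra_simps)
  moreover have "pderiv p1 * (pderiv p1 * smult (inverse D) f) - p1 * (smult (-4 * inverse D) f) =
      (pderiv p1 * pderiv p1 + smult 4 p1) * smult (inverse D) f"
    by (simp add: distrib_right mult.assoc smult_add_right mult.commute[of 4])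
  ultimately have "pderiv p1 * (pderiv p1 * smult (inverse D) f) - p1 * (smult (-4 * inverse D) f) =
      [:D:] * smult (inverse D) f" by simp
  also have "\<dots> = f" using D by simp
  finally show ?thesis by blast
qed

lemma p1_dvd_deriv: "p1 dvd pderiv p1 * f \<Longrightarrow> p1 dvd f"
proof -
  assume a: "p1 dvd pderiv p1 * f"
  obtain k v where "pderiv p1 * k - p1 * v = 1" using bezout by blast
  then have "f = (pderiv p1 * k - p1 * v) * f" by simp
  also have "\<dots> = (pderiv p1 * f) * k - p1 * (v * f)" by (simp add: algebra_simps)
  finally show "p1 dvd f" using a by (metis dvd_diff dvd_mult2 dvd_triv_left)
qed

section \<open>The part of degree zero in \<open>B\<close> for \<open>eps = 1\<close>\<close>

context
  assumes eps1: "eps = 1"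
begin

abbreviation th :: "'k poly \<Rightarrow> 'k poly" where "th \<equiv> psc (q^2)"
abbreviation th' :: "'k poly \<Rightarrow> 'k poly" where "th' \<equiv> psc (inverse (q^2))"

lemma th_th' [simp]: "th (th' f) = f" "th' (th f) = f"
  by (simp_all add: psc_psc)

text \<open>\<open>ev\<close> and \<open>od\<close> are the differentials on words of even and odd
  length in this part, with \<open>L = l\<close> on plain words and \<open>L = l2\<close> on words
  followed by \<open>A\<close>; conjugation with \<open>B\<close> shows up as the dilation
  \<open>th\<close>.\<close>

definition ev :: "'k \<Rightarrow> (bool \<Rightarrow> 'k poly) \<Rightarrow> bool \<Rightarrow> 'k poly" where
  "ev L f s = (if s then f False + smult (inverse L) (th' (f True)) else f True + smult L (th (f False)))"

definition od :: "'k \<Rightarrow> (bool \<Rightarrow> 'k poly) \<Rightarrow> bool \<Rightarrow> 'k poly" where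
  "od L f s = (if s then p2 * (f False - smult L (th (f True))) else p1 * (f True - smult (inverse L) (th' (f False))))"

definition l2 :: 'k where "l2 = l * q^2"

lemma l2_nz [simp]: "l2 \<noteq> 0" by (simp add: l2_def)

lemma pdd0: "pdd n 0 f s = (if even n then ev l f s else od l f s)"
  by (cases "even n"; cases s)
    (simp_all add: pdd_def ev_def od_def rho_def mu_def wt_def lastB_def lp_def qs_def psc_simps psc_pQ algebra_simps smult_diff_right)

lemma pdbar0: "pdbar n 0 f s = (if even n then ev l2 f s else od l2 f s)"
  by (cases "even n"; cases s)
    (simp_all add: pdbar_def ev_def od_def rho_def mu_def wt_def lastB_def lp_def qs_def l2_def psc_simps psc_pQ
      algebra_simps smult_diff_right)

lemma th_pderiv: "smult (q^2) (th (pderiv p1)) = pderiv p2"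
  by (simp add: pQ_def pderiv_pCons psc_pCons power2_eq_square algebra_simps)

text \<open>In this part the left and the right copy of \<open>A\<close> act alike, so the
  difference quotient degenerates to the derivative.\<close>

lemma pkap0: "pkap n 0 f s = (if s = even n then pderiv p2 * f s else pderiv p1 * f s)"
  unfolding pkap_def c1_def c2_def by (simp add: eps1 pQ_def pderiv_pCons power2_eq_square power4_eq_xxxx algebra_simps)

lemma pdel0: "pdel 0 f s = 0"
  unfolding pdel_def by (simp add: eps1)

lemma th_p1: "th p1 = p2" "th' p2 = p1"
  by (simp_all add: psc_pQ)

lemma L_generic: "l * (q^2) ^ i \<noteq> 1" "l2 * (q^2) ^ i \<noteq> 1"
proof -
  show *: "l * (q^2) ^ i \<noteq> 1" for i
  proof
    assume "l * (q^2) ^ i = 1"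
    then have "l = inverse (q ^ (2 * i))" by (metis inverse_unique mult.commute power_mult)
    then show False using l_generic[OF eps1] by blast
  qed
  show "l2 * (q^2) ^ i \<noteq> 1" using *[of "Suc i"] by (simp add: l2_def mult_ac)
qed

lemma ev_zero: "ev L f True = 0 \<Longrightarrow> L \<noteq> 0 \<Longrightarrow> f True = - smult L (th (f False))"
proof -
  assume a: "ev L f True = 0" "L \<noteq> 0"
  then have "smult L (th (f False + smult (inverse L) (th' (f True)))) = 0" by (simp add: ev_def)
  then show ?thesis using a(2) by (simp add: psc_add psc_smult smult_add_right eq_neg_iff_add_eq_0 add.commute)
qed

text \<open>Where the two tags are identified only this sum is available. It has the form
  \<open>u - L u(q\<^sup>2 X)\<close>, so genericity still recovers \<open>u\<close>.\<close>

lemma od_sum: "L \<noteq> 0 \<Longrightarrow> od L f True + od L f False =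
    p1 * (f True - smult (inverse L) (th' (f False)))
    - smult L (th (p1 * (f True - smult (inverse L) (th' (f False)))))"
  by (simp add: od_def psc_simps th_p1 smult_diff_right algebra_simps)

lemma od_zero:
  assumes "L \<noteq> 0" "\<And>i. L * (q^2) ^ i \<noteq> 1" "od L f True + od L f False = 0 \<or> od L f False = 0"
  shows "f False = smult L (th (f True))"
proof -
  let ?u = "p1 * (f True - smult (inverse L) (th' (f False)))"
  have "?u = 0"
    using assms(3)
  proof
    assume "od L f True + od L f False = 0"
    then have "?u = smult L (th ?u)" using od_sum[OF assms(1), of f] by simp
    then show ?thesis using one_minus_psc_injective[OF assms(2)] by blast
  qed (simp add: od_def)
  moreover have "p1 \<noteq> 0" by (simp add: pQ_def)
  ultimately have "f True = smult (inverse L) (th' (f False))" by simp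
  then have "smult L (th (f True)) = smult L (th (smult (inverse L) (th' (f False))))" by simp
  then show ?thesis using assms(1) by (simp add: psc_smult)
qed

text \<open>The differentials alternate with the parity of \<open>m\<close>. For even
  \<open>m\<close> the word part is cleared through \<open>ev\<close>, and the rest is reached
  because \<open>p1\<close> and its derivative generate all polynomials. For odd \<open>m\<close>
  the cycle condition makes \<open>p1\<close> divide its derivative times \<open>f False\<close>;
  coprimality then makes \<open>p1\<close> divide \<open>f False\<close>, so \<open>od\<close>
  clears the word part.\<close>

lemma PD_exact_zero:
  assumes cyc: "PD m 0 x = pzero" and v: "pvalid (Suc m) x"
  shows "\<exists>y. x = PD (Suc m) 0 y"
proof (cases "even m")
  case True
  define f where "f = fst x"
  have f: "f False = smult l (th (f True))"
  proof (rule od_zero)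
    show "od l f True + od l f False = 0 \<or> od l f False = 0"
      using arg_cong[OF cyc, of "\<lambda>x. fst x True"] arg_cong[OF cyc, of "\<lambda>x. fst x False"] True
      by (cases "m = 0") (simp_all add: PD_def pcol_def pdd0 pdel0 pzero_def f_def add.commute)
  qed (use L_generic in auto)
  define y1 where "y1 = (\<lambda>s. if s then 0 else f True, (\<lambda>s. 0) :: bool \<Rightarrow> 'k poly)"
  define x1 where "x1 = psub x (PD (Suc m) 0 y1)"
  have x1: "PD m 0 x1 = pzero" "pvalid (Suc m) x1"
    unfolding x1_def using psub_boundary[OF cyc v] by auto
  have fx1: "fst x1 s = 0" for s
    using True f by (cases s) (simp_all add: x1_def psub_def PD_def pcol_def pdd0 pdel0 y1_def ev_def flip: f_def)
  define g where "g = snd x1"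
  have "\<exists>y. x1 = PD (Suc m) 0 y"
  proof (cases m)
    case 0
    have gF: "g False = 0" using x1(2) 0 by (simp add: pvalid_def g_def)
    \<comment> \<open>Here the two tags of the second component are added, and a boundary
      contributes \<open>u - l2 u(q\<^sup>2 X)\<close> with \<open>u\<close> the combination of
      \<open>k\<close> and \<open>v\<close> below.\<close>
    obtain u where u: "u - smult l2 (th u) = g True"
      using one_minus_psc_surjective[of l2 "q^2" "g True"] L_generic by blast
    obtain k v where kv: "pderiv p1 * k - p1 * v = u" using bezout by blast
    \<comment> \<open>The first component is chosen in the kernel of \<open>ev\<close>, so that it
      leaves the word part alone while \<open>kap\<close> contributes the derivative of
      \<open>p1\<close> times \<open>k\<close>.\<close>
    define y where "y = (\<lambda>s. if s then - smult l (th k) else k, \<lambda>s. if s then v else 0)"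
    have "fst (PD (Suc 0) 0 y) s = 0" for s
      by (simp add: PD_def pcol_def pdd0 pdel0 y_def ev_def psc_simps)
    moreover have "snd (PD (Suc 0) 0 y) s = g s" for s
    proof (cases s)
      case True
      have "od l2 (snd y) True + od l2 (snd y) False = p1 * v - smult l2 (th (p1 * v))"
        using od_sum[of l2 "snd y"] by (simp add: y_def)
      moreover have "pkap 2 0 (fst y) True + pkap 2 0 (fst y) False = pderiv p1 * k - smult l2 (th (pderiv p1 * k))"
        by (simp add: pkap0 y_def psc_mult l2_def flip: th_pderiv)
      ultimately have "snd (PD (Suc 0) 0 y) True = u - smult l2 (th u)"
        unfolding kv[symmetric]
        by (simp add: PD_def pcol_def pdbar0 psc_diff smult_diff_right numeral_2_eq_2 algebra_simps)
      then show ?thesis using u True by simp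
    next
      case False
      then show ?thesis using gF by (simp add: PD_def pcol_def)
    qed
    ultimately have "x1 = PD (Suc m) 0 y" using 0 fx1 by (auto simp: prod_eq_iff fun_eq_iff g_def)
    then show ?thesis by blast
  next
    case (Suc p)
    then have p0: "p \<noteq> 0" using True by (cases p) auto
    have fx1': "fst x1 = (\<lambda>s. 0)" using fx1 by auto
    have "ev l2 g True = 0"
      using arg_cong[OF x1(1), of "\<lambda>x. snd x True"] Suc True p0
      by (simp add: PD_def pcol_def pdbar0 fx1' pzero_def g_def)
    then have g: "g True = - smult l2 (th (g False))" by (rule ev_zero) simp
    obtain k v where kv: "pderiv p1 * k - p1 * v = g False" using bezout by blast
    define y where "y = (\<lambda>s. if s then - smult l (th k) else k, \<lambda>s. if s then v else 0)"
    have "fst (PD (Suc m) 0 y) s = 0" for s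
      using True by (simp add: PD_def pcol_def pdd0 pdel0 y_def ev_def psc_simps)
    moreover have "snd (PD (Suc m) 0 y) s = g s" for s
    proof (cases s)
      case False
      then show ?thesis using True Suc kv
        by (simp add: PD_def pcol_def pdbar0 pkap0 y_def od_def mult.commute)
    next
      case sT: True
      have "snd (PD (Suc m) 0 y) True = pderiv p2 * (- smult l (th k)) + p2 * smult l2 (th v)"
        using True Suc by (simp add: PD_def pcol_def pdbar0 pkap0 y_def od_def)
      also have "\<dots> = - smult l2 (th (pderiv p1 * k - p1 * v))"
        by (simp add: psc_simps th_p1 l2_def smult_diff_right flip: th_pderiv)
      finally show ?thesis using kv g sT by simp
    qed
    ultimately have "x1 = PD (Suc m) 0 y" using fx1 by (auto simp: prod_eq_iff fun_eq_iff g_def)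
    then show ?thesis by blast
  qed
  then show ?thesis unfolding x1_def using psub_exact by blast
next
  case False
  then obtain p where m: "m = Suc p" by (cases m) auto
  define f g where "f = fst x" and "g = snd x"
  have "ev l f True = 0"
    using arg_cong[OF cyc, of "\<lambda>x. fst x True"] False
    by (cases "m = 0") (simp_all add: PD_def pcol_def pdd0 pdel0 pzero_def f_def)
  then have f: "f True = - smult l (th (f False))" by (rule ev_zero) simp
  \<comment> \<open>The second component of the cycle condition is \<open>u\<close> on one tag and
    \<open>- l2 u(q\<^sup>2 X)\<close> on the other; for \<open>p = 0\<close> only their sum is
    known, and genericity again gives \<open>u = 0\<close>.\<close>
  define u where "u = pderiv p1 * f False - p1 * (g True - smult (inverse l2) (th' (g False)))"
  have uT: "pkap (Suc m) 0 f True - pdbar m 0 g True = - smult l2 (th u)"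
  proof -
    have "pkap (Suc m) 0 f True = - smult l2 (th (pderiv p1 * f False))"
      using False by (simp add: pkap0 f l2_def psc_mult mult.commute flip: th_pderiv)
    moreover have "pdbar m 0 g True = - smult l2 (th (p1 * (g True - smult (inverse l2) (th' (g False)))))"
      using False by (simp add: pdbar0 od_def psc_simps th_p1 smult_diff_right algebra_simps)
    ultimately show ?thesis by (simp add: u_def psc_diff smult_diff_right)
  qed
  have uF: "pkap (Suc m) 0 f False - pdbar m 0 g False = u"
    using False by (simp add: pkap0 pdbar0 od_def u_def)
  have "u = 0"
  proof (cases p)
    case 0
    have "u - smult l2 (th u) = 0"
      using arg_cong[OF cyc, of "\<lambda>x. snd x True"] uT uF 0 m
      by (simp add: PD_def pcol_def pzero_def f_def g_def)
    then show ?thesis using one_minus_psc_injective[of l2 "q^2" u] L_generic by simp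
  next
    case (Suc p')
    then show ?thesis using arg_cong[OF cyc, of "\<lambda>x. snd x False"] uF m
      by (simp add: PD_def pcol_def pzero_def f_def g_def)
  qed
  then have "p1 dvd pderiv p1 * f False" by (simp add: u_def)
  from p1_dvd_deriv[OF this] obtain v where v1: "f False = p1 * v" by (rule dvdE)
  define y1 where "y1 = (\<lambda>s. if s then v else 0, (\<lambda>s. 0) :: bool \<Rightarrow> 'k poly)"
  define x1 where "x1 = psub x (PD (Suc m) 0 y1)"
  have x1: "PD m 0 x1 = pzero" "pvalid (Suc m) x1"
    unfolding x1_def using psub_boundary[OF cyc v] by auto
  have fx1: "fst x1 = (\<lambda>s. 0)"
  proof
    fix s show "fst x1 s = 0"
      using False f v1 by (cases s)
        (simp_all add: x1_def psub_def PD_def pcol_def pdd0 pdel0 y1_def od_def psc_simps th_p1 flip: f_def)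
  qed
  define h where "h = snd x1"
  have "od l2 h True + od l2 h False = 0 \<or> od l2 h False = 0"
    using arg_cong[OF x1(1), of "\<lambda>x. snd x True"] arg_cong[OF x1(1), of "\<lambda>x. snd x False"] m False
    by (cases p) (simp_all add: PD_def pcol_def pdbar0 fx1 pzero_def h_def neg_eq_iff_add_eq_0 minus_equation_iff)
  then have h: "h False = smult l2 (th (h True))"
    by (intro od_zero) (use L_generic in auto)
  define y where "y = ((\<lambda>s. 0) :: bool \<Rightarrow> 'k poly, \<lambda>s. if s then 0 else - h True)"
  have "snd (PD (Suc m) 0 y) s = h s" for s
    using False m h by (cases s) (simp_all add: PD_def pcol_def pdbar0 y_def ev_def psc_minus)
  moreover have "fst (PD (Suc m) 0 y) s = 0" for s by (simp add: PD_def pcol_def pdel0 y_def)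
  ultimately have "x1 = PD (Suc m) 0 y" using fx1 by (auto simp: prod_eq_iff fun_eq_iff h_def)
  then show ?thesis unfolding x1_def using psub_exact by blast
qed

lemma PD_0_zero: "fst (PD 0 0 y) True =
    p1 * (fst y True - smult (inverse l) (th' (fst y False)))
    - smult l (th (p1 * (fst y True - smult (inverse l) (th' (fst y False)))))"
  using od_sum[of l "fst y"] by (simp add: PD_def pcol_def pdd0 pdel0)

text \<open>The image consists of the polynomials \<open>u - l u(q\<^sup>2 X)\<close> with
  \<open>u\<close> a multiple of \<open>p1\<close>. Writing \<open>f\<close> in this form with
  arbitrary \<open>u\<close> and dividing \<open>u\<close> by \<open>p1\<close> leaves a remainder
  of degree below two, and the operator does not raise the degree.\<close>

lemma PD_0_zero_surj: "\<exists>y a b. snd y False = 0 \<and> f = fst (PD 0 0 y) True + [:a, b:]"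
proof -
  obtain u where u: "u - smult l (th u) = f"
    using one_minus_psc_surjective[of l "q^2" f] L_generic by blast
  define r where "r = u mod p1"
  have dp: "degree p1 = 2" "p1 \<noteq> 0" by (simp_all add: pQ_def)
  have "r = 0 \<or> degree r < 2" unfolding r_def using degree_mod_less[OF dp(2), of u] dp by simp
  then have "degree r < 2" by auto
  then have c: "coeff r i = 0" if "i \<ge> 2" for i using that by (simp add: coeff_eq_0)
  define t where "t = u div p1"
  define y where "y = (\<lambda>s. if s then t else 0, (\<lambda>s. 0) :: bool \<Rightarrow> 'k poly)"
  have us: "u = p1 * t + r" unfolding r_def t_def by simp
  have "fst (PD 0 0 y) True = p1 * t - smult l (th (p1 * t))" by (simp add: PD_0_zero y_def)
  then have "f = fst (PD 0 0 y) True + (r - smult l (th r))"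
  proof -
    have "u - smult l (th u) = (p1 * t - smult l (th (p1 * t))) + (r - smult l (th r))"
      by (simp add: us psc_add smult_add_right)
    then show ?thesis using u \<open>fst (PD 0 0 y) True = _\<close> by simp
  qed
  moreover have "r - smult l (th r) = [:coeff (r - smult l (th r)) 0, coeff (r - smult l (th r)) 1:]"
  proof (rule poly_eqI)
    fix i
    show "coeff (r - smult l (th r)) i = coeff [:coeff (r - smult l (th r)) 0, coeff (r - smult l (th r)) 1:] i"
      using c[of i] by (cases i rule: nat.exhaust; cases "i - 1") (auto simp: coeff_psc coeff_pCons split: nat.split)
  qed
  moreover have "snd y False = 0" by (simp add: y_def)
  ultimately show ?thesis by metis
qed

text \<open>A nonzero multiple of \<open>p1\<close> has degree at least two, and its leading
  coefficient is multiplied by a nonzero eigenvalue.\<close>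

lemma PD_0_zero_indep:
  assumes "fst (PD 0 0 y) True = [:a, b:]"
  shows "a = 0 \<and> b = 0"
proof -
  define v where "v = fst y True - smult (inverse l) (th' (fst y False))"
  define u where "u = p1 * v"
  have e: "u - smult l (th u) = [:a, b:]" using assms unfolding PD_0_zero u_def v_def .
  have "v = 0"
  proof (rule ccontr)
    assume v: "v \<noteq> 0"
    then have "degree u = 2 + degree v" unfolding u_def by (subst degree_mult_eq) (auto simp: pQ_def)
    then have "coeff [:a, b:] (degree u) = 0" by (intro coeff_eq_0) auto
    moreover have "coeff (u - smult l (th u)) (degree u) = (1 - l * (q^2) ^ degree u) * lead_coeff u"
      by (simp add: coeff_psc algebra_simps)
    moreover have "lead_coeff u \<noteq> 0"
    proof -
      have "p1 \<noteq> 0" by (simp add: pQ_def)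
      then show ?thesis using v by (simp add: u_def)
    qed
    ultimately show False using L_generic(1)[of "degree u"] e by simp
  qed
  then show ?thesis using e by (simp add: u_def)
qed

end

end

section \<open>Vanishing of the Hochschild homology\<close>

context podles_generic
begin

lemma words1_exists:
  assumes "finite {j. H j \<noteq> 0}"
  shows "\<exists>y\<in>words (Suc 0). \<forall>j. wcw y j = (H j :: 'k poly)"
proof -
  define J where "J = {j. H j \<noteq> 0}"
  define y where "y = (\<Sum>i\<in>J. \<Sum>n\<le>degree (H i). fscale (coeff (H i) n) (basis [(n, i)]))"
  have fin: "finite J" using assms by (simp add: J_def)
  have "Poly_Mapping.lookup y [(n, j)] = coeff (H j) n" for n j
  proof -
    have "Poly_Mapping.lookup y [(n, j)] = (\<Sum>i\<in>J. if i = j then coeff (H j) n else 0)"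
      by (auto simp: y_def lookup_sum lookup_single when_def if_distrib coeff_eq_0 intro!: sum.cong cong: if_cong)
    then show ?thesis using fin by (simp add: J_def)
  qed
  then have "wcw y j = H j" for j by (intro poly_eqI) (simp add: coeff_wcw)
  moreover have "y \<in> words (Suc 0)" unfolding y_def by (intro words_sum words_scale) simp
  ultimately show ?thesis by blast
qed

lemma finite_wcw: "finite {j. wcw x j \<noteq> 0}"
proof (rule finite_subset)
  show "{j. wcw x j \<noteq> 0} \<subseteq> (\<lambda>w. snd (hd w)) ` Poly_Mapping.keys x"
  proof
    fix j assume "j \<in> {j. wcw x j \<noteq> 0}"
    then obtain i where "coeff (wcw x j) i \<noteq> 0" by (auto simp: poly_eq_iff)
    then have "[(i, j)] \<in> Poly_Mapping.keys x" by (simp add: coeff_wcw in_keys_iff)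
    then show "j \<in> (\<lambda>w. snd (hd w)) ` Poly_Mapping.keys x" by force
  qed
qed simp

lemma comp_eqI:
  assumes "x \<in> F m (Suc 0)" "y \<in> F m (Suc 0)" "\<And>w. comp m w x = comp m w y"
  shows "x = y"
proof -
  have w: "fst x s \<in> words (Suc 0)" "snd x s \<in> words (Suc 0)" "fst y s \<in> words (Suc 0)" "snd y s \<in> words (Suc 0)" for s
    using assms by (auto simp: F_def)
  have "wcw (fst x s) j = wcw (fst y s) j" for s j
    using arg_cong[OF assms(3)[of "j + wt m s"], of "\<lambda>x. fst x s"] by (simp add: comp_def)
  moreover have "wcw (snd x s) j = wcw (snd y s) j" for s j
    using arg_cong[OF assms(3)[of "j + wt (m - 1) s"], of "\<lambda>x. snd x s"] by (simp add: comp_def)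
  ultimately have "fst x s = fst y s" "snd x s = snd y s" for s
    using w by (auto intro: words1_eqI)
  then show ?thesis by (auto simp: prod_eq_iff)
qed

text \<open>Prescribed homogeneous components assemble to a chain only if almost all of them vanish,
  since chains have finite support.\<close>

lemma comp_exists:
  assumes fin: "finite {w. G w \<noteq> pzero}" and v: "\<And>w. pvalid m (G w)"
  shows "\<exists>x\<in>F m (Suc 0). \<forall>w. comp m w x = G w"
proof -
  have finG: "finite {j. fst (G (j + a)) s \<noteq> 0}" "finite {j. snd (G (j + a)) s \<noteq> 0}" for a s
  proof -
    have "{j. fst (G (j + a)) s \<noteq> 0} \<subseteq> (\<lambda>w. w - a) ` {w. G w \<noteq> pzero}"
      "{j. snd (G (j + a)) s \<noteq> 0} \<subseteq> (\<lambda>w. w - a) ` {w. G w \<noteq> pzero}"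
      by (auto simp: pzero_def image_iff prod_eq_iff fun_eq_iff algebra_simps)
    then show "finite {j. fst (G (j + a)) s \<noteq> 0}" "finite {j. snd (G (j + a)) s \<noteq> 0}"
      using fin finite_subset finite_imageI by blast+
  qed
  have "\<exists>y\<in>words (Suc 0). \<forall>j. wcw y j = fst (G (j + wt m s)) s" for s
    by (rule words1_exists[OF finG(1)])
  moreover have "\<exists>y\<in>words (Suc 0). \<forall>j. wcw y j = snd (G (j + wt (m - 1) s)) s" for s
    by (rule words1_exists[OF finG(2)])
  ultimately obtain a b where a: "\<And>s. a s \<in> words (Suc 0)" "\<And>s j. wcw (a s) j = fst (G (j + wt m s)) s"
    and b: "\<And>s. b s \<in> words (Suc 0)" "\<And>s j. wcw (b s) j = snd (G (j + wt (m - 1) s)) s"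
    by metis
  have z: "y = 0" if "y \<in> words (Suc 0)" "\<And>j. wcw y j = 0" for y
    using that by (intro words1_eqI) auto
  have "(a, b) \<in> F m (Suc 0)"
    using v a b by (auto simp: F_def pvalid_def fun_eq_iff intro!: z)
  moreover have "comp m w (a, b) = G w" for w
    by (simp add: comp_def a b)
  ultimately show ?thesis by blast
qed

lemma finite_comp: "finite {w. comp m w x \<noteq> pzero}"
proof (rule finite_subset)
  let ?A = "\<lambda>f n s. (\<lambda>j. j + wt n s) ` {j. wcw (f x s) j \<noteq> 0}"
  show "{w. comp m w x \<noteq> pzero} \<subseteq> (\<Union>s. ?A fst m s) \<union> (\<Union>s. ?A snd (m - 1) s)"
  proof
    fix w assume "w \<in> {w. comp m w x \<noteq> pzero}"
    then obtain s where "wcw (fst x s) (w - wt m s) \<noteq> 0 \<or> wcw (snd x s) (w - wt (m - 1) s) \<noteq> 0"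
      by (auto simp: comp_def pzero_def fun_eq_iff)
    moreover have "w = (w - wt n s) + wt n s" for n s by simp
    ultimately show "w \<in> (\<Union>s. ?A fst m s) \<union> (\<Union>s. ?A snd (m - 1) s)" by blast
  qed
  show "finite ((\<Union>s. ?A fst m s) \<union> (\<Union>s. ?A snd (m - 1) s))"
    by (auto intro!: finite_wcw)
qed

lemma comp_pvalid: "x \<in> F m (Suc 0) \<Longrightarrow> pvalid m (comp m w x)"
  by (auto simp: F_def pvalid_def comp_def fun_eq_iff)

lemma comp_fzero: "comp m w fzero = pzero"
  by (simp add: comp_def fzero_def pzero_def)

lemma q_powi: "w \<noteq> 0 \<Longrightarrow> q powi w \<noteq> 1"
proof
  assume w: "w \<noteq> 0" and q: "q powi w = 1"
  show False
  proof (cases "w > 0")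
    case True
    then have "q ^ nat w = 1" using q by (simp add: power_int_def)
    then show False using q_root[of "nat w"] True by simp
  next
    case False
    then have "inverse (q ^ nat (- w)) = 1" using q w by (simp add: power_int_def power_inverse)
    then have "q ^ nat (- w) = 1" by (metis inverse_1 inverse_inverse_eq)
    then show False using q_root[of "nat (- w)"] False w by simp
  qed
qed

text \<open>Squaring gives \<open>q powi (4 * w) = 1\<close>, hence \<open>w = 0\<close> as
  \<open>q\<close> is not a root of unity.\<close>

lemma eigenvalue_zero: "eps - q powi (2 * w) = 0 \<Longrightarrow> eps = 1 \<and> w = 0"
proof -
  assume e: "eps - q powi (2 * w) = 0"
  have "q powi (4 * w) = (q powi (2 * w)) * (q powi (2 * w))" by (simp flip: power_int_add)
  also have "\<dots> = eps * eps" using e by simp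
  finally have "q powi (4 * w) = 1" by simp
  then have "w = 0" using q_powi[of "4 * w"] by auto
  then show ?thesis using e by simp
qed

lemma PD_exact:
  assumes "PD m w x = pzero" "pvalid (Suc m) x"
  shows "\<exists>y. x = PD (Suc m) w y"
proof (cases "eps - q powi (2 * w) = 0")
  case True
  then have "eps = 1" "w = 0" using eigenvalue_zero by auto
  then show ?thesis using PD_exact_zero assms by simp
qed (use PD_exact_unit assms in blast)

lemma small_exact:
  assumes x: "x \<in> F (Suc m) (Suc 0)" and cyc: "D m x = fzero"
  shows "\<exists>y\<in>F (Suc (Suc m)) (Suc 0). x = D (Suc m) y"
proof -
  \<comment> \<open>The primitive of a zero component is fixed to be zero, so that only finitely
    many of the chosen primitives are nonzero.\<close>
  have "\<exists>y. comp (Suc m) w x = PD (Suc m) w y \<and> (comp (Suc m) w x = pzero \<longrightarrow> y = pzero)" for w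
  proof (cases "comp (Suc m) w x = pzero")
    case True
    have "PD (Suc m) w pzero = pzero"
      by (auto simp: PD_def pzero_def pcol_def fun_eq_iff split: nat.split)
    then show ?thesis using True by (intro exI[of _ pzero]) simp
  next
    case False
    have "PD m w (comp (Suc m) w x) = pzero"
      using comp_D[OF x, of w] cyc by (simp add: comp_fzero)
    then show ?thesis using PD_exact comp_pvalid[OF x] False by blast
  qed
  then obtain G where G: "\<And>w. comp (Suc m) w x = PD (Suc m) w (G w)" "\<And>w. comp (Suc m) w x = pzero \<Longrightarrow> G w = pzero"
    by metis
  have "finite {w. G w \<noteq> pzero}"
    by (rule finite_subset[OF _ finite_comp[of "Suc m" x]]) (use G(2) in blast)
  moreover have "pvalid (Suc (Suc m)) (G w)" for w by (simp add: pvalid_def)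
  ultimately obtain y where y: "y \<in> F (Suc (Suc m)) (Suc 0)" "\<And>w. comp (Suc (Suc m)) w y = G w"
    using comp_exists by blast
  have "x = D (Suc m) y"
    by (rule comp_eqI[OF x D_F[OF y(1)]]) (simp add: comp_D[OF y(1)] y(2) G(1))
  then show ?thesis using y by blast
qed

text \<open>Treats \<open>face0\<close> as the differential out of degree zero, so that the chase is
  uniform in \<open>m\<close>.\<close>

definition augmented_cycle :: "nat \<Rightarrow> 'k tagged \<times> 'k tagged \<Rightarrow> bool" where
  "augmented_cycle m x = (case m of 0 \<Rightarrow> face0 (fst x True) = 0 | Suc p \<Rightarrow> D p x = fzero)"

lemma fadd_fdiff: "x = fadd y (fdiff x y)"
  by (auto simp: fadd_def fdiff_def)

lemma insert_one_cycle:
  assumes "z \<in> F m (Suc k)" "fmap fhoch z = fzero"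
  shows "z = fmap fhoch (fmap insert_one z)"
proof -
  have "fadd u fzero = u" for u by (simp add: fadd_def fzero_def)
  then show ?thesis using fhoch_insert_one_F[OF assms(1)] assms(2) by (simp add: fmap_fhoch_lin)
qed

text \<open>The double complex has exact rows by \<open>F_exact\<close>, except for the bottom row, which is the small
  complex, and exact columns by \<open>insert_one\<close>.\<close>

lemma double_complex_chase:
  assumes "x \<in> F m (Suc (Suc k))" "m + k \<ge> 1" "augmented_cycle m (fmap fhoch x)"
  shows "\<exists>u\<in>F (Suc m) (Suc (Suc k)). \<exists>u'\<in>F m (Suc (Suc (Suc k))). x = fadd (D m u) (fmap fhoch u')"
  using assms
proof (induction k arbitrary: m x)
  case 0
  \<comment> \<open>Here \<open>m \<ge> 1\<close>, by the bound on \<open>m + k\<close>; exactness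
    of the bottom row is available in positive degrees.\<close>
  then obtain p where m: "m = Suc p" by (cases m) auto
  have "fmap fhoch x \<in> F (Suc p) (Suc 0)" using 0 m fhoch_F by blast
  then obtain v where v: "v \<in> F (Suc m) (Suc 0)" "fmap fhoch x = D m v"
    using small_exact[of "fmap fhoch x" p] 0 m by (auto simp: augmented_cycle_def)
  define u where "u = fmap insert_one v"
  have u: "u \<in> F (Suc m) (Suc (Suc 0))" unfolding u_def using v by (intro insert_one_F)
  have "fmap fhoch v = fzero" using v(1) by (auto simp: F_def fmap_def fzero_def fhoch_words0)
  then have "fmap fhoch u = v"
    using fhoch_insert_one_F[OF v(1)] unfolding u_def by (auto simp: fmap_fhoch_lin) (simp add: fadd_def fzero_def)
  then have "fmap fhoch (fdiff x (D m u)) = fzero"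
    using v(2) D_fhoch[OF u] by (simp add: fmap_fhoch_lin) (simp add: fdiff_def fzero_def)
  moreover have z: "fdiff x (D m u) \<in> F m (Suc (Suc 0))" using 0 u by (auto intro: fdiff_F D_F)
  ultimately have "x = fadd (D m u) (fmap fhoch (fmap insert_one (fdiff x (D m u))))"
    using insert_one_cycle fadd_fdiff by metis
  then show ?case using u insert_one_F[OF z] by blast
next
  case (Suc k)
  have y: "fmap fhoch x \<in> F m (Suc (Suc k))" using Suc.prems(1) by (rule fhoch_F)
  have "\<exists>x'\<in>F (Suc m) (Suc (Suc k)). fmap fhoch x = D m x'"
  proof (cases m)
    case 0
    then show ?thesis using F_exact_0 y Suc.prems(3) by (simp add: augmented_cycle_def)
  next
    case (Suc p)
    then show ?thesis using F_exact y Suc.prems(3) by (simp add: augmented_cycle_def)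
  qed
  then obtain x' where x': "x' \<in> F (Suc m) (Suc (Suc k))" "fmap fhoch x = D m x'" by blast
  have "D m (fmap fhoch x') = fzero"
    using D_fhoch[OF x'(1)] fhoch_fhoch_F[OF Suc.prems(1)] x'(2) by simp
  then have "augmented_cycle (Suc m) (fmap fhoch x')" by (simp add: augmented_cycle_def)
  with Suc.IH[OF x'(1)] obtain u u' where u: "u \<in> F (Suc (Suc m)) (Suc (Suc k))" "u' \<in> F (Suc m) (Suc (Suc (Suc k)))"
    "x' = fadd (D (Suc m) u) (fmap fhoch u')" by auto
  have "D m x' = fmap fhoch (D m u')"
    using D_D[OF u(1)] D_fhoch[OF u(2)] by (simp add: u(3) D_fadd) (simp add: fadd_def fzero_def)
  then have "fmap fhoch (fdiff x (D m u')) = fzero"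
    using x'(2) by (simp add: fmap_fhoch_lin) (simp add: fdiff_def fzero_def)
  moreover have z: "fdiff x (D m u') \<in> F m (Suc (Suc (Suc k)))" using Suc.prems u by (auto intro: fdiff_F D_F)
  ultimately have "x = fadd (D m u') (fmap fhoch (fmap insert_one (fdiff x (D m u'))))"
    using insert_one_cycle fadd_fdiff by metis
  then show ?case using u insert_one_F[OF z] by blast
qed

text \<open>Inserting a unit lifts \<open>z\<close> to free coefficients. The chase splits the lift
  into a differential of the resolution, which \<open>face0\<close> kills, and a
  \<open>fhoch\<close>-boundary, which \<open>face0\<close> turns into a
  \<open>hoch\<close>-boundary.\<close>

lemma hoch_exact:
  assumes z: "z \<in> words (Suc (Suc n))" and cyc: "hoch z = 0"
  shows "\<exists>y\<in>words (Suc (Suc (Suc n))). z = hoch y"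
proof -
  define z0 where "z0 = insert_one z"
  have z0: "z0 \<in> words (Suc (Suc (Suc n)))" "face0 z0 = z"
    unfolding z0_def using z insert_one_words face0_insert_one by blast+
  define x :: "'k tagged \<times> 'k tagged" where "x = (\<lambda>s. if s then z0 else 0, \<lambda>s. 0)"
  have x: "x \<in> F 0 (Suc (Suc (Suc n)))" using z0 by (auto simp: F_def x_def)
  have "face0 (fhoch z0) = 0" using hoch_face0[OF z0(1)] z0(2) cyc by simp
  then have "augmented_cycle 0 (fmap fhoch x)" by (simp add: augmented_cycle_def fmap_def x_def)
  with double_complex_chase[OF x] obtain u u' where u: "u \<in> F (Suc 0) (Suc (Suc (Suc n)))"
    "u' \<in> F 0 (Suc (Suc (Suc (Suc n))))" "x = fadd (D 0 u) (fmap fhoch u')" by auto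
  have "z0 = fst (D 0 u) True + fhoch (fst u' True)"
    using arg_cong[OF u(3), of "\<lambda>x. fst x True"] by (simp add: x_def fadd_def fmap_def)
  moreover have u': "fst u' True \<in> words (Suc (Suc (Suc (Suc n))))" using u(2) by (auto simp: F_def)
  ultimately have "z = hoch (face0 (fst u' True))"
    using z0(2) face0_D[OF u(1)] hoch_face0[OF u'] by (simp add: face0_lin)
  moreover have "face0 (fst u' True) \<in> words (Suc (Suc (Suc n)))" using u' by (rule face0_words)
  ultimately show ?thesis by blast
qed

section \<open>Restriction to weight one, and Hochschild homology in degree zero\<close>

definition proj_one :: "((nat \<times> int) list \<Rightarrow>\<^sub>0 'k) \<Rightarrow> ((nat \<times> int) list \<Rightarrow>\<^sub>0 'k)" where
  "proj_one = lin (\<lambda>w. if prod_list (map chi w) = 1 then basis w else 0)"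

lemma klin_proj_one [klin_intros]: "klin f \<Longrightarrow> klin (\<lambda>x. proj_one (f x))"
  unfolding proj_one_def by (intro klin_intros)

lemma proj_one_weight_words: "x \<in> weight_words n a \<Longrightarrow> proj_one x = (if a = 1 then x else 0)"
  unfolding weight_words_def
  by (rule klin_ext_on, assumption) (auto intro!: klin_intros simp: proj_one_def)

lemma proj_one_words: "x \<in> words n \<Longrightarrow> proj_one x \<in> weight_words n 1"
  unfolding weight_words_def words_def
  by (rule klin_supported, assumption) (auto intro!: klin_intros simp: proj_one_def)

lemma proj_one_hoch: "x \<in> words (Suc (Suc n)) \<Longrightarrow> hoch (proj_one x) = proj_one (hoch x)"
proof (rule words_ext, assumption)
  fix w :: "(nat \<times> int) list" assume w: "length w = Suc (Suc n)"
  then have "hoch (basis w) \<in> weight_words (Suc n) (prod_list (map chi w))"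
    by (intro hoch_weight_words) simp
  from proj_one_weight_words[OF this] show "hoch (proj_one (basis w)) = proj_one (hoch (basis w))"
    by (simp add: proj_one_def[of] hoch_lin)
qed (intro klin_intros)+

sublocale acyc: acyclic_cyclic_complex "\<lambda>n. weight_words (Suc n) 1" cycl face0 "tcons unit" hoch bar norm_op wproj
proof
  fix n and x :: "(nat \<times> int) list \<Rightarrow>\<^sub>0 'k"
  assume x: "x \<in> weight_words (Suc (Suc n)) 1" "hoch x = 0"
  then obtain y where y: "y \<in> words (Suc (Suc (Suc n)))" "x = hoch y"
    using hoch_exact weight_words_words by blast
  have "x = proj_one x" using proj_one_weight_words[OF x(1)] by simp
  also have "\<dots> = hoch (proj_one y)" using y by (simp add: proj_one_hoch)
  finally show "\<exists>y\<in>weight_words (Suc (Suc (Suc n))) 1. x = hoch y"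
    using proj_one_words[OF y(1)] by blast
qed

text \<open>With \<open>hoch_D0\<close> this identifies the boundaries in degree zero with those of
  the small complex. The primitive is found by lifting along the augmentation of the columns; its
  sign comes from \<open>hoch = face0 - fhoch\<close>.\<close>

lemma D0_hoch:
  assumes Y: "Y \<in> F (Suc 0) (Suc 0)"
  shows "\<exists>z\<in>words (Suc (Suc 0)). fst (D 0 Y) True = hoch z"
proof -
  define T where "T = fmap insert_one Y"
  have T: "T \<in> F (Suc 0) (Suc (Suc 0))" unfolding T_def using Y by (rule insert_one_F)
  have "fmap fhoch Y = fzero" using Y by (auto simp: F_def fmap_def fzero_def fhoch_words0)
  then have "fmap fhoch T = Y"
    using fhoch_insert_one_F[OF Y] unfolding T_def by (auto simp: fmap_fhoch_lin) (simp add: fadd_def fzero_def)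
  then have e: "fhoch (fst (D 0 T) True) = fst (D 0 Y) True"
    using arg_cong[OF D_fhoch[OF T], of "\<lambda>x. fst x True"] by (simp add: fmap_def)
  have "fst (D 0 T) True \<in> words (Suc (Suc 0))" using D_F[OF T] by (auto simp: F_def)
  moreover have "fst (D 0 Y) True = hoch (- fst (D 0 T) True)"
    using e face0_D[OF T] by (simp add: fhoch_def hoch_lin)
  ultimately show ?thesis using words_minus by blast
qed

lemma hoch_D0:
  assumes z: "z \<in> words (Suc (Suc 0))"
  shows "\<exists>Y\<in>F (Suc 0) (Suc 0). hoch z = fst (D 0 Y) True"
proof -
  define v where "v = face0 z"
  have v: "v \<in> words (Suc 0)" unfolding v_def using z by (rule face0_words)
  define x :: "'k tagged \<times> 'k tagged" where "x = (\<lambda>s. if s then z - insert_one v else 0, \<lambda>s. 0)"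
  have x: "x \<in> F 0 (Suc (Suc 0))" using z v by (auto simp: F_def x_def intro!: words_diff insert_one_words)
  have "face0 (fst x True) = 0" using face0_insert_one[OF v] by (simp add: x_def face0_lin v_def)
  then obtain T where T: "T \<in> F (Suc 0) (Suc (Suc 0))" "x = D 0 T" using F_exact_0[OF x] by blast
  have "fhoch z - fhoch (insert_one v) = fst (D 0 (fmap fhoch T)) True"
    using arg_cong[OF D_fhoch[OF T(1)], of "\<lambda>x. fst x True"] unfolding T(2)[symmetric]
    by (simp add: fmap_def x_def fhoch_lin)
  moreover have "fhoch (insert_one v) = v"
    using fhoch_insert_one[OF v] fhoch_words0[OF v] by (simp add: insert_one_lin)
  moreover have "fhoch z - v = - hoch z" by (simp add: fhoch_def v_def)
  ultimately have "hoch z = - fst (D 0 (fmap fhoch T)) True" by (metis minus_minus)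
  then have "hoch z = fst (D 0 (fdiff fzero (fmap fhoch T))) True"
    unfolding D_fdiff D_fzero by (simp add: fdiff_def fzero_def)
  moreover have "fdiff fzero (fmap fhoch T) \<in> F (Suc 0) (Suc 0)"
  proof (rule fdiff_F[OF _ fhoch_F[OF T(1)]])
    show "fzero \<in> F (Suc 0) (Suc 0)" by (simp add: F_def fzero_def)
  qed
  ultimately show ?thesis by blast
qed

lemma D0_surj:
  assumes x: "x \<in> words (Suc 0)"
    and ex: "\<And>w. \<exists>y. snd y False = 0 \<and> fst (PD 0 w y) True = wcw x w"
  shows "\<exists>z\<in>words (Suc (Suc 0)). x = hoch z"
proof -
  have "\<exists>y. snd y False = 0 \<and> fst (PD 0 w y) True = wcw x w \<and> (wcw x w = 0 \<longrightarrow> y = pzero)" for w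
  proof (cases "wcw x w = 0")
    case True
    then show ?thesis by (intro exI[of _ pzero]) (simp add: pzero_def PD_def pcol_def)
  qed (use ex in blast)
  then obtain G where G: "\<And>w. snd (G w) False = 0" "\<And>w. fst (PD 0 w (G w)) True = wcw x w"
    "\<And>w. wcw x w = 0 \<Longrightarrow> G w = pzero" by metis
  have "finite {w. G w \<noteq> pzero}"
    by (rule finite_subset[OF _ finite_wcw[of x]]) (use G(3) in blast)
  moreover have "pvalid (Suc 0) (G w)" for w using G by (simp add: pvalid_def)
  ultimately obtain Y where Y: "Y \<in> F (Suc 0) (Suc 0)" "\<And>w. comp (Suc 0) w Y = G w"
    using comp_exists by blast
  have "wcw (fst (D 0 Y) True) w = wcw x w" for w
    using arg_cong[OF comp_D[OF Y(1), of w], of "\<lambda>x. fst x True"] Y(2) G(2) by (simp add: comp_def wt_def)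
  moreover have "fst (D 0 Y) True \<in> words (Suc 0)" using D_F[OF Y(1)] by (auto simp: F_def)
  ultimately have "x = fst (D 0 Y) True" using x by (intro words1_eqI) auto
  then show ?thesis using D0_hoch[OF Y(1)] by simp
qed

lemma hoch_surj_twisted:
  assumes "eps \<noteq> 1" "x \<in> weight_words (Suc 0) 1"
  shows "\<exists>z\<in>weight_words (Suc (Suc 0)) 1. x = hoch z"
proof -
  have "\<exists>z\<in>words (Suc (Suc 0)). x = hoch z"
    using assms PD_exact_unit_0 eigenvalue_zero weight_words_words by (intro D0_surj) blast+
  then obtain z where "z \<in> words (Suc (Suc 0))" "x = hoch z" by blast
  then show ?thesis
    using proj_one_weight_words[OF assms(2)] proj_one_hoch proj_one_words by metis
qed

lemma hoch_span:
  assumes eps1: "eps = 1" and x: "x \<in> weight_words (Suc 0) 1"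
  shows "\<exists>z\<in>weight_words (Suc (Suc 0)) 1. \<exists>a b. x = hoch z + fscale a (basis [(0, 0)]) + fscale b (basis [(1, 0)])"
proof -
  obtain y a b where y: "snd y False = 0" "wcw x 0 = fst (PD 0 0 y) True + [:a, b:]"
    using PD_0_zero_surj[OF eps1] by blast
  define r where "r = fscale a (basis [(0, 0)]) + fscale b (basis [(1 :: nat, 0 :: int)])"
  have wr: "wcw r j = (if j = 0 then [:a, b:] else 0)" for j
    by (auto simp: r_def wcw_add wcw_fscale wcw_basis monom_0 monom_Suc)
  have "chi (1, 0) = 1" unfolding chi_def by (simp add: eps1)
  then have r1: "r \<in> weight_words (Suc 0) 1"
    unfolding r_def by (intro weight_words_intros) simp_all
  have "\<exists>z\<in>words (Suc (Suc 0)). x - r = hoch z"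
  proof (rule D0_surj)
    show "x - r \<in> words (Suc 0)" using x r1 by (intro words_diff weight_words_words)
    show "\<exists>y. snd y False = 0 \<and> fst (PD 0 w y) True = wcw (x - r) w" for w
    proof (cases "w = 0")
      case True
      then show ?thesis using y by (intro exI[of _ y]) (simp add: wcw_diff wr)
    next
      case False
      then show ?thesis using PD_exact_unit_0 eigenvalue_zero by blast
    qed
  qed
  then obtain z where z: "z \<in> words (Suc (Suc 0))" "x - r = hoch z" by blast
  have "x - r = proj_one (x - r)" using proj_one_weight_words[OF weight_words_diff[OF x r1]] by simp
  also have "\<dots> = hoch (proj_one z)" using z by (simp add: proj_one_hoch)
  finally have "x = hoch (proj_one z) + r" by (simp add: algebra_simps)
  then show ?thesis using proj_one_words[OF z(1)] by (auto simp: r_def add.assoc)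
qed

lemma hoch_indep:
  assumes eps1: "eps = 1" and z: "z \<in> words (Suc (Suc 0))"
    and eq: "fscale a (basis [(0, 0)]) + fscale b (basis [(1, 0)]) = hoch z"
  shows "a = 0 \<and> b = 0"
proof -
  obtain Y where Y: "Y \<in> F (Suc 0) (Suc 0)" "hoch z = fst (D 0 Y) True" using hoch_D0[OF z] by blast
  have "wcw (hoch z) 0 = [:a, b:]"
    unfolding eq[symmetric] by (simp add: wcw_add wcw_fscale wcw_basis monom_0 monom_Suc)
  moreover have "wcw (hoch z) 0 = fst (PD 0 0 (comp (Suc 0) 0 Y)) True"
    using arg_cong[OF comp_D[OF Y(1), of 0], of "\<lambda>x. fst x True"] Y(2) by (simp add: comp_def wt_def)
  ultimately show ?thesis using PD_0_zero_indep[OF eps1] by metis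
qed

end

section \<open>Tensor powers of the algebra in terms of words\<close>

lemma subspace_mem:
  assumes "fvs.subspace S"
  shows "0 \<in> S" "x \<in> S \<Longrightarrow> y \<in> S \<Longrightarrow> x + y \<in> S" "x \<in> S \<Longrightarrow> fscale a x \<in> S"
    "x \<in> S \<Longrightarrow> y \<in> S \<Longrightarrow> x - y \<in> S"
  using assms by (auto intro: fvs.subspace_0 fvs.subspace_add fvs.subspace_scale fvs.subspace_diff)

lemma subspace_kernel: "klin f \<Longrightarrow> fvs.subspace {x. f x \<in> S}" if "fvs.subspace S"
  using subspace_mem[OF that] by (intro fvs.subspaceI) (auto simp: klin_zero klin_add klin_scale)

lemma subspace_supported: "fvs.subspace (supported S)"
  by (intro fvs.subspaceI) (auto intro: supported_intros)

lemma lin_mem_subspace: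
  assumes "fvs.subspace S" "\<And>i. f i \<in> S"
  shows "lin f v \<in> S"
  unfolding lin_def using assms by (intro fvs.subspace_sum fvs.subspace_scale)

text \<open>The assumption describes only the effect of \<open>tw\<close> on coordinates, so that
  the given automorphisms \<open>\<sigma>\<close> and \<open>\<tau>\<close> are handled
  together.\<close>

locale podles_chains = podles_generic q c d eps l
  for q c d eps l :: "'k::field_char_0" +
  fixes tw :: "'k free_alg set \<Rightarrow> 'k free_alg set"
  assumes tw_class: "\<exists>y. tw (podles_class q c d x) = podles_class q c d y \<and> rep y unit = diag chi (rep x unit)"
begin

abbreviation M :: "('k, 'k free_alg set) module" where "M \<equiv> podles q c d"
abbreviation cls :: "'k free_alg \<Rightarrow> 'k free_alg set" where "cls \<equiv> podles_class q c d"

lemma cls_eq_iff: "cls x = cls y \<longleftrightarrow> rep x unit = rep y unit"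
proof
  assume e: "cls x = cls y"
  have "x \<in> cls x"
    using I_zero by (force simp: podles_class_def a_r_coset_def' free_ring_def)
  then have "x \<in> cls y" using e by simp
  then have "x - y \<in> I" by (auto simp: podles_class_def a_r_coset_def' free_ring_def)
  then show "rep x unit = rep y unit" using eqv_rep by (simp add: eqv_def)
next
  assume "rep x unit = rep y unit"
  then have "x - y \<in> I" by (simp add: eqv_iff[symmetric] eqv_def)
  then show "cls x = cls y" by (rule podles_class_eqI)
qed

lemma carrier_M: "carrier M = range cls"
  by (auto simp: podles_def Let_def FactRing_def A_RCOSETS_def' podles_class_def) (auto simp: free_ring_def)

definition cf :: "'k free_alg set \<Rightarrow> 'k pvec" where
  "cf X = rep (SOME x. X = cls x) unit"

lemma cf_cls [simp]: "cf (cls x) = rep x unit"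
proof -
  have "cls x = cls (SOME y. cls x = cls y)" by (rule someI[of _ x]) simp
  then show ?thesis by (simp add: cf_def cls_eq_iff)
qed

lemma cf_eq: "X \<in> carrier M \<Longrightarrow> Y \<in> carrier M \<Longrightarrow> cf X = cf Y \<Longrightarrow> X = Y"
  unfolding carrier_M using cls_eq_iff by (elim imageE) simp

lemma cls_carrier [simp]: "cls x \<in> carrier M"
  by (simp add: carrier_M)

lemma cf_mult: "X \<in> carrier M \<Longrightarrow> Y \<in> carrier M \<Longrightarrow> cf (X \<otimes>\<^bsub>M\<^esub> Y) = mul (cf X) (cf Y) \<and> X \<otimes>\<^bsub>M\<^esub> Y \<in> carrier M"
  and cf_add: "X \<in> carrier M \<Longrightarrow> Y \<in> carrier M \<Longrightarrow> cf (X \<oplus>\<^bsub>M\<^esub> Y) = cf X + cf Y \<and> X \<oplus>\<^bsub>M\<^esub> Y \<in> carrier M"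
  and cf_smult: "X \<in> carrier M \<Longrightarrow> cf (a \<odot>\<^bsub>M\<^esub> X) = fscale a (cf X) \<and> a \<odot>\<^bsub>M\<^esub> X \<in> carrier M"
  and cf_one: "cf \<one>\<^bsub>M\<^esub> = unit" "\<one>\<^bsub>M\<^esub> \<in> carrier M"
  by (auto simp: carrier_M podles_operations rep_simps rep_mult mul_rep)

lemma cf_tw: "X \<in> carrier M \<Longrightarrow> cf (tw X) = diag chi (cf X)" and tw_carrier: "X \<in> carrier M \<Longrightarrow> tw X \<in> carrier M"
  using tw_class by (auto simp: carrier_M) (metis cf_cls, metis rangeI)

definition bas :: "nat \<times> int \<Rightarrow> 'k free_alg set" where
  "bas i = cls (lift (basis i))"

lemma bas_carrier [simp]: "bas i \<in> carrier M" and cf_bas [simp]: "cf (bas i) = basis i"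
  by (simp_all add: bas_def rep_lift_unit)

definition tens :: "'k free_alg set list \<Rightarrow> ((nat \<times> int) list \<Rightarrow>\<^sub>0 'k)" where
  "tens as = foldr (\<lambda>a. tcons (cf a)) as (basis [])"

lemma tens_simps [simp]: "tens [] = basis []" "tens (a # as) = tcons (cf a) (tens as)"
  by (simp_all add: tens_def)

lemma tens_words: "tens as \<in> words (length as)"
  by (induction as) (auto intro: tcons_words)

definition Psi :: "('k free_alg set list \<Rightarrow>\<^sub>0 'k) \<Rightarrow> ((nat \<times> int) list \<Rightarrow>\<^sub>0 'k)" where
  "Psi = lin tens"

lemma klin_Psi [klin_intros]: "klin f \<Longrightarrow> klin (\<lambda>x. Psi (f x))"
  unfolding Psi_def by (intro klin_intros)

lemma Psi_basis [simp]: "Psi (basis as) = tens as"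
  by (simp add: Psi_def)

lemmas Psi_lin =
  klin_Psi[OF klin_id, THEN klin_zero] klin_Psi[OF klin_id, THEN klin_add]
  klin_Psi[OF klin_id, THEN klin_diff] klin_Psi[OF klin_id, THEN klin_minus]
  klin_Psi[OF klin_id, THEN klin_scale] klin_Psi[OF klin_id, THEN klin_sum]

text \<open>A section of \<open>Psi\<close>, inverse to it modulo \<open>tensor_rel\<close>; so the
  tensor powers presented by generators and relations are replaced by words in the basis.\<close>

definition unPsi :: "((nat \<times> int) list \<Rightarrow>\<^sub>0 'k) \<Rightarrow> ('k free_alg set list \<Rightarrow>\<^sub>0 'k)" where
  "unPsi = lin (\<lambda>w. basis (map bas w))"

lemma klin_unPsi [klin_intros]: "klin f \<Longrightarrow> klin (\<lambda>x. unPsi (f x))"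
  unfolding unPsi_def by (intro klin_intros)

lemma tens_map_bas: "tens (map bas w) = basis w"
  by (induction w) auto

lemma Psi_unPsi: "Psi (unPsi y) = y"
  by (rule klin_ext[where v = y]) (auto intro!: klin_intros simp: unPsi_def tens_map_bas)

lemma chains_supported: "chains M n = supported (tuples M n)"
  by (simp add: chains_def supported_def)

lemma unPsi_chains: "y \<in> words (Suc n) \<Longrightarrow> unPsi y \<in> chains M n"
  unfolding words_def chains_supported
  by (rule klin_supported, assumption) (auto intro!: klin_intros simp: unPsi_def tuples_def)

lemma Psi_chains: "x \<in> chains M n \<Longrightarrow> Psi x \<in> words (Suc n)"
  unfolding words_def chains_supported
proof (rule klin_supported, assumption)
  fix as assume "as \<in> tuples M n"
  then show "Psi (basis as) \<in> supported {w. length w = Suc n}"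
    using tens_words[of as] by (simp add: tuples_def words_def)
qed (intro klin_intros)

lemma tensor_rel_subspace: "fvs.subspace (tensor_rel M n)"
  unfolding tensor_rel_def by (rule fvs.subspace_span)

lemma tens_linear:
  "a \<in> carrier M \<Longrightarrow> b \<in> carrier M \<Longrightarrow> tens (us @ (a \<oplus>\<^bsub>M\<^esub> b) # vs) = tens (us @ a # vs) + tens (us @ b # vs)"
  "a \<in> carrier M \<Longrightarrow> tens (us @ (s \<odot>\<^bsub>M\<^esub> a) # vs) = fscale s (tens (us @ a # vs))"
  by (induction us) (auto simp: cf_add cf_smult tcons_simps)

lemma Psi_tensor_rel: "x \<in> tensor_rel M n \<Longrightarrow> Psi x = 0"
proof -
  have "fvs.subspace {x. Psi x \<in> {0}}"
    by (rule subspace_kernel) (auto intro!: klin_intros klin_Psi[OF klin_id] simp: fvs.subspace_def)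
  moreover have "a \<in> carrier M" if "us @ a # vs \<in> tuples M n" for us a vs
    using that by (auto simp: tuples_def)
  ultimately have "tensor_rel M n \<subseteq> {x. Psi x \<in> {0}}"
    unfolding tensor_rel_def by (intro fvs.span_minimal) (auto simp: Psi_lin tens_linear)
  then show "x \<in> tensor_rel M n \<Longrightarrow> Psi x = 0" by auto
qed

lemma tensor_rel_chains: "tensor_rel M n \<subseteq> chains M n"
  unfolding tensor_rel_def chains_supported
proof (rule fvs.span_minimal[OF _ subspace_supported], safe)
  fix us vs a b assume "us @ a # vs \<in> tuples M n" "b \<in> carrier M"
  moreover from this have "us @ b # vs \<in> tuples M n" "us @ (a \<oplus>\<^bsub>M\<^esub> b) # vs \<in> tuples M n"
    using cf_add[of a b] by (simp_all add: tuples_def)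
  ultimately show "basis (us @ (a \<oplus>\<^bsub>M\<^esub> b) # vs) - basis (us @ a # vs) - basis (us @ b # vs) \<in> supported (tuples M n)"
    by (intro supported_diff) simp_all
next
  fix us vs a s assume "us @ a # vs \<in> tuples M n"
  moreover from this have "us @ (s \<odot>\<^bsub>M\<^esub> a) # vs \<in> tuples M n"
    using cf_smult[of a s] by (simp add: tuples_def)
  ultimately show "basis (us @ (s \<odot>\<^bsub>M\<^esub> a) # vs) - fscale s (basis (us @ a # vs)) \<in> supported (tuples M n)"
    by (intro supported_diff supported_scale) simp_all
qed

lemma expand_slot:
  assumes "us @ a # vs \<in> tuples M n"
  shows "lin (\<lambda>i. basis (us @ bas i # vs)) v - basis (us @ cls (lift v) # vs) \<in> tensor_rel M n"
proof -
  have t: "us @ cls x # vs \<in> tuples M n" for x using assms by (auto simp: tuples_def)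
  have addg: "basis (us @ cls (x + y) # vs) - basis (us @ cls x # vs) - basis (us @ cls y # vs) \<in> tensor_rel M n" for x y
    unfolding tensor_rel_def podles_operations(3)[symmetric]
    by (rule fvs.span_base) (use t cls_carrier in blast)
  have scaleg: "basis (us @ cls (fscale s x) # vs) - fscale s (basis (us @ cls x # vs)) \<in> tensor_rel M n" for s x
    unfolding tensor_rel_def podles_operations(4)[symmetric]
    by (rule fvs.span_base) (use t in blast)
  note S = subspace_mem[OF tensor_rel_subspace]
  show ?thesis
  proof (induction v rule: free_vector_induct)
    case zero
    show ?case using S(3)[OF scaleg[of 0 0], of "-1"] by (simp add: lift_lin)
  next
    case (add u v)
    from S(4)[OF S(2)[OF add] addg[of "lift u" "lift v"]] show ?case
      by (simp add: lift_lin lin_add algebra_simps)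
  next
    case (scale s v)
    from S(4)[OF S(3)[OF scale, of s] scaleg[of s "lift v"]] show ?case
      by (simp add: lift_lin lin_fscale fvs.scale_right_diff_distrib)
  next
    case (basis i)
    show ?case by (simp add: bas_def S(1))
  qed
qed

text \<open>The prefix \<open>us\<close> is arbitrary because the induction expands the first slot
  and then moves it into the prefix.\<close>

lemma expand_tuple:
  assumes "us @ as \<in> tuples M n"
  shows "lin (\<lambda>w. basis (us @ map bas w)) (tens as) - basis (us @ as) \<in> tensor_rel M n"
  using assms
proof (induction as arbitrary: us)
  case Nil
  then show ?case by (simp add: subspace_mem[OF tensor_rel_subspace])
next
  case (Cons a as)
  note S = subspace_mem[OF tensor_rel_subspace]
  have a: "a \<in> carrier M" using Cons.prems by (auto simp: tuples_def)
  then have "cls (lift (cf a)) = a" by (intro cf_eq) (simp_all add: rep_lift_unit)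
  then have 1: "lin (\<lambda>i. basis (us @ bas i # as)) (cf a) - basis (us @ a # as) \<in> tensor_rel M n"
    using expand_slot[OF Cons.prems, of "cf a"] by simp
  have 2: "lin (\<lambda>w. basis (us @ map bas w)) (tcons v y)
      = lin (\<lambda>i. lin (\<lambda>w. basis ((us @ [bas i]) @ map bas w)) y) v" for v y
  proof (rule klin_ext[where v = v])
    show "lin (\<lambda>w. basis (us @ map bas w)) (tcons (basis i) y) =
        lin (\<lambda>i. lin (\<lambda>w. basis ((us @ [bas i]) @ map bas w)) y) (basis i)" for i
      by (rule klin_ext[where v = y]) (auto intro!: klin_intros)
  qed (intro klin_intros)+
  have "(us @ [bas i]) @ as \<in> tuples M n" for i using Cons.prems by (auto simp: tuples_def)
  note IH = Cons.IH[OF this]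
  have "lin (\<lambda>i. lin (\<lambda>w. basis ((us @ [bas i]) @ map bas w)) (tens as) - basis ((us @ [bas i]) @ as)) (cf a)
      \<in> tensor_rel M n"
    by (rule lin_mem_subspace[OF tensor_rel_subspace IH])
  moreover have "lin (\<lambda>i. f i - g i) v = lin f v - lin g v" for f g :: "nat \<times> int \<Rightarrow> 'k free_alg set list \<Rightarrow>\<^sub>0 'k" and v
    by (simp add: lin_def fvs.scale_right_diff_distrib sum_subtractf)
  ultimately have "lin (\<lambda>w. basis (us @ map bas w)) (tens (a # as)) - lin (\<lambda>i. basis (us @ bas i # as)) (cf a)
      \<in> tensor_rel M n"
    by (simp add: 2)
  from S(2)[OF this 1] show ?case by simp
qed

lemma unPsi_Psi: "x \<in> chains M n \<Longrightarrow> unPsi (Psi x) - x \<in> tensor_rel M n"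
  unfolding chains_supported
proof (induction rule: supported_induct)
  case (basis as)
  then show ?case using expand_tuple[of "[]" as n] by (simp add: unPsi_def)
qed (auto simp: Psi_lin klin_zero[OF klin_unPsi[OF klin_id]] klin_add[OF klin_unPsi[OF klin_id]] klin_scale[OF klin_unPsi[OF klin_id]]
    subspace_mem[OF tensor_rel_subspace] add_diff_add fvs.scale_right_diff_distrib[symmetric])

lemma tensor_rel_iff: "x \<in> chains M n \<Longrightarrow> x \<in> tensor_rel M n \<longleftrightarrow> Psi x = 0"
proof
  assume "x \<in> chains M n" "Psi x = 0"
  then have "- x \<in> tensor_rel M n" using unPsi_Psi[of x n] by (simp add: klin_zero[OF klin_unPsi[OF klin_id]])
  then show "x \<in> tensor_rel M n" using subspace_mem(3)[OF tensor_rel_subspace, of "- x" n "-1"] by simp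
qed (rule Psi_tensor_rel)

definition good :: "'k free_alg set list set" where
  "good = {as. as \<noteq> [] \<and> set as \<subseteq> carrier M}"

lemma tuples_good: "tuples M n \<subseteq> good"
  by (auto simp: tuples_def good_def)

lemma chains_good: "x \<in> chains M n \<Longrightarrow> x \<in> supported good"
  unfolding chains_supported using supported_mono tuples_good by blast

definition tsn :: "'k pvec \<Rightarrow> ((nat \<times> int) list \<Rightarrow>\<^sub>0 'k) \<Rightarrow> ((nat \<times> int) list \<Rightarrow>\<^sub>0 'k)" where
  "tsn v y = lin (\<lambda>i. tsnoc i y) v"

lemma tens_snoc: "tens (as @ [z]) = tsn (cf z) (tens as)"
proof (induction as)
  case Nil
  have "tcons v (basis []) = tsn v (basis [])" for v
    by (rule klin_ext[where v = v]) (auto intro!: klin_intros simp: tsn_def)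
  then show ?case by simp
next
  case (Cons a as)
  have "tcons u (tsn v y) = tsn v (tcons u y)" for u v y
    by (rule klin_ext[where v = v]) (auto intro!: klin_intros simp: tsn_def tsnoc_tcons)
  then show ?case using Cons by simp
qed

lemma cycl_tens: "cycl (tens (as @ [z])) = fscale ((-1) ^ length as) (tcons (diag chi (cf z)) (tens as))"
proof -
  have "cycl (tsn v (tens as)) = fscale ((-1) ^ length as) (tcons (diag chi v) (tens as))" for v
    by (rule klin_ext[where v = v])
      (auto intro!: klin_intros simp: tsn_def cycl_tsnoc[OF tens_words] tcons_simps mult.commute)
  then show ?thesis by (simp add: tens_snoc)
qed

lemma cyc_basis: "cyc tw (basis (as @ [z])) = fscale ((-1) ^ length as) (basis (tw z # as))"
  by (simp add: cyc_def)

lemma klin_cyc [klin_intros]: "klin f \<Longrightarrow> klin (\<lambda>x. cyc tw (f x))"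
  unfolding cyc_def by (intro klin_intros)

lemma good_snocE:
  assumes "as \<in> good"
  obtains u z where "as = u @ [z]" "z \<in> carrier M" "set u \<subseteq> carrier M"
  using assms by (cases as rule: rev_cases) (auto simp: good_def)

lemma Psi_cyc: "x \<in> supported good \<Longrightarrow> Psi (cyc tw x) = cycl (Psi x)"
proof (rule klin_ext_on, assumption)
  fix as assume "as \<in> good"
  then show "Psi (cyc tw (basis as)) = cycl (Psi (basis as))"
    by (rule good_snocE) (simp add: cyc_basis Psi_lin cf_tw cycl_tens)
qed (intro klin_intros)+

lemma cyc_supported:
  assumes "x \<in> supported S" "S \<subseteq> good" "\<And>u z. u @ [z] \<in> S \<Longrightarrow> tw z # u \<in> S"
  shows "cyc tw x \<in> supported S"
  using assms(1)
proof (rule klin_supported)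
  fix as assume as: "as \<in> S"
  then have "as \<in> good" using assms(2) by auto
  then show "cyc tw (basis as) \<in> supported S"
    by (rule good_snocE) (use assms(3) as in \<open>auto simp: cyc_basis intro!: supported_scale\<close>)
qed (intro klin_intros)

lemma cyc_chains: "x \<in> chains M n \<Longrightarrow> cyc tw x \<in> chains M n"
  unfolding chains_supported
  by (rule cyc_supported[OF _ tuples_good]) (auto simp: tuples_def tw_carrier)

definition inner_face :: "nat \<Rightarrow> 'k free_alg set list \<Rightarrow> 'k free_alg set list" where
  "inner_face j as = take j as @ (as ! j \<otimes>\<^bsub>M\<^esub> as ! Suc j) # drop (j + 2) as"

lemma bar_tens:
  "set as \<subseteq> carrier M \<Longrightarrow> bar (tens as) = (\<Sum>j<length as - 1. fscale ((-1) ^ j) (tens (inner_face j as)))"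
proof (induction as)
  case Nil
  then show ?case by simp
next
  case (Cons a as)
  show ?case
  proof (cases as)
    case Nil
    have "tcons (cf a) (basis []) \<in> words (Suc 0)" by (rule tcons_words) simp
    then show ?thesis using Nil bar_words0 by simp
  next
    case bs: (Cons b bs)
    have f: "tens (inner_face 0 (a # as)) = face0 (tcons (cf a) (tens as))"
      using Cons.prems bs by (simp add: cf_mult inner_face_def)
    have e: "fscale ((-1) ^ Suc j) (tens (inner_face (Suc j) (a # as))) =
        - tcons (cf a) (fscale ((-1) ^ j) (tens (inner_face j as)))" for j
      by (simp add: tcons_simps inner_face_def)
    have "length (a # as) - 1 = Suc (length as - 1)" by (simp add: bs)
    then have "(\<Sum>j<length (a # as) - 1. fscale ((-1) ^ j) (tens (inner_face j (a # as)))) =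
        tens (inner_face 0 (a # as)) + (\<Sum>j<length as - 1. - tcons (cf a) (fscale ((-1) ^ j) (tens (inner_face j as))))"
      unfolding e[symmetric] by (simp only: sum.lessThan_Suc_shift power_0 fvs.scale_one)
    also have "\<dots> = face0 (tens (a # as)) - tcons (cf a) (bar (tens as))"
      using Cons by (simp add: f klin_sum[OF klin_tcons_right[OF klin_id]] sum_negf)
    finally show ?thesis by (simp add: bar_tcons)
  qed
qed

lemma hoch_b_basis: "2 \<le> length as \<Longrightarrow> hoch_b M tw (basis as) =
    (\<Sum>j<length as - 1. fscale ((-1) ^ j) (basis (inner_face j as)))
    + fscale ((-1) ^ (length as - 1)) (basis ((tw (last as) \<otimes>\<^bsub>M\<^esub> hd as) # butlast (tl as)))"
  "length as \<le> 1 \<Longrightarrow> hoch_b M tw (basis as) = 0"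
  unfolding hoch_b_def lin_basis inner_face_def
  by (rule if_not_P, simp) (rule if_P)

lemma klin_hoch_b [klin_intros]: "klin f \<Longrightarrow> klin (\<lambda>x. hoch_b M tw (f x))"
  unfolding hoch_b_def by (intro klin_intros)

lemma Psi_hoch_b: "x \<in> supported good \<Longrightarrow> Psi (hoch_b M tw x) = hoch (Psi x)"
proof (rule klin_ext_on, assumption)
  fix as assume as: "as \<in> good"
  show "Psi (hoch_b M tw (basis as)) = hoch (Psi (basis as))"
  proof (cases "length as \<le> 1")
    case True
    then have "length as = Suc 0" using as by (cases as) (auto simp: good_def)
    then have "hoch (tens as) = 0" using tens_words[of as] hoch_words0 by simp
    then show ?thesis using True by (simp add: hoch_b_basis Psi_lin)
  next
    case False
    obtain a u z where u: "as = a # u @ [z]"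
      using False by (cases as; cases "tl as" rule: rev_cases) auto
    have c: "set as \<subseteq> carrier M" "z \<in> carrier M" "a \<in> carrier M" using as u by (auto simp: good_def)
    have "face0 (cycl (tens as)) = fscale ((-1) ^ Suc (length u)) (tens ((tw z \<otimes>\<^bsub>M\<^esub> a) # u))"
      using cycl_tens[of "a # u" z] c by (simp add: u face0_lin cf_mult tw_carrier cf_tw)
    then show ?thesis
      using False bar_tens[OF c(1)] by (simp add: hoch_b_basis Psi_lin hoch_def) (simp add: u)
  qed
qed (intro klin_intros)+

lemma face_tuples:
  assumes "as \<in> tuples M (Suc n)" "j < Suc n"
  shows "inner_face j as \<in> tuples M n"
proof -
  have "as ! j \<in> carrier M" "as ! Suc j \<in> carrier M" using assms by (auto simp: tuples_def subset_iff)
  moreover have "set (take j as) \<subseteq> carrier M" "set (drop (j + 2) as) \<subseteq> carrier M"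
    using assms set_take_subset[of j as] set_drop_subset[of "j + 2" as] by (auto simp: tuples_def)
  ultimately show ?thesis using assms by (auto simp: tuples_def cf_mult inner_face_def)
qed

lemma hoch_b_chains: "x \<in> chains M (Suc n) \<Longrightarrow> hoch_b M tw x \<in> chains M n"
  unfolding chains_supported
proof (rule klin_supported, assumption)
  fix as assume as: "as \<in> tuples M (Suc n)"
  then have l: "2 \<le> length as" "length as - 1 = Suc n" by (simp_all add: tuples_def)
  then obtain a u z where u: "as = a # u @ [z]"
    by (cases as; cases "tl as" rule: rev_cases) auto
  have "(tw (last as) \<otimes>\<^bsub>M\<^esub> hd as) # butlast (tl as) \<in> tuples M n"
    using as by (auto simp: u tuples_def cf_mult tw_carrier)
  then have "basis ((tw (last as) \<otimes>\<^bsub>M\<^esub> hd as) # butlast (tl as)) \<in> supported (tuples M n)" by simp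
  moreover have "basis (inner_face j as) \<in> supported (tuples M n)" if "j \<in> {..<Suc n}" for j
    using face_tuples[OF as] that by simp
  ultimately show "hoch_b M tw (basis as) \<in> supported (tuples M n)"
    unfolding hoch_b_basis(1)[OF l(1)] l(2)
    by (intro supported_add supported_sum supported_scale) assumption+
qed (intro klin_intros)

lemma hoch_b_chains0: "x \<in> chains M 0 \<Longrightarrow> hoch_b M tw x = 0"
  unfolding chains_supported
  by (rule klin_ext_on[where g = "\<lambda>_. 0"], assumption) ((intro klin_intros)+, simp add: hoch_b_basis tuples_def)

lemma klin_cyc_norm [klin_intros]: "klin f \<Longrightarrow> klin (\<lambda>x. cyc_norm tw (f x))"
  unfolding cyc_norm_def by (intro klin_intros)

lemma klin_norm_op [klin_intros]: "klin f \<Longrightarrow> klin (\<lambda>x. norm_op (f x))"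
  unfolding norm_op_def by (intro klin_intros)

lemma cyc_pow_chains: "x \<in> chains M n \<Longrightarrow> (cyc tw ^^ i) x \<in> chains M n"
  by (induction i) (auto intro: cyc_chains)

lemma cyc_norm_chains: "x \<in> chains M n \<Longrightarrow> cyc_norm tw x \<in> chains M n"
  unfolding chains_supported
proof (rule klin_supported, assumption)
  fix as assume "as \<in> tuples M n"
  then have "(cyc tw ^^ i) (basis as :: _ \<Rightarrow>\<^sub>0 'k) \<in> supported (tuples M n)" for i
    using cyc_pow_chains[of "basis as" n i] by (simp add: chains_supported)
  then show "cyc_norm tw (basis as :: _ \<Rightarrow>\<^sub>0 'k) \<in> supported (tuples M n)"
    unfolding cyc_norm_def lin_basis by (intro supported_sum)
qed (intro klin_intros)

lemma Psi_cyc_norm: "x \<in> supported good \<Longrightarrow> Psi (cyc_norm tw x) = norm_op (Psi x)"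
proof (rule klin_ext_on, assumption)
  fix as assume as: "as \<in> good"
  then have "as \<in> tuples M (length as - 1)" by (auto simp: good_def tuples_def)
  then have ch: "(cyc tw ^^ i) (basis as) \<in> chains M (length as - 1)" for i
    by (intro cyc_pow_chains) (simp add: chains_supported)
  have "Psi ((cyc tw ^^ i) (basis as)) = (cycl ^^ i) (tens as)" for i
    by (induction i) (simp_all add: Psi_cyc[OF chains_good[OF ch]])
  then show "Psi (cyc_norm tw (basis as)) = norm_op (Psi (basis as))"
    using norm_op_words[OF tens_words[of as]] by (simp add: cyc_norm_def Psi_lin)
qed (intro klin_intros)+

abbreviation cons_one :: "('k free_alg set list \<Rightarrow>\<^sub>0 'k) \<Rightarrow> ('k free_alg set list \<Rightarrow>\<^sub>0 'k)" where
  "cons_one \<equiv> lin (\<lambda>as. basis (\<one>\<^bsub>M\<^esub> # as))"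

lemma Psi_cons_one: "Psi (cons_one x) = tcons unit (Psi x)"
  by (rule klin_ext[where v = x]) (auto intro!: klin_intros simp: cf_one)

lemma cons_one_chains: "(x :: _ \<Rightarrow>\<^sub>0 'k) \<in> chains M n \<Longrightarrow> cons_one x \<in> chains M (Suc n)"
  unfolding chains_supported
  by (rule klin_supported, assumption) (auto intro!: klin_intros simp: tuples_def cf_one)

lemma connes_B_eq: "connes_B M tw x = cons_one (cyc_norm tw x) - cyc tw (cons_one (cyc_norm tw x))"
  by (simp add: connes_B_def Let_def)

lemma klin_connes_B [klin_intros]: "klin f \<Longrightarrow> klin (\<lambda>x. connes_B M tw (f x))"
  unfolding connes_B_eq by (intro klin_intros)

lemma connes_B_chains: "x \<in> chains M n \<Longrightarrow> connes_B M tw x \<in> chains M (Suc n)"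
  using cyc_chains[OF cons_one_chains[OF cyc_norm_chains]] cons_one_chains[OF cyc_norm_chains]
  unfolding connes_B_eq chains_supported by (intro supported_diff)

lemma good_chains_ext:
  assumes "x \<in> supported good" "klin f" "klin g" "\<And>n y. y \<in> chains M n \<Longrightarrow> f y = g y"
  shows "f x = g x"
  using assms(1)
proof (rule klin_ext_on)
  fix as assume "as \<in> good"
  then have "basis as \<in> chains M (length as - 1)" by (auto simp: good_def tuples_def chains_supported)
  then show "f (basis as) = g (basis as)" by (rule assms(4))
qed (use assms in auto)

lemma Psi_connes_B: "x \<in> supported good \<Longrightarrow> Psi (connes_B M tw x) = cyc.B (Psi x)"
proof (rule good_chains_ext, assumption)
  fix n y assume y: "y \<in> chains M n"
  have "Psi (cons_one (cyc_norm tw y)) = tcons unit (norm_op (Psi y))"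
    by (simp add: Psi_cons_one Psi_cyc_norm[OF chains_good[OF y]])
  then show "Psi (connes_B M tw y) = cyc.B (Psi y)"
    using chains_good[OF cons_one_chains[OF cyc_norm_chains[OF y]]]
    by (simp add: connes_B_eq cyc.B_def Psi_lin Psi_cyc)
qed (unfold cyc.B_def, (intro klin_intros)+)

lemma klin_upper [klin_intros]: "klin f \<Longrightarrow> klin (\<lambda>x. upper n (f x))"
  unfolding upper_def by (intro klin_intros)

lemma klin_wproj [klin_intros]: "klin f \<Longrightarrow> klin (\<lambda>x. wproj n (f x))"
  unfolding wproj_def by (intro klin_intros)

lemma wproj_words: "y \<in> words m \<Longrightarrow> wproj n y = (if m = Suc n then y else 0)"
  by (rule words_ext, assumption) (auto intro!: klin_intros simp: wproj_def)

lemma Psi_upper: "Psi (upper n x) = wproj n (Psi x)"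
  by (rule klin_ext[where v = x]) (auto intro!: klin_intros simp: upper_def wproj_words[OF tens_words] Psi_lin)

lemma upper_chains: "x \<in> supported good \<Longrightarrow> upper n x \<in> chains M n"
  unfolding chains_supported
  by (rule klin_supported, assumption) (auto intro!: klin_intros simp: upper_def good_def tuples_def)

end

section \<open>Coordinates of weight one\<close>

context podles_chains
begin

abbreviation V :: "nat \<Rightarrow> ((nat \<times> int) list \<Rightarrow>\<^sub>0 'k) set" where
  "V n \<equiv> weight_words (Suc n) 1"

lemma proj_one_commute:
  assumes "x \<in> supported S" "klin f"
    and "\<And>w. w \<in> S \<Longrightarrow> \<exists>m. f (basis w) \<in> weight_words m (prod_list (map chi w))"
  shows "proj_one (f x) = f (proj_one x)"
proof (rule klin_ext_on[OF assms(1)])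
  fix w assume "w \<in> S"
  then obtain m where "f (basis w) \<in> weight_words m (prod_list (map chi w))" using assms(3) by blast
  from proj_one_weight_words[OF this] show "proj_one (f (basis w)) = f (proj_one (basis w))"
    by (simp add: proj_one_def klin_zero[OF assms(2)])
qed (use assms(2) in \<open>auto intro: klin_comp klin_proj_one klin_proj_one[OF klin_id]\<close>)

abbreviation nonempty :: "((nat \<times> int) list \<Rightarrow>\<^sub>0 'k) set" where
  "nonempty \<equiv> supported {w. w \<noteq> []}"

lemma basis_weight_words: "w \<noteq> [] \<Longrightarrow> basis w \<in> weight_words (Suc (length w - 1)) (prod_list (map chi w))"
  by simp

lemma norm_op_weight_words:
  assumes "x \<in> weight_words (Suc n) a"
  shows "norm_op x \<in> weight_words (Suc n) a"
proof -
  have "(cycl ^^ i) x \<in> weight_words (Suc n) a" for i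
    using assms by (induction i) (auto intro: cycl_weight_words)
  then show ?thesis
    unfolding norm_op_words[OF weight_words_words[OF assms]] weight_words_def by (intro supported_sum)
qed

lemma unit_weight_words: "x \<in> weight_words n a \<Longrightarrow> tcons unit x \<in> weight_words (Suc n) a"
  using tcons_weight_words[of unit 1 x n a] by (simp add: chi_def)

lemma B_weight_words: "x \<in> weight_words (Suc n) a \<Longrightarrow> cyc.B x \<in> weight_words (Suc (Suc n)) a"
  unfolding cyc.B_def by (intro weight_words_diff cycl_weight_words unit_weight_words norm_op_weight_words)

lemma proj_one_cycl: "x \<in> nonempty \<Longrightarrow> proj_one (cycl x) = cycl (proj_one x)"
  by (rule proj_one_commute, assumption)
    (auto intro: klin_cycl[OF klin_id] intro!: exI cycl_weight_words[OF basis_weight_words])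

lemma proj_one_B: "x \<in> nonempty \<Longrightarrow> proj_one (cyc.B x) = cyc.B (proj_one x)"
  by (rule proj_one_commute, assumption)
    (auto intro: cyc.klin_B intro!: exI B_weight_words[OF basis_weight_words])

lemma proj_one_hoch_all: "x \<in> nonempty \<Longrightarrow> proj_one (hoch x) = hoch (proj_one x)"
proof (rule proj_one_commute, assumption)
  fix w :: "(nat \<times> int) list" assume w: "w \<in> {w. w \<noteq> []}"
  show "\<exists>m. hoch (basis w) \<in> weight_words m (prod_list (map chi w))"
  proof (cases "length w = Suc 0")
    case True
    then show ?thesis using hoch_words0[of "basis w"] by simp
  next
    case False
    then have "length w = Suc (Suc (length w - 2))" using w by (cases w; cases "tl w") auto
    then have "basis w \<in> weight_words (Suc (Suc (length w - 2))) (prod_list (map chi w))" by simp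
    then show ?thesis using hoch_weight_words by blast
  qed
qed (rule klin_hoch[OF klin_id])

lemma proj_one_wproj: "proj_one (wproj n x) = wproj n (proj_one x)"
  by (rule proj_one_commute[OF supported_UNIV])
    (use klin_wproj[OF klin_id] in \<open>auto intro!: exI[of _ "Suc n"] simp: wproj_def\<close>)

text \<open>Coordinates on the quotient by \<open>sigma_rel\<close>: components of weight other than
  1 are zero there, and \<open>sigma_rel_iff\<close> shows that nothing else is lost.\<close>

definition PsiP :: "('k free_alg set list \<Rightarrow>\<^sub>0 'k) \<Rightarrow> ((nat \<times> int) list \<Rightarrow>\<^sub>0 'k)" where
  "PsiP x = proj_one (Psi x)"

lemma klin_PsiP [klin_intros]: "klin f \<Longrightarrow> klin (\<lambda>x. PsiP (f x))"
  unfolding PsiP_def by (intro klin_intros)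

lemmas PsiP_lin =
  klin_PsiP[OF klin_id, THEN klin_zero] klin_PsiP[OF klin_id, THEN klin_add]
  klin_PsiP[OF klin_id, THEN klin_diff] klin_PsiP[OF klin_id, THEN klin_minus]
  klin_PsiP[OF klin_id, THEN klin_scale]

lemmas unPsi_lin =
  klin_unPsi[OF klin_id, THEN klin_zero] klin_unPsi[OF klin_id, THEN klin_add]
  klin_unPsi[OF klin_id, THEN klin_diff] klin_unPsi[OF klin_id, THEN klin_minus]
  klin_unPsi[OF klin_id, THEN klin_scale]

lemma Psi_nonempty: "x \<in> supported good \<Longrightarrow> Psi x \<in> nonempty"
proof (rule klin_supported, assumption)
  fix as assume "as \<in> good"
  then show "Psi (basis as) \<in> nonempty"
    using tens_words[of as] by (auto simp: words_def good_def elim!: supported_mono)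
qed (intro klin_intros klin_id)

lemma PsiP_cyc: "x \<in> supported good \<Longrightarrow> PsiP (cyc tw x) = cycl (PsiP x)"
  and PsiP_hoch_b: "x \<in> supported good \<Longrightarrow> PsiP (hoch_b M tw x) = hoch (PsiP x)"
  and PsiP_connes_B: "x \<in> supported good \<Longrightarrow> PsiP (connes_B M tw x) = cyc.B (PsiP x)"
  and PsiP_upper: "PsiP (upper n x) = wproj n (PsiP x)"
  by (simp_all add: PsiP_def Psi_cyc Psi_hoch_b Psi_connes_B Psi_upper proj_one_cycl proj_one_hoch_all
      proj_one_B proj_one_wproj Psi_nonempty)

lemma PsiP_chains: "x \<in> chains M n \<Longrightarrow> PsiP x \<in> V n"
  unfolding PsiP_def by (intro proj_one_words Psi_chains)

lemma PsiP_unPsi: "y \<in> cyc.Tot n \<Longrightarrow> PsiP (unPsi y) = y"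
  unfolding PsiP_def Psi_unPsi
proof (induction rule: cyc.Tot_induct)
  case (add x y)
  then show ?case by (simp add: klin_add[OF klin_proj_one[OF klin_id]])
next
  case (V m x)
  then show ?case by (simp add: proj_one_weight_words)
qed

lemma PsiP_unPsi_V: "y \<in> V n \<Longrightarrow> PsiP (unPsi y) = y"
  by (rule PsiP_unPsi[OF cyc.V_Tot])

lemma unPsi_V: "y \<in> V n \<Longrightarrow> unPsi y \<in> chains M n"
  by (intro unPsi_chains weight_words_words)

section \<open>The relations\<close>

lemma cyc_pow_append:
  assumes "set v \<subseteq> carrier M"
  shows "(cyc tw ^^ length v) (basis (u @ v)) =
     fscale ((-1) ^ ((length u + length v - 1) * length v)) (basis (map tw v @ u) :: _ \<Rightarrow>\<^sub>0 'k)"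
proof (induction v arbitrary: u rule: rev_induct)
  case (snoc i v)
  have "(cyc tw ^^ length (v @ [i])) (basis (u @ v @ [i]) :: _ \<Rightarrow>\<^sub>0 'k) = (cyc tw ^^ length v) (cyc tw (basis ((u @ v) @ [i])))"
    by (simp add: funpow_swap1)
  also have "\<dots> = (cyc tw ^^ length v) (fscale ((-1) ^ length (u @ v)) (basis ((tw i # u) @ v)))"
    by (subst cyc_basis) simp
  also have "\<dots> = fscale ((-1) ^ length (u @ v)) ((cyc tw ^^ length v) (basis ((tw i # u) @ v)))"
    by (rule klin_scale) (intro klin_funpow klin_intros klin_cyc[OF klin_id])
  also have "\<dots> = fscale ((-1) ^ ((length u + length (v @ [i]) - 1) * length (v @ [i]))) (basis (map tw (v @ [i]) @ u))"
    unfolding snoc.IH by (simp add: power_add mult_ac)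
  finally show ?case .
qed simp

lemma cyc_pow_basis:
  assumes "as \<in> tuples M n"
  shows "(cyc tw ^^ Suc n) (basis as) = (basis (map tw as) :: _ \<Rightarrow>\<^sub>0 'k)"
proof -
  have "even (n * Suc n)" by simp
  then have "(-1::'k) ^ (n * Suc n) = 1" by (rule neg_one_even_power)
  then show ?thesis using cyc_pow_append[of as "[]"] assms by (simp add: tuples_def)
qed

lemma basis_chains: "as \<in> tuples M n \<Longrightarrow> (basis as :: _ \<Rightarrow>\<^sub>0 'k) \<in> chains M n"
  by (simp add: chains_supported)

lemma PsiP_cyc_pow: "x \<in> chains M n \<Longrightarrow> PsiP ((cyc tw ^^ i) x) = (cycl ^^ i) (PsiP x)"
  by (induction i) (simp_all add: PsiP_cyc[OF chains_good[OF cyc_pow_chains]])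

lemma PsiP_tw: "as \<in> tuples M n \<Longrightarrow> PsiP (basis (map tw as)) = PsiP (basis as)"
  using PsiP_cyc_pow[OF basis_chains, of as n "Suc n"] cycl_pow[OF PsiP_chains[OF basis_chains, of as n]]
  by (simp only: cyc_pow_basis)

lemma PsiP_sigma_rel: "x \<in> sigma_rel M tw n \<Longrightarrow> PsiP x = 0"
proof -
  have "fvs.subspace {x. PsiP x \<in> {0}}"
    by (rule subspace_kernel) (auto intro!: klin_PsiP[OF klin_id] simp: fvs.subspace_def)
  then have "sigma_rel M tw n \<subseteq> {x. PsiP x \<in> {0}}"
    unfolding sigma_rel_def
    by (intro fvs.span_minimal)
      (auto simp: PsiP_lin PsiP_tw, simp add: PsiP_def Psi_tensor_rel klin_zero[OF klin_proj_one[OF klin_id]])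
  then show "x \<in> sigma_rel M tw n \<Longrightarrow> PsiP x = 0" by auto
qed

lemma rel_subspace:
  "fvs.subspace (sigma_rel M tw n)" "fvs.subspace (lambda_rel M tw n)" "fvs.subspace (tot_rel M tw n)"
  unfolding sigma_rel_def lambda_rel_def tot_rel_def by (rule fvs.subspace_span)+

lemma tensor_sigma_rel: "tensor_rel M n \<subseteq> sigma_rel M tw n"
  unfolding sigma_rel_def by (auto intro: fvs.span_base)

lemma tens_tw: "tens (map tw (map bas w)) = fscale (prod_list (map chi w)) (basis w)"
  by (induction w) (simp_all add: cf_tw tcons_simps)

text \<open>The automorphism multiplies the word by its weight \<open>a\<close>, so
  \<open>1 - a\<close> times the word is a relation, and this scalar is invertible.\<close>

lemma unPsi_other_weight:
  assumes "length w = Suc n" "prod_list (map chi w) \<noteq> 1"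
  shows "unPsi (basis w) \<in> sigma_rel M tw n"
proof -
  let ?a = "prod_list (map chi w)" and ?e = "basis (map bas w)" and ?f = "basis (map tw (map bas w))"
  note S = subspace_mem[OF rel_subspace(1)[of n]]
  have t: "map bas w \<in> tuples M n" "map tw (map bas w) \<in> tuples M n"
    using assms by (auto simp: tuples_def tw_carrier)
  have "?e - ?f \<in> sigma_rel M tw n"
    unfolding sigma_rel_def using t by (intro fvs.span_base) blast
  moreover have "?f - fscale ?a ?e \<in> sigma_rel M tw n"
  proof (rule subsetD[OF tensor_sigma_rel], subst tensor_rel_iff)
    show "?f - fscale ?a ?e \<in> chains M n"
      unfolding chains_supported using t by (intro supported_diff supported_scale) simp_all
    show "Psi (?f - fscale ?a ?e) = 0"
      by (simp only: Psi_lin Psi_basis tens_tw tens_map_bas diff_self)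
  qed
  ultimately have "(?e - ?f) + (?f - fscale ?a ?e) \<in> sigma_rel M tw n" by (rule S(2))
  then have "fscale (1 - ?a) ?e \<in> sigma_rel M tw n" by (simp add: fvs.scale_left_diff_distrib)
  from S(3)[OF this, of "inverse (1 - ?a)"] show ?thesis using assms by (simp add: unPsi_def)
qed

lemma sigma_rel_iff:
  assumes "x \<in> chains M n"
  shows "x \<in> sigma_rel M tw n \<longleftrightarrow> PsiP x = 0"
proof
  note S = subspace_mem[OF rel_subspace(1)[of n]]
  assume P: "PsiP x = 0"
  have "Psi x - proj_one (Psi x) \<in> supported {w. length w = Suc n \<and> prod_list (map chi w) \<noteq> 1}"
  proof (rule klin_supported[OF Psi_chains[OF assms, unfolded words_def]])
    show "klin (\<lambda>y. y - proj_one y)" by (intro klin_intros)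
  qed (simp add: proj_one_def)
  then have y: "Psi x \<in> supported {w. length w = Suc n \<and> prod_list (map chi w) \<noteq> 1}"
    using P by (simp add: PsiP_def)
  have "unPsi (Psi x) \<in> sigma_rel M tw n"
    using y by (induction rule: supported_induct) (auto simp: unPsi_lin S unPsi_other_weight)
  from S(4)[OF this subsetD[OF tensor_sigma_rel unPsi_Psi[OF assms]]] show "x \<in> sigma_rel M tw n" by simp
qed (rule PsiP_sigma_rel)

definition lambda_words :: "nat \<Rightarrow> ((nat \<times> int) list \<Rightarrow>\<^sub>0 'k) set" where
  "lambda_words n = {v - cycl v | v. v \<in> V n}"

lemma lambda_words_subspace: "fvs.subspace (lambda_words n)"
proof (rule fvs.subspaceI)
  show "0 \<in> lambda_words n" unfolding lambda_words_def
    by (intro CollectI exI[of _ 0]) (simp add: cycl_lin)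
next
  fix x y assume "x \<in> lambda_words n" "y \<in> lambda_words n"
  then obtain u v where "u \<in> V n" "v \<in> V n" "x = u - cycl u" "y = v - cycl v"
    by (auto simp: lambda_words_def)
  then have "u + v \<in> V n" "x + y = (u + v) - cycl (u + v)"
    by (auto simp: cycl_lin weight_words_add)
  then show "x + y \<in> lambda_words n" unfolding lambda_words_def by blast
next
  fix a x assume "x \<in> lambda_words n"
  then obtain u where "u \<in> V n" "fscale a x = fscale a u - cycl (fscale a u)"
    by (auto simp: lambda_words_def cycl_lin fvs.scale_right_diff_distrib)
  then show "fscale a x \<in> lambda_words n" unfolding lambda_words_def using weight_words_scale by blast
qed

lemma cyc_lambda_rel:
  assumes "u \<in> chains M n"
  shows "u - cyc tw u \<in> lambda_rel M tw n"
  using assms unfolding chains_supported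
proof (induction rule: supported_induct)
  case (basis as)
  then show ?case unfolding lambda_rel_def by (intro fvs.span_base) blast
next
  case (add u v)
  from subspace_mem(2)[OF rel_subspace(2) add] show ?case
    by (simp add: klin_add[OF klin_cyc[OF klin_id]] algebra_simps)
qed (auto simp: subspace_mem[OF rel_subspace(2)] klin_zero[OF klin_cyc[OF klin_id]] klin_scale[OF klin_cyc[OF klin_id]]
    simp flip: fvs.scale_right_diff_distrib)

text \<open>The power \<open>n + 1\<close> of the cyclic operator applies the automorphism to every
  letter, and \<open>1 - t\<close> divides \<open>1 - t\<^sup>n\<^sup>+\<^sup>1\<close>.\<close>

lemma sigma_lambda_rel: "sigma_rel M tw n \<subseteq> lambda_rel M tw n"
proof -
  note S = subspace_mem[OF rel_subspace(2)[of n]]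
  have pow: "u - (cyc tw ^^ i) u \<in> lambda_rel M tw n" if "u \<in> chains M n" for u i
  proof (induction i)
    case 0
    show ?case by (simp add: S)
  next
    case (Suc i)
    from S(2)[OF Suc cyc_lambda_rel[OF cyc_pow_chains[OF that, of i]]] show ?case by simp
  qed
  show ?thesis
    unfolding sigma_rel_def
  proof (rule fvs.span_minimal[OF _ rel_subspace(2)], safe)
    fix x assume "x \<in> tensor_rel M n"
    then show "x \<in> lambda_rel M tw n" unfolding lambda_rel_def by (auto intro: fvs.span_base)
  next
    fix as assume "as \<in> tuples M n"
    from pow[OF basis_chains[OF this], of "Suc n"] show "basis as - basis (map tw as) \<in> lambda_rel M tw n"
      by (simp only: cyc_pow_basis[OF \<open>as \<in> tuples M n\<close>])
  qed
qed

lemma lambda_rel_iff: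
  assumes "x \<in> chains M n"
  shows "x \<in> lambda_rel M tw n \<longleftrightarrow> PsiP x \<in> lambda_words n"
proof
  have "lambda_rel M tw n \<subseteq> {x. PsiP x \<in> lambda_words n}"
    unfolding lambda_rel_def
  proof (rule fvs.span_minimal, safe)
    show "fvs.subspace {x. PsiP x \<in> lambda_words n}"
      by (rule subspace_kernel[OF lambda_words_subspace klin_PsiP[OF klin_id]])
  next
    fix x assume "x \<in> tensor_rel M n"
    then show "PsiP x \<in> lambda_words n"
      using tensor_sigma_rel PsiP_sigma_rel subspace_mem(1)[OF lambda_words_subspace] by (metis subsetD)
  next
    fix as assume "as \<in> tuples M n"
    note b = basis_chains[OF this]
    show "PsiP (basis as - cyc tw (basis as)) \<in> lambda_words n"
      using PsiP_chains[OF b] by (auto simp: PsiP_lin PsiP_cyc[OF chains_good[OF b]] lambda_words_def)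
  qed
  then show "x \<in> lambda_rel M tw n \<Longrightarrow> PsiP x \<in> lambda_words n" by auto
next
  assume "PsiP x \<in> lambda_words n"
  then obtain v where v: "v \<in> V n" "PsiP x = v - cycl v" by (auto simp: lambda_words_def)
  let ?u = "unPsi v"
  note u = unPsi_V[OF v(1)]
  have "x - (?u - cyc tw ?u) \<in> chains M n"
    using assms u cyc_chains[OF u] unfolding chains_supported by (intro supported_diff)
  moreover have "PsiP (x - (?u - cyc tw ?u)) = 0"
    using v by (simp add: PsiP_lin PsiP_cyc[OF chains_good[OF u]] PsiP_unPsi_V[OF v(1)])
  ultimately have "x - (?u - cyc tw ?u) \<in> lambda_rel M tw n"
    using sigma_rel_iff sigma_lambda_rel by blast
  from subspace_mem(2)[OF rel_subspace(2) this cyc_lambda_rel[OF u]] show "x \<in> lambda_rel M tw n" by simp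
qed

lemma lambda_rel_chains: "lambda_rel M tw n \<subseteq> chains M n"
  unfolding lambda_rel_def
proof (rule fvs.span_minimal, safe)
  show "fvs.subspace (chains M n)" unfolding chains_supported by (rule subspace_supported)
next
  fix as assume "as \<in> tuples M n"
  note b = basis_chains[OF this]
  show "basis as - cyc tw (basis as) \<in> chains M n"
    using b cyc_chains[OF b] unfolding chains_supported by (rule supported_diff)
qed (use tensor_rel_chains in blast)

section \<open>The total complex\<close>

abbreviation tot_degs :: "nat \<Rightarrow> nat set" where
  "tot_degs n \<equiv> {m. m \<le> n \<and> even (n - m)}"

lemma tot_chains_supported: "tot_chains M n = supported (\<Union>m\<in>tot_degs n. tuples M m)"
  by (simp add: tot_chains_def supported_def)

lemma tot_chains_good: "x \<in> tot_chains M n \<Longrightarrow> x \<in> supported good"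
  unfolding tot_chains_supported using tuples_good by (blast intro: supported_mono)

lemma chains_tot: "m \<in> tot_degs n \<Longrightarrow> chains M m \<subseteq> tot_chains M n"
  unfolding tot_chains_supported chains_supported by (auto intro: supported_mono)

lemma PsiP_tot: "x \<in> tot_chains M n \<Longrightarrow> PsiP x \<in> cyc.Tot n"
  unfolding tot_chains_supported
proof (induction rule: supported_induct)
  case (basis as)
  then obtain m where "m \<le> n" "even (n - m)" "as \<in> tuples M m" by blast
  then show ?case using cyc.V_Tot_le[OF PsiP_chains[OF basis_chains]] by blast
qed (simp_all add: PsiP_lin cyc.Tot_add cyc.Tot_scale)

lemma unPsi_tot: "y \<in> cyc.Tot n \<Longrightarrow> unPsi y \<in> tot_chains M n"
proof (induction n arbitrary: y rule: cyc.Tot.induct)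
  case 1
  then show ?case using unPsi_V[of y 0] chains_tot[of 0 0] by auto
next
  case 2
  then show ?case using unPsi_V[of y 1] chains_tot[of 1 1] by auto
next
  case (3 n)
  from 3(2) obtain x1 x2 where x: "y = x1 + x2" "x1 \<in> V (Suc (Suc n))" "x2 \<in> cyc.Tot n" by (rule cyc.TotE)
  have "unPsi x1 \<in> tot_chains M (Suc (Suc n))" using unPsi_V[OF x(2)] chains_tot[of "Suc (Suc n)" "Suc (Suc n)"] by auto
  moreover have "tot_chains M n \<subseteq> tot_chains M (Suc (Suc n))"
    unfolding tot_chains_supported
    by (intro subsetI, erule supported_mono, intro UN_mono) (auto simp: Suc_diff_le)
  then have "unPsi x2 \<in> tot_chains M (Suc (Suc n))" using 3(1)[OF x(3)] by blast
  ultimately show ?case unfolding x(1) unPsi_lin tot_chains_supported by (rule supported_add)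
qed

lemma upper_tot_chains: "x \<in> tot_chains M n \<Longrightarrow> upper n x \<in> chains M n"
  by (rule upper_chains[OF tot_chains_good])

lemma PsiP_lower: "PsiP (lower n x) = cyc.low n (PsiP x)"
  by (simp add: lower_def cyc.low_def PsiP_lin PsiP_upper)

lemma lower_good: "(x :: _ \<Rightarrow>\<^sub>0 'k) \<in> supported good \<Longrightarrow> lower n x \<in> supported good"
  unfolding lower_def using chains_good[OF upper_chains] by (intro supported_diff)

lemma PsiP_tot_d: "x \<in> supported good \<Longrightarrow> PsiP (tot_d M tw n x) = cyc.dtot n (PsiP x)"
  by (simp add: tot_d_def cyc.dtot_def PsiP_lin PsiP_hoch_b PsiP_connes_B lower_good PsiP_lower)

lemma klin_tot_d [klin_intros]: "klin f \<Longrightarrow> klin (\<lambda>x. tot_d M tw n (f x))"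
  unfolding tot_d_def lower_def by (intro klin_intros klin_diff_fun klin_plus)

lemma lower_tot_chains:
  assumes "x \<in> tot_chains M (Suc (Suc n))"
  shows "lower (Suc (Suc n)) x \<in> tot_chains M n"
  using assms unfolding tot_chains_supported
proof (rule klin_supported)
  fix as assume "as \<in> (\<Union>m\<in>tot_degs (Suc (Suc n)). tuples M m)"
  then obtain m where m: "m \<le> Suc (Suc n)" "even (Suc (Suc n) - m)" "as \<in> tuples M m" by blast
  show "lower (Suc (Suc n)) (basis as) \<in> supported (\<Union>m\<in>tot_degs n. tuples M m)"
  proof (cases "m = Suc (Suc n)")
    case True
    then show ?thesis using m by (simp add: lower_def upper_def tuples_def)
  next
    case False
    then have "m \<le> n" using m by (cases "m = Suc n") auto
    then have "m \<in> tot_degs n" using m by (simp add: Suc_diff_le)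
    then show ?thesis using m False by (auto simp: lower_def upper_def tuples_def)
  qed
qed (unfold lower_def, intro klin_diff_fun klin_upper klin_id)

lemma tot_d_chains:
  assumes "x \<in> tot_chains M (Suc n)"
  shows "tot_d M tw (Suc n) x \<in> tot_chains M n"
  using assms unfolding tot_chains_supported
proof (rule klin_supported)
  fix as assume "as \<in> (\<Union>m\<in>tot_degs (Suc n). tuples M m)"
  then obtain m where m: "m \<le> Suc n" "even (Suc n - m)" "as \<in> tuples M m" by blast
  note b = basis_chains[OF m(3)]
  have h: "hoch_b M tw (basis as) \<in> tot_chains M n"
  proof (cases m)
    case 0
    then show ?thesis using hoch_b_chains0[of "basis as"] b by (simp add: tot_chains_supported)
  next
    case (Suc k)
    then have "k \<in> tot_degs n" using m by simp
    then show ?thesis using hoch_b_chains[of "basis as" k] b Suc chains_tot by blast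
  qed
  show "tot_d M tw (Suc n) (basis as) \<in> supported (\<Union>m\<in>tot_degs n. tuples M m)"
  proof (cases "m = Suc n")
    case True
    then have "lower (Suc n) (basis as) = (0 :: _ \<Rightarrow>\<^sub>0 'k)" using m by (simp add: lower_def upper_def tuples_def)
    then show ?thesis using h by (simp add: tot_d_def tot_chains_supported klin_zero[OF klin_connes_B[OF klin_id]])
  next
    case False
    then have l: "lower (Suc n) (basis as) = (basis as :: _ \<Rightarrow>\<^sub>0 'k)" using m by (simp add: lower_def upper_def tuples_def)
    have "m \<noteq> n" using m by auto
    then have "Suc m \<in> tot_degs n" using m False by (auto simp: Suc_diff_le even_Suc_div_two)
    then have "connes_B M tw (basis as) \<in> tot_chains M n" using connes_B_chains[OF b] chains_tot by blast
    then show ?thesis using h unfolding tot_d_def l tot_chains_supported by (intro supported_add)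
  qed
qed (intro klin_tot_d klin_id)

lemma tot_d_0: "x \<in> tot_chains M 0 \<Longrightarrow> tot_d M tw 0 x = 0"
proof -
  assume x: "x \<in> tot_chains M 0"
  then have c: "x \<in> chains M 0" unfolding tot_chains_supported chains_supported by (simp cong: conj_cong)
  have "lower 0 x = 0"
    using c unfolding chains_supported
  proof (rule klin_ext_on[where f = "lower 0" and g = "\<lambda>_. 0"])
    show "klin (lower 0)" unfolding lower_def by (intro klin_intros)
  qed (auto simp: lower_def upper_def tuples_def intro: klin_const_zero)
  then show ?thesis by (simp add: tot_d_def hoch_b_chains0[OF c] klin_zero[OF klin_connes_B[OF klin_id]])
qed

lemma tot_rel_chains: "tot_rel M tw n \<subseteq> tot_chains M n"
  unfolding tot_rel_def
proof (rule fvs.span_minimal)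
  show "fvs.subspace (tot_chains M n)" unfolding tot_chains_supported by (rule subspace_supported)
  show "(\<Union>m\<in>tot_degs n. sigma_rel M tw m) \<subseteq> tot_chains M n"
    using sigma_lambda_rel lambda_rel_chains chains_tot by blast
qed

lemma tot_rel_iff:
  assumes "x \<in> tot_chains M n"
  shows "x \<in> tot_rel M tw n \<longleftrightarrow> PsiP x = 0"
proof
  have "fvs.subspace {x. PsiP x \<in> {0}}"
    by (rule subspace_kernel) (auto intro!: klin_PsiP[OF klin_id] simp: fvs.subspace_def)
  then have "tot_rel M tw n \<subseteq> {x. PsiP x \<in> {0}}"
    unfolding tot_rel_def by (intro fvs.span_minimal) (auto simp: PsiP_sigma_rel)
  then show "x \<in> tot_rel M tw n \<Longrightarrow> PsiP x = 0" by auto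
next
  assume P: "PsiP x = 0"
  have fin: "finite (tot_degs n)" by (rule finite_subset[of _ "{..n}"]) auto
  have "(\<Sum>m\<in>tot_degs n. upper m x) = x"
    using assms unfolding tot_chains_supported
  proof (rule klin_ext_on)
    fix as assume "as \<in> (\<Union>m\<in>tot_degs n. tuples M m)"
    then obtain m where m: "m \<in> tot_degs n" "length as = Suc m" by (auto simp: tuples_def)
    then have "(\<Sum>k\<in>tot_degs n. upper k (basis as)) = (\<Sum>k\<in>tot_degs n. if m = k then basis as else 0)"
      by (intro sum.cong) (auto simp: upper_def)
    also have "\<dots> = basis as" using m(1) by (subst sum.delta'[OF fin]) (rule if_P)
    finally show "(\<Sum>k\<in>tot_degs n. upper k (basis as)) = basis as" .
  qed (intro klin_intros)+
  moreover have "upper m x \<in> tot_rel M tw n" if "m \<in> tot_degs n" for m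
  proof -
    have "upper m x \<in> sigma_rel M tw m"
      using upper_chains[OF tot_chains_good[OF assms]] P
      by (simp add: sigma_rel_iff PsiP_upper klin_zero[OF klin_wproj[OF klin_id]])
    then show ?thesis unfolding tot_rel_def using that by (intro fvs.span_base) blast
  qed
  then have "(\<Sum>m\<in>tot_degs n. upper m x) \<in> tot_rel M tw n"
    by (intro fvs.subspace_sum rel_subspace)
  ultimately show "x \<in> tot_rel M tw n" by simp
qed

end

section \<open>Homology classes\<close>

lemma coset_eq_iff:
  assumes "fvs.subspace N"
  shows "coset x N = coset y N \<longleftrightarrow> x - y \<in> N"
proof
  note S = subspace_mem[OF assms]
  assume e: "coset x N = coset y N"
  have "x \<in> coset x N" unfolding coset_def using S(1) by (intro CollectI exI[of _ 0]) simp
  then show "x - y \<in> N" unfolding e by (auto simp: coset_def)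
next
  note S = subspace_mem[OF assms]
  have sub: "coset a N \<subseteq> coset b N" if "a - b \<in> N" for a b
  proof
    fix z assume "z \<in> coset a N"
    then obtain r where "r \<in> N" "z = a + r" by (auto simp: coset_def)
    then have "z = b + ((a - b) + r)" "(a - b) + r \<in> N" using that S by simp_all
    then show "z \<in> coset b N" unfolding coset_def by blast
  qed
  assume "x - y \<in> N"
  moreover from S(3)[OF this, of "-1"] have "y - x \<in> N" by simp
  ultimately show "coset x N = coset y N" using sub by blast
qed

lemma coset_zero: "coset 0 N = N"
  by (simp add: coset_def)

text \<open>The unions in the definitions of induced maps and of scalar multiples run over equal
  cosets, so one representative suffices.\<close>

lemma UN_coset:
  assumes "fvs.subspace N" "fvs.subspace N'" "klin f" "\<And>r. r \<in> N \<Longrightarrow> f r \<in> N'"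
  shows "(\<Union>z\<in>coset x N. coset (f z) N') = coset (f x) N'"
proof -
  have "coset (f z) N' = coset (f x) N'" if "z \<in> coset x N" for z
  proof -
    from that obtain r where "r \<in> N" "z = x + r" by (auto simp: coset_def)
    then show ?thesis using assms(4) by (simp add: coset_eq_iff[OF assms(2)] klin_add[OF assms(3)])
  qed
  moreover have "x \<in> coset x N"
    unfolding coset_def using subspace_mem(1)[OF assms(1)] by (intro CollectI exI[of _ 0]) simp
  ultimately show ?thesis by (intro SUP_eq_const) blast+
qed

lemma coset_add:
  assumes "fvs.subspace N"
  shows "{u + v | u v. u \<in> coset x N \<and> v \<in> coset y N} = coset (x + y) N"
proof safe
  fix u v assume "u \<in> coset x N" "v \<in> coset y N"
  then obtain r r' where "r \<in> N" "r' \<in> N" "u + v = (x + y) + (r + r')" by (auto simp: coset_def)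
  then show "u + v \<in> coset (x + y) N" unfolding coset_def using subspace_mem(2)[OF assms] by blast
next
  fix z assume "z \<in> coset (x + y) N"
  then obtain r where "r \<in> N" "z = (x + r) + (y + 0)" by (auto simp: coset_def add_ac)
  then show "\<exists>u v. z = u + v \<and> u \<in> coset x N \<and> v \<in> coset y N"
    unfolding coset_def using subspace_mem(1)[OF assms] by blast
qed

section \<open>Homology groups and the periodicity map in terms of words\<close>

context podles_chains
begin

definition HC_bounds :: "nat \<Rightarrow> ((nat \<times> int) list \<Rightarrow>\<^sub>0 'k) set" where
  "HC_bounds n = {hoch y + r | y r. y \<in> V (Suc n) \<and> r \<in> lambda_words n}"

lemma HC_bounds_subspace: "fvs.subspace (HC_bounds n)"
proof (rule fvs.subspaceI)
  note L = subspace_mem[OF lambda_words_subspace[of n]]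
  show "0 \<in> HC_bounds n" unfolding HC_bounds_def using L(1) by (intro CollectI exI[of _ 0]) (simp add: hoch_lin)
next
  note L = subspace_mem[OF lambda_words_subspace[of n]]
  fix x x' assume "x \<in> HC_bounds n" "x' \<in> HC_bounds n"
  then obtain y r y' r' where *: "y \<in> V (Suc n)" "r \<in> lambda_words n" "y' \<in> V (Suc n)" "r' \<in> lambda_words n"
    "x = hoch y + r" "x' = hoch y' + r'" by (auto simp: HC_bounds_def)
  then have "x + x' = hoch (y + y') + (r + r')" "y + y' \<in> V (Suc n)" "r + r' \<in> lambda_words n"
    using L by (simp_all add: hoch_lin weight_words_add)
  then show "x + x' \<in> HC_bounds n" unfolding HC_bounds_def by blast
next
  note L = subspace_mem[OF lambda_words_subspace[of n]]
  fix a x assume "x \<in> HC_bounds n"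
  then obtain y r where *: "y \<in> V (Suc n)" "r \<in> lambda_words n" "x = hoch y + r" by (auto simp: HC_bounds_def)
  then have "fscale a x = hoch (fscale a y) + fscale a r" "fscale a y \<in> V (Suc n)" "fscale a r \<in> lambda_words n"
    using L by (simp_all add: hoch_lin weight_words_scale fvs.scale_right_distrib)
  then show "fscale a x \<in> HC_bounds n" unfolding HC_bounds_def by blast
qed

definition tot_bounds :: "nat \<Rightarrow> ((nat \<times> int) list \<Rightarrow>\<^sub>0 'k) set" where
  "tot_bounds n = cyc.dtot (Suc n) ` cyc.Tot (Suc n)"

lemma tot_bounds_subspace: "fvs.subspace (tot_bounds n)"
proof (rule fvs.subspaceI)
  show "0 \<in> tot_bounds n" unfolding tot_bounds_def by (rule image_eqI[of _ _ 0]) (simp_all add: cyc.dtot_lin)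
next
  fix x y assume "x \<in> tot_bounds n" "y \<in> tot_bounds n"
  then show "x + y \<in> tot_bounds n"
    unfolding tot_bounds_def using cyc.Tot_add by (auto simp flip: cyc.dtot_lin)
next
  fix a x assume "x \<in> tot_bounds n"
  then show "fscale a x \<in> tot_bounds n"
    unfolding tot_bounds_def using cyc.Tot_scale by (auto simp flip: klin_scale[OF cyc.klin_dtot])
qed

lemma HC_zero: "\<zero>\<^bsub>HC M tw n\<^esub> = {x \<in> chains M n. PsiP x \<in> HC_bounds n}"
proof -
  have "{hoch_b M tw y + r | y r. y \<in> chains M (Suc n) \<and> r \<in> lambda_rel M tw n}
      = {x \<in> chains M n. PsiP x \<in> HC_bounds n}"
  proof safe
    fix y r assume y: "y \<in> chains M (Suc n)" and r: "r \<in> lambda_rel M tw n"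
    then have rc: "r \<in> chains M n" using lambda_rel_chains by blast
    show "hoch_b M tw y + r \<in> chains M n"
      using rc hoch_b_chains[OF y] unfolding chains_supported by (intro supported_add)
    show "PsiP (hoch_b M tw y + r) \<in> HC_bounds n"
      unfolding PsiP_lin PsiP_hoch_b[OF chains_good[OF y]] HC_bounds_def
      using PsiP_chains[OF y] r lambda_rel_iff[OF rc] by blast
  next
    fix x assume x: "x \<in> chains M n" and "PsiP x \<in> HC_bounds n"
    then obtain y r where y: "y \<in> V (Suc n)" "r \<in> lambda_words n" "PsiP x = hoch y + r"
      by (auto simp: HC_bounds_def)
    note u = unPsi_V[OF y(1)]
    have "x - hoch_b M tw (unPsi y) \<in> chains M n"
      using x hoch_b_chains[OF u] unfolding chains_supported by (intro supported_diff)
    moreover have "PsiP (x - hoch_b M tw (unPsi y)) = r"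
      using y by (simp add: PsiP_lin PsiP_hoch_b[OF chains_good[OF u]] PsiP_unPsi_V)
    ultimately have "x - hoch_b M tw (unPsi y) \<in> lambda_rel M tw n" using y lambda_rel_iff by simp
    then show "\<exists>y r. x = hoch_b M tw y + r \<and> y \<in> chains M (Suc n) \<and> r \<in> lambda_rel M tw n"
      using u by (intro exI[of _ "unPsi y"] exI[of _ "x - hoch_b M tw (unPsi y)"]) simp
  qed
  then show ?thesis by (simp add: HC_def homology_def quotient_space_def)
qed

lemma HC_zero_subspace: "fvs.subspace \<zero>\<^bsub>HC M tw n\<^esub>"
proof -
  have "fvs.subspace (chains M n \<inter> {x. PsiP x \<in> HC_bounds n})"
    unfolding chains_supported
    by (intro fvs.subspace_inter subspace_supported subspace_kernel[OF HC_bounds_subspace] klin_PsiP klin_id)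
  moreover have "chains M n \<inter> {x. PsiP x \<in> HC_bounds n} = {x \<in> chains M n. PsiP x \<in> HC_bounds n}" by blast
  ultimately show ?thesis by (simp only: HC_zero)
qed

lemma HC_tot_zero: "\<zero>\<^bsub>HC_tot M tw n\<^esub> = {x \<in> tot_chains M n. PsiP x \<in> tot_bounds n}"
proof -
  have "{tot_d M tw (Suc n) y + r | y r. y \<in> tot_chains M (Suc n) \<and> r \<in> tot_rel M tw n}
      = {x \<in> tot_chains M n. PsiP x \<in> tot_bounds n}"
  proof safe
    fix y r assume y: "y \<in> tot_chains M (Suc n)" and r: "r \<in> tot_rel M tw n"
    then have rc: "r \<in> tot_chains M n" using tot_rel_chains by blast
    show "tot_d M tw (Suc n) y + r \<in> tot_chains M n"
      using rc tot_d_chains[OF y] unfolding tot_chains_supported by (intro supported_add)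
    show "PsiP (tot_d M tw (Suc n) y + r) \<in> tot_bounds n"
      using PsiP_tot[OF y] r tot_rel_iff[OF rc]
      by (simp add: PsiP_lin PsiP_tot_d[OF tot_chains_good[OF y]] tot_bounds_def)
  next
    fix x assume x: "x \<in> tot_chains M n" and "PsiP x \<in> tot_bounds n"
    then obtain y where y: "y \<in> cyc.Tot (Suc n)" "PsiP x = cyc.dtot (Suc n) y" by (auto simp: tot_bounds_def)
    note u = unPsi_tot[OF y(1)]
    have "x - tot_d M tw (Suc n) (unPsi y) \<in> tot_chains M n"
      using x tot_d_chains[OF u] unfolding tot_chains_supported by (intro supported_diff)
    moreover have "PsiP (x - tot_d M tw (Suc n) (unPsi y)) = 0"
      using y by (simp add: PsiP_lin PsiP_tot_d[OF tot_chains_good[OF u]] PsiP_unPsi)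
    ultimately have "x - tot_d M tw (Suc n) (unPsi y) \<in> tot_rel M tw n" using tot_rel_iff by simp
    then show "\<exists>y r. x = tot_d M tw (Suc n) y + r \<and> y \<in> tot_chains M (Suc n) \<and> r \<in> tot_rel M tw n"
      using u by (intro exI[of _ "unPsi y"] exI[of _ "x - tot_d M tw (Suc n) (unPsi y)"]) simp
  qed
  then show ?thesis by (simp add: HC_tot_def homology_def quotient_space_def)
qed

lemma HC_tot_zero_subspace: "fvs.subspace \<zero>\<^bsub>HC_tot M tw n\<^esub>"
proof -
  have "fvs.subspace (tot_chains M n \<inter> {x. PsiP x \<in> tot_bounds n})"
    unfolding tot_chains_supported
    by (intro fvs.subspace_inter subspace_supported subspace_kernel[OF tot_bounds_subspace] klin_PsiP klin_id)
  moreover have "tot_chains M n \<inter> {x. PsiP x \<in> tot_bounds n} = {x \<in> tot_chains M n. PsiP x \<in> tot_bounds n}" by blast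
  ultimately show ?thesis by (simp only: HC_tot_zero)
qed

definition HC_cl :: "nat \<Rightarrow> ((nat \<times> int) list \<Rightarrow>\<^sub>0 'k) \<Rightarrow> ('k free_alg set list \<Rightarrow>\<^sub>0 'k) set" where
  "HC_cl n y = coset (unPsi y) \<zero>\<^bsub>HC M tw n\<^esub>"

definition tot_cl :: "nat \<Rightarrow> ((nat \<times> int) list \<Rightarrow>\<^sub>0 'k) \<Rightarrow> ('k free_alg set list \<Rightarrow>\<^sub>0 'k) set" where
  "tot_cl n y = coset (unPsi y) \<zero>\<^bsub>HC_tot M tw n\<^esub>"

lemma coset_HC_eq:
  assumes "x \<in> chains M n" "y \<in> chains M n"
  shows "coset x \<zero>\<^bsub>HC M tw n\<^esub> = coset y \<zero>\<^bsub>HC M tw n\<^esub> \<longleftrightarrow> PsiP x - PsiP y \<in> HC_bounds n"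
proof -
  have "x - y \<in> chains M n" using assms unfolding chains_supported by (rule supported_diff)
  then show ?thesis unfolding coset_eq_iff[OF HC_zero_subspace] by (simp add: HC_zero PsiP_lin)
qed

lemma coset_HC_tot_eq:
  assumes "x \<in> tot_chains M n" "y \<in> tot_chains M n"
  shows "coset x \<zero>\<^bsub>HC_tot M tw n\<^esub> = coset y \<zero>\<^bsub>HC_tot M tw n\<^esub> \<longleftrightarrow> PsiP x - PsiP y \<in> tot_bounds n"
proof -
  have "x - y \<in> tot_chains M n" using assms unfolding tot_chains_supported by (rule supported_diff)
  then show ?thesis unfolding coset_eq_iff[OF HC_tot_zero_subspace] by (simp add: HC_tot_zero PsiP_lin)
qed

lemma coset_HC_cl: "x \<in> chains M n \<Longrightarrow> coset x \<zero>\<^bsub>HC M tw n\<^esub> = HC_cl n (PsiP x)"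
  using subspace_mem(1)[OF HC_bounds_subspace]
  by (simp add: HC_cl_def coset_HC_eq unPsi_V[OF PsiP_chains] PsiP_unPsi_V[OF PsiP_chains])

lemma coset_tot_cl: "x \<in> tot_chains M n \<Longrightarrow> coset x \<zero>\<^bsub>HC_tot M tw n\<^esub> = tot_cl n (PsiP x)"
  using subspace_mem(1)[OF tot_bounds_subspace]
  by (simp add: tot_cl_def coset_HC_tot_eq unPsi_tot[OF PsiP_tot] PsiP_unPsi[OF PsiP_tot])

lemma HC_cl_eq: "y \<in> V n \<Longrightarrow> z \<in> V n \<Longrightarrow> HC_cl n y = HC_cl n z \<longleftrightarrow> y - z \<in> HC_bounds n"
  by (simp add: HC_cl_def coset_HC_eq unPsi_V PsiP_unPsi_V)

lemma tot_cl_eq: "y \<in> cyc.Tot n \<Longrightarrow> z \<in> cyc.Tot n \<Longrightarrow> tot_cl n y = tot_cl n z \<longleftrightarrow> y - z \<in> tot_bounds n"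
  by (simp add: tot_cl_def coset_HC_tot_eq unPsi_tot PsiP_unPsi)

lemma HC_cl_zero: "HC_cl n 0 = \<zero>\<^bsub>HC M tw n\<^esub>"
  by (simp add: HC_cl_def unPsi_lin coset_zero)

definition HC_cycles :: "nat \<Rightarrow> ((nat \<times> int) list \<Rightarrow>\<^sub>0 'k) set" where
  "HC_cycles n = {y \<in> V n. n > 0 \<longrightarrow> hoch y \<in> lambda_words (n - 1)}"

lemma hoch_b_lambda_iff:
  assumes "x \<in> chains M n"
  shows "hoch_b M tw x \<in> lambda_rel M tw (n - 1) \<longleftrightarrow> PsiP x \<in> HC_cycles n"
proof (cases n)
  case 0
  then show ?thesis
    using assms PsiP_chains[OF assms] hoch_b_chains0 subspace_mem(1)[OF rel_subspace(2)] by (simp add: HC_cycles_def)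
next
  case (Suc m)
  then show ?thesis
    using assms PsiP_chains[OF assms]
    by (simp add: HC_cycles_def lambda_rel_iff hoch_b_chains PsiP_hoch_b[OF chains_good[OF assms]])
qed

lemma carrier_HC: "carrier (HC M tw n) = HC_cl n ` HC_cycles n"
proof -
  have "carrier (HC M tw n) = {coset x \<zero>\<^bsub>HC M tw n\<^esub> | x. x \<in> chains M n \<and> hoch_b M tw x \<in> lambda_rel M tw (n - 1)}"
    by (simp add: HC_def homology_def quotient_space_def)
  also have "\<dots> = HC_cl n ` HC_cycles n"
  proof safe
    fix x assume "x \<in> chains M n" "hoch_b M tw x \<in> lambda_rel M tw (n - 1)"
    then show "coset x \<zero>\<^bsub>HC M tw n\<^esub> \<in> HC_cl n ` HC_cycles n"
      unfolding coset_HC_cl[OF \<open>x \<in> chains M n\<close>] using hoch_b_lambda_iff by blast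
  next
    fix y assume y: "y \<in> HC_cycles n"
    then have yV: "y \<in> V n" by (simp add: HC_cycles_def)
    note u = unPsi_V[OF yV]
    have "hoch_b M tw (unPsi y) \<in> lambda_rel M tw (n - 1)"
      using y hoch_b_lambda_iff[OF u] by (simp add: PsiP_unPsi_V[OF yV])
    then show "\<exists>x. HC_cl n y = coset x \<zero>\<^bsub>HC M tw n\<^esub> \<and> x \<in> chains M n \<and> hoch_b M tw x \<in> lambda_rel M tw (n - 1)"
      unfolding HC_cl_def using u by blast
  qed
  finally show ?thesis .
qed

definition tot_cycles :: "nat \<Rightarrow> ((nat \<times> int) list \<Rightarrow>\<^sub>0 'k) set" where
  "tot_cycles n = {y \<in> cyc.Tot n. cyc.dtot n y = 0}"

lemma tot_d_rel_iff:
  assumes "x \<in> tot_chains M n"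
  shows "tot_d M tw n x \<in> tot_rel M tw (n - 1) \<longleftrightarrow> PsiP x \<in> tot_cycles n"
proof (cases n)
  case 0
  then have "tot_d M tw n x = 0" using assms tot_d_0 by simp
  then show ?thesis
    using PsiP_tot_d[OF tot_chains_good[OF assms], of n] PsiP_tot[OF assms] subspace_mem(1)[OF rel_subspace(3)]
    by (simp add: tot_cycles_def PsiP_lin)
next
  case (Suc m)
  then show ?thesis
    using assms PsiP_tot[OF assms]
    by (simp add: tot_cycles_def tot_rel_iff tot_d_chains PsiP_tot_d[OF tot_chains_good[OF assms]])
qed

lemma carrier_HC_tot: "carrier (HC_tot M tw n) = tot_cl n ` tot_cycles n"
proof -
  have "carrier (HC_tot M tw n) =
      {coset x \<zero>\<^bsub>HC_tot M tw n\<^esub> | x. x \<in> tot_chains M n \<and> tot_d M tw n x \<in> tot_rel M tw (n - 1)}"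
    by (simp add: HC_tot_def homology_def quotient_space_def)
  also have "\<dots> = tot_cl n ` tot_cycles n"
  proof safe
    fix x assume "x \<in> tot_chains M n" "tot_d M tw n x \<in> tot_rel M tw (n - 1)"
    then show "coset x \<zero>\<^bsub>HC_tot M tw n\<^esub> \<in> tot_cl n ` tot_cycles n"
      unfolding coset_tot_cl[OF \<open>x \<in> tot_chains M n\<close>] using tot_d_rel_iff by blast
  next
    fix y assume y: "y \<in> tot_cycles n"
    then have yT: "y \<in> cyc.Tot n" by (simp add: tot_cycles_def)
    note u = unPsi_tot[OF yT]
    have "tot_d M tw n (unPsi y) \<in> tot_rel M tw (n - 1)"
      using y tot_d_rel_iff[OF u] by (simp add: PsiP_unPsi[OF yT])
    then show "\<exists>x. tot_cl n y = coset x \<zero>\<^bsub>HC_tot M tw n\<^esub> \<and> x \<in> tot_chains M n \<and> tot_d M tw n x \<in> tot_rel M tw (n - 1)"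
      unfolding tot_cl_def using u by blast
  qed
  finally show ?thesis .
qed

lemma HC_smult: "a \<odot>\<^bsub>HC M tw n\<^esub> HC_cl n y = HC_cl n (fscale a y)"
proof -
  have "a \<odot>\<^bsub>HC M tw n\<^esub> HC_cl n y = (\<Union>x\<in>HC_cl n y. coset (fscale a x) \<zero>\<^bsub>HC M tw n\<^esub>)"
    by (simp add: HC_def homology_def quotient_space_def)
  also have "\<dots> = coset (fscale a (unPsi y)) \<zero>\<^bsub>HC M tw n\<^esub>"
    unfolding HC_cl_def
    by (rule UN_coset[OF HC_zero_subspace HC_zero_subspace])
      (auto intro: klin_fscale klin_id subspace_mem(3)[OF HC_zero_subspace])
  finally show ?thesis by (simp add: HC_cl_def unPsi_lin)
qed

lemma HC_add: "HC_cl n y \<oplus>\<^bsub>HC M tw n\<^esub> HC_cl n z = HC_cl n (y + z)"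
proof -
  have "HC_cl n y \<oplus>\<^bsub>HC M tw n\<^esub> HC_cl n z = {u + v | u v. u \<in> HC_cl n y \<and> v \<in> HC_cl n z}"
    by (simp add: HC_def homology_def quotient_space_def)
  also have "\<dots> = coset (unPsi y + unPsi z) \<zero>\<^bsub>HC M tw n\<^esub>"
    unfolding HC_cl_def by (rule coset_add[OF HC_zero_subspace])
  finally show ?thesis by (simp add: HC_cl_def unPsi_lin)
qed

lemma HC_comparison_cl:
  assumes "y \<in> cyc.Tot n"
  shows "HC_comparison M tw n (tot_cl n y) = HC_cl n (wproj n y)"
proof -
  have "HC_comparison M tw n (tot_cl n y) = coset (upper n (unPsi y)) \<zero>\<^bsub>HC M tw n\<^esub>"
    unfolding HC_comparison_def induced_def tot_cl_def
  proof (rule UN_coset[OF HC_tot_zero_subspace HC_zero_subspace klin_upper[OF klin_id]])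
    fix r assume r: "r \<in> \<zero>\<^bsub>HC_tot M tw n\<^esub>"
    then obtain z where z: "z \<in> cyc.Tot (Suc n)" "PsiP r = cyc.dtot (Suc n) z" and rc: "r \<in> tot_chains M n"
      by (auto simp: HC_tot_zero tot_bounds_def)
    from cyc.proj_dtot[OF z(1)] have "wproj n (PsiP r) \<in> HC_bounds n"
      unfolding z(2) HC_bounds_def lambda_words_def by blast
    then show "upper n r \<in> \<zero>\<^bsub>HC M tw n\<^esub>" using upper_tot_chains[OF rc] by (simp add: HC_zero PsiP_upper)
  qed
  then show ?thesis
    using coset_HC_cl[OF upper_tot_chains[OF unPsi_tot[OF assms]]] by (simp add: PsiP_upper PsiP_unPsi[OF assms])
qed

lemma low_tot_bounds:
  assumes "x \<in> tot_bounds (Suc (Suc n))"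
  shows "cyc.low (Suc (Suc n)) x \<in> tot_bounds n"
proof -
  from assms obtain z where z: "z \<in> cyc.Tot (Suc (Suc (Suc n)))" "x = cyc.dtot (Suc (Suc (Suc n))) z"
    by (auto simp: tot_bounds_def)
  show ?thesis
    unfolding z(2) cyc.low_dtot[OF z(1)] tot_bounds_def using cyc.low_Tot[OF z(1)] by blast
qed

lemma HC_tot_S_cl:
  assumes "y \<in> cyc.Tot (Suc (Suc n))"
  shows "HC_tot_S M tw n (tot_cl (Suc (Suc n)) y) = tot_cl n (cyc.low (Suc (Suc n)) y)"
proof -
  have "HC_tot_S M tw n (tot_cl (Suc (Suc n)) y) = coset (lower (Suc (Suc n)) (unPsi y)) \<zero>\<^bsub>HC_tot M tw n\<^esub>"
    unfolding HC_tot_S_def induced_def tot_cl_def add_2_eq_Suc'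
  proof (rule UN_coset[OF HC_tot_zero_subspace HC_tot_zero_subspace])
    show "klin (lower (Suc (Suc n)))" unfolding lower_def by (intro klin_intros)
  next
    fix r assume "r \<in> \<zero>\<^bsub>HC_tot M tw (Suc (Suc n))\<^esub>"
    then show "lower (Suc (Suc n)) r \<in> \<zero>\<^bsub>HC_tot M tw n\<^esub>"
      by (auto simp: HC_tot_zero PsiP_lower intro: lower_tot_chains low_tot_bounds)
  qed
  then show ?thesis
    using coset_tot_cl[OF lower_tot_chains[OF unPsi_tot[OF assms]]] by (simp add: PsiP_lower PsiP_unPsi[OF assms])
qed

lemma wproj_cycle: "y \<in> tot_cycles n \<Longrightarrow> wproj n y \<in> HC_cycles n"
  using cyc.b_proj_cycle[of y n] cyc.proj_V[of y n] by (auto simp: tot_cycles_def HC_cycles_def lambda_words_def)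

lemma tot_cycles_lin:
  "x \<in> tot_cycles n \<Longrightarrow> y \<in> tot_cycles n \<Longrightarrow> x + y \<in> tot_cycles n"
  "x \<in> tot_cycles n \<Longrightarrow> y \<in> tot_cycles n \<Longrightarrow> x - y \<in> tot_cycles n"
  "x \<in> tot_cycles n \<Longrightarrow> fscale a x \<in> tot_cycles n"
  by (auto simp: tot_cycles_def cyc.dtot_lin klin_scale[OF cyc.klin_dtot] intro: cyc.Tot_add cyc.Tot_diff cyc.Tot_scale)

lemma comparison_bounds:
  assumes "y \<in> tot_cycles n" "wproj n y \<in> HC_bounds n"
  shows "y \<in> tot_bounds n"
proof -
  from assms(2) obtain z v where "z \<in> V (Suc n)" "v \<in> V n" "wproj n y = hoch z + (v - cycl v)"
    by (auto simp: HC_bounds_def lambda_words_def)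
  then show ?thesis
    using cyc.Tot_cycle_comparison[of y n z v] assms(1) by (auto simp: tot_cycles_def tot_bounds_def)
qed

lemma bounds_comparison: "y \<in> tot_bounds n \<Longrightarrow> wproj n y \<in> HC_bounds n"
  using cyc.proj_dtot by (fastforce simp: tot_bounds_def HC_bounds_def lambda_words_def)

lemma inj_comparison: "inj_on (HC_comparison M tw n) (carrier (HC_tot M tw n))"
proof (rule inj_onI)
  fix X Y assume "X \<in> carrier (HC_tot M tw n)" "Y \<in> carrier (HC_tot M tw n)"
    and XY: "HC_comparison M tw n X = HC_comparison M tw n Y"
  then obtain y z where yz: "y \<in> tot_cycles n" "z \<in> tot_cycles n" and e: "X = tot_cl n y" "Y = tot_cl n z"
    by (auto simp: carrier_HC_tot)
  then have T: "y \<in> cyc.Tot n" "z \<in> cyc.Tot n" by (simp_all add: tot_cycles_def)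
  have "wproj n y - wproj n z \<in> HC_bounds n"
    using XY T by (simp add: e HC_comparison_cl HC_cl_eq[OF cyc.proj_V cyc.proj_V])
  then have "wproj n (y - z) \<in> HC_bounds n" by (simp add: klin_diff[OF klin_wproj[OF klin_id]])
  then show "X = Y"
    using comparison_bounds tot_cycles_lin(2)[OF yz] T by (simp add: e tot_cl_eq)
qed

text \<open>Injectivity of the comparison evaluates the inverse in the definition of
  \<open>S\<close> on a class that comes from a total cycle; \<open>S\<close> then drops the top
  component of that cycle.\<close>

lemma HC_S_cl:
  assumes y: "y \<in> tot_cycles (Suc (Suc n))"
  shows "HC_S M tw n (HC_cl (Suc (Suc n)) (wproj (Suc (Suc n)) y)) = HC_cl n (wproj n (cyc.low (Suc (Suc n)) y))"
proof -
  let ?n = "Suc (Suc n)"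
  have T: "y \<in> cyc.Tot ?n" using y by (simp add: tot_cycles_def)
  have "tot_cl ?n y \<in> carrier (HC_tot M tw ?n)" using y by (simp add: carrier_HC_tot)
  then have "inv_into (carrier (HC_tot M tw ?n)) (HC_comparison M tw ?n) (HC_comparison M tw ?n (tot_cl ?n y)) = tot_cl ?n y"
    by (rule inv_into_f_f[OF inj_comparison])
  then show ?thesis
    unfolding HC_S_def add_2_eq_Suc' HC_comparison_cl[OF T]
    by (simp add: HC_tot_S_cl[OF T] HC_comparison_cl[OF cyc.low_Tot[OF T]])
qed

text \<open>Each \<open>S\<close> drops the top component, so \<open>n\<close> of them leave the one
  in degree zero.\<close>

lemma HC_S_pow_cl:
  "y \<in> tot_cycles (2 * n) \<Longrightarrow> HC_S_pow M tw n (HC_cl (2 * n) (wproj (2 * n) y)) = HC_cl 0 (wproj 0 y)"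
proof (induction n arbitrary: y)
  case (Suc n)
  let ?z = "cyc.low (Suc (Suc (2 * n))) y"
  have T: "y \<in> cyc.Tot (Suc (Suc (2 * n)))" "cyc.dtot (Suc (Suc (2 * n))) y = 0"
    using Suc.prems by (simp_all add: tot_cycles_def)
  have "?z \<in> tot_cycles (2 * n)"
    using cyc.low_Tot[OF T(1)] cyc.low_cycle[OF T] by (simp add: tot_cycles_def)
  note IH = Suc.IH[OF this]
  have "wproj 0 ?z = wproj 0 y"
    using cyc.proj_other[OF cyc.proj_V[OF T(1)], of 0] by (simp add: cyc.low_def klin_diff[OF klin_wproj[OF klin_id]])
  then show ?case using HC_S_cl[of y "2 * n"] Suc.prems IH by simp
qed simp

text \<open>A cyclic cycle lifts to a total cycle, which is a boundary as soon as its lowest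
  component causes no obstruction; the comparison carries this back to the cyclic complex.\<close>

lemma HC_trivial:
  assumes "n > 0" "odd n \<or> eps \<noteq> 1"
  shows "carrier (HC M tw n) = {\<zero>\<^bsub>HC M tw n\<^esub>}"
proof -
  have "HC_cl n x = \<zero>\<^bsub>HC M tw n\<^esub>" if "x \<in> HC_cycles n" for x
  proof -
    have x: "x \<in> V n" "\<exists>u\<in>V (n - 1). hoch x = u - cycl u"
      using that assms(1) by (auto simp: HC_cycles_def lambda_words_def)
    obtain y v where y: "y \<in> cyc.Tot n" "cyc.dtot n y = 0" "v \<in> V n" "wproj n y = x - (v - cycl v)"
      using cyc.S_lift[OF x(1)] x(2) by blast
    \<comment> \<open>An even \<open>n\<close> forces \<open>eps \<noteq> 1\<close>, where every
      chain of weight one in degree zero is a boundary.\<close>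
    have "\<exists>z\<in>V 1. wproj 0 y = hoch z" if "even n"
      using hoch_surj_twisted[OF _ cyc.Tot_proj_V[OF y(1), of 0]] assms(2) that by simp
    then have "y \<in> tot_bounds n"
      using acyc.Tot_cycle_boundary[OF y(1,2)] by (auto simp: tot_bounds_def)
    then have "x - (v - cycl v) \<in> HC_bounds n" using bounds_comparison y(4) by metis
    moreover have "v - cycl v \<in> HC_bounds n"
      unfolding HC_bounds_def lambda_words_def using y(3)
      by (intro CollectI exI[of _ 0] exI[of _ "v - cycl v"]) (auto simp: hoch_lin)
    ultimately have "x \<in> HC_bounds n" using subspace_mem(2)[OF HC_bounds_subspace] by fastforce
    then show ?thesis using HC_cl_eq[OF x(1), of 0] by (simp add: HC_cl_zero)
  qed
  moreover have "0 \<in> HC_cycles n"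
    using subspace_mem(1)[OF lambda_words_subspace] by (simp add: HC_cycles_def hoch_lin)
  ultimately show ?thesis unfolding carrier_HC by auto
qed

text \<open>\<open>X\<close> and \<open>Y\<close> are the classes of total cycles with lowest
  components \<open>1\<close> and \<open>A\<close>. A total cycle is a boundary exactly when its
  lowest component is a Hochschild boundary, so everything is decided in degree zero.\<close>

lemma HC_even:
  assumes eps1: "eps = 1"
  shows "\<exists>X Y. HC_S_pow M tw n X = HC0_class M tw \<one>\<^bsub>M\<^esub> \<and>
           HC_S_pow M tw n Y = HC0_class M tw (cls (free_gen GA)) \<and>
           direct_sum_of_lines (HC M tw (2 * n)) X Y"
proof -
  let ?H = "HC M tw (2 * n)" and ?e = "basis [(0, 0)]" and ?f = "basis [(1 :: nat, 0 :: int)]"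
  have chi1: "chi (0, 0) = 1" "chi (1, 0) = 1" unfolding chi_def by (simp_all add: eps1)
  then have V0: "?e \<in> V 0" "?f \<in> V 0" by simp_all
  obtain y where y: "y \<in> tot_cycles (2 * n)" "wproj 0 y = ?e"
    using acyc.Tot_cycle_exists[OF V0(1)] by (auto simp: tot_cycles_def)
  obtain z where z: "z \<in> tot_cycles (2 * n)" "wproj 0 z = ?f"
    using acyc.Tot_cycle_exists[OF V0(2)] by (auto simp: tot_cycles_def)
  define X where "X = HC_cl (2 * n) (wproj (2 * n) y)"
  define Y where "Y = HC_cl (2 * n) (wproj (2 * n) z)"
  have cl0: "HC0_class M tw (cls x) = HC_cl 0 (proj_one (tcons (rep x unit) (basis [])))" for x
  proof -
    have "basis [cls x] \<in> chains M 0" by (simp add: chains_supported tuples_def)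
    from coset_HC_cl[OF this] show ?thesis by (simp add: HC0_class_def PsiP_def)
  qed
  have "proj_one ?e = ?e" "proj_one ?f = ?f" using V0 proj_one_weight_words by auto
  moreover have "rep (free_gen GA) unit = basis (1, 0)" by (simp add: rep_simps opA_def)
  ultimately have cls: "HC_cl 0 ?e = HC0_class M tw \<one>\<^bsub>M\<^esub>" "HC_cl 0 ?f = HC0_class M tw (cls (free_gen GA))"
    unfolding podles_operations(1) cl0 by (simp_all add: rep_one)
  define g where "g a b = fscale a y + fscale b z" for a b
  have g: "g a b \<in> tot_cycles (2 * n)" for a b
    unfolding g_def using y z by (intro tot_cycles_lin)
  have gT: "g a b \<in> cyc.Tot (2 * n)" for a b using g by (simp add: tot_cycles_def)
  have comb: "a \<odot>\<^bsub>?H\<^esub> X \<oplus>\<^bsub>?H\<^esub> b \<odot>\<^bsub>?H\<^esub> Y = HC_cl (2 * n) (wproj (2 * n) (g a b))" for a b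
    unfolding X_def Y_def HC_smult HC_add g_def
    by (simp add: klin_add[OF klin_wproj[OF klin_id]] klin_scale[OF klin_wproj[OF klin_id]])
  have g0: "wproj 0 (g a b) = fscale a ?e + fscale b ?f" for a b
    using y z by (simp add: g_def klin_add[OF klin_wproj[OF klin_id]] klin_scale[OF klin_wproj[OF klin_id]])
  have "bij_betw (\<lambda>(a, b). a \<odot>\<^bsub>?H\<^esub> X \<oplus>\<^bsub>?H\<^esub> b \<odot>\<^bsub>?H\<^esub> Y) UNIV (carrier ?H)"
    unfolding comb
  proof (rule bij_betwI')
    fix p p' :: "'k \<times> 'k"
    obtain a b a' b' where p: "p = (a, b)" "p' = (a', b')" by (cases p, cases p')
    show "(case p of (a, b) \<Rightarrow> HC_cl (2 * n) (wproj (2 * n) (g a b))) =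
        (case p' of (a, b) \<Rightarrow> HC_cl (2 * n) (wproj (2 * n) (g a b))) \<longleftrightarrow> p = p'"
    proof
      assume "(case p of (a, b) \<Rightarrow> HC_cl (2 * n) (wproj (2 * n) (g a b))) =
        (case p' of (a, b) \<Rightarrow> HC_cl (2 * n) (wproj (2 * n) (g a b)))"
      then have "wproj (2 * n) (g a b) - wproj (2 * n) (g a' b') \<in> HC_bounds (2 * n)"
        using p HC_cl_eq[OF cyc.proj_V[OF gT] cyc.proj_V[OF gT]] by simp
      moreover have "g a b - g a' b' = g (a - a') (b - b')"
        by (simp add: g_def fvs.scale_left_diff_distrib algebra_simps)
      ultimately have "g (a - a') (b - b') \<in> tot_bounds (2 * n)"
        using comparison_bounds[OF g] by (metis klin_diff[OF klin_wproj[OF klin_id]])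
      then obtain w where w: "w \<in> cyc.Tot (Suc (2 * n))" "g (a - a') (b - b') = cyc.dtot (Suc (2 * n)) w"
        by (auto simp: tot_bounds_def)
      \<comment> \<open>The lowest component of a total boundary is a Hochschild boundary, and
        \<open>1\<close> and \<open>A\<close> are independent modulo those.\<close>
      from cyc.proj_0_dtot[OF w(1)] have "wproj 1 w \<in> V 1" "fscale (a - a') ?e + fscale (b - b') ?f = hoch (wproj 1 w)"
        unfolding w(2)[symmetric] g0 by auto
      from hoch_indep[OF eps1 _ this(2)] weight_words_words[OF this(1)] show "p = p'" using p by simp
    qed simp
  next
    fix p :: "'k \<times> 'k"
    show "(case p of (a, b) \<Rightarrow> HC_cl (2 * n) (wproj (2 * n) (g a b))) \<in> carrier ?H"
      using wproj_cycle[OF g] by (auto simp: carrier_HC split: prod.split)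
  next
    fix C assume "C \<in> carrier ?H"
    then obtain x where x: "x \<in> HC_cycles (2 * n)" "C = HC_cl (2 * n) x" by (auto simp: carrier_HC)
    then have xV: "x \<in> V (2 * n)" "2 * n > 0 \<Longrightarrow> \<exists>u\<in>V (2 * n - 1). hoch x = u - cycl u"
      by (auto simp: HC_cycles_def lambda_words_def)
    obtain s v where s: "s \<in> cyc.Tot (2 * n)" "cyc.dtot (2 * n) s = 0" "v \<in> V (2 * n)" "wproj (2 * n) s = x - (v - cycl v)"
      using cyc.S_lift[OF xV(1) xV(2)] by blast
    \<comment> \<open>Subtracting the combination \<open>g a b\<close> leaves a total cycle whose
      lowest component is a boundary.\<close>
    obtain r a b where r: "r \<in> V 1" "wproj 0 s = hoch r + fscale a ?e + fscale b ?f"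
      using hoch_span[OF eps1 cyc.Tot_proj_V[OF s(1), of 0]] by auto
    have "s - g a b \<in> tot_cycles (2 * n)" using s g by (intro tot_cycles_lin) (auto simp: tot_cycles_def)
    moreover have "wproj 0 (s - g a b) = hoch r" by (simp add: klin_diff[OF klin_wproj[OF klin_id]] g0 r(2))
    ultimately have "s - g a b \<in> tot_bounds (2 * n)"
      using acyc.Tot_cycle_boundary[of "s - g a b" "2 * n"] r(1) by (auto simp: tot_bounds_def tot_cycles_def)
    from bounds_comparison[OF this] have "(x - (v - cycl v)) - wproj (2 * n) (g a b) \<in> HC_bounds (2 * n)"
      by (simp only: klin_diff[OF klin_wproj[OF klin_id]] s(4))
    moreover have "v - cycl v \<in> HC_bounds (2 * n)"
      unfolding HC_bounds_def lambda_words_def using s(3)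
      by (intro CollectI exI[of _ 0] exI[of _ "v - cycl v"]) (auto simp: hoch_lin)
    ultimately have "((x - (v - cycl v)) - wproj (2 * n) (g a b)) + (v - cycl v) \<in> HC_bounds (2 * n)"
      by (rule subspace_mem(2)[OF HC_bounds_subspace])
    moreover have "((x - (v - cycl v)) - wproj (2 * n) (g a b)) + (v - cycl v) = x - wproj (2 * n) (g a b)" by simp
    ultimately have "x - wproj (2 * n) (g a b) \<in> HC_bounds (2 * n)" by (simp only:)
    then have "C = HC_cl (2 * n) (wproj (2 * n) (g a b))" using x(2) HC_cl_eq[OF xV(1) cyc.proj_V[OF gT]] by simp
    then show "\<exists>p\<in>UNIV. C = (case p of (a, b) \<Rightarrow> HC_cl (2 * n) (wproj (2 * n) (g a b)))" by auto
  qed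
  moreover have "X \<in> carrier ?H" "Y \<in> carrier ?H"
    using wproj_cycle[OF y(1)] wproj_cycle[OF z(1)] by (auto simp: X_def Y_def carrier_HC)
  ultimately have "direct_sum_of_lines ?H X Y" by (simp add: direct_sum_of_lines_def)
  moreover have "HC_S_pow M tw n X = HC0_class M tw \<one>\<^bsub>M\<^esub>"
    "HC_S_pow M tw n Y = HC0_class M tw (cls (free_gen GA))"
    using HC_S_pow_cl[OF y(1)] HC_S_pow_cl[OF z(1)] y(2) z(2) cls by (simp_all add: X_def Y_def)
  ultimately show ?thesis by blast
qed

end

context podles_algebra
begin

text \<open>If \<open>diag chi\<close> intertwines each generator with its image, it intertwines all
  words; this links the automorphism given on generators to the eigenvalues.\<close>

lemma rep_free_hom:
  assumes "\<And>g v. rep (f g) (diag chi v) = diag chi (gen_op g v)"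
  shows "rep (free_hom f x) (diag chi v) = diag chi (rep x v)"
proof (induction x rule: free_vector_induct)
  case (basis w)
  have "rep (prod_list (map f ws)) (diag chi v) = diag chi (foldr gen_op ws v)" for ws
    by (induction ws) (simp_all add: rep_one rep_mult assms)
  then show ?case by (simp add: free_hom_def rep_basis)
qed (simp_all add: free_hom_add free_hom_fscale rep_simps klin_zero[OF klin_diag[OF klin_id]]
    klin_add[OF klin_diag[OF klin_id]] klin_scale[OF klin_diag[OF klin_id]] free_hom_def rep_zero lin_add lin_fscale)

lemma diag_unit: "diag chi unit = unit"
  by (simp add: chi_def)

end

theorem proposition5p1:
  fixes q c d l :: "'k::field_char_0"
  assumes "q \<noteq> 0" and "\<And>m::nat. m > 0 \<Longrightarrow> q ^ m \<noteq> 1"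
    and "c + d \<noteq> 0" and "l \<noteq> 0"
  shows
    "(l \<notin> {inverse (q ^ (2 * m)) | m::nat. True} \<longrightarrow>
       (let P = podles q c d; \<sigma> = podles_sigma q c d l in
        \<forall>n. (\<exists>X Y. HC_S_pow P \<sigma> n X = HC0_class P \<sigma> \<one>\<^bsub>P\<^esub> \<and>
                   HC_S_pow P \<sigma> n Y = HC0_class P \<sigma> (podles_class q c d (free_gen GA)) \<and>
                   direct_sum_of_lines (HC P \<sigma> (2 * n)) X Y) \<and>
            carrier (HC P \<sigma> (2 * n + 1)) = {\<zero>\<^bsub>HC P \<sigma> (2 * n + 1)\<^esub>}))
     \<and>
     (c = d \<and> l \<noteq> 1 \<longrightarrow>
       (let P = podles q c d; \<tau> = podles_tau q c d l in
        \<forall>n\<ge>1. carrier (HC P \<tau> n) = {\<zero>\<^bsub>HC P \<tau> n\<^esub>}))"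
proof (intro conjI impI)
  assume l: "l \<notin> {inverse (q ^ (2 * m)) | m::nat. True}"
  then have l1: "l \<noteq> 1" by (metis (mono_tags, lifting) inverse_1 mem_Collect_eq mult_0_right power_0)
  interpret podles_generic q c d 1 l
    by unfold_locales (use assms l l1 in auto)
  interpret podles_chains q c d 1 l "podles_sigma q c d l"
  proof
    have "rep (sigma_gens l g) (diag chi v) = diag chi (gen_op g v)" for g v
      using assms(4) by (cases g) (simp_all add: rep_simps diag_gen)
    from rep_free_hom[OF this, of _ unit]
    show "\<exists>y. podles_sigma q c d l (podles_class q c d x) = podles_class q c d y \<and> rep y unit = diag chi (rep x unit)" for x
      using podles_sigma_class[OF assms(4)] by (intro exI[of _ "free_hom (sigma_gens l) x"]) (simp add: diag_unit del: diag_basis)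
  qed
  show "let P = podles q c d; \<sigma> = podles_sigma q c d l in
        \<forall>n. (\<exists>X Y. HC_S_pow P \<sigma> n X = HC0_class P \<sigma> \<one>\<^bsub>P\<^esub> \<and>
                   HC_S_pow P \<sigma> n Y = HC0_class P \<sigma> (podles_class q c d (free_gen GA)) \<and>
                   direct_sum_of_lines (HC P \<sigma> (2 * n)) X Y) \<and>
            carrier (HC P \<sigma> (2 * n + 1)) = {\<zero>\<^bsub>HC P \<sigma> (2 * n + 1)\<^esub>}"
    unfolding Let_def using HC_even[OF refl] HC_trivial by simp
next
  assume "c = d \<and> l \<noteq> 1"
  then have dc: "d = c" and l1: "l \<noteq> 1" by simp_all
  have "(-1 :: 'k) \<noteq> 1" by simp
  interpret podles_generic q c c "-1" l
    by unfold_locales (use assms l1 dc in auto)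
  interpret podles_chains q c c "-1" l "podles_tau q c c l"
  proof
    have "rep (tau_gens l g) (diag chi v) = diag chi (gen_op g v)" for g v
      using assms(4) by (cases g) (simp_all add: rep_simps diag_gen)
    from rep_free_hom[OF this, of _ unit]
    show "\<exists>y. podles_tau q c c l (podles_class q c c x) = podles_class q c c y \<and> rep y unit = diag chi (rep x unit)" for x
      using podles_tau_class[OF assms(4)] by (intro exI[of _ "free_hom (tau_gens l) x"]) (simp add: diag_unit del: diag_basis)
  qed
  \<comment> \<open>Here \<open>eps = -1\<close> differs from 1 in characteristic zero, so
    \<open>HC_trivial\<close> covers the even degrees as well.\<close>
  show "let P = podles q c d; \<tau> = podles_tau q c d l in \<forall>n\<ge>1. carrier (HC P \<tau> n) = {\<zero>\<^bsub>HC P \<tau> n\<^esub>}"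
    unfolding Let_def dc using HC_trivial by simp
qed

end
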